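(* Let $f\in W^{2,2}_{\mathrm{conf}}(Q_+,\mathbb{R}^3)$ satisfy $\langle f,e_3\rangle=0$ and $\langle\nu_f,e_3\rangle=0$ along $I$. Let $\phi\in W^{2,2}\cap W^{1,\infty}(Q_+,\mathbb{R}^3)$ be admissible at $f$, i.e. $\langle\phi,e_3\rangle=0$ and $\langle\partial_y\phi,\nu_f\rangle=0$ along $I$. Then there exist $\delta>0$ and a $C^1$ curve $t\mapsto f(t)\in W^{2,2}_{\mathrm{imm}}(Q_+,\mathbb{R}^3)$, $t\in(-\delta,\delta)$, such that $f(0)=f$, $\frac{d}{dt}f(t)|_{t=0}=\phi$, and for all $t\in(-\delta,\delta)$ $$\langle f(t),e_3\rangle=0\quad\text{and}\quad\langle\nu_{f(t)},e_3\rangle=0\quad\text{along } I .$$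
   Context: Notation: $Q=(-\pi,\pi)\times(-1,1)\subset\mathbb{R}^2$ with coordinates $(x,y)$, $Q_+=\{(x,y)\in Q: y>0\}$, $I=(-\pi,\pi)\times\{0\}$; $e_3=(0,0,1)$. For $f:Q_+\to\mathbb{R}^3$, $g_{ij}=\langle\partial_i f,\partial_j f\rangle$ is the induced metric. Set $$W^{2,2}_{\mathrm{imm}}(Q_+,\mathbb{R}^3)=\{f\in W^{2,2}\cap W^{1,\infty}(Q_+,\mathbb{R}^3):\ \operatorname{ess\,inf}(\det g)>0\},$$ an open subset of the Banach space $W^{2,2}\cap W^{1,\infty}(Q_+,\mathbb{R}^3)$; differentiability of curves is with respect to the norm of this space. $W^{2,2}_{\mathrm{conf}}(Q_+,\mathbb{R}^3)$ is the set of $f\in W^{2,2}_{\mathrm{imm}}(Q_+,\mathbb{R}^3)$ with $g_{11}=g_{22}$ and $g_{12}=0$ almost everywhere. The unit normal is $\nu_f=\frac{\partial_x f\times\partial_y f}{|\partial_x f\times\partial_y f|}\in W^{1,2}\cap L^\infty(Q_+,\mathbb{R}^3)$. Values of $f$, $\phi$, $\nu_f$ and first derivatives along $I$ are understood as traces, and equations along $I$ hold almost everywhere. *)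

theory Defs
  imports "HOL-Analysis.Analysis" "HOL-Probability.Essential_Supremum"
begin

section \<open>Lebesgue spaces\<close>

(* Elements of function spaces are represented by functions; equality in the space is
   equality almost everywhere. *)

definition L2_space :: "'a measure \<Rightarrow> ('a \<Rightarrow> 'b::euclidean_space) set" where
  "L2_space M = {u \<in> borel_measurable M. integrable M (\<lambda>p. (norm (u p))\<^sup>2)}"

definition L2_norm :: "'a measure \<Rightarrow> ('a \<Rightarrow> 'b::euclidean_space) \<Rightarrow> real" where
  "L2_norm M u = sqrt (\<integral>p. (norm (u p))\<^sup>2 \<partial>M)"

definition Linf_space :: "'a measure \<Rightarrow> ('a \<Rightarrow> 'b::euclidean_space) set" where
  "Linf_space M = {u \<in> borel_measurable M. esssup M (\<lambda>p. ereal (norm (u p))) < \<infinity>}"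

definition Linf_norm :: "'a measure \<Rightarrow> ('a \<Rightarrow> 'b::euclidean_space) \<Rightarrow> real" where
  "Linf_norm M u = real_of_ereal (esssup M (\<lambda>p. ereal (norm (u p))))"

definition essinf :: "'a measure \<Rightarrow> ('a \<Rightarrow> real) \<Rightarrow> ereal" where
  "essinf M h = - esssup M (\<lambda>p. ereal (- h p))"


section \<open>Weak derivatives and Sobolev spaces\<close>

primrec C_k :: "nat \<Rightarrow> ('a::euclidean_space \<Rightarrow> 'b::euclidean_space) \<Rightarrow> bool" where
  "C_k 0 u \<longleftrightarrow> continuous_on UNIV u"
| "C_k (Suc k) u \<longleftrightarrow>
     u differentiable_on UNIV \<and> (\<forall>v. C_k k (\<lambda>p. frechet_derivative u (at p) v))"

definition smooth :: "('a::euclidean_space \<Rightarrow> 'b::euclidean_space) \<Rightarrow> bool" where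
  "smooth u \<longleftrightarrow> (\<forall>k. C_k k u)"

definition test_function :: "'a::euclidean_space set \<Rightarrow> ('a \<Rightarrow> real) \<Rightarrow> bool" where
  "test_function \<Omega> \<zeta> \<longleftrightarrow>
     smooth \<zeta> \<and> compact (closure {p. \<zeta> p \<noteq> 0}) \<and> closure {p. \<zeta> p \<noteq> 0} \<subseteq> \<Omega>"

definition locally_integrable ::
    "'a::euclidean_space set \<Rightarrow> ('a \<Rightarrow> 'b::euclidean_space) \<Rightarrow> bool" where
  "locally_integrable \<Omega> u \<longleftrightarrow> (\<forall>K. compact K \<and> K \<subseteq> \<Omega> \<longrightarrow> integrable (lebesgue_on K) u)"

definition has_weak_deriv ::
    "'a::euclidean_space set \<Rightarrow> 'a \<Rightarrow> ('a \<Rightarrow> 'b::euclidean_space) \<Rightarrow> ('a \<Rightarrow> 'b) \<Rightarrow> bool" where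
  "has_weak_deriv \<Omega> v u g \<longleftrightarrow>
     locally_integrable \<Omega> u \<and> locally_integrable \<Omega> g \<and>
     (\<forall>\<zeta>. test_function \<Omega> \<zeta> \<longrightarrow>
        (\<integral>p. frechet_derivative \<zeta> (at p) v *\<^sub>R u p \<partial>(lebesgue_on \<Omega>)) =
        - (\<integral>p. \<zeta> p *\<^sub>R g p \<partial>(lebesgue_on \<Omega>)))"

(* The weak derivative in direction v, determined up to a null set. *)
definition weak_deriv ::
    "'a::euclidean_space set \<Rightarrow> 'a \<Rightarrow> ('a \<Rightarrow> 'b::euclidean_space) \<Rightarrow> 'a \<Rightarrow> 'b" where
  "weak_deriv \<Omega> v u = (SOME g. has_weak_deriv \<Omega> v u g)"

(* The Sobolev space of order k over a Lebesgue space X. *)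
primrec sobolev ::
    "'a::euclidean_space set \<Rightarrow> ('a \<Rightarrow> 'b::euclidean_space) set \<Rightarrow> nat \<Rightarrow> ('a \<Rightarrow> 'b) set" where
  "sobolev \<Omega> X 0 = X"
| "sobolev \<Omega> X (Suc k) =
     {u \<in> X. \<forall>v\<in>Basis. \<exists>g \<in> sobolev \<Omega> X k. has_weak_deriv \<Omega> v u g}"

primrec sobolev_norm ::
    "'a::euclidean_space set \<Rightarrow> (('a \<Rightarrow> 'b::euclidean_space) \<Rightarrow> real) \<Rightarrow> nat \<Rightarrow> ('a \<Rightarrow> 'b) \<Rightarrow> real" where
  "sobolev_norm \<Omega> N 0 u = N u"
| "sobolev_norm \<Omega> N (Suc k) u =
     N u + (\<Sum>v\<in>Basis. sobolev_norm \<Omega> N k (weak_deriv \<Omega> v u))"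


section \<open>The half rectangle and traces\<close>

definition Q :: "(real \<times> real) set" where
  "Q = {(x, y). - pi < x \<and> x < pi \<and> - 1 < y \<and> y < 1}"

definition Q_plus :: "(real \<times> real) set" where
  "Q_plus = {(x, y) \<in> Q. y > 0}"

(* The segment I is parametrised by its first coordinate. *)
definition I_measure :: "real measure" where
  "I_measure = lebesgue_on {- pi <..< pi}"

abbreviation L2_Q :: "(real \<times> real \<Rightarrow> 'b::euclidean_space) set" where
  "L2_Q \<equiv> L2_space (lebesgue_on Q_plus)"

abbreviation Linf_Q :: "(real \<times> real \<Rightarrow> 'b::euclidean_space) set" where
  "Linf_Q \<equiv> Linf_space (lebesgue_on Q_plus)"

abbreviation d_x :: "(real \<times> real \<Rightarrow> 'b::euclidean_space) \<Rightarrow> real \<times> real \<Rightarrow> 'b" where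
  "d_x \<equiv> weak_deriv Q_plus (1, 0)"

abbreviation d_y :: "(real \<times> real \<Rightarrow> 'b::euclidean_space) \<Rightarrow> real \<times> real \<Rightarrow> 'b" where
  "d_y \<equiv> weak_deriv Q_plus (0, 1)"

(* g is the trace along I of u in W^{1,2}: the trace operator is the continuous extension to
   W^{1,2} of the restriction to I of functions smooth up to the boundary. *)
definition has_trace ::
    "(real \<times> real \<Rightarrow> 'b::euclidean_space) \<Rightarrow> (real \<Rightarrow> 'b) \<Rightarrow> bool" where
  "has_trace u g \<longleftrightarrow>
     u \<in> sobolev Q_plus L2_Q 1 \<and> g \<in> L2_space I_measure \<and>
     (\<exists>U. (\<forall>n::nat. smooth (U n)) \<and>
        (\<lambda>n. sobolev_norm Q_plus (L2_norm (lebesgue_on Q_plus)) 1 (\<lambda>p. U n p - u p))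
          \<longlonglongrightarrow> 0 \<and>
        (\<lambda>n. L2_norm I_measure (\<lambda>x. U n (x, 0) - g x)) \<longlonglongrightarrow> 0)"

definition trace_I :: "(real \<times> real \<Rightarrow> 'b::euclidean_space) \<Rightarrow> real \<Rightarrow> 'b" where
  "trace_I u = (SOME g. has_trace u g)"


section \<open>Immersions of class W22\<close>

definition e3 :: "real^3" where
  "e3 = vector [0, 0, 1]"

definition W22_W1inf :: "(real \<times> real \<Rightarrow> real^3) set" where
  "W22_W1inf = sobolev Q_plus L2_Q 2 \<inter> sobolev Q_plus Linf_Q 1"

definition W_norm :: "(real \<times> real \<Rightarrow> real^3) \<Rightarrow> real" where
  "W_norm u =
     sobolev_norm Q_plus (L2_norm (lebesgue_on Q_plus)) 2 u +
     sobolev_norm Q_plus (Linf_norm (lebesgue_on Q_plus)) 1 u"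

definition g11 :: "(real \<times> real \<Rightarrow> real^3) \<Rightarrow> real \<times> real \<Rightarrow> real" where
  "g11 f p = d_x f p \<bullet> d_x f p"

definition g12 :: "(real \<times> real \<Rightarrow> real^3) \<Rightarrow> real \<times> real \<Rightarrow> real" where
  "g12 f p = d_x f p \<bullet> d_y f p"

definition g22 :: "(real \<times> real \<Rightarrow> real^3) \<Rightarrow> real \<times> real \<Rightarrow> real" where
  "g22 f p = d_y f p \<bullet> d_y f p"

definition det_g :: "(real \<times> real \<Rightarrow> real^3) \<Rightarrow> real \<times> real \<Rightarrow> real" where
  "det_g f p = g11 f p * g22 f p - (g12 f p)\<^sup>2"

definition W22_imm :: "(real \<times> real \<Rightarrow> real^3) set" where
  "W22_imm = {f \<in> W22_W1inf. essinf (lebesgue_on Q_plus) (det_g f) > 0}"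

definition W22_conf :: "(real \<times> real \<Rightarrow> real^3) set" where
  "W22_conf = {f \<in> W22_imm. AE p in lebesgue_on Q_plus. g11 f p = g22 f p \<and> g12 f p = 0}"

definition unit_normal :: "(real \<times> real \<Rightarrow> real^3) \<Rightarrow> real \<times> real \<Rightarrow> real^3" where
  "unit_normal f p = cross3 (d_x f p) (d_y f p) /\<^sub>R norm (cross3 (d_x f p) (d_y f p))"

definition admissible :: "(real \<times> real \<Rightarrow> real^3) \<Rightarrow> (real \<times> real \<Rightarrow> real^3) \<Rightarrow> bool" where
  "admissible f \<phi> \<longleftrightarrow>
     (AE x in I_measure. trace_I \<phi> x \<bullet> e3 = 0) \<and>
     (AE x in I_measure. trace_I (d_y \<phi>) x \<bullet> trace_I (unit_normal f) x = 0)"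


section \<open>Curves in the Banach space\<close>

definition has_curve_deriv ::
    "(real \<Rightarrow> real \<times> real \<Rightarrow> real^3) \<Rightarrow> (real \<times> real \<Rightarrow> real^3) \<Rightarrow> real \<Rightarrow> bool" where
  "has_curve_deriv F D t \<longleftrightarrow>
     D \<in> W22_W1inf \<and>
     ((\<lambda>h. W_norm (\<lambda>p. (F (t + h) p - F t p) /\<^sub>R h - D p)) \<longlongrightarrow> 0) (at 0)"

definition C1_curve_on :: "real set \<Rightarrow> (real \<Rightarrow> real \<times> real \<Rightarrow> real^3) \<Rightarrow> bool" where
  "C1_curve_on T F \<longleftrightarrow>
     (\<forall>t\<in>T. F t \<in> W22_W1inf) \<and>
     (\<exists>F'. (\<forall>t\<in>T. has_curve_deriv F (F' t) t) \<and>
        (\<forall>t\<in>T. ((\<lambda>s. W_norm (\<lambda>p. F' s p - F' t p)) \<longlongrightarrow> 0) (at t within T)))"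

end

(* Along I the hypotheses (f conformal, f_3 = 0 and nu_3 = 0) give f_y = (0, 0, +-lambda), and
   admissibility means that the horizontal part of phi_y is c f_x with c = <phi_y, f_x> / g_11. We
   take the quadratic curve F(t) = f + t phi + t^2 psi, where psi vanishes along I and psi_y = c phi_x
   there. Then the horizontal part of F(t)_y along I is t c (f_x + t phi_x), a multiple of that of
   F(t)_x, so the third component of F(t)_x x F(t)_y vanishes exactly.

   psi is obtained by extending h = c phi_x, which is only in W^{1,2} and L^oo: psi(x, y) is y times an
   average of h over a region of diameter comparable to y near (x, 0). Integration by parts in the
   averaging variables puts psi into W^{2,2} and W^{1,oo}.

   Traces are handled through density of smooth functions: mollifying after a contraction into
   the interior commutes with weak derivatives up to a factor tending to 1. *)
theory Submission
  imports Defs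
begin

section \<open>Smooth functions and cutoffs\<close>

text \<open>The plain candidate \<open>y h\<close> for \<psi> fails: its second derivatives contain
  \<open>y h_xx\<close>, while h has only first derivatives. Averaging spends the factor y on the
  first differentiation: y times a derivative of h at the sampled point is a derivative in the
  averaging variable, which integration by parts moves onto the kernel. So the first derivatives of
  \<psi> are averages of h, bounded like h, and the second ones involve only h and its first
  derivatives.

  Along I everything rests on two facts. The bounded W^{1,2} functions form an algebra on which the
  trace is multiplicative; hence the algebra of tangent vectors can be done pointwise on traces. And
  the trace of u_x vanishes if that of u does; this turns f_3 = 0 into a statement about the tangent
  f_x.

  The derivatives and traces in the definitions are arbitrary choices among almost everywhere equal
  functions. Identities are therefore proved for explicitly named derivatives and traces, and moved
  to the chosen ones by uniqueness. Averages and iterated integrals moreover require Borel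
  representatives.\<close>

lemma C_k_Suc_imp: "C_k (Suc k) u \<Longrightarrow> C_k k u"
  by (induction k arbitrary: u) (auto intro: differentiable_imp_continuous_on)

text \<open>Derivatives on the whole space are unique, so an explicitly known derivative may replace
  the choice \<open>frechet_derivative\<close> in the recursion.\<close>

lemma C_k_SucI:
  assumes "\<And>p. (u has_derivative u' p) (at p)" and "\<And>v. C_k k (\<lambda>p. u' p v)"
  shows "C_k (Suc k) u"
proof -
  have "frechet_derivative u (at p) = u' p" for p
    using assms(1) frechet_derivative_at by metis
  moreover have "u differentiable_on UNIV"
    using assms(1) by (auto simp: differentiable_on_def differentiable_def)
  ultimately show ?thesis using assms(2) by simp
qed

lemma C_k_SucD:
  assumes "C_k (Suc k) u"
  shows "(u has_derivative frechet_derivative u (at p)) (at p)" "C_k k (\<lambda>p. frechet_derivative u (at p) v)"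
  using assms by (auto simp: differentiable_on_def frechet_derivative_works)

lemma C_k_const [simp]: "C_k k (\<lambda>p. c)"
  by (induction k arbitrary: c) (auto intro!: C_k_SucI derivative_eq_intros simp del: C_k.simps(2))

lemma C_k_bounded_linear: "bounded_linear L \<Longrightarrow> C_k k L"
  by (cases k) (auto intro!: C_k_SucI bounded_linear_imp_has_derivative linear_continuous_on simp del: C_k.simps(2))

lemma C_k_add: "C_k k u \<Longrightarrow> C_k k w \<Longrightarrow> C_k k (\<lambda>p. u p + w p)"
proof (induction k arbitrary: u w)
  case 0 then show ?case by (simp add: continuous_intros)
next
  case (Suc k)
  show ?case
  proof (rule C_k_SucI)
    show "((\<lambda>p. u p + w p) has_derivative
        (\<lambda>v. frechet_derivative u (at p) v + frechet_derivative w (at p) v)) (at p)" for p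
      by (intro has_derivative_add C_k_SucD(1)[OF Suc.prems(1)] C_k_SucD(1)[OF Suc.prems(2)])
    show "C_k k (\<lambda>p. frechet_derivative u (at p) v + frechet_derivative w (at p) v)" for v
      by (intro Suc.IH C_k_SucD(2) Suc.prems)
  qed
qed

text \<open>By Leibniz the derivative is a sum of two products of the same kind, one with u
  differentiated and one with w. Hence the induction runs over all pairs of factors at once.\<close>

lemma C_k_prod:
  assumes "bounded_bilinear bl"
  shows "C_k k u \<Longrightarrow> C_k k w \<Longrightarrow> C_k k (\<lambda>p. bl (u p) (w p))"
proof (induction k arbitrary: u w)
  case 0 then show ?case by (simp add: bounded_bilinear.continuous_on[OF assms])
next
  case (Suc k)
  show ?case
  proof (rule C_k_SucI)
    show "((\<lambda>p. bl (u p) (w p)) has_derivative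
        (\<lambda>v. bl (u p) (frechet_derivative w (at p) v) + bl (frechet_derivative u (at p) v) (w p))) (at p)" for p
      by (intro bounded_bilinear.FDERIV[OF assms] C_k_SucD(1)[OF Suc.prems(1)] C_k_SucD(1)[OF Suc.prems(2)])
    show "C_k k (\<lambda>p. bl (u p) (frechet_derivative w (at p) v) + bl (frechet_derivative u (at p) v) (w p))" for v
      by (intro C_k_add Suc.IH C_k_SucD(2)[OF Suc.prems(1)] C_k_SucD(2)[OF Suc.prems(2)]
          C_k_Suc_imp[OF Suc.prems(1)] C_k_Suc_imp[OF Suc.prems(2)])
  qed
qed

lemmas C_k_mult = C_k_prod[OF bounded_bilinear_mult]
lemmas C_k_scaleR = C_k_prod[OF bounded_bilinear_scaleR]

lemma C_k_affine:
  assumes L: "bounded_linear L"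
  shows "C_k k u \<Longrightarrow> C_k k (\<lambda>p. u (b + L p))"
proof (induction k arbitrary: u)
  case 0
  have "continuous_on UNIV (\<lambda>p. b + L p)"
    by (intro continuous_intros linear_continuous_on L)
  then show ?case using 0 by (auto intro: continuous_on_compose2)
next
  case (Suc k)
  have "((\<lambda>p. u (b + L p)) has_derivative (\<lambda>v. frechet_derivative u (at (b + L p)) (L v))) (at p)" for p
    by (rule has_derivative_compose[of "\<lambda>p. b + L p" L])
       (use C_k_SucD(1)[OF Suc.prems] in \<open>auto intro!: derivative_eq_intros bounded_linear_imp_has_derivative L\<close>)
  then show ?case
    by (rule C_k_SucI) (use Suc.IH[OF C_k_SucD(2)[OF Suc.prems]] in auto)
qed

text \<open>Polynomials times a cutoff serve as the test functions in the uniqueness proof for weak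
  derivatives, where density comes from Stone-Weierstrass.\<close>

lemma smooth_polynomial: "real_polynomial_function P \<Longrightarrow> smooth P"
  unfolding smooth_def
  by (induction rule: real_polynomial_function.induct)
     (auto intro: C_k_bounded_linear C_k_add C_k_mult)

section \<open>A smooth function supported in a square\<close>

definition flat_exp :: "nat \<Rightarrow> real \<Rightarrow> real" where
  "flat_exp m t = (if t > 0 then exp (- 1 / t) / t ^ m else 0)"

lemma flat_exp_tendsto_0: "(flat_exp m \<longlongrightarrow> 0) (at 0)"
proof -
  have "((\<lambda>t. inverse t ^ m / exp (inverse t)) \<longlongrightarrow> 0) (at_right (0::real))"
    using filterlim_compose[OF tendsto_power_div_exp_0 filterlim_inverse_at_top_right] .
  then have "(flat_exp m \<longlongrightarrow> 0) (at_right 0)"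
    by (rule Lim_transform_eventually)
       (auto simp: eventually_at_filter flat_exp_def exp_minus divide_simps power_inverse)
  moreover have "(flat_exp m \<longlongrightarrow> 0) (at_left 0)"
    by (rule Lim_transform_eventually[OF tendsto_const]) (auto simp: eventually_at_filter flat_exp_def)
  ultimately show ?thesis by (simp add: filterlim_at_split)
qed

text \<open>The parameter m makes the family closed under differentiation up to linear combinations,
  which reduces smoothness to an induction over the order.\<close>

lemma flat_exp_deriv:
  "(flat_exp m has_field_derivative flat_exp (m + 2) t - m * flat_exp (m + 1) t) (at t)"
proof -
  consider "t > 0" | "t < 0" | "t = 0" by linarith
  then show ?thesis
  proof cases
    case 1
    have pw: "t ^ k = t * t ^ (k - Suc 0)" if "k \<noteq> 0" for k
      using that by (cases k) auto
    have "((\<lambda>t. exp (- 1 / t) / t ^ m) has_field_derivative flat_exp (m + 2) t - m * flat_exp (m + 1) t) (at t)"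
      using 1 by (cases m) (auto intro!: derivative_eq_intros simp: flat_exp_def field_simps power2_eq_square, metis pw)
    then show ?thesis
      by (rule has_field_derivative_transform_within_open[where S="{0<..}"]) (use 1 in \<open>auto simp: flat_exp_def\<close>)
  next
    case 2
    have "((\<lambda>t. 0) has_field_derivative flat_exp (m + 2) t - m * flat_exp (m + 1) t) (at t)"
      using 2 by (auto intro!: derivative_eq_intros simp: flat_exp_def)
    then show ?thesis
      by (rule has_field_derivative_transform_within_open[where S="{..<0}"]) (use 2 in \<open>auto simp: flat_exp_def\<close>)
  next
    case 3
    \<comment> \<open>Division by h only raises the exponent: away from 0 the difference quotient at
      0 is \<open>flat_exp (Suc m)\<close>.\<close>
    have "((\<lambda>h. (flat_exp m (0 + h) - flat_exp m 0) / h) \<longlongrightarrow> 0) (at 0)"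
      by (rule Lim_transform_eventually[OF flat_exp_tendsto_0[of "Suc m"]])
         (auto simp: eventually_at_filter flat_exp_def field_simps)
    then show ?thesis using 3 by (simp add: DERIV_def flat_exp_def)
  qed
qed

lemma smooth_flat_exp: "C_k k (flat_exp m)"
proof (induction k arbitrary: m)
  case 0
  show ?case unfolding C_k.simps
    by (rule DERIV_continuous_on) (use flat_exp_deriv in \<open>blast intro: has_field_derivative_at_within\<close>)
next
  case (Suc k)
  show ?case
  proof (rule C_k_SucI)
    show "(flat_exp m has_derivative (*) (flat_exp (m + 2) p - m * flat_exp (m + 1) p)) (at p)" for p
      using flat_exp_deriv by (simp add: has_field_derivative_def)
    show "C_k k (\<lambda>p. (flat_exp (m + 2) p - m * flat_exp (m + 1) p) * v)" for v
    proof -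
      have "C_k k (\<lambda>p. (flat_exp (m + 2) p + (- real m) * flat_exp (m + 1) p) * v)"
        by (intro C_k_mult C_k_add C_k_const Suc)
      then show ?thesis by simp
    qed
  qed
qed

text \<open>A product of one-dimensional bumps instead of a radial one, because all regions that
  occur are boxes: it is nonzero exactly on the open square of half side 1.\<close>

definition bump :: "real \<times> real \<Rightarrow> real" where
  "bump p = (flat_exp 0 (1 + fst p) * flat_exp 0 (1 - fst p)) * (flat_exp 0 (1 + snd p) * flat_exp 0 (1 - snd p))"

lemma smooth_bump: "smooth bump"
proof -
  have "C_k k bump" for k
    unfolding bump_def[abs_def]
    using C_k_affine[OF bounded_linear_fst smooth_flat_exp[of k 0], of 1]
      C_k_affine[OF bounded_linear_snd smooth_flat_exp[of k 0], of 1]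
      C_k_affine[OF bounded_linear_minus[OF bounded_linear_fst] smooth_flat_exp[of k 0], of 1]
      C_k_affine[OF bounded_linear_minus[OF bounded_linear_snd] smooth_flat_exp[of k 0], of 1]
    by (intro C_k_mult) simp_all
  then show ?thesis by (simp add: smooth_def)
qed

lemma bump_nonneg: "bump p \<ge> 0"
  by (simp add: bump_def flat_exp_def)

lemma bump_eq_0_iff: "bump p = 0 \<longleftrightarrow> \<not> (\<bar>fst p\<bar> < 1 \<and> \<bar>snd p\<bar> < 1)"
  by (auto simp: bump_def flat_exp_def)

section \<open>Mean convergence\<close>

lemma L2_spaceD:
  assumes "u \<in> L2_space M"
  shows "u \<in> borel_measurable M" "integrable M (\<lambda>p. (norm (u p))\<^sup>2)"
  using assms by (auto simp: L2_space_def)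

lemma L2_spaceI_dominated:
  fixes u :: "'a \<Rightarrow> 'b::euclidean_space"
  assumes "integrable M g" "u \<in> borel_measurable M" "AE p in M. (norm (u p))\<^sup>2 \<le> g p"
  shows "u \<in> L2_space M"
  unfolding L2_space_def mem_Collect_eq
  by (intro conjI assms(2) Bochner_Integration.integrable_bound[OF assms(1)])
     (use assms in \<open>auto elim!: eventually_mono\<close>)

text \<open>Estimates are carried out for squared norms; this inequality takes the place of the
  triangle inequality in L2, at the price of a factor 2.\<close>

lemma norm_add_power2_le: "(norm (a + b))\<^sup>2 \<le> 2 * (norm a)\<^sup>2 + 2 * (norm b)\<^sup>2"
proof -
  have "(norm (a + b))\<^sup>2 \<le> (norm a + norm b)\<^sup>2"
    by (intro power_mono norm_triangle_ineq) auto
  also have "\<dots> \<le> 2 * (norm a)\<^sup>2 + 2 * (norm b)\<^sup>2"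
    using zero_le_power2[of "norm a - norm b"] by (simp add: power2_eq_square algebra_simps)
  finally show ?thesis .
qed

lemma L2_space_add:
  assumes "u \<in> L2_space M" "w \<in> L2_space M"
  shows "(\<lambda>p. u p + w p) \<in> L2_space M"
proof (rule L2_spaceI_dominated)
  show "integrable M (\<lambda>p. 2 * (norm (u p))\<^sup>2 + 2 * (norm (w p))\<^sup>2)"
    using assms by (auto simp: L2_space_def)
  show "AE p in M. (norm (u p + w p))\<^sup>2 \<le> 2 * (norm (u p))\<^sup>2 + 2 * (norm (w p))\<^sup>2"
    by (simp add: norm_add_power2_le)
  show "(\<lambda>p. u p + w p) \<in> borel_measurable M"
    using assms by (auto simp: L2_space_def)
qed

lemma L2_space_bounded_mult:
  assumes "u \<in> L2_space M" "c \<in> borel_measurable M" "AE p in M. \<bar>c p\<bar> \<le> C"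
  shows "(\<lambda>p. c p *\<^sub>R u p) \<in> L2_space M"
proof (rule L2_spaceI_dominated)
  show "integrable M (\<lambda>p. C\<^sup>2 * (norm (u p))\<^sup>2)"
    using assms by (auto simp: L2_space_def)
  show "AE p in M. (norm (c p *\<^sub>R u p))\<^sup>2 \<le> C\<^sup>2 * (norm (u p))\<^sup>2"
    using assms(3)
  proof eventually_elim
    case (elim p)
    then have "\<bar>c p\<bar>\<^sup>2 \<le> C\<^sup>2" by (intro power_mono) auto
    then show ?case by (simp add: power_mult_distrib mult_right_mono)
  qed
  show "(\<lambda>p. c p *\<^sub>R u p) \<in> borel_measurable M"
    using assms by (auto simp: L2_space_def)
qed

lemma L2_space_scaleR: "u \<in> L2_space M \<Longrightarrow> (\<lambda>p. c *\<^sub>R u p) \<in> L2_space M"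
  by (rule L2_space_bounded_mult[where C="\<bar>c\<bar>"]) auto

lemma L2_space_diff:
  assumes "u \<in> L2_space M" "w \<in> L2_space M"
  shows "(\<lambda>p. u p - w p) \<in> L2_space M"
  using L2_space_add[OF assms(1) L2_space_scaleR[OF assms(2), of "-1"]] by simp

lemma L2_space_cong_AE:
  assumes "u \<in> L2_space M" "w \<in> borel_measurable M" "AE p in M. u p = w p"
  shows "w \<in> L2_space M"
  by (rule L2_spaceI_dominated[OF L2_spaceD(2)[OF assms(1)] assms(2)])
     (use assms(3) in \<open>auto elim: eventually_mono\<close>)

lemma integrable_bounded:
  fixes u :: "'a \<Rightarrow> 'b::euclidean_space"
  assumes "finite_measure M" "u \<in> borel_measurable M" "AE p in M. norm (u p) \<le> C"
  shows "integrable M u"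
  using finite_measure.integrable_const_bound[OF assms(1) assms(3,2)] .

lemma L2_space_bounded:
  fixes u :: "'a \<Rightarrow> 'b::euclidean_space"
  assumes "finite_measure M" "u \<in> borel_measurable M" "AE p in M. norm (u p) \<le> C"
  shows "u \<in> L2_space M"
proof -
  have "AE p in M. norm ((norm (u p))\<^sup>2) \<le> C\<^sup>2"
    using assms(3) by eventually_elim (auto intro: power_mono)
  then have "integrable M (\<lambda>p. (norm (u p))\<^sup>2)"
    using assms by (intro integrable_bounded) auto
  then show ?thesis using assms(2) by (simp add: L2_space_def)
qed

lemma L2_space_integrable:
  assumes "finite_measure M" "u \<in> L2_space M"
  shows "integrable M u"
proof (rule Bochner_Integration.integrable_bound)
  show "integrable M (\<lambda>p. 1 + (norm (u p))\<^sup>2)"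
    by (intro Bochner_Integration.integrable_add L2_spaceD(2) finite_measure.integrable_const assms)
  show "AE p in M. norm (u p) \<le> norm (1 + (norm (u p))\<^sup>2)"
  proof (intro AE_I2)
    fix p
    have "norm (u p) \<le> 1 + (norm (u p))\<^sup>2"
      using zero_le_power2[of "norm (u p) - 1"] norm_ge_zero[of "u p"]
      by (simp add: power2_eq_square algebra_simps del: norm_ge_zero)
    then show "norm (u p) \<le> norm (1 + (norm (u p))\<^sup>2)" by simp
  qed
qed (use assms L2_spaceD in auto)

lemma L2_space_norm_mult_integrable:
  assumes "u \<in> L2_space M" "w \<in> L2_space M"
  shows "integrable M (\<lambda>p. norm (u p) * norm (w p))"
proof (rule Bochner_Integration.integrable_bound)
  show "integrable M (\<lambda>p. (norm (u p))\<^sup>2 + (norm (w p))\<^sup>2)"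
    by (intro Bochner_Integration.integrable_add L2_spaceD(2) assms)
  have "norm (norm (u p) * norm (w p)) \<le> norm ((norm (u p))\<^sup>2 + (norm (w p))\<^sup>2)" for p
    using zero_le_power2[of "norm (u p) - norm (w p)"] mult_nonneg_nonneg[of "norm (u p)" "norm (w p)"]
    by (simp add: power2_eq_square algebra_simps del: mult_nonneg_nonneg)
  then show "AE p in M. norm (norm (u p) * norm (w p)) \<le> norm ((norm (u p))\<^sup>2 + (norm (w p))\<^sup>2)"
    by simp
qed (use L2_spaceD(1)[OF assms(1)] L2_spaceD(1)[OF assms(2)] in measurable)

text \<open>The integral of \<open>(t * norm u - norm w)^2\<close> is a nonnegative quadratic
  polynomial in t; evaluate it at \<open>t = C / A\<close>.\<close>

lemma Cauchy_Schwarz_integral: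
  assumes "u \<in> L2_space M" "w \<in> L2_space M"
  shows "(\<integral>p. norm (u p) * norm (w p) \<partial>M)\<^sup>2 \<le> (\<integral>p. (norm (u p))\<^sup>2 \<partial>M) * (\<integral>p. (norm (w p))\<^sup>2 \<partial>M)"
proof -
  define A where "A = (\<integral>p. (norm (u p))\<^sup>2 \<partial>M)"
  define B where "B = (\<integral>p. (norm (w p))\<^sup>2 \<partial>M)"
  define C where "C = (\<integral>p. norm (u p) * norm (w p) \<partial>M)"
  note int = L2_spaceD(2)[OF assms(1)] L2_spaceD(2)[OF assms(2)] L2_space_norm_mult_integrable[OF assms]
  have "0 \<le> (\<integral>p. (t * norm (u p) - norm (w p))\<^sup>2 \<partial>M)" for t by simp
  also have "(\<integral>p. (t * norm (u p) - norm (w p))\<^sup>2 \<partial>M) =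
      (\<integral>p. t\<^sup>2 * (norm (u p))\<^sup>2 - 2 * t * (norm (u p) * norm (w p)) + (norm (w p))\<^sup>2 \<partial>M)" for t
    by (intro Bochner_Integration.integral_cong) (auto simp: power2_eq_square algebra_simps)
  also have "\<dots> t = t\<^sup>2 * A - 2 * t * C + B" for t
    using int by (simp add: A_def B_def C_def)
  finally have q: "0 \<le> t\<^sup>2 * A - 2 * t * C + B" for t .
  have A: "A \<ge> 0" by (simp add: A_def)
  have "C\<^sup>2 \<le> A * B"
  proof (cases "A = 0")
    case True
    have "C = 0"
    proof (rule ccontr)
      assume "C \<noteq> 0"
      \<comment> \<open>For \<open>A = 0\<close> the polynomial is affine in t, and this t gives it
        the value -1.\<close>
      then show False using q[of "(B + 1) / (2 * C)"] True by simp
    qed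
    then show ?thesis using True by simp
  next
    case False
    have "0 \<le> A * ((C / A)\<^sup>2 * A - 2 * (C / A) * C + B)"
      using q A by (intro mult_nonneg_nonneg)
    also have "\<dots> = A * B - C\<^sup>2"
      using False by (simp add: field_simps power2_eq_square)
    finally show ?thesis by simp
  qed
  then show ?thesis by (simp add: A_def B_def C_def)
qed

text \<open>Membership is part of the notion because the Bochner integral of a non-integrable
  function is 0, so that a vanishing integral alone would say nothing.\<close>

definition L2_tendsto :: "'a measure \<Rightarrow> (nat \<Rightarrow> 'a \<Rightarrow> 'b::euclidean_space) \<Rightarrow> ('a \<Rightarrow> 'b) \<Rightarrow> bool" where
  "L2_tendsto M X Y \<longleftrightarrow> (\<forall>n. X n \<in> L2_space M) \<and> Y \<in> L2_space M \<and>
     (\<lambda>n. \<integral>p. (norm (X n p - Y p))\<^sup>2 \<partial>M) \<longlonglongrightarrow> 0"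

definition L1_tendsto :: "'a measure \<Rightarrow> (nat \<Rightarrow> 'a \<Rightarrow> 'b::euclidean_space) \<Rightarrow> ('a \<Rightarrow> 'b) \<Rightarrow> bool" where
  "L1_tendsto M X Y \<longleftrightarrow> (\<forall>n. integrable M (X n)) \<and> integrable M Y \<and>
     (\<lambda>n. \<integral>p. norm (X n p - Y p) \<partial>M) \<longlonglongrightarrow> 0"

lemma L2_tendstoD:
  assumes "L2_tendsto M X Y"
  shows "X n \<in> L2_space M" "Y \<in> L2_space M" "(\<lambda>n. \<integral>p. (norm (X n p - Y p))\<^sup>2 \<partial>M) \<longlonglongrightarrow> 0"
  using assms by (auto simp: L2_tendsto_def)

lemma L1_tendstoD:
  assumes "L1_tendsto M X Y"
  shows "integrable M (X n)" "integrable M Y" "(\<lambda>n. \<integral>p. norm (X n p - Y p) \<partial>M) \<longlonglongrightarrow> 0"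
  using assms by (auto simp: L1_tendsto_def)

text \<open>The two measures may differ. In this way an estimate of boundary values by integrals
  over the half rectangle yields convergence on I.\<close>

lemma L2_tendsto_dominated:
  assumes X: "L2_tendsto M X Y" and Z: "\<And>n. Z n \<in> L2_space N" "W \<in> L2_space N"
    and le: "\<And>n. (\<integral>p. (norm (Z n p - W p))\<^sup>2 \<partial>N) \<le> C * (\<integral>p. (norm (X n p - Y p))\<^sup>2 \<partial>M)"
  shows "L2_tendsto N Z W"
  unfolding L2_tendsto_def
proof (intro conjI allI Z)
  show "(\<lambda>n. \<integral>p. (norm (Z n p - W p))\<^sup>2 \<partial>N) \<longlonglongrightarrow> 0"
  proof (rule tendsto_sandwich[OF _ _ tendsto_const])
    show "(\<lambda>n. C * (\<integral>p. (norm (X n p - Y p))\<^sup>2 \<partial>M)) \<longlonglongrightarrow> 0"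
      using tendsto_mult_right_zero[OF L2_tendstoD(3)[OF X]] .
  qed (use le in auto)
qed

lemma L1_tendsto_dominated:
  assumes Z: "\<And>n. integrable N (Z n)" "integrable N W"
    and le: "\<And>n. (\<integral>p. norm (Z n p - W p) \<partial>N) \<le> b n" and b: "b \<longlonglongrightarrow> 0"
  shows "L1_tendsto N Z W"
  unfolding L1_tendsto_def
  by (intro conjI allI Z tendsto_sandwich[OF _ _ tendsto_const b]) (use le in auto)

lemma L2_tendsto_add:
  assumes "L2_tendsto M X Y" "L2_tendsto M X' Y'"
  shows "L2_tendsto M (\<lambda>n p. X n p + X' n p) (\<lambda>p. Y p + Y' p)"
  unfolding L2_tendsto_def
proof (intro conjI allI L2_space_add L2_tendstoD(1)[OF assms(1)] L2_tendstoD(1)[OF assms(2)]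
    L2_tendstoD(2)[OF assms(1)] L2_tendstoD(2)[OF assms(2)])
  let ?d = "\<lambda>n p. (norm (X n p - Y p))\<^sup>2" and ?d' = "\<lambda>n p. (norm (X' n p - Y' p))\<^sup>2"
  have i: "integrable M (?d n)" "integrable M (?d' n)" for n
    using assms by (auto intro!: L2_spaceD(2) L2_space_diff dest: L2_tendstoD)
  have le: "(\<integral>p. (norm (X n p + X' n p - (Y p + Y' p)))\<^sup>2 \<partial>M) \<le>
      2 * (\<integral>p. ?d n p \<partial>M) + 2 * (\<integral>p. ?d' n p \<partial>M)" for n
  proof -
    have "(\<integral>p. (norm (X n p + X' n p - (Y p + Y' p)))\<^sup>2 \<partial>M) \<le> (\<integral>p. 2 * ?d n p + 2 * ?d' n p \<partial>M)"
    proof (rule integral_mono_AE')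
      show "AE p in M. (norm (X n p + X' n p - (Y p + Y' p)))\<^sup>2 \<le> 2 * ?d n p + 2 * ?d' n p"
        using norm_add_power2_le[of "X n p - Y p" "X' n p - Y' p" for p] by (auto simp: algebra_simps)
    qed (use i in auto)
    then show ?thesis using i by simp
  qed
  have "(\<lambda>n. 2 * (\<integral>p. ?d n p \<partial>M) + 2 * (\<integral>p. ?d' n p \<partial>M)) \<longlonglongrightarrow> 2 * 0 + 2 * 0"
    by (intro tendsto_intros L2_tendstoD(3) assms)
  then have t: "(\<lambda>n. 2 * (\<integral>p. ?d n p \<partial>M) + 2 * (\<integral>p. ?d' n p \<partial>M)) \<longlonglongrightarrow> 0" by simp
  show "(\<lambda>n. \<integral>p. (norm (X n p + X' n p - (Y p + Y' p)))\<^sup>2 \<partial>M) \<longlonglongrightarrow> 0"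
    by (rule tendsto_sandwich[OF _ _ tendsto_const t]) (use le in auto)
qed

lemma L2_tendsto_bounded_mult:
  assumes X: "L2_tendsto M X Y" and c: "c \<in> borel_measurable M" "AE p in M. \<bar>c p\<bar> \<le> C"
  shows "L2_tendsto M (\<lambda>n p. c p *\<^sub>R X n p) (\<lambda>p. c p *\<^sub>R Y p)"
proof (rule L2_tendsto_dominated[OF X])
  show "(\<lambda>p. c p *\<^sub>R X n p) \<in> L2_space M" "(\<lambda>p. c p *\<^sub>R Y p) \<in> L2_space M" for n
    by (intro L2_space_bounded_mult[OF _ c] L2_tendstoD[OF X])+
  have i: "integrable M (\<lambda>p. (norm (X n p - Y p))\<^sup>2)" for n
    by (intro L2_spaceD(2) L2_space_diff L2_tendstoD[OF X])
  have "(\<integral>p. (norm (c p *\<^sub>R X n p - c p *\<^sub>R Y p))\<^sup>2 \<partial>M) \<le> (\<integral>p. C\<^sup>2 * (norm (X n p - Y p))\<^sup>2 \<partial>M)" for n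
  proof (rule integral_mono_AE')
    show "AE p in M. (norm (c p *\<^sub>R X n p - c p *\<^sub>R Y p))\<^sup>2 \<le> C\<^sup>2 * (norm (X n p - Y p))\<^sup>2"
      using c(2)
    proof eventually_elim
      case (elim p)
      then have "\<bar>c p\<bar>\<^sup>2 \<le> C\<^sup>2" by (intro power_mono) auto
      then show ?case by (simp add: power_mult_distrib mult_right_mono flip: scaleR_diff_right)
    qed
  qed (use i in auto)
  then show "(\<integral>p. (norm (c p *\<^sub>R X n p - c p *\<^sub>R Y p))\<^sup>2 \<partial>M) \<le> C\<^sup>2 * (\<integral>p. (norm (X n p - Y p))\<^sup>2 \<partial>M)" for n
    by simp
qed

lemma L2_tendsto_const: "u \<in> L2_space M \<Longrightarrow> L2_tendsto M (\<lambda>n. u) u"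
  by (simp add: L2_tendsto_def)

lemma L2_tendsto_scaleR: "L2_tendsto M X Y \<Longrightarrow> L2_tendsto M (\<lambda>n p. c *\<^sub>R X n p) (\<lambda>p. c *\<^sub>R Y p)"
  by (rule L2_tendsto_bounded_mult[where C="\<bar>c\<bar>"]) auto

lemma L2_tendsto_diff:
  assumes "L2_tendsto M X Y" "L2_tendsto M X' Y'"
  shows "L2_tendsto M (\<lambda>n p. X n p - X' n p) (\<lambda>p. Y p - Y' p)"
  using L2_tendsto_add[OF assms(1) L2_tendsto_scaleR[OF assms(2), of "-1"]] by simp

text \<open>The bound is \<open>norm (G z) \<le> norm (G 0) + C * norm z\<close>; finiteness of the
  measure makes the constant \<open>G 0\<close> square integrable.\<close>

lemma L2_tendsto_lipschitz:
  assumes X: "L2_tendsto M X Y" and M: "finite_measure M"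
    and G: "\<And>a b. norm (G a - G b) \<le> C * norm (a - b)" and [measurable]: "G \<in> borel_measurable borel"
  shows "L2_tendsto M (\<lambda>n p. G (X n p)) (\<lambda>p. G (Y p))"
proof -
  have G2: "(norm (G a - G b))\<^sup>2 \<le> C\<^sup>2 * (norm (a - b))\<^sup>2" for a b
    using power_mono[OF G[of a b], of 2] by (simp add: power_mult_distrib)
  have L2: "(\<lambda>p. G (u p)) \<in> L2_space M" if "u \<in> L2_space M" for u
  proof (rule L2_spaceI_dominated)
    note [measurable] = L2_spaceD(1)[OF that]
    show "(\<lambda>p. G (u p)) \<in> borel_measurable M" by measurable
    show "integrable M (\<lambda>p. 2 * (C\<^sup>2 * (norm (u p))\<^sup>2) + 2 * (norm (G 0))\<^sup>2)"
      using L2_spaceD(2)[OF that] M by (intro Bochner_Integration.integrable_add) (auto intro: finite_measure.integrable_const)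
    have "(norm (G (u p)))\<^sup>2 \<le> 2 * (C\<^sup>2 * (norm (u p))\<^sup>2) + 2 * (norm (G 0))\<^sup>2" for p
      using norm_add_power2_le[of "G (u p) - G 0" "G 0"] G2[of "u p" 0] by simp
    then show "AE p in M. (norm (G (u p)))\<^sup>2 \<le> 2 * (C\<^sup>2 * (norm (u p))\<^sup>2) + 2 * (norm (G 0))\<^sup>2" by simp
  qed
  show ?thesis
  proof (rule L2_tendsto_dominated[OF X])
    show "(\<lambda>p. G (X n p)) \<in> L2_space M" "(\<lambda>p. G (Y p)) \<in> L2_space M" for n
      by (intro L2 L2_tendstoD[OF X])+
    have i: "integrable M (\<lambda>p. (norm (X n p - Y p))\<^sup>2)" for n
      by (intro L2_spaceD(2) L2_space_diff L2_tendstoD[OF X])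
    have "(\<integral>p. (norm (G (X n p) - G (Y p)))\<^sup>2 \<partial>M) \<le> (\<integral>p. C\<^sup>2 * (norm (X n p - Y p))\<^sup>2 \<partial>M)" for n
      by (rule integral_mono_AE') (use i G2 in auto)
    then show "(\<integral>p. (norm (G (X n p) - G (Y p)))\<^sup>2 \<partial>M) \<le> C\<^sup>2 * (\<integral>p. (norm (X n p - Y p))\<^sup>2 \<partial>M)" for n
      by simp
  qed
qed

lemma L2_tendsto_cong_AE:
  assumes "L2_tendsto M X Y" "\<And>n. X' n \<in> borel_measurable M" "\<And>n. AE p in M. X n p = X' n p"
    "Y' \<in> borel_measurable M" "AE p in M. Y p = Y' p"
  shows "L2_tendsto M X' Y'"
proof (rule L2_tendsto_dominated[OF assms(1), where C=1])
  show X': "X' n \<in> L2_space M" "Y' \<in> L2_space M" for n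
    using L2_space_cong_AE[OF L2_tendstoD(1)[OF assms(1)]] L2_space_cong_AE[OF L2_tendstoD(2)[OF assms(1)]] assms
    by blast+
  have [measurable]: "X n \<in> borel_measurable M" "Y \<in> borel_measurable M" for n
    using L2_tendstoD(1,2)[OF assms(1)] by (auto simp: L2_space_def)
  note [measurable] = assms(2,4)
  have "AE p in M. (norm (X' n p - Y' p))\<^sup>2 = (norm (X n p - Y p))\<^sup>2" for n
    using assms(3)[of n] assms(5) by eventually_elim auto
  then have "(\<integral>p. (norm (X' n p - Y' p))\<^sup>2 \<partial>M) = (\<integral>p. (norm (X n p - Y p))\<^sup>2 \<partial>M)" for n
    by (intro integral_cong_AE) auto
  then show "(\<integral>p. (norm (X' n p - Y' p))\<^sup>2 \<partial>M) \<le> 1 * (\<integral>p. (norm (X n p - Y p))\<^sup>2 \<partial>M)" for n by simp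
qed

text \<open>Write the difference of the products as (X - Y)(X' - Y') + (X - Y) Y' + Y (X' - Y') and
  apply Cauchy-Schwarz to each term. Products of L2 limits converge in L1 only, which is why both
  notions of convergence are carried along.\<close>

lemma L1_tendsto_bilinear:
  fixes bl :: "'b::euclidean_space \<Rightarrow> 'c::euclidean_space \<Rightarrow> 'd::euclidean_space" and M :: "'a measure"
  assumes bl: "bounded_bilinear bl" and X: "L2_tendsto M X Y" and X': "L2_tendsto M X' Y'"
  shows "L1_tendsto M (\<lambda>n p. bl (X n p) (X' n p)) (\<lambda>p. bl (Y p) (Y' p))"
proof -
  obtain K where K: "K \<ge> 0" "\<And>a b. norm (bl a b) \<le> norm a * norm b * K"
    using bounded_bilinear.nonneg_bounded[OF bl] by auto
  have int: "integrable M (\<lambda>p. bl (u p) (w p))" if "u \<in> L2_space M" "w \<in> L2_space M" for u w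
  proof (rule Bochner_Integration.integrable_bound)
    show "integrable M (\<lambda>p. K * (norm (u p) * norm (w p)))"
      using L2_space_norm_mult_integrable[OF that] by simp
    show "(\<lambda>p. bl (u p) (w p)) \<in> borel_measurable M"
      using L2_spaceD(1)[OF that(1)] L2_spaceD(1)[OF that(2)]
      by (rule borel_measurable_continuous_Pair)
         (auto intro!: bounded_bilinear.continuous_on[OF bl] continuous_intros)
  qed (use K in \<open>auto simp: mult_ac\<close>)
  note L2 = L2_tendstoD(1,2)[OF X] L2_tendstoD(1,2)[OF X']
  define b where "b n = K * (sqrt (\<integral>p. (norm (X n p - Y p))\<^sup>2 \<partial>M) * sqrt (\<integral>p. (norm (X' n p - Y' p))\<^sup>2 \<partial>M)
      + sqrt (\<integral>p. (norm (X n p - Y p))\<^sup>2 \<partial>M) * sqrt (\<integral>p. (norm (Y' p))\<^sup>2 \<partial>M)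
      + sqrt (\<integral>p. (norm (Y p))\<^sup>2 \<partial>M) * sqrt (\<integral>p. (norm (X' n p - Y' p))\<^sup>2 \<partial>M))" for n
  have cs: "(\<integral>p. norm (u p) * norm (w p) \<partial>M) \<le> sqrt (\<integral>p. (norm (u p))\<^sup>2 \<partial>M) * sqrt (\<integral>p. (norm (w p))\<^sup>2 \<partial>M)"
    if "u \<in> L2_space M" "w \<in> L2_space M" for u :: "'a \<Rightarrow> 'b" and w :: "'a \<Rightarrow> 'c"
    using real_le_rsqrt[OF Cauchy_Schwarz_integral[OF that]] by (simp add: real_sqrt_mult)
  show ?thesis
  proof (rule L1_tendsto_dominated)
    show "integrable M (\<lambda>p. bl (X n p) (X' n p))" "integrable M (\<lambda>p. bl (Y p) (Y' p))" for n
      by (intro int L2)+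
    have "(\<lambda>n. b n) \<longlonglongrightarrow> K * (sqrt 0 * sqrt 0 + sqrt 0 * sqrt (\<integral>p. (norm (Y' p))\<^sup>2 \<partial>M)
        + sqrt (\<integral>p. (norm (Y p))\<^sup>2 \<partial>M) * sqrt 0)"
      unfolding b_def by (intro tendsto_intros L2_tendstoD(3) X X')
    then show "b \<longlonglongrightarrow> 0" by simp
    show "(\<integral>p. norm (bl (X n p) (X' n p) - bl (Y p) (Y' p)) \<partial>M) \<le> b n" for n
    proof -
      let ?f = "\<lambda>p. K * (norm (X n p - Y p) * norm (X' n p - Y' p) + norm (X n p - Y p) * norm (Y' p)
          + norm (Y p) * norm (X' n p - Y' p))"
      have D: "(\<lambda>p. X n p - Y p) \<in> L2_space M" "(\<lambda>p. X' n p - Y' p) \<in> L2_space M"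
        by (intro L2_space_diff L2)+
      note i = L2_space_norm_mult_integrable[OF D] L2_space_norm_mult_integrable[OF D(1) L2(4)]
        L2_space_norm_mult_integrable[OF L2(2) D(2)]
      have "(\<integral>p. norm (bl (X n p) (X' n p) - bl (Y p) (Y' p)) \<partial>M) \<le> (\<integral>p. ?f p \<partial>M)"
      proof (rule integral_mono_AE')
        have "norm (bl (X n p) (X' n p) - bl (Y p) (Y' p)) \<le> ?f p" for p
        proof -
          have "bl (X n p) (X' n p) - bl (Y p) (Y' p) =
              bl (X n p - Y p) (X' n p - Y' p) + bl (X n p - Y p) (Y' p) + bl (Y p) (X' n p - Y' p)"
            by (simp add: bounded_bilinear.diff_left[OF bl] bounded_bilinear.diff_right[OF bl])
          also have "norm \<dots> \<le> norm (bl (X n p - Y p) (X' n p - Y' p)) + norm (bl (X n p - Y p) (Y' p))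
              + norm (bl (Y p) (X' n p - Y' p))"
            by (intro order_trans[OF norm_triangle_ineq] add_mono) auto
          also have "\<dots> \<le> norm (X n p - Y p) * norm (X' n p - Y' p) * K + norm (X n p - Y p) * norm (Y' p) * K
              + norm (Y p) * norm (X' n p - Y' p) * K"
            by (intro add_mono K)
          finally show ?thesis by (simp add: algebra_simps)
        qed
        then show "AE p in M. norm (bl (X n p) (X' n p) - bl (Y p) (Y' p)) \<le> ?f p" by simp
      qed (use i K in auto)
      also have "\<dots> = K * ((\<integral>p. norm (X n p - Y p) * norm (X' n p - Y' p) \<partial>M)
          + (\<integral>p. norm (X n p - Y p) * norm (Y' p) \<partial>M) + (\<integral>p. norm (Y p) * norm (X' n p - Y' p) \<partial>M))"
        using i by simp
      also have "\<dots> \<le> b n"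
        unfolding b_def by (intro mult_left_mono add_mono cs D L2 K)
      finally show ?thesis .
    qed
  qed
qed

text \<open>On a finite measure space the constant 1 is square integrable; multiply by it.\<close>

lemma L2_tendsto_imp_L1:
  assumes X: "L2_tendsto M X Y" and M: "finite_measure M"
  shows "L1_tendsto M X Y"
proof -
  have "L2_tendsto M (\<lambda>n p. 1 :: real) (\<lambda>p. 1)"
    by (intro L2_tendsto_const L2_space_bounded[OF M, where C=1]) auto
  from L1_tendsto_bilinear[OF bounded_bilinear_scaleR this X] show ?thesis by simp
qed

lemma L1_tendsto_add:
  assumes "L1_tendsto M X Y" "L1_tendsto M X' Y'"
  shows "L1_tendsto M (\<lambda>n p. X n p + X' n p) (\<lambda>p. Y p + Y' p)"
proof (rule L1_tendsto_dominated)
  note i = L1_tendstoD(1,2)[OF assms(1)] L1_tendstoD(1,2)[OF assms(2)]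
  show "integrable M (\<lambda>p. X n p + X' n p)" "integrable M (\<lambda>p. Y p + Y' p)" for n
    using i by auto
  show "(\<integral>p. norm (X n p + X' n p - (Y p + Y' p)) \<partial>M) \<le> (\<integral>p. norm (X n p - Y p) \<partial>M) + (\<integral>p. norm (X' n p - Y' p) \<partial>M)" for n
  proof -
    have "(\<integral>p. norm (X n p + X' n p - (Y p + Y' p)) \<partial>M) \<le> (\<integral>p. norm (X n p - Y p) + norm (X' n p - Y' p) \<partial>M)"
      using i by (intro integral_mono) (auto intro: norm_diff_triangle_ineq)
    then show ?thesis using i by simp
  qed
  show "(\<lambda>n. (\<integral>p. norm (X n p - Y p) \<partial>M) + (\<integral>p. norm (X' n p - Y' p) \<partial>M)) \<longlonglongrightarrow> 0"
    using tendsto_add[OF L1_tendstoD(3)[OF assms(1)] L1_tendstoD(3)[OF assms(2)]] by simp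
qed

lemma L1_tendsto_bounded_mult:
  assumes X: "L1_tendsto M X Y" and c: "c \<in> borel_measurable M" "AE p in M. \<bar>c p\<bar> \<le> C"
  shows "L1_tendsto M (\<lambda>n p. c p *\<^sub>R X n p) (\<lambda>p. c p *\<^sub>R Y p)"
proof (rule L1_tendsto_dominated)
  note i = L1_tendstoD(1,2)[OF X]
  have int: "integrable M (\<lambda>p. c p *\<^sub>R u p)" if "integrable M u" for u :: "'a \<Rightarrow> 'b"
  proof (rule Bochner_Integration.integrable_bound)
    show "integrable M (\<lambda>p. C * norm (u p))" using that by simp
    show "AE p in M. norm (c p *\<^sub>R u p) \<le> norm (C * norm (u p))"
      using c(2) by eventually_elim (auto simp: abs_mult intro!: mult_right_mono)
  qed (use c that in auto)
  show "integrable M (\<lambda>p. c p *\<^sub>R X n p)" "integrable M (\<lambda>p. c p *\<^sub>R Y p)" for n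
    by (intro int i)+
  show "(\<integral>p. norm (c p *\<^sub>R X n p - c p *\<^sub>R Y p) \<partial>M) \<le> C * (\<integral>p. norm (X n p - Y p) \<partial>M)" for n
  proof -
    have "(\<integral>p. norm (c p *\<^sub>R X n p - c p *\<^sub>R Y p) \<partial>M) \<le> (\<integral>p. C * norm (X n p - Y p) \<partial>M)"
    proof (rule integral_mono_AE')
      show "AE p in M. norm (c p *\<^sub>R X n p - c p *\<^sub>R Y p) \<le> C * norm (X n p - Y p)"
        using c(2) by eventually_elim (auto intro!: mult_right_mono simp flip: scaleR_diff_right)
      show "AE p in M. 0 \<le> C * norm (X n p - Y p)"
        using c(2) by eventually_elim auto
    qed (use i in auto)
    then show ?thesis by simp
  qed
  show "(\<lambda>n. C * (\<integral>p. norm (X n p - Y p) \<partial>M)) \<longlonglongrightarrow> 0"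
    using tendsto_mult_right_zero[OF L1_tendstoD(3)[OF X]] .
qed

lemma L1_tendsto_integral:
  assumes "L1_tendsto M X Y"
  shows "(\<lambda>n. \<integral>p. X n p \<partial>M) \<longlonglongrightarrow> (\<integral>p. Y p \<partial>M)"
proof -
  note i = L1_tendstoD(1,2)[OF assms]
  have "norm ((\<integral>p. X n p \<partial>M) - (\<integral>p. Y p \<partial>M)) \<le> (\<integral>p. norm (X n p - Y p) \<partial>M)" for n
    using integral_norm_bound[of M "\<lambda>p. X n p - Y p"] i by simp
  then have "(\<lambda>n. (\<integral>p. X n p \<partial>M) - (\<integral>p. Y p \<partial>M)) \<longlonglongrightarrow> 0"
    by (intro Lim_null_comparison[OF always_eventually L1_tendstoD(3)[OF assms]]) auto
  then show ?thesis by (simp add: LIM_zero_iff)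
qed

lemma L1_tendsto_unique:
  assumes "L1_tendsto M X Y" "L1_tendsto M X Z"
  shows "AE p in M. Y p = Z p"
proof -
  note i = L1_tendstoD(1,2)[OF assms(1)] L1_tendstoD(2)[OF assms(2)]
  have "(\<integral>p. norm (Y p - Z p) \<partial>M) \<le> (\<integral>p. norm (X n p - Y p) \<partial>M) + (\<integral>p. norm (X n p - Z p) \<partial>M)" for n
  proof -
    have "(\<integral>p. norm (Y p - Z p) \<partial>M) \<le> (\<integral>p. norm (X n p - Y p) + norm (X n p - Z p) \<partial>M)"
      using i by (intro integral_mono) (auto intro: norm_triangle_sub order_trans[OF _ norm_triangle_ineq4] simp: norm_minus_commute)
    then show ?thesis using i by simp
  qed
  moreover have "(\<lambda>n. (\<integral>p. norm (X n p - Y p) \<partial>M) + (\<integral>p. norm (X n p - Z p) \<partial>M)) \<longlonglongrightarrow> 0 + 0"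
    by (intro tendsto_add L1_tendstoD(3) assms)
  ultimately have "(\<integral>p. norm (Y p - Z p) \<partial>M) \<le> 0"
    by (intro LIMSEQ_le_const[where X="\<lambda>n. (\<integral>p. norm (X n p - Y p) \<partial>M) + (\<integral>p. norm (X n p - Z p) \<partial>M)"]) auto
  then have "(\<integral>p. norm (Y p - Z p) \<partial>M) = 0" by (intro antisym) auto
  then have "AE p in M. norm (Y p - Z p) = 0"
    using i by (subst (asm) integral_nonneg_eq_0_iff_AE) auto
  then show ?thesis by (auto elim: eventually_mono)
qed

section \<open>Weak derivatives on the half rectangle\<close>

abbreviation MQ :: "(real \<times> real) measure" where
  "MQ \<equiv> lebesgue_on Q_plus"

lemma Q_plus_eq_box: "Q_plus = box (- pi, 0) (pi, 1)"
  by (auto simp: Q_plus_def Q_def box_def Basis_prod_def)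

lemma mem_Q_plus: "p \<in> Q_plus \<longleftrightarrow> - pi < fst p \<and> fst p < pi \<and> 0 < snd p \<and> snd p < 1"
  by (auto simp: Q_plus_def Q_def)

lemma Q_plus_borel [measurable, simp]: "Q_plus \<in> sets borel"
  by (simp add: Q_plus_eq_box)

lemma Q_plus_lebesgue [simp]: "Q_plus \<in> sets lebesgue"
  by (simp add: Q_plus_eq_box)

lemma finite_measure_MQ: "finite_measure MQ"
  by (rule finite_measureI) (simp add: emeasure_restrict_space Q_plus_eq_box emeasure_lborel_box_eq)

lemma borel_measurable_lebesgue_on:
  "u \<in> borel_measurable borel \<Longrightarrow> u \<in> borel_measurable (lebesgue_on S)"
  by (intro measurable_restrict_space1 measurable_completion) simp

lemma continuous_bounded_on_bounded:
  fixes g :: "'a::heine_borel \<Rightarrow> 'b::real_normed_vector"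
  assumes "continuous_on UNIV g" "bounded S"
  obtains B where "B \<ge> 0" "\<And>p. p \<in> S \<Longrightarrow> norm (g p) \<le> B"
proof -
  have "compact (g ` closure S)"
    using assms by (intro compact_continuous_image continuous_on_subset[OF assms(1)]) (auto simp: compact_closure)
  then obtain B where "\<And>x. x \<in> g ` closure S \<Longrightarrow> norm x \<le> B"
    using compact_imp_bounded bounded_iff by metis
  then have "norm (g p) \<le> max B 0" if "p \<in> S" for p
    using that closure_subset by (metis image_eqI in_mono le_max_iff_disj)
  then show ?thesis using that[of "max B 0"] by auto
qed

lemma bounded_Q_plus [simp]: "bounded Q_plus"
  by (simp add: Q_plus_eq_box)

lemma continuous_AE_bounded_MQ:
  assumes "continuous_on UNIV g"
  obtains B where "AE p in MQ. norm (g p) \<le> B"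
proof -
  obtain B where "\<And>p. p \<in> Q_plus \<Longrightarrow> norm (g p) \<le> B"
    using continuous_bounded_on_bounded[OF assms bounded_Q_plus] by blast
  then have "AE p in MQ. norm (g p) \<le> B" by (intro AE_I2) auto
  then show ?thesis using that by blast
qed

lemma continuous_measurable_MQ:
  "continuous_on UNIV g \<Longrightarrow> g \<in> borel_measurable MQ"
  by (intro borel_measurable_lebesgue_on borel_measurable_continuous_onI)

lemma continuous_L2_MQ:
  fixes g :: "real \<times> real \<Rightarrow> 'b::euclidean_space"
  assumes "continuous_on UNIV g" shows "g \<in> L2_space MQ"
  using L2_space_bounded[OF finite_measure_MQ continuous_measurable_MQ[OF assms]] continuous_AE_bounded_MQ[OF assms]
  by metis

lemma continuous_integrable_MQ:
  fixes g :: "real \<times> real \<Rightarrow> 'b::euclidean_space"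
  assumes "continuous_on UNIV g" shows "integrable MQ g"
  by (intro L2_space_integrable finite_measure_MQ continuous_L2_MQ assms)

lemma integral_MQ_continuous:
  fixes g :: "real \<times> real \<Rightarrow> 'b::euclidean_space"
  assumes "continuous_on UNIV g" shows "(\<integral>p. g p \<partial>MQ) = integral (cbox (- pi, 0) (pi, 1)) g"
  using lebesgue_integral_eq_integral[OF continuous_integrable_MQ[OF assms]]
  by (simp add: Q_plus_eq_box integral_open_interval)

lemma integrable_MQ_imp_locally:
  assumes "integrable MQ u" shows "locally_integrable Q_plus u"
  unfolding locally_integrable_def
proof safe
  fix K assume K: "compact K" "K \<subseteq> Q_plus"
  then have Kl: "K \<in> sets lebesgue" by (simp add: lmeasurable_compact fmeasurableD)
  have "set_integrable lebesgue Q_plus u"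
    using assms by (simp add: set_integrable_def integrable_restrict_space)
  then have "set_integrable lebesgue K u"
    using set_integrable_subset Kl K(2) by blast
  then show "integrable (lebesgue_on K) u"
    using Kl by (simp add: set_integrable_def integrable_restrict_space)
qed

text \<open>Continuous differentiability in a single direction is all that integration by parts
  uses. It is inherited by products, compositions and parameter integrals with little effort,
  whereas full smoothness of the averages below would have to be proved separately.\<close>

definition C1_along :: "'a::euclidean_space \<Rightarrow> ('a \<Rightarrow> 'b::euclidean_space) \<Rightarrow> ('a \<Rightarrow> 'b) \<Rightarrow> bool" where
  "C1_along v F F' \<longleftrightarrow> continuous_on UNIV F \<and> continuous_on UNIV F' \<and>
     (\<forall>p t. ((\<lambda>s. F (p + s *\<^sub>R v)) has_vector_derivative F' (p + t *\<^sub>R v)) (at t))"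

lemma C1_alongD:
  assumes "C1_along v F F'"
  shows "continuous_on UNIV F" "continuous_on UNIV F'"
    "((\<lambda>s. F (p + s *\<^sub>R v)) has_vector_derivative F' (p + t *\<^sub>R v)) (at t)"
  using assms by (auto simp: C1_along_def)

lemma C1_along_has_derivative:
  assumes "\<And>p. (F has_derivative F' p) (at p)" "continuous_on UNIV (\<lambda>p. F' p v)"
  shows "C1_along v F (\<lambda>p. F' p v)"
  unfolding C1_along_def
proof (intro conjI allI assms(2))
  show "continuous_on UNIV F"
    using assms(1) by (meson continuous_at_imp_continuous_on has_derivative_continuous)
  show "((\<lambda>s. F (p + s *\<^sub>R v)) has_vector_derivative F' (p + t *\<^sub>R v) v) (at t)" for p t
  proof -
    have "((\<lambda>s. F (p + s *\<^sub>R v)) has_derivative (\<lambda>h. F' (p + t *\<^sub>R v) (h *\<^sub>R v))) (at t)"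
      by (rule has_derivative_compose[of "\<lambda>s. p + s *\<^sub>R v" _ _ _ F]) (auto intro!: derivative_eq_intros assms(1))
    then show ?thesis
      using linear_scale[OF has_derivative_linear[OF assms(1)]] by (simp add: has_vector_derivative_def)
  qed
qed

lemma C1_along_smooth:
  assumes "smooth U" shows "C1_along v U (\<lambda>p. frechet_derivative U (at p) v)"
proof (rule C1_along_has_derivative)
  have "C_k (Suc 0) U" using assms by (simp add: smooth_def)
  from C_k_SucD[OF this] show "(U has_derivative frechet_derivative U (at p)) (at p)"
    "continuous_on UNIV (\<lambda>p. frechet_derivative U (at p) v)" for p by auto
qed

lemma C1_along_prod:
  assumes bl: "bounded_bilinear bl" and F: "C1_along v F F'" and G: "C1_along v G G'"
  shows "C1_along v (\<lambda>p. bl (F p) (G p)) (\<lambda>p. bl (F p) (G' p) + bl (F' p) (G p))"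
  unfolding C1_along_def
  using C1_alongD[OF F] C1_alongD[OF G]
  by (auto intro!: bounded_bilinear.continuous_on[OF bl] continuous_intros
      bounded_bilinear.has_vector_derivative[OF bl])

lemma C1_along_chain:
  fixes g g' :: "real \<Rightarrow> real"
  assumes F: "C1_along v F F'" and g: "\<And>z. (g has_field_derivative g' z) (at z)" and g': "continuous_on UNIV g'"
  shows "C1_along v (\<lambda>p. g (F p)) (\<lambda>p. g' (F p) * F' p)"
  unfolding C1_along_def
proof (intro conjI allI)
  have "continuous_on UNIV g" using g by (meson DERIV_continuous_on has_field_derivative_at_within)
  then show "continuous_on UNIV (\<lambda>p. g (F p))" "continuous_on UNIV (\<lambda>p. g' (F p) * F' p)"
    using C1_alongD[OF F] g' by (auto intro!: continuous_intros intro: continuous_on_compose2)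
  show "((\<lambda>s. g (F (p + s *\<^sub>R v))) has_vector_derivative g' (F (p + t *\<^sub>R v)) * F' (p + t *\<^sub>R v)) (at t)" for p t
    using DERIV_chain2[OF g, of "\<lambda>s. F (p + s *\<^sub>R v)" "F' (p + t *\<^sub>R v)" t UNIV] C1_alongD(3)[OF F, of p t]
    by (simp add: has_real_derivative_iff_has_vector_derivative)
qed

text \<open>Fubini with the differentiated variable innermost, then the fundamental theorem of
  calculus. It is applied both to test functions on the half rectangle and to kernels on the
  averaging box.\<close>

lemma integral_partial_x_eq_0:
  fixes F :: "real \<times> real \<Rightarrow> 'b::euclidean_space"
  assumes F: "C1_along (1, 0) F F'" and ab: "a \<le> b" and eq: "\<And>y. c \<le> y \<Longrightarrow> y \<le> d \<Longrightarrow> F (a, y) = F (b, y)"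
  shows "integral (cbox (a, c) (b, d)) F' = 0"
proof -
  note cont = continuous_on_subset[OF C1_alongD(2)[OF F] subset_UNIV]
  have "integral (cbox (a, c) (b, d)) F' = integral (cbox a b) (\<lambda>x. integral (cbox c d) (\<lambda>y. F' (x, y)))"
    by (rule integral_prod_continuous[OF cont])
  also have "\<dots> = integral (cbox c d) (\<lambda>y. integral (cbox a b) (\<lambda>x. F' (x, y)))"
    by (rule integral_swap_continuous) (simp add: cont)
  also have "\<dots> = integral (cbox c d) (\<lambda>y. 0)"
  proof (rule integral_cong)
    fix y assume y: "y \<in> cbox c d"
    have "((\<lambda>x. F' (x, y)) has_integral F (b, y) - F (a, y)) {a..b}"
      using C1_alongD(3)[OF F, of "(0, y)"]
      by (intro fundamental_theorem_of_calculus[OF ab]) (auto intro: has_vector_derivative_at_within)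
    then show "integral (cbox a b) (\<lambda>x. F' (x, y)) = 0"
      using eq y by (auto simp: integral_unique)
  qed
  finally show ?thesis by simp
qed

lemma integral_partial_y_eq_0:
  fixes F :: "real \<times> real \<Rightarrow> 'b::euclidean_space"
  assumes F: "C1_along (0, 1) F F'" and cd: "c \<le> d" and eq: "\<And>x. a \<le> x \<Longrightarrow> x \<le> b \<Longrightarrow> F (x, c) = F (x, d)"
  shows "integral (cbox (a, c) (b, d)) F' = 0"
proof -
  note cont = continuous_on_subset[OF C1_alongD(2)[OF F] subset_UNIV]
  have "integral (cbox (a, c) (b, d)) F' = integral (cbox a b) (\<lambda>x. integral (cbox c d) (\<lambda>y. F' (x, y)))"
    by (rule integral_prod_continuous[OF cont])
  also have "\<dots> = integral (cbox a b) (\<lambda>x. 0)"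
  proof (rule integral_cong)
    fix x assume x: "x \<in> cbox a b"
    have "((\<lambda>y. F' (x, y)) has_integral F (x, d) - F (x, c)) {c..d}"
      using C1_alongD(3)[OF F, of "(x, 0)"]
      by (intro fundamental_theorem_of_calculus[OF cd]) (auto intro: has_vector_derivative_at_within)
    then show "integral (cbox c d) (\<lambda>y. F' (x, y)) = 0"
      using eq x by (auto simp: integral_unique)
  qed
  finally show ?thesis by simp
qed

lemma Basis_real_prod: "(Basis :: (real \<times> real) set) = {(1, 0), (0, 1)}"
  by (auto simp: Basis_prod_def)

lemma test_functionD:
  assumes "test_function \<Omega> \<zeta>"
  shows "smooth \<zeta>" "p \<notin> \<Omega> \<Longrightarrow> \<zeta> p = 0"
  using assms closure_subset[of "{p. \<zeta> p \<noteq> 0}"] by (auto simp: test_function_def)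

text \<open>A test function vanishes outside the open rectangle, in particular on its sides, so the
  integral of the derivative of \<zeta> F is 0.\<close>

lemma C1_along_has_weak_deriv:
  assumes F: "C1_along v F F'" and v: "v \<in> Basis"
  shows "has_weak_deriv Q_plus v F F'"
  unfolding has_weak_deriv_def
proof (intro conjI allI impI)
  note c = C1_alongD[OF F]
  show "locally_integrable Q_plus F" "locally_integrable Q_plus F'"
    by (intro integrable_MQ_imp_locally continuous_integrable_MQ c)+
  fix \<zeta> assume \<zeta>: "test_function Q_plus \<zeta>"
  let ?d = "\<lambda>p. frechet_derivative \<zeta> (at p) v"
  have Z: "C1_along v \<zeta> ?d" by (rule C1_along_smooth[OF test_functionD(1)[OF \<zeta>]])
  note cz = C1_alongD[OF Z]
  have P: "C1_along v (\<lambda>p. \<zeta> p *\<^sub>R F p) (\<lambda>p. \<zeta> p *\<^sub>R F' p + ?d p *\<^sub>R F p)"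
    by (rule C1_along_prod[OF bounded_bilinear_scaleR Z F])
  have 0: "\<zeta> (x, y) = 0" if "x = - pi \<or> x = pi \<or> y = 0 \<or> y = 1" for x y
    using that by (intro test_functionD(2)[OF \<zeta>]) (auto simp: mem_Q_plus)
  have "(\<integral>p. \<zeta> p *\<^sub>R F' p + ?d p *\<^sub>R F p \<partial>MQ) = 0"
    unfolding integral_MQ_continuous[OF C1_alongD(2)[OF P]]
    using v unfolding Basis_real_prod
  proof
    assume "v = (1, 0)"
    with P have "C1_along (1, 0) (\<lambda>p. \<zeta> p *\<^sub>R F p) (\<lambda>p. \<zeta> p *\<^sub>R F' p + ?d p *\<^sub>R F p)" by simp
    then show "integral (cbox (- pi, 0) (pi, 1)) (\<lambda>p. \<zeta> p *\<^sub>R F' p + ?d p *\<^sub>R F p) = 0"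
      by (rule integral_partial_x_eq_0) (auto simp: 0)
  next
    assume "v \<in> {(0, 1)}"
    with P have "C1_along (0, 1) (\<lambda>p. \<zeta> p *\<^sub>R F p) (\<lambda>p. \<zeta> p *\<^sub>R F' p + ?d p *\<^sub>R F p)" by simp
    then show "integral (cbox (- pi, 0) (pi, 1)) (\<lambda>p. \<zeta> p *\<^sub>R F' p + ?d p *\<^sub>R F p) = 0"
      by (rule integral_partial_y_eq_0) (auto simp: 0)
  qed
  moreover have "integrable MQ (\<lambda>p. \<zeta> p *\<^sub>R F' p)" "integrable MQ (\<lambda>p. ?d p *\<^sub>R F p)"
    by (intro continuous_integrable_MQ continuous_intros c cz)+
  ultimately show "(\<integral>p. ?d p *\<^sub>R F p \<partial>MQ) = - (\<integral>p. \<zeta> p *\<^sub>R F' p \<partial>MQ)"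
    by (simp add: eq_neg_iff_add_eq_0 add.commute)
qed

text \<open>Test functions and their derivatives are bounded, so the defining identity passes to L1
  limits. The product rule, the chain rule and the derivatives of averages are all obtained by this
  passage from smooth approximations.\<close>

lemma has_weak_deriv_L1_limit:
  assumes w: "\<And>n. has_weak_deriv Q_plus v (X n) (X' n)"
    and X: "L1_tendsto MQ X Y" and X': "L1_tendsto MQ X' Y'"
  shows "has_weak_deriv Q_plus v Y Y'"
  unfolding has_weak_deriv_def
proof (intro conjI allI impI integrable_MQ_imp_locally L1_tendstoD(2)[OF X] L1_tendstoD(2)[OF X'])
  fix \<zeta> assume \<zeta>: "test_function Q_plus \<zeta>"
  let ?d = "\<lambda>p. frechet_derivative \<zeta> (at p) v"
  note cz = C1_alongD[OF C1_along_smooth[OF test_functionD(1)[OF \<zeta>], of v]]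
  obtain B where B: "AE p in MQ. \<bar>\<zeta> p\<bar> \<le> B" using continuous_AE_bounded_MQ[OF cz(1)] by auto
  obtain B' where B': "AE p in MQ. \<bar>?d p\<bar> \<le> B'" using continuous_AE_bounded_MQ[OF cz(2)] by auto
  have "(\<lambda>n. \<integral>p. ?d p *\<^sub>R X n p \<partial>MQ) \<longlonglongrightarrow> (\<integral>p. ?d p *\<^sub>R Y p \<partial>MQ)"
    by (intro L1_tendsto_integral L1_tendsto_bounded_mult[OF X _ B'] continuous_measurable_MQ cz)
  moreover have "(\<lambda>n. - (\<integral>p. \<zeta> p *\<^sub>R X' n p \<partial>MQ)) \<longlonglongrightarrow> - (\<integral>p. \<zeta> p *\<^sub>R Y' p \<partial>MQ)"
    by (intro tendsto_minus L1_tendsto_integral L1_tendsto_bounded_mult[OF X' _ B] continuous_measurable_MQ cz)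
  moreover have "(\<integral>p. ?d p *\<^sub>R X n p \<partial>MQ) = - (\<integral>p. \<zeta> p *\<^sub>R X' n p \<partial>MQ)" for n
    using w[of n] \<zeta> by (simp add: has_weak_deriv_def)
  ultimately show "(\<integral>p. ?d p *\<^sub>R Y p \<partial>MQ) = - (\<integral>p. \<zeta> p *\<^sub>R Y' p \<partial>MQ)"
    using LIMSEQ_unique by simp
qed

text \<open>Stone-Weierstrass extends the orthogonality from polynomials to continuous functions. A
  sequence of continuous functions converging to sgn h almost everywhere then shows that the
  integral of |h| is 0.\<close>

lemma AE_eq_0_if_orthogonal_polynomials:
  fixes h :: "'a::euclidean_space \<Rightarrow> real"
  assumes S: "bounded S" "S \<in> sets lebesgue" and h: "integrable (lebesgue_on S) h"
    and orth: "\<And>P. real_polynomial_function P \<Longrightarrow> (\<integral>p. P p * h p \<partial>lebesgue_on S) = 0"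
  shows "AE p in lebesgue_on S. h p = 0"
proof -
  let ?M = "lebesgue_on S"
  have meas: "g \<in> borel_measurable ?M" if "continuous_on UNIV g" for g :: "'a \<Rightarrow> real"
    using that by (intro borel_measurable_lebesgue_on borel_measurable_continuous_onI)
  have int: "integrable ?M (\<lambda>p. g p * h p)" if g: "continuous_on UNIV g" for g :: "'a \<Rightarrow> real"
  proof -
    obtain B where "B \<ge> 0" "\<And>p. p \<in> S \<Longrightarrow> norm (g p) \<le> B"
      using continuous_bounded_on_bounded[OF g S(1)] by blast
    then have "AE p in ?M. norm (g p * h p) \<le> norm (B * \<bar>h p\<bar>)"
      by (intro AE_I2) (simp add: abs_mult mult_right_mono)
    moreover have "integrable ?M (\<lambda>p. B * \<bar>h p\<bar>)" "(\<lambda>p. g p * h p) \<in> borel_measurable ?M"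
      using h meas[OF g] by auto
    ultimately show ?thesis by (rule Bochner_Integration.integrable_bound[rotated 2])
  qed
  have cont: "(\<integral>p. g p * h p \<partial>?M) = 0" if g: "continuous_on UNIV g" for g :: "'a \<Rightarrow> real"
  proof -
    define J where "J = (\<integral>p. \<bar>h p\<bar> \<partial>?M)"
    have "\<bar>\<integral>p. g p * h p \<partial>?M\<bar> \<le> inverse (Suc n) * J" for n
    proof -
      obtain P where P: "real_polynomial_function P" "\<And>p. p \<in> closure S \<Longrightarrow> \<bar>g p - P p\<bar> < inverse (Suc n)"
        using Stone_Weierstrass_real_polynomial_function[of "closure S" g "inverse (Suc n)"] S g
        by (auto simp: compact_closure intro: continuous_on_subset)
      have cP: "continuous_on UNIV P"
        using P(1) continuous_on_polymonial_function real_polynomial_function_eq by metis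
      have "(\<integral>p. g p * h p \<partial>?M) = (\<integral>p. g p * h p - P p * h p \<partial>?M)"
        using int[OF g] int[OF cP] orth[OF P(1)] by simp
      also have "\<bar>\<dots>\<bar> \<le> (\<integral>p. \<bar>g p * h p - P p * h p\<bar> \<partial>?M)"
        by (rule integral_abs_bound)
      also have "\<dots> \<le> (\<integral>p. inverse (Suc n) * \<bar>h p\<bar> \<partial>?M)"
      proof (rule integral_mono)
        fix p assume "p \<in> space ?M"
        then have "\<bar>g p - P p\<bar> \<le> inverse (Suc n)"
          using P(2)[of p] closure_subset[of S] by auto
        then have "\<bar>g p - P p\<bar> * \<bar>h p\<bar> \<le> inverse (Suc n) * \<bar>h p\<bar>"
          by (intro mult_right_mono) auto
        then show "\<bar>g p * h p - P p * h p\<bar> \<le> inverse (Suc n) * \<bar>h p\<bar>"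
          by (simp flip: left_diff_distrib abs_mult)
      qed (use h int[OF g] int[OF cP] in auto)
      finally show ?thesis by (simp add: J_def)
    qed
    moreover have "(\<lambda>n. inverse (real (Suc n)) * J) \<longlonglongrightarrow> 0"
      using tendsto_mult_left_zero[OF LIMSEQ_inverse_real_of_nat] .
    ultimately have "\<bar>\<integral>p. g p * h p \<partial>?M\<bar> \<le> 0"
      by (intro LIMSEQ_le_const[where X="\<lambda>n. inverse (real (Suc n)) * J"]) blast+
    then show ?thesis by simp
  qed
  have hm: "h \<in> borel_measurable ?M" using h by auto
  then have "(\<lambda>p. sgn (h p)) \<in> borel_measurable ?M" by measurable
  then have "(\<lambda>p. sgn (h p)) measurable_on S"
    using measurable_on_iff_borel_measurable[OF S(2)] by blast
  then obtain N g where N: "negligible N" and g: "\<And>n. continuous_on UNIV (g n)"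
    and lim: "\<And>x. x \<notin> N \<Longrightarrow> (\<lambda>n. g n x) \<longlonglongrightarrow> (if x \<in> S then sgn (h x) else 0)"
    unfolding measurable_on_def by auto
  \<comment> \<open>Clipping to [-1, 1] leaves the limit sgn h unchanged and makes |h| an integrable
    majorant.\<close>
  define g' where "g' n p = max (-1) (min 1 (g n p))" for n p
  have g': "continuous_on UNIV (g' n)" for n
    unfolding g'_def by (intro continuous_intros g)
  have "(\<lambda>n. \<integral>p. g' n p * h p \<partial>?M) \<longlonglongrightarrow> (\<integral>p. sgn (h p) * h p \<partial>?M)"
  proof (rule integral_dominated_convergence)
    show "integrable ?M (\<lambda>p. \<bar>h p\<bar>)" using h by simp
    have "AE x in lebesgue. x \<notin> N"
      using N by (simp add: AE_not_in negligible_iff_null_sets)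
    then have "AE x in ?M. x \<notin> N"
      using S(2) by (auto simp: AE_restrict_space_iff elim: eventually_mono)
    then show "AE x in ?M. (\<lambda>n. g' n x * h x) \<longlonglongrightarrow> sgn (h x) * h x"
      using AE_space
    proof eventually_elim
      case (elim x)
      then have "(\<lambda>n. g n x) \<longlonglongrightarrow> sgn (h x)" using lim[of x] by auto
      then have "(\<lambda>n. g' n x) \<longlonglongrightarrow> max (-1) (min 1 (sgn (h x)))"
        unfolding g'_def by (intro tendsto_intros)
      also have "max (-1) (min 1 (sgn (h x))) = sgn (h x)" by (auto simp: sgn_if)
      finally show ?case by (intro tendsto_intros)
    qed
    show "AE x in ?M. norm (g' n x * h x) \<le> \<bar>h x\<bar>" for n
      by (intro AE_I2) (auto simp: g'_def abs_mult intro!: mult_left_le_one_le)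
    show "(\<lambda>x. sgn (h x) * h x) \<in> borel_measurable ?M" using hm by measurable
    show "(\<lambda>x. g' n x * h x) \<in> borel_measurable ?M" for n using int[OF g'] by auto
  qed
  then have "(\<integral>p. sgn (h p) * h p \<partial>?M) = 0"
    by (simp add: cont[OF g'] LIMSEQ_const_iff)
  moreover have "sgn (h p) * h p = \<bar>h p\<bar>" for p by (simp add: sgn_if)
  ultimately have "(\<integral>p. \<bar>h p\<bar> \<partial>?M) = 0" by simp
  then show ?thesis
    using h by (subst (asm) integral_nonneg_eq_0_iff_AE) auto
qed

text \<open>Positive exactly on the concentric copy of \<open>Q_plus\<close> scaled by 1 - 1/(n +
  2); these copies exhaust \<open>Q_plus\<close>, and the shift by 2 keeps the factor positive at n
  = 0.\<close>

definition cutoff :: "nat \<Rightarrow> real \<times> real \<Rightarrow> real" where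
  "cutoff n p = bump (fst p / (pi * (1 - 1 / (real n + 2))), (snd p - 1 / 2) / (1 / 2 * (1 - 1 / (real n + 2))))"

lemma smooth_cutoff: "smooth (cutoff n)"
proof -
  let ?r = "1 - 1 / (real n + 2)"
  let ?L = "\<lambda>p :: real \<times> real. (fst p / (pi * ?r), snd p / (1 / 2 * ?r))"
  have "bounded_linear ?L"
    by (intro bounded_linear_Pair bounded_linear_compose[OF bounded_linear_divide bounded_linear_fst]
        bounded_linear_compose[OF bounded_linear_divide bounded_linear_snd])
  then have "C_k k (\<lambda>p. bump ((0, - (1 / 2) / (1 / 2 * ?r)) + ?L p))" for k
    using smooth_bump by (intro C_k_affine) (auto simp: smooth_def)
  moreover have "cutoff n = (\<lambda>p. bump ((0, - (1 / 2) / (1 / 2 * ?r)) + ?L p))"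
    by (auto simp: cutoff_def fun_eq_iff diff_divide_distrib)
  ultimately show ?thesis by (simp add: smooth_def)
qed

lemma cutoff_eq_0_iff:
  "cutoff n p = 0 \<longleftrightarrow> \<not> (\<bar>fst p\<bar> < pi * (1 - 1 / (real n + 2)) \<and> \<bar>snd p - 1 / 2\<bar> < 1 / 2 * (1 - 1 / (real n + 2)))"
proof -
  have "1 - 1 / (real n + 2) > 0" by (simp add: field_simps)
  then have "pi * (1 - 1 / (real n + 2)) > 0" "1 / 2 * (1 - 1 / (real n + 2)) > 0" by simp_all
  moreover have "\<bar>a / c\<bar> < 1 \<longleftrightarrow> \<bar>a\<bar> < c" if "c > 0" for a c :: real
    using that by (simp add: abs_divide)
  ultimately show ?thesis
    unfolding cutoff_def bump_eq_0_iff fst_conv snd_conv by presburger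
qed

lemma cutoff_eventually_nonzero:
  assumes "p \<in> Q_plus"
  shows "\<forall>\<^sub>F n in sequentially. cutoff n p \<noteq> 0"
proof -
  have "\<bar>fst p\<bar> < pi" "\<bar>snd p - 1 / 2\<bar> < 1 / 2" using assms unfolding mem_Q_plus by linarith+
  moreover have "(\<lambda>n. 1 / (real n + 2)) \<longlonglongrightarrow> 0"
    using LIMSEQ_ignore_initial_segment[OF lim_1_over_n[where 'a=real], of 2] by (simp add: add.commute)
  then have "(\<lambda>n. c * (1 - 1 / (real n + 2))) \<longlonglongrightarrow> c * (1 - 0)" for c
    by (intro tendsto_intros)
  from this[of pi] this[of "1/2"] have "(\<lambda>n. pi * (1 - 1 / (real n + 2))) \<longlonglongrightarrow> pi"
    "(\<lambda>n. 1 / 2 * (1 - 1 / (real n + 2))) \<longlonglongrightarrow> 1 / 2" by simp_all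
  ultimately have "\<forall>\<^sub>F n in sequentially. \<bar>fst p\<bar> < pi * (1 - 1 / (real n + 2)) \<and>
      \<bar>snd p - 1 / 2\<bar> < 1 / 2 * (1 - 1 / (real n + 2))"
    by (intro eventually_conj) (auto dest: order_tendstoD)
  then show ?thesis by (simp add: cutoff_eq_0_iff)
qed

lemma test_function_if_compact_superset:
  assumes "smooth \<zeta>" "compact K" "K \<subseteq> \<Omega>" "\<And>p. \<zeta> p \<noteq> 0 \<Longrightarrow> p \<in> K"
  shows "test_function \<Omega> \<zeta>"
proof -
  have "closure {p. \<zeta> p \<noteq> 0} \<subseteq> K"
    using assms by (intro closure_minimal) (auto simp: compact_imp_closed)
  then show ?thesis
    using assms by (auto simp: test_function_def compact_closure intro: bounded_subset compact_imp_bounded)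
qed

lemma test_function_cutoff_mult:
  assumes "smooth P" shows "test_function Q_plus (\<lambda>p. P p * cutoff n p)"
proof (rule test_function_if_compact_superset)
  let ?r = "1 - 1 / (real n + 2)"
  let ?K = "cbox (- (pi * ?r), 1 / 2 - 1 / 2 * ?r) (pi * ?r, 1 / 2 + 1 / 2 * ?r)"
  show "smooth (\<lambda>p. P p * cutoff n p)"
    using assms smooth_cutoff by (auto simp: smooth_def intro: C_k_mult)
  have r: "0 < ?r" "?r < 1" by (simp_all add: field_simps)
  show "compact ?K" by simp
  define c r where "c = pi * ?r" and "r = ?r"
  have "c < pi" "0 < r" "r < 1" using r by (simp_all add: c_def r_def)
  then have "cbox (- c, 1 / 2 - 1 / 2 * r) (c, 1 / 2 + 1 / 2 * r) \<subseteq> Q_plus"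
    by (auto simp: mem_Q_plus cbox_Pair_eq)
  then show "?K \<subseteq> Q_plus" by (simp add: c_def r_def)
  show "p \<in> ?K" if "P p * cutoff n p \<noteq> 0" for p
  proof -
    have "\<bar>fst p\<bar> < pi * ?r" "\<bar>snd p - 1 / 2\<bar> < 1 / 2 * ?r"
      using that cutoff_eq_0_iff[of n p] by auto
    then have "- (pi * ?r) \<le> fst p" "fst p \<le> pi * ?r" "1 / 2 - 1 / 2 * ?r \<le> snd p" "snd p \<le> 1 / 2 + 1 / 2 * ?r"
      by linarith+
    then show ?thesis
      unfolding cbox_Pair_eq mem_Times_iff fst_conv snd_conv box_real atLeastAtMost_iff by blast
  qed
qed

lemma locally_integrable_diff:
  "locally_integrable \<Omega> u \<Longrightarrow> locally_integrable \<Omega> w \<Longrightarrow> locally_integrable \<Omega> (\<lambda>p. u p - w p)"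
  by (auto simp: locally_integrable_def)

text \<open>A locally integrable function may fail to be integrable near the boundary, but the
  compact support of the test function keeps away from it.\<close>

lemma integrable_MQ_test_function_mult:
  assumes u: "locally_integrable Q_plus u" and \<zeta>: "test_function Q_plus \<zeta>"
  shows "integrable MQ (\<lambda>p. \<zeta> p *\<^sub>R u p)"
proof -
  let ?K = "closure {p. \<zeta> p \<noteq> 0}"
  have K: "compact ?K" "?K \<subseteq> Q_plus" using \<zeta> by (auto simp: test_function_def)
  have Kl: "?K \<in> sets lebesgue" by (simp add: lmeasurable_compact fmeasurableD K)
  have c: "continuous_on UNIV \<zeta>" using C1_alongD(1)[OF C1_along_smooth[OF test_functionD(1)[OF \<zeta>]]] .
  obtain B where B: "B \<ge> 0" "\<And>p. p \<in> ?K \<Longrightarrow> norm (\<zeta> p) \<le> B"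
    using continuous_bounded_on_bounded[OF c compact_imp_bounded[OF K(1)]] by blast
  have i: "integrable (lebesgue_on ?K) u" using u K by (auto simp: locally_integrable_def)
  have "integrable (lebesgue_on ?K) (\<lambda>p. \<zeta> p *\<^sub>R u p)"
  proof (rule Bochner_Integration.integrable_bound)
    show "integrable (lebesgue_on ?K) (\<lambda>p. B * norm (u p))" using i by simp
    show "(\<lambda>p. \<zeta> p *\<^sub>R u p) \<in> borel_measurable (lebesgue_on ?K)"
      using i c by (intro borel_measurable_scaleR[OF borel_measurable_lebesgue_on[OF borel_measurable_continuous_onI]]) auto
    show "AE p in lebesgue_on ?K. norm (\<zeta> p *\<^sub>R u p) \<le> norm (B * norm (u p))"
      using B by (intro AE_I2) (simp add: mult_right_mono)
  qed
  then have "integrable lebesgue (\<lambda>p. indicator ?K p *\<^sub>R \<zeta> p *\<^sub>R u p)"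
    using Kl by (simp add: integrable_restrict_space)
  also have "(\<lambda>p. indicator ?K p *\<^sub>R \<zeta> p *\<^sub>R u p) = (\<lambda>p. indicator Q_plus p *\<^sub>R \<zeta> p *\<^sub>R u p)"
    using closure_subset[of "{p. \<zeta> p \<noteq> 0}"] K(2) by (auto simp: fun_eq_iff indicator_def)
  finally show ?thesis by (simp add: integrable_restrict_space)
qed

text \<open>A polynomial has no compact support and cannot be a test function, but its product with
  \<open>cutoff n\<close> can. So each component of \<open>cutoff n\<close> times g - g' is
  integrable and orthogonal to all polynomials, hence zero almost everywhere; at any given point
  \<open>cutoff n\<close> is nonzero for some n.\<close>

lemma has_weak_deriv_unique:
  assumes g: "has_weak_deriv Q_plus v u g" and g': "has_weak_deriv Q_plus v u g'"
  shows "AE p in MQ. g p = g' p"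
proof -
  let ?d = "\<lambda>p. g p - g' p"
  note l = g[unfolded has_weak_deriv_def] g'[unfolded has_weak_deriv_def]
  have loc: "locally_integrable Q_plus ?d" using l by (auto intro: locally_integrable_diff)
  have orth: "(\<integral>p. \<zeta> p *\<^sub>R ?d p \<partial>MQ) = 0" if \<zeta>: "test_function Q_plus \<zeta>" for \<zeta>
  proof -
    have "integrable MQ (\<lambda>p. \<zeta> p *\<^sub>R g p)" "integrable MQ (\<lambda>p. \<zeta> p *\<^sub>R g' p)"
      using integrable_MQ_test_function_mult[OF _ \<zeta>] l by auto
    moreover have "(\<integral>p. \<zeta> p *\<^sub>R g p \<partial>MQ) = (\<integral>p. \<zeta> p *\<^sub>R g' p \<partial>MQ)"
    proof -
      have "- (\<integral>p. \<zeta> p *\<^sub>R g p \<partial>MQ) = - (\<integral>p. \<zeta> p *\<^sub>R g' p \<partial>MQ)"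
        using l(1)[THEN conjunct2, THEN conjunct2, rule_format, OF \<zeta>]
          l(2)[THEN conjunct2, THEN conjunct2, rule_format, OF \<zeta>] by (rule trans[OF sym])
      then show ?thesis by simp
    qed
    ultimately show ?thesis by (simp add: scaleR_diff_right)
  qed
  have *: "AE p in MQ. cutoff n p * (?d p \<bullet> b) = 0" for n b
  proof (rule AE_eq_0_if_orthogonal_polynomials)
    have t: "test_function Q_plus (\<lambda>p. P p * cutoff n p)" if "real_polynomial_function P" for P
      by (intro test_function_cutoff_mult smooth_polynomial that)
    have "integrable MQ (\<lambda>p. cutoff n p *\<^sub>R ?d p)"
      using integrable_MQ_test_function_mult[OF loc t[of "\<lambda>p. 1"]] by (simp add: real_polynomial_function.intros)
    from integrable_inner_left[OF this, of b] show "integrable MQ (\<lambda>p. cutoff n p * (?d p \<bullet> b))" by simp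
    fix P :: "real \<times> real \<Rightarrow> real" assume P: "real_polynomial_function P"
    have "(\<integral>p. P p * (cutoff n p * (?d p \<bullet> b)) \<partial>MQ) = (\<integral>p. ((P p * cutoff n p) *\<^sub>R ?d p) \<bullet> b \<partial>MQ)"
      by (simp add: mult.assoc)
    also have "\<dots> = (\<integral>p. (P p * cutoff n p) *\<^sub>R ?d p \<partial>MQ) \<bullet> b"
      using integral_inner_left[of b MQ] integrable_MQ_test_function_mult[OF loc t[OF P]] by blast
    also have "\<dots> = 0" using orth[OF t[OF P]] by simp
    finally show "(\<integral>p. P p * (cutoff n p * (?d p \<bullet> b)) \<partial>MQ) = 0" .
  qed auto
  have "AE p in MQ. \<forall>n. \<forall>b\<in>Basis. cutoff n p * (?d p \<bullet> b) = 0"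
    unfolding AE_all_countable using * by (intro allI AE_finite_allI finite_Basis) auto
  then show ?thesis using AE_space
  proof eventually_elim
    case (elim p)
    then obtain n where "cutoff n p \<noteq> 0"
      using cutoff_eventually_nonzero[of p] by (auto simp: eventually_sequentially)
    have "?d p \<bullet> b = 0" if "b \<in> Basis" for b
    proof -
      have "cutoff n p * (?d p \<bullet> b) = 0" using elim(1) that by blast
      then show ?thesis using \<open>cutoff n p \<noteq> 0\<close> by simp
    qed
    then have "?d p = 0" by (rule euclidean_eqI[OF trans]) simp_all
    then show ?case by simp
  qed
qed

section \<open>Mollification\<close>

text \<open>Cauchy-Schwarz for the factors sqrt k and sqrt k u, that is, Jensen with the weight k.
  Extended integrals are used so that the right side may be infinite and Tonelli can be applied to
  it directly.\<close>

lemma norm_integral_power2_le: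
  fixes u :: "'a \<Rightarrow> 'b::euclidean_space"
  assumes [measurable]: "k \<in> borel_measurable M" "u \<in> borel_measurable M" and k: "\<And>w. k w \<ge> 0"
    and fin: "(\<integral>\<^sup>+w. k w \<partial>M) < \<infinity>"
  shows "ennreal ((norm (\<integral>w. k w *\<^sub>R u w \<partial>M))\<^sup>2) \<le> (\<integral>\<^sup>+w. k w \<partial>M) * (\<integral>\<^sup>+w. ennreal (k w * (norm (u w))\<^sup>2) \<partial>M)"
proof -
  consider "(\<integral>\<^sup>+w. k w \<partial>M) = 0" | "(\<integral>\<^sup>+w. k w \<partial>M) \<noteq> 0" "(\<integral>\<^sup>+w. ennreal (k w * (norm (u w))\<^sup>2) \<partial>M) = \<infinity>"
    | "(\<integral>\<^sup>+w. ennreal (k w * (norm (u w))\<^sup>2) \<partial>M) < \<infinity>"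
    by (metis top.not_eq_extremum infinity_ennreal_def)
  then show ?thesis
  proof cases
    \<comment> \<open>A weight of mass 0 is treated apart because in the extended reals 0 times
      infinity is 0.\<close>
    case 1
    then have "AE w in M. k w = 0"
      using k by (subst (asm) nn_integral_0_iff_AE) (auto elim!: eventually_mono simp: ennreal_eq_0_iff antisym)
    then have "AE w in M. k w *\<^sub>R u w = 0" by eventually_elim simp
    then have "(\<integral>w. k w *\<^sub>R u w \<partial>M) = 0" by (rule integral_eq_zero_AE)
    then show ?thesis by simp
  next
    case 2
    then show ?thesis by (simp add: ennreal_mult_top)
  next
    case 3
    let ?s = "\<lambda>w. sqrt (k w)" and ?t = "\<lambda>w. sqrt (k w) *\<^sub>R u w"
    have ik: "integrable M k" using fin k by (intro integrableI_nonneg) auto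
    have iku: "integrable M (\<lambda>w. k w * (norm (u w))\<^sup>2)" using 3 k by (intro integrableI_nonneg) auto
    have s: "?s \<in> L2_space M" "?t \<in> L2_space M"
      using ik iku k by (auto simp: L2_space_def power_mult_distrib)
    have "norm (\<integral>w. k w *\<^sub>R u w \<partial>M) \<le> (\<integral>w. norm (k w *\<^sub>R u w) \<partial>M)" by (rule integral_norm_bound)
    also have "\<dots> = (\<integral>w. norm (?s w) * norm (?t w) \<partial>M)"
      using k by (intro Bochner_Integration.integral_cong refl) (simp flip: mult.assoc)
    finally have "(norm (\<integral>w. k w *\<^sub>R u w \<partial>M))\<^sup>2 \<le> (\<integral>w. norm (?s w) * norm (?t w) \<partial>M)\<^sup>2"
      by (intro power_mono) auto
    also have "\<dots> \<le> (\<integral>w. (norm (?s w))\<^sup>2 \<partial>M) * (\<integral>w. (norm (?t w))\<^sup>2 \<partial>M)"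
      by (rule Cauchy_Schwarz_integral[OF s])
    also have "\<dots> = (\<integral>w. k w \<partial>M) * (\<integral>w. k w * (norm (u w))\<^sup>2 \<partial>M)"
      using k by (simp add: power_mult_distrib)
    finally have "ennreal ((norm (\<integral>w. k w *\<^sub>R u w \<partial>M))\<^sup>2) \<le> ennreal ((\<integral>w. k w \<partial>M) * (\<integral>w. k w * (norm (u w))\<^sup>2 \<partial>M))"
      by (rule ennreal_leI)
    also have "\<dots> = (\<integral>\<^sup>+w. k w \<partial>M) * (\<integral>\<^sup>+w. ennreal (k w * (norm (u w))\<^sup>2) \<partial>M)"
    proof -
      have "(\<integral>\<^sup>+w. k w \<partial>M) = ennreal (\<integral>w. k w \<partial>M)"
        using ik k by (intro nn_integral_eq_integral) auto
      moreover have "(\<integral>\<^sup>+w. ennreal (k w * (norm (u w))\<^sup>2) \<partial>M) = ennreal (\<integral>w. k w * (norm (u w))\<^sup>2 \<partial>M)"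
        using iku k by (intro nn_integral_eq_integral) auto
      ultimately show ?thesis
        using k by (simp only: ennreal_mult[symmetric] integral_nonneg_AE mult_nonneg_nonneg zero_le_power2 AE_I2)
    qed
    finally show ?thesis .
  qed
qed

text \<open>Truncate u first; then truncate in the same way continuous functions that converge to u
  almost everywhere. The common bound allows dominated convergence in both steps.\<close>

lemma L2_dense_continuous:
  fixes u :: "'a::euclidean_space \<Rightarrow> 'b::euclidean_space"
  assumes u: "u \<in> L2_space (lebesgue_on S)" and S: "S \<in> sets lebesgue" "finite_measure (lebesgue_on S)" and e: "e > 0"
  obtains g where "continuous_on UNIV g" "g \<in> L2_space (lebesgue_on S)"
    "(\<integral>p. (norm (g p - u p))\<^sup>2 \<partial>lebesgue_on S) < e"
proof -
  let ?M = "lebesgue_on S"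
  \<comment> \<open>Radial retraction onto the ball of radius k. Below it is used at
    \<open>Suc k\<close>, where the denominator is positive and the map is continuous.\<close>
  define \<tau> where "\<tau> k z = (real k / max (real k) (norm z)) *\<^sub>R z" for k :: nat and z :: 'b
  have \<tau>1: "norm (\<tau> k z) \<le> norm z" "norm (\<tau> k z) \<le> real k" for k z
    by (cases "k = 0"; auto simp: \<tau>_def divide_simps max_def mult_le_cancel_right1)+
  have \<tau>c: "continuous_on UNIV (\<tau> (Suc k))" for k
    unfolding \<tau>_def by (intro continuous_intros) (auto simp: max_def)
  have [measurable]: "\<tau> (Suc k) \<in> borel_measurable borel" for k
    by (intro borel_measurable_continuous_onI \<tau>c)
  note [measurable] = L2_spaceD(1)[OF u]
  have "(\<lambda>k. \<integral>p. (norm (\<tau> (Suc k) (u p) - u p))\<^sup>2 \<partial>?M) \<longlonglongrightarrow> (\<integral>p. 0 \<partial>?M)"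
  proof (rule integral_dominated_convergence)
    show "integrable ?M (\<lambda>p. 2 * (norm (u p))\<^sup>2 + 2 * (norm (u p))\<^sup>2)"
      using L2_spaceD(2)[OF u] by auto
    have "(norm (\<tau> (Suc k) z - z))\<^sup>2 \<le> 2 * (norm z)\<^sup>2 + 2 * (norm z)\<^sup>2" for k z
    proof -
      have "(norm (\<tau> (Suc k) z))\<^sup>2 \<le> (norm z)\<^sup>2" by (intro power_mono \<tau>1) auto
      then show ?thesis
        using norm_add_power2_le[of "\<tau> (Suc k) z" "- z"] unfolding norm_minus_cancel diff_conv_add_uminus[symmetric]
        by linarith
    qed
    then show "AE p in ?M. norm ((norm (\<tau> (Suc k) (u p) - u p))\<^sup>2) \<le> 2 * (norm (u p))\<^sup>2 + 2 * (norm (u p))\<^sup>2" for k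
      by simp
    have "(\<lambda>k. (norm (\<tau> (Suc k) z - z))\<^sup>2) \<longlonglongrightarrow> 0" for z
    proof (rule tendsto_eventually)
      obtain n where n: "norm z \<le> real n" using real_arch_simple by blast
      show "\<forall>\<^sub>F k in sequentially. (norm (\<tau> (Suc k) z - z))\<^sup>2 = 0"
        using eventually_ge_at_top[of n]
      proof eventually_elim
        case (elim k)
        then have "max (real (Suc k)) (norm z) = real (Suc k)" using n by simp
        then show ?case by (simp add: \<tau>_def del: of_nat_Suc)
      qed
    qed
    then show "AE p in ?M. (\<lambda>k. (norm (\<tau> (Suc k) (u p) - u p))\<^sup>2) \<longlonglongrightarrow> 0" by simp
  qed simp_all
  \<comment> \<open>Each of the two errors enters the final estimate with a factor 2, hence e /
    4.\<close>
  then have "\<forall>\<^sub>F k in sequentially. (\<integral>p. (norm (\<tau> (Suc k) (u p) - u p))\<^sup>2 \<partial>?M) < e / 4"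
    using e by (intro order_tendstoD(2)) auto
  then obtain k where k: "(\<integral>p. (norm (\<tau> (Suc k) (u p) - u p))\<^sup>2 \<partial>?M) < e / 4"
    by (auto simp: eventually_sequentially)
  have "u measurable_on S"
    using measurable_on_iff_borel_measurable[OF S(1)] L2_spaceD(1)[OF u] by blast
  then obtain N g where N: "negligible N" and g: "\<And>n. continuous_on UNIV (g n)"
    and lim: "\<And>x. x \<notin> N \<Longrightarrow> (\<lambda>n. g n x) \<longlonglongrightarrow> (if x \<in> S then u x else 0)"
    unfolding measurable_on_def by auto
  define g' where "g' n p = \<tau> (Suc k) (g n p)" for n p
  have g': "continuous_on UNIV (g' n)" for n
    unfolding g'_def by (rule continuous_on_compose2[OF \<tau>c g]) auto
  have [measurable]: "g' n \<in> borel_measurable ?M" for n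
    by (intro borel_measurable_lebesgue_on borel_measurable_continuous_onI g')
  have L2g': "g' n \<in> L2_space ?M" for n
    using \<tau>1(2) by (intro L2_space_bounded[OF S(2), where C="real (Suc k)"]) (auto simp: g'_def simp del: of_nat_Suc)
  have L2\<tau>: "(\<lambda>p. \<tau> (Suc k) (u p)) \<in> L2_space ?M"
    using \<tau>1(2) by (intro L2_space_bounded[OF S(2), where C="real (Suc k)"]) (auto simp del: of_nat_Suc)
  have "(\<lambda>n. \<integral>p. (norm (g' n p - \<tau> (Suc k) (u p)))\<^sup>2 \<partial>?M) \<longlonglongrightarrow> (\<integral>p. 0 \<partial>?M)"
  proof (rule integral_dominated_convergence)
    show "integrable ?M (\<lambda>p. 2 * (real (Suc k))\<^sup>2 + 2 * (real (Suc k))\<^sup>2)"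
      using S(2) by (intro finite_measure.integrable_const)
    show "AE p in ?M. norm ((norm (g' n p - \<tau> (Suc k) (u p)))\<^sup>2) \<le> 2 * (real (Suc k))\<^sup>2 + 2 * (real (Suc k))\<^sup>2" for n
    proof (rule AE_I2)
      fix p
      have "(norm (g' n p - \<tau> (Suc k) (u p)))\<^sup>2 \<le> 2 * (norm (g' n p))\<^sup>2 + 2 * (norm (\<tau> (Suc k) (u p)))\<^sup>2"
        using norm_add_power2_le[of "g' n p" "- \<tau> (Suc k) (u p)"] by simp
      also have "\<dots> \<le> 2 * (real (Suc k))\<^sup>2 + 2 * (real (Suc k))\<^sup>2"
        unfolding g'_def by (intro add_mono mult_left_mono power_mono \<tau>1) auto
      finally show "norm ((norm (g' n p - \<tau> (Suc k) (u p)))\<^sup>2) \<le> 2 * (real (Suc k))\<^sup>2 + 2 * (real (Suc k))\<^sup>2"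
        by simp
    qed
    have "AE x in lebesgue. x \<notin> N"
      using N by (simp add: AE_not_in negligible_iff_null_sets)
    then have "AE x in ?M. x \<notin> N"
      using S(1) by (auto simp: AE_restrict_space_iff elim: eventually_mono)
    then show "AE p in ?M. (\<lambda>n. (norm (g' n p - \<tau> (Suc k) (u p)))\<^sup>2) \<longlonglongrightarrow> 0"
      using AE_space
    proof eventually_elim
      case (elim x)
      then have "(\<lambda>n. g n x) \<longlonglongrightarrow> u x" using lim[of x] by auto
      then have "(\<lambda>n. g' n x) \<longlonglongrightarrow> \<tau> (Suc k) (u x)"
        unfolding g'_def by (rule continuous_on_tendsto_compose[OF \<tau>c]) auto
      then have "(\<lambda>n. (norm (g' n x - \<tau> (Suc k) (u x)))\<^sup>2) \<longlonglongrightarrow> (norm (\<tau> (Suc k) (u x) - \<tau> (Suc k) (u x)))\<^sup>2"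
        by (intro tendsto_intros)
      then show ?case by simp
    qed
  qed simp_all
  then have "\<forall>\<^sub>F n in sequentially. (\<integral>p. (norm (g' n p - \<tau> (Suc k) (u p)))\<^sup>2 \<partial>?M) < e / 4"
    using e by (intro order_tendstoD(2)) auto
  then obtain n where n: "(\<integral>p. (norm (g' n p - \<tau> (Suc k) (u p)))\<^sup>2 \<partial>?M) < e / 4"
    by (auto simp: eventually_sequentially)
  have i: "integrable ?M (\<lambda>p. (norm (g' n p - \<tau> (Suc k) (u p)))\<^sup>2)"
    "integrable ?M (\<lambda>p. (norm (\<tau> (Suc k) (u p) - u p))\<^sup>2)"
    by (intro L2_spaceD(2) L2_space_diff L2g' L2\<tau> u)+
  have "(\<integral>p. (norm (g' n p - u p))\<^sup>2 \<partial>?M) \<le>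
      (\<integral>p. 2 * (norm (g' n p - \<tau> (Suc k) (u p)))\<^sup>2 + 2 * (norm (\<tau> (Suc k) (u p) - u p))\<^sup>2 \<partial>?M)"
  proof (rule integral_mono_AE')
    have "(norm (g' n p - u p))\<^sup>2 \<le> 2 * (norm (g' n p - \<tau> (Suc k) (u p)))\<^sup>2 + 2 * (norm (\<tau> (Suc k) (u p) - u p))\<^sup>2" for p
      using norm_add_power2_le[of "g' n p - \<tau> (Suc k) (u p)" "\<tau> (Suc k) (u p) - u p"] by simp
    then show "AE p in ?M. (norm (g' n p - u p))\<^sup>2 \<le>
        2 * (norm (g' n p - \<tau> (Suc k) (u p)))\<^sup>2 + 2 * (norm (\<tau> (Suc k) (u p) - u p))\<^sup>2" by simp
  qed (use i in auto)
  also have "\<dots> < e" using i n k by simp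
  finally show ?thesis using that[OF g' L2g'] by blast
qed

section \<open>Convolution of an integrable function with a smooth kernel\<close>

lemma smooth_uniform_linearization:
  fixes \<kappa> :: "'a::euclidean_space \<Rightarrow> real"
  assumes \<kappa>: "smooth \<kappa>" and e: "e > 0"
  obtains d where "d > 0" "\<And>q h. norm q \<le> R \<Longrightarrow> norm h < d \<Longrightarrow>
    \<bar>\<kappa> (q + h) - \<kappa> q - frechet_derivative \<kappa> (at q) h\<bar> \<le> e * norm h"
proof -
  let ?D = "\<lambda>q. frechet_derivative \<kappa> (at q)"
  have "C_k (Suc 0) \<kappa>" using \<kappa> by (simp add: smooth_def)
  from C_k_SucD[OF this] have D: "(\<kappa> has_derivative ?D q) (at q)" and cD: "continuous_on UNIV (\<lambda>q. ?D q v)" for q v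
    by auto
  \<comment> \<open>As \<open>d \<le> 1\<close>, the segment from q to q + h stays in this ball,
    where compactness makes all partial derivatives of \<kappa> uniformly continuous.\<close>
  let ?C = "cball (0::'a) (R + 1)"
  have "\<exists>d>0. \<forall>q\<in>?C. \<forall>q'\<in>?C. dist q' q < d \<longrightarrow> dist (?D q' b) (?D q b) < e / (real DIM('a))" for b
    using compact_uniformly_continuous[OF continuous_on_subset[OF cD[of b] subset_UNIV] compact_cball] e
    by (simp add: uniformly_continuous_on_def)
  then obtain \<delta> where \<delta>: "\<And>b. \<delta> b > 0" "\<And>b q q'. q \<in> ?C \<Longrightarrow> q' \<in> ?C \<Longrightarrow> dist q' q < \<delta> b \<Longrightarrow> dist (?D q' b) (?D q b) < e / (real DIM('a))"
    by metis
  define d where "d = min 1 (Min (\<delta> ` Basis))"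
  have d: "d > 0" "d \<le> 1" "\<And>b. b \<in> Basis \<Longrightarrow> d \<le> \<delta> b"
    using \<delta>(1) by (auto simp: d_def min_le_iff_disj)
  show ?thesis
  proof (rule that[OF d(1)])
    fix q h :: 'a assume q: "norm q \<le> R" and h: "norm h < d"
    have on: "norm (?D (q + t *\<^sub>R h) v - ?D q v) \<le> e * norm v" if "t \<in> {0..1}" for t v
    proof -
      have th: "norm (t *\<^sub>R h) \<le> norm h" using that by (simp add: mult_left_le_one_le)
      have qc: "q \<in> ?C" "q + t *\<^sub>R h \<in> ?C"
        using q h d th norm_triangle_ineq[of q "t *\<^sub>R h"] by auto
      have lin: "?D p v = (\<Sum>b\<in>Basis. (v \<bullet> b) * ?D p b)" for p
        by (subst euclidean_representation[of v, symmetric])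
           (simp add: linear_sum[OF has_derivative_linear[OF D]] linear_scale[OF has_derivative_linear[OF D]])
      have "norm (?D (q + t *\<^sub>R h) v - ?D q v) = \<bar>\<Sum>b\<in>Basis. (v \<bullet> b) * (?D (q + t *\<^sub>R h) b - ?D q b)\<bar>"
        unfolding lin[of "q + t *\<^sub>R h"] lin[of q] by (simp add: sum_subtractf right_diff_distrib)
      also have "\<dots> \<le> (\<Sum>b\<in>Basis. \<bar>(v \<bullet> b) * (?D (q + t *\<^sub>R h) b - ?D q b)\<bar>)" by (rule sum_abs)
      also have "\<dots> \<le> (\<Sum>b\<in>(Basis :: 'a set). norm v * (e / real DIM('a)))"
      proof (rule sum_mono)
        fix b :: 'a assume b: "b \<in> Basis"
        have "dist (q + t *\<^sub>R h) q < \<delta> b" using th h d(3)[OF b] by (simp add: dist_norm)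
        from \<delta>(2)[OF qc this] have "\<bar>?D (q + t *\<^sub>R h) b - ?D q b\<bar> \<le> e / real DIM('a)"
          by (simp add: dist_real_def)
        then show "\<bar>(v \<bullet> b) * (?D (q + t *\<^sub>R h) b - ?D q b)\<bar> \<le> norm v * (e / real DIM('a))"
          unfolding abs_mult using Basis_le_norm[OF b, of v] by (intro mult_mono) auto
      qed
      also have "\<dots> = e * norm v" by simp
      finally show ?thesis .
    qed
    have "norm (\<kappa> (q + h) - \<kappa> q - ?D q (q + h - q)) \<le> norm (q + h - q) * e"
    proof (rule differentiable_bound_linearization[where S="(\<lambda>t. q + t *\<^sub>R h) ` {0..1}"])
      show "(\<kappa> has_derivative ?D x) (at x within (\<lambda>t. q + t *\<^sub>R h) ` {0..1})" for x
        using D has_derivative_at_withinI by blast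
      show "onorm (?D x - ?D q) \<le> e" if "x \<in> (\<lambda>t. q + t *\<^sub>R h) ` {0..1}" for x
        using on that by (intro onorm_le) auto
      show "q \<in> (\<lambda>t. q + t *\<^sub>R h) ` {0..1}" by (rule image_eqI[of _ _ 0]) auto
    qed auto
    then show "\<bar>\<kappa> (q + h) - \<kappa> q - ?D q h\<bar> \<le> e * norm h" by (simp add: mult.commute)
  qed
qed

lemma integrable_smooth_mult_MQ:
  fixes u :: "real \<times> real \<Rightarrow> 'b::euclidean_space"
  assumes "continuous_on UNIV \<kappa>" "integrable MQ u"
  shows "integrable MQ (\<lambda>w. \<kappa> w *\<^sub>R u w)"
proof -
  obtain B where B: "AE p in MQ. \<bar>\<kappa> p\<bar> \<le> B" using continuous_AE_bounded_MQ[OF assms(1)] by auto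
  have "L1_tendsto MQ (\<lambda>n. u) u" using assms by (simp add: L1_tendsto_def)
  from L1_tendsto_bounded_mult[OF this continuous_measurable_MQ[OF assms(1)] B] show ?thesis
    by (rule L1_tendstoD(2))
qed

text \<open>Differentiation under the integral rests on a Taylor remainder of \<kappa> that is
  uniform in w, which ranges over a bounded set; u contributes only its L1 norm. The affine argument
  of \<kappa> anticipates the contraction in \<open>shrink\<close>.\<close>

lemma smooth_convolution_has_derivative:
  fixes u :: "real \<times> real \<Rightarrow> 'b::euclidean_space"
  assumes \<kappa>: "smooth \<kappa>" and u: "integrable MQ u"
  shows "((\<lambda>p. \<integral>w. \<kappa> (b + t *\<^sub>R p - w) *\<^sub>R u w \<partial>MQ) has_derivative
    (\<lambda>v. \<integral>w. (frechet_derivative \<kappa> (at (b + t *\<^sub>R p - w)) (t *\<^sub>R v)) *\<^sub>R u w \<partial>MQ)) (at p)"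
proof -
  let ?D = "\<lambda>q. frechet_derivative \<kappa> (at q)"
  have "C_k (Suc 0) \<kappa>" using \<kappa> by (simp add: smooth_def)
  from C_k_SucD[OF this] have D: "(\<kappa> has_derivative ?D q) (at q)" and cD: "continuous_on UNIV (\<lambda>q. ?D q v)" for q v
    by auto
  have c\<kappa>: "continuous_on UNIV \<kappa>" using C1_alongD(1)[OF C1_along_smooth[OF \<kappa>]] .
  have cshift: "continuous_on UNIV (\<lambda>w. F (a - w))" if "continuous_on UNIV F" for F :: "real \<times> real \<Rightarrow> real" and a
    by (rule continuous_on_compose2[OF that]) (auto intro!: continuous_intros)
  have i: "integrable MQ (\<lambda>w. \<kappa> (a - w) *\<^sub>R u w)" "integrable MQ (\<lambda>w. ?D (a - w) v *\<^sub>R u w)" for a v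
    by (intro integrable_smooth_mult_MQ cshift c\<kappa> cD u)+
  obtain RQ where RQ: "\<And>w. w \<in> Q_plus \<Longrightarrow> norm w \<le> RQ"
    using bounded_Q_plus bounded_iff by metis
  define J where "J = (\<integral>w. norm (u w) \<partial>MQ)"
  have J: "J \<ge> 0" by (simp add: J_def)
  let ?a = "b + t *\<^sub>R p"
  have lin: "linear (\<lambda>v. \<integral>w. ?D (?a - w) (t *\<^sub>R v) *\<^sub>R u w \<partial>MQ)"
  proof (rule linearI)
    note l = has_derivative_linear[OF D]
    show "(\<integral>w. ?D (?a - w) (t *\<^sub>R (v + v')) *\<^sub>R u w \<partial>MQ) =
        (\<integral>w. ?D (?a - w) (t *\<^sub>R v) *\<^sub>R u w \<partial>MQ) + (\<integral>w. ?D (?a - w) (t *\<^sub>R v') *\<^sub>R u w \<partial>MQ)" for v v'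
      using i by (simp add: scaleR_add_right linear_add[OF l] scaleR_add_left)
    show "(\<integral>w. ?D (?a - w) (t *\<^sub>R (r *\<^sub>R v)) *\<^sub>R u w \<partial>MQ) = r *\<^sub>R (\<integral>w. ?D (?a - w) (t *\<^sub>R v) *\<^sub>R u w \<partial>MQ)" for r v
      using i[of ?a] by (simp add: linear_scale[OF l] mult.left_commute flip: scaleR_scaleR integral_scaleR_right)
  qed
  show ?thesis
    unfolding has_derivative_at_alt
  proof (intro conjI allI impI)
    show "bounded_linear (\<lambda>v. \<integral>w. ?D (?a - w) (t *\<^sub>R v) *\<^sub>R u w \<partial>MQ)"
      using lin by (simp add: linear_conv_bounded_linear)
    fix e :: real assume e: "e > 0"
    \<comment> \<open>Chosen so that the final bound is exactly \<open>e * norm (y - p)\<close>; the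
      added ones keep the denominator positive when t or J is 0.\<close>
    define e' where "e' = e / ((\<bar>t\<bar> + 1) * (J + 1))"
    have e': "e' > 0" "e' * (\<bar>t\<bar> + 1) * (J + 1) = e" using e J by (auto simp: e'_def)
    obtain d where d: "d > 0" "\<And>q h. norm q \<le> norm ?a + RQ \<Longrightarrow> norm h < d \<Longrightarrow>
        \<bar>\<kappa> (q + h) - \<kappa> q - ?D q h\<bar> \<le> e' * norm h"
      using smooth_uniform_linearization[OF \<kappa> e'(1)] by metis
    show "\<exists>d>0. \<forall>y. norm (y - p) < d \<longrightarrow>
        norm ((\<integral>w. \<kappa> (b + t *\<^sub>R y - w) *\<^sub>R u w \<partial>MQ) - (\<integral>w. \<kappa> (?a - w) *\<^sub>R u w \<partial>MQ)
          - (\<integral>w. ?D (?a - w) (t *\<^sub>R (y - p)) *\<^sub>R u w \<partial>MQ)) \<le> e * norm (y - p)"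
    proof (intro exI[of _ "d / (\<bar>t\<bar> + 1)"] conjI allI impI)
      show "0 < d / (\<bar>t\<bar> + 1)" using d by simp
      fix y assume y: "norm (y - p) < d / (\<bar>t\<bar> + 1)"
      let ?h = "t *\<^sub>R (y - p)"
      have h: "norm ?h \<le> (\<bar>t\<bar> + 1) * norm (y - p)" by (simp add: mult_right_mono)
      have "(\<bar>t\<bar> + 1) * norm (y - p) < d" using y by (simp add: field_simps)
      with h have hd: "norm ?h < d" by linarith
      have eq: "b + t *\<^sub>R y - w = (?a - w) + ?h" for w by (simp add: algebra_simps)
      let ?r = "\<lambda>w. \<kappa> (b + t *\<^sub>R y - w) - \<kappa> (?a - w) - ?D (?a - w) ?h"
      have split: "(\<integral>w. \<kappa> (b + t *\<^sub>R y - w) *\<^sub>R u w \<partial>MQ) - (\<integral>w. \<kappa> (?a - w) *\<^sub>R u w \<partial>MQ)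
          - (\<integral>w. ?D (?a - w) ?h *\<^sub>R u w \<partial>MQ) = (\<integral>w. ?r w *\<^sub>R u w \<partial>MQ)"
        using i by (simp add: scaleR_diff_left)
      have "norm (\<integral>w. ?r w *\<^sub>R u w \<partial>MQ) \<le> (\<integral>w. norm (?r w *\<^sub>R u w) \<partial>MQ)" by (rule integral_norm_bound)
      also have "\<dots> \<le> (\<integral>w. (e' * norm ?h) * norm (u w) \<partial>MQ)"
      proof (rule integral_mono)
        show "integrable MQ (\<lambda>w. norm (?r w *\<^sub>R u w))"
          using i by (auto simp: scaleR_diff_left)
        fix w assume "w \<in> space MQ"
        then have "norm (?a - w) \<le> norm ?a + RQ"
          using RQ[of w] norm_triangle_ineq4[of ?a w] by auto
        from d(2)[OF this hd] have "\<bar>?r w\<bar> \<le> e' * norm ?h" by (simp add: eq)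
        then show "norm (?r w *\<^sub>R u w) \<le> (e' * norm ?h) * norm (u w)"
          unfolding norm_scaleR real_norm_def by (intro mult_right_mono) auto
      qed (use u in auto)
      also have "\<dots> = e' * norm ?h * J" by (simp add: J_def)
      also have "\<dots> \<le> e' * ((\<bar>t\<bar> + 1) * norm (y - p)) * (J + 1)"
        using e' J h by (intro mult_mono mult_left_mono) auto
      also have "\<dots> = e * norm (y - p)" by (simp flip: e'(2))
      finally show "norm ((\<integral>w. \<kappa> (b + t *\<^sub>R y - w) *\<^sub>R u w \<partial>MQ) - (\<integral>w. \<kappa> (?a - w) *\<^sub>R u w \<partial>MQ)
          - (\<integral>w. ?D (?a - w) (t *\<^sub>R (y - p)) *\<^sub>R u w \<partial>MQ)) \<le> e * norm (y - p)"
        unfolding split .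
    qed
  qed
qed

lemma smooth_frechet_derivative: "smooth \<kappa> \<Longrightarrow> smooth (\<lambda>q. frechet_derivative \<kappa> (at q) v)"
  unfolding smooth_def using C_k_SucD(2) by blast

lemma smooth_convolution:
  fixes u :: "real \<times> real \<Rightarrow> 'b::euclidean_space"
  assumes \<kappa>: "smooth \<kappa>" and u: "integrable MQ u"
  shows "smooth (\<lambda>p. \<integral>w. \<kappa> (b + t *\<^sub>R p - w) *\<^sub>R u w \<partial>MQ)"
proof -
  have "C_k k (\<lambda>p. \<integral>w. \<kappa> (b + t *\<^sub>R p - w) *\<^sub>R u w \<partial>MQ)" if "smooth \<kappa>" for k \<kappa>
    using that
  proof (induction k arbitrary: \<kappa>)
    case 0
    then show ?case
      unfolding C_k.simps
      by (intro continuous_at_imp_continuous_on ballI has_derivative_continuous[OF smooth_convolution_has_derivative[OF 0 u]])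
  next
    case (Suc k)
    show ?case
      by (rule C_k_SucI[OF smooth_convolution_has_derivative[OF Suc.prems u]])
         (intro Suc.IH smooth_frechet_derivative Suc.prems)
  qed
  then show ?thesis using \<kappa> by (simp add: smooth_def)
qed

section \<open>Change of variables and the mass of the mollifier\<close>

lemma nn_integral_MQ:
  assumes "f \<in> borel_measurable borel"
  shows "(\<integral>\<^sup>+p. f p \<partial>MQ) = (\<integral>\<^sup>+p. f p * indicator Q_plus p \<partial>lborel)"
  by (subst nn_integral_restrict_space) (auto simp: nn_integral_completion)

lemma nn_integral_lborel_affine:
  fixes f :: "'a::euclidean_space \<Rightarrow> ennreal"
  assumes [measurable]: "f \<in> borel_measurable borel" and c: "c \<noteq> 0"
  shows "(\<integral>\<^sup>+x. f x \<partial>lborel) = ennreal (\<bar>c\<bar> ^ DIM('a)) * (\<integral>\<^sup>+x. f (t + c *\<^sub>R x) \<partial>lborel)"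
  by (subst lborel_affine[OF c, of t])
     (simp add: nn_integral_density nn_integral_distr nn_integral_cmult)

lemma continuous_bump: "continuous_on UNIV bump"
  using C1_alongD(1)[OF C1_along_smooth[OF smooth_bump]] .

lemma bump_measurable [measurable]: "bump \<in> borel_measurable borel"
  using continuous_bump by (rule borel_measurable_continuous_onI)

definition bump_integral :: real where
  "bump_integral = enn2real (\<integral>\<^sup>+p. bump p \<partial>lborel)"

lemma bump_integral: "(\<integral>\<^sup>+p. bump p \<partial>lborel) = ennreal bump_integral" "bump_integral > 0"
proof -
  obtain B where B: "B \<ge> 0" "\<And>p. p \<in> cbox (-1, -1) (1 :: real, 1 :: real) \<Longrightarrow> norm (bump p) \<le> B"
    using continuous_bounded_on_bounded[OF continuous_bump bounded_cbox] by blast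
  have "bump p \<le> B * indicator (cbox (-1, -1) (1 :: real, 1 :: real)) p" for p
  proof (cases "p \<in> cbox (-1, -1) (1 :: real, 1 :: real)")
    case True then show ?thesis using B(2)[of p] by simp
  next
    case False
    then have "\<not> (\<bar>fst p\<bar> < 1 \<and> \<bar>snd p\<bar> < 1)" by (cases p) (auto simp: cbox_Pair_eq)
    then show ?thesis using bump_eq_0_iff[of p] False by simp
  qed
  then have "(\<integral>\<^sup>+p. bump p \<partial>lborel) \<le> (\<integral>\<^sup>+p. ennreal B * indicator (cbox (-1, -1) (1 :: real, 1 :: real)) p \<partial>lborel)"
    using B(1) by (intro nn_integral_mono) (auto simp: ennreal_mult[symmetric] ennreal_indicator[symmetric] simp del: ennreal_indicator intro!: ennreal_leI)
  also have "\<dots> < \<infinity>"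
    by (simp add: nn_integral_cmult emeasure_lborel_cbox_eq ennreal_mult_less_top)
  finally have fin: "(\<integral>\<^sup>+p. bump p \<partial>lborel) < \<infinity>" .
  then show *: "(\<integral>\<^sup>+p. bump p \<partial>lborel) = ennreal bump_integral"
    by (simp add: bump_integral_def)
  have "(\<integral>\<^sup>+p. bump p \<partial>lborel) \<noteq> 0"
  proof
    assume "(\<integral>\<^sup>+p. bump p \<partial>lborel) = 0"
    then have "AE p in lborel. ennreal (bump p) = 0" by (subst (asm) nn_integral_0_iff_AE) auto
    then have "AE p in lborel. p \<notin> box (-1, -1) (1 :: real, 1 :: real)"
    proof eventually_elim
      case (elim p)
      then have "bump p = 0" using bump_nonneg[of p] by (simp add: ennreal_eq_0_iff)
      then show ?case by (cases p) (auto simp: bump_eq_0_iff box_def Basis_real_prod)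
    qed
    then have "emeasure lborel (box (-1, -1) (1 :: real, 1 :: real)) = 0"
      by (subst (asm) AE_iff_measurable[of "box (-1, -1) (1 :: real, 1 :: real)"]) auto
    then show False by (simp add: emeasure_lborel_box_eq Basis_real_prod)
  qed
  then show "bump_integral > 0"
    unfolding bump_integral_def using fin by (simp add: enn2real_positive_iff zero_less_iff_neq_zero)
qed

text \<open>The shift by 8 gives \<open>moll_eps n \<le> 1 / 8\<close>, so the contraction factor
  \<open>1 - 4 * moll_eps n\<close> is never below 1/2.\<close>

definition moll_eps :: "nat \<Rightarrow> real" where
  "moll_eps n = 1 / (real n + 8)"

lemma moll_eps: "0 < moll_eps n" "moll_eps n \<le> 1 / 8" "moll_eps \<longlonglongrightarrow> 0"
proof -
  show "0 < moll_eps n" "moll_eps n \<le> 1 / 8" by (simp_all add: moll_eps_def divide_simps)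
  show "moll_eps \<longlonglongrightarrow> 0"
    using LIMSEQ_ignore_initial_segment[OF lim_1_over_n[where 'a=real], of 8]
    by (simp add: moll_eps_def[abs_def] add.commute)
qed

definition moll_bump :: "nat \<Rightarrow> real \<times> real \<Rightarrow> real" where
  "moll_bump n q = bump ((1 / moll_eps n) *\<^sub>R q) * (1 / ((moll_eps n)\<^sup>2 * bump_integral))"

text \<open>Contraction towards the centre \<open>(0, 1 / 2)\<close>, which moves \<open>Q_plus\<close> away from its boundary by more than the
  radius of the mollifier; hence the mollifier is a test function and no extension of \<open>u\<close> is needed.\<close>

abbreviation shrink :: "nat \<Rightarrow> real \<times> real \<Rightarrow> real \<times> real" where
  "shrink n p \<equiv> (4 * moll_eps n) *\<^sub>R (0, 1 / 2) + (1 - 4 * moll_eps n) *\<^sub>R p"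

definition moll :: "nat \<Rightarrow> (real \<times> real \<Rightarrow> 'b::euclidean_space) \<Rightarrow> real \<times> real \<Rightarrow> 'b" where
  "moll n u p = (\<integral>w. moll_bump n (shrink n p - w) *\<^sub>R u w \<partial>MQ)"

lemma smooth_moll_bump: "smooth (moll_bump n)"
proof -
  have "C_k k (\<lambda>q. bump (0 + (1 / moll_eps n) *\<^sub>R q) * (1 / ((moll_eps n)\<^sup>2 * bump_integral)))" for k
    using smooth_bump by (intro C_k_mult C_k_const C_k_affine bounded_linear_scaleR_right) (auto simp: smooth_def)
  then show ?thesis by (simp add: moll_bump_def[abs_def] smooth_def)
qed

lemma continuous_moll_bump: "continuous_on UNIV (moll_bump n)"
  using C1_alongD(1)[OF C1_along_smooth[OF smooth_moll_bump]] .

lemma moll_bump_measurable [measurable]: "moll_bump n \<in> borel_measurable borel"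
  using continuous_moll_bump by (rule borel_measurable_continuous_onI)

lemma moll_bump_nonneg: "moll_bump n q \<ge> 0"
  using bump_nonneg bump_integral(2) by (simp add: moll_bump_def)

lemma moll_bump_support:
  assumes "moll_bump n q \<noteq> 0" shows "\<bar>fst q\<bar> < moll_eps n" "\<bar>snd q\<bar> < moll_eps n"
  using assms moll_eps(1)[of n] bump_eq_0_iff[of "(1 / moll_eps n) *\<^sub>R q"]
  by (auto simp: moll_bump_def abs_mult field_simps)

text \<open>Origin of the factor 4: the half height 1/2 shrinks by 4 eps / 2 = 2 eps, of which one
  eps is used up by the support of the mollifier and one remains as distance to the boundary.
  Horizontally there is more room, because pi exceeds 1/2.\<close>

lemma shrink_support:
  assumes p: "p \<in> Q_plus" and w: "moll_bump n (shrink n p - w) \<noteq> 0"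
  shows "w \<in> cbox (- pi + moll_eps n, moll_eps n) (pi - moll_eps n, 1 - moll_eps n)"
proof -
  let ?e = "moll_eps n"
  note s = moll_bump_support[OF w] and e = moll_eps(1,2)[of n]
  have p': "\<bar>fst p\<bar> \<le> pi" "\<bar>snd p - 1 / 2\<bar> \<le> 1 / 2" using p unfolding mem_Q_plus by linarith+
  have l: "0 \<le> 1 - 4 * ?e" using e by simp
  have "\<bar>(1 - 4 * ?e) * fst p\<bar> \<le> (1 - 4 * ?e) * pi"
    using p' l by (simp add: abs_mult mult_left_mono)
  moreover have "(1 - 4 * ?e) * pi = pi - 4 * (?e * pi)" by (simp add: algebra_simps)
  moreover have "?e * 1 \<le> ?e * pi" using e pi_gt3 by (intro mult_left_mono) auto
  moreover have "\<bar>(1 - 4 * ?e) * fst p - fst w\<bar> < ?e" using s(1) by simp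
  ultimately have 1: "\<bar>fst w\<bar> \<le> pi - ?e" using e by linarith
  define A B where "A = (1 - 4 * ?e) * (snd p - 1 / 2)" and "B = 2 * ?e + (1 - 4 * ?e) * snd p"
  have "\<bar>A\<bar> \<le> (1 - 4 * ?e) * (1 / 2)"
    using p' l unfolding abs_mult A_def by (intro mult_mono) auto
  moreover have "A = B - 1 / 2" by (simp add: A_def B_def algebra_simps)
  moreover have "\<bar>B - snd w\<bar> < ?e" using s(2) by (simp add: B_def)
  ultimately have 2: "\<bar>snd w - 1 / 2\<bar> \<le> 1 / 2 - ?e"
    unfolding abs_le_iff abs_less_iff by (simp add: algebra_simps)
  show ?thesis
    using 1 2 unfolding cbox_Pair_eq mem_Times_iff fst_conv snd_conv box_real atLeastAtMost_iff by linarith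
qed

lemma moll_cbox_subset: "cbox (- pi + moll_eps n, moll_eps n) (pi - moll_eps n, 1 - moll_eps n) \<subseteq> Q_plus"
  using moll_eps(1)[of n] by (auto simp: cbox_Pair_eq mem_Q_plus)

lemma test_function_moll:
  assumes p: "p \<in> Q_plus"
  shows "test_function Q_plus (\<lambda>w. moll_bump n (shrink n p - w))"
proof (rule test_function_if_compact_superset[OF _ compact_cbox moll_cbox_subset])
  have "C_k k (\<lambda>w. moll_bump n (shrink n p + (- w)))" for k
    using smooth_moll_bump by (intro C_k_affine bounded_linear_minus bounded_linear_ident) (auto simp: smooth_def)
  then show "smooth (\<lambda>w. moll_bump n (shrink n p - w))" by (simp add: smooth_def)
qed (rule shrink_support[OF p])

lemma nn_integral_moll_bump:
  assumes r: "r \<noteq> 0"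
  shows "(\<integral>\<^sup>+w. moll_bump n (a + r *\<^sub>R w) \<partial>lborel) = ennreal (1 / r\<^sup>2)"
proof -
  let ?e = "moll_eps n"
  have e: "?e > 0" by (rule moll_eps)
  have "(\<integral>\<^sup>+w. moll_bump n (a + r *\<^sub>R w) \<partial>lborel) =
      ennreal (\<bar>?e / r\<bar> ^ DIM(real \<times> real)) * (\<integral>\<^sup>+w. moll_bump n (a + r *\<^sub>R ((- 1 / r) *\<^sub>R a + (?e / r) *\<^sub>R w)) \<partial>lborel)"
    using e r by (intro nn_integral_lborel_affine) auto
  also have "(\<lambda>w. moll_bump n (a + r *\<^sub>R ((- 1 / r) *\<^sub>R a + (?e / r) *\<^sub>R w))) = (\<lambda>w. moll_bump n (?e *\<^sub>R w))"
    using r by (simp add: scaleR_add_right scaleR_diff_right)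
  also have "(\<integral>\<^sup>+w. moll_bump n (?e *\<^sub>R w) \<partial>lborel) = ennreal (1 / (?e\<^sup>2 * bump_integral)) * ennreal bump_integral"
  proof -
    have "ennreal (moll_bump n (?e *\<^sub>R w)) = ennreal (1 / (?e\<^sup>2 * bump_integral)) * ennreal (bump w)" for w
      using e bump_integral(2) bump_nonneg by (simp add: moll_bump_def flip: ennreal_mult)
    then show ?thesis by (simp add: nn_integral_cmult bump_integral(1))
  qed
  also have "\<dots> = ennreal (1 / ?e\<^sup>2)"
    using e bump_integral(2) by (simp flip: ennreal_mult)
  also have "ennreal (\<bar>?e / r\<bar> ^ DIM(real \<times> real)) * ennreal (1 / ?e\<^sup>2) = ennreal (1 / r\<^sup>2)"
    using e by (simp add: power_divide power2_eq_square flip: ennreal_mult)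
  finally show ?thesis .
qed

lemma nn_integral_moll_bump_right:
  assumes p: "p \<in> Q_plus"
  shows "(\<integral>\<^sup>+w. moll_bump n (shrink n p - w) \<partial>MQ) = 1"
proof -
  have "(\<integral>\<^sup>+w. moll_bump n (shrink n p - w) \<partial>MQ) = (\<integral>\<^sup>+w. ennreal (moll_bump n (shrink n p - w)) * indicator Q_plus w \<partial>lborel)"
    by (rule nn_integral_MQ) measurable
  also have "\<dots> = (\<integral>\<^sup>+w. moll_bump n (shrink n p + (- 1) *\<^sub>R w) \<partial>lborel)"
  proof (rule nn_integral_cong)
    fix w
    have "moll_bump n (shrink n p - w) = 0" if "w \<notin> Q_plus"
      using shrink_support[OF p, of n w] moll_cbox_subset that by blast
    then show "ennreal (moll_bump n (shrink n p - w)) * indicator Q_plus w = moll_bump n (shrink n p + (- 1) *\<^sub>R w)"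
      by (cases "w \<in> Q_plus") auto
  qed
  finally show ?thesis by (simp only: nn_integral_moll_bump) simp
qed

text \<open>Here the contracted variable is integrated, so the change of variables costs (1 - 4
  eps)^(-2), which is at most 4.\<close>

lemma nn_integral_moll_bump_left:
  "(\<integral>\<^sup>+p. moll_bump n (shrink n p - w) \<partial>MQ) \<le> 4"
proof -
  let ?e = "moll_eps n"
  have e: "1 - 4 * ?e \<ge> 1 / 2" using moll_eps(2)[of n] by simp
  have "(\<integral>\<^sup>+p. moll_bump n (shrink n p - w) \<partial>MQ) = (\<integral>\<^sup>+p. ennreal (moll_bump n (shrink n p - w)) * indicator Q_plus p \<partial>lborel)"
    by (rule nn_integral_MQ) measurable
  also have "\<dots> \<le> (\<integral>\<^sup>+p. moll_bump n (((4 * ?e) *\<^sub>R (0, 1 / 2) - w) + (1 - 4 * ?e) *\<^sub>R p) \<partial>lborel)"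
    by (intro nn_integral_mono) (auto simp: indicator_def algebra_simps)
  also have "\<dots> = ennreal (1 / (1 - 4 * ?e)\<^sup>2)"
    using e by (intro nn_integral_moll_bump) auto
  also have "\<dots> \<le> ennreal 4"
  proof (intro ennreal_leI)
    have "(1 / 2)\<^sup>2 \<le> (1 - 4 * ?e)\<^sup>2" using e by (intro power_mono) auto
    then show "1 / (1 - 4 * ?e)\<^sup>2 \<le> 4" using e by (simp add: power_divide divide_simps)
  qed
  finally show ?thesis by simp
qed

section \<open>Mollification as an operator on L2\<close>

lemma moll_integrable:
  fixes u :: "real \<times> real \<Rightarrow> 'b::euclidean_space"
  assumes "integrable MQ u"
  shows "integrable MQ (\<lambda>w. moll_bump n (a - w) *\<^sub>R u w)"
  by (intro integrable_smooth_mult_MQ assms continuous_on_compose2[OF continuous_moll_bump])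
     (auto intro!: continuous_intros)

lemma smooth_moll: "integrable MQ u \<Longrightarrow> smooth (moll n u)"
  unfolding moll_def[abs_def] by (rule smooth_convolution[OF smooth_moll_bump])

lemma moll_diff:
  assumes "integrable MQ u" "integrable MQ w"
  shows "moll n (\<lambda>p. u p - w p) p = moll n u p - moll n w p"
  using moll_integrable[OF assms(1)] moll_integrable[OF assms(2)] by (simp add: moll_def scaleR_diff_right)

lemma moll_continuous: "integrable MQ u \<Longrightarrow> continuous_on UNIV (moll n u)"
  using C1_alongD(1)[OF C1_along_smooth[OF smooth_moll]] .

text \<open>Schur test: Jensen with the unit mass of the kernel in w, then Tonelli, then the mass in
  p, which is at most 4.\<close>

lemma moll_L2_bound:
  assumes u: "u \<in> L2_space MQ"
  shows "(\<integral>p. (norm (moll n u p))\<^sup>2 \<partial>MQ) \<le> 4 * (\<integral>p. (norm (u p))\<^sup>2 \<partial>MQ)"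
proof -
  interpret pair_sigma_finite MQ MQ
    by (intro pair_sigma_finite.intro finite_measure.axioms(1) finite_measure_MQ)
  note [measurable] = L2_spaceD(1)[OF u]
  have iu: "integrable MQ u" by (rule L2_space_integrable[OF finite_measure_MQ u])
  have [measurable]: "(\<lambda>z. moll_bump n (shrink n (snd z) - fst z)) \<in> borel_measurable (MQ \<Otimes>\<^sub>M MQ)"
  proof -
    have [measurable]: "(\<lambda>p. p) \<in> MQ \<rightarrow>\<^sub>M borel"
      by (rule borel_measurable_lebesgue_on) simp
    then have "fst \<in> (MQ \<Otimes>\<^sub>M MQ) \<rightarrow>\<^sub>M borel" "snd \<in> (MQ \<Otimes>\<^sub>M MQ) \<rightarrow>\<^sub>M borel"
      using measurable_compose[OF measurable_fst] measurable_compose[OF measurable_snd] by blast+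
    then show ?thesis by measurable
  qed
  have "(\<integral>\<^sup>+p. ennreal ((norm (moll n u p))\<^sup>2) \<partial>MQ) \<le>
      (\<integral>\<^sup>+p. (\<integral>\<^sup>+w. ennreal (moll_bump n (shrink n p - w) * (norm (u w))\<^sup>2) \<partial>MQ) \<partial>MQ)"
  proof (rule nn_integral_mono)
    fix p assume "p \<in> space MQ"
    then have p: "p \<in> Q_plus" by simp
    have "(\<lambda>w. moll_bump n (shrink n p - w)) \<in> borel_measurable MQ"
      by (intro borel_measurable_lebesgue_on) measurable
    moreover have "(\<integral>\<^sup>+w. moll_bump n (shrink n p - w) \<partial>MQ) < \<infinity>"
      unfolding nn_integral_moll_bump_right[OF p] by simp
    ultimately have "ennreal ((norm (moll n u p))\<^sup>2) \<le> (\<integral>\<^sup>+w. moll_bump n (shrink n p - w) \<partial>MQ) *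
        (\<integral>\<^sup>+w. ennreal (moll_bump n (shrink n p - w) * (norm (u w))\<^sup>2) \<partial>MQ)"
      unfolding moll_def by (rule norm_integral_power2_le[OF _ L2_spaceD(1)[OF u] moll_bump_nonneg])
    then show "ennreal ((norm (moll n u p))\<^sup>2) \<le> (\<integral>\<^sup>+w. ennreal (moll_bump n (shrink n p - w) * (norm (u w))\<^sup>2) \<partial>MQ)"
      unfolding nn_integral_moll_bump_right[OF p] mult_1_left .
  qed
  also have "\<dots> = (\<integral>\<^sup>+w. (\<integral>\<^sup>+p. ennreal (moll_bump n (shrink n p - w) * (norm (u w))\<^sup>2) \<partial>MQ) \<partial>MQ)"
    by (intro Fubini') (unfold split_beta', measurable)
  also have "\<dots> = (\<integral>\<^sup>+w. ennreal ((norm (u w))\<^sup>2) * (\<integral>\<^sup>+p. moll_bump n (shrink n p - w) \<partial>MQ) \<partial>MQ)"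
  proof (rule nn_integral_cong)
    fix w
    have "(\<lambda>p. moll_bump n (shrink n p - w)) \<in> borel_measurable MQ"
      by (intro borel_measurable_lebesgue_on) measurable
    then show "(\<integral>\<^sup>+p. ennreal (moll_bump n (shrink n p - w) * (norm (u w))\<^sup>2) \<partial>MQ) =
        ennreal ((norm (u w))\<^sup>2) * (\<integral>\<^sup>+p. moll_bump n (shrink n p - w) \<partial>MQ)"
      using moll_bump_nonneg by (subst nn_integral_cmult[symmetric]) (auto simp: ennreal_mult mult.commute)
  qed
  also have "\<dots> \<le> (\<integral>\<^sup>+w. ennreal ((norm (u w))\<^sup>2) * 4 \<partial>MQ)"
    by (intro nn_integral_mono mult_left_mono nn_integral_moll_bump_left) auto
  also have "\<dots> = 4 * ennreal (\<integral>p. (norm (u p))\<^sup>2 \<partial>MQ)"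
    using L2_spaceD(2)[OF u] by (simp add: mult.commute[of _ 4] nn_integral_cmult nn_integral_eq_integral)
  also have "(\<integral>\<^sup>+p. ennreal ((norm (moll n u p))\<^sup>2) \<partial>MQ) = ennreal (\<integral>p. (norm (moll n u p))\<^sup>2 \<partial>MQ)"
    using L2_spaceD(2)[OF continuous_L2_MQ[OF moll_continuous[OF iu]]] by (intro nn_integral_eq_integral) auto
  finally show ?thesis by (simp add: ennreal_mult'[symmetric] ennreal_le_iff flip: ennreal_numeral)
qed

lemma moll_tendsto_continuous:
  fixes g :: "real \<times> real \<Rightarrow> 'b::euclidean_space"
  assumes g: "continuous_on UNIV g" and p: "p \<in> Q_plus"
  shows "(\<lambda>n. moll n g p) \<longlonglongrightarrow> g p"
proof (rule tendstoI)
  fix e :: real assume e: "e > 0"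
  have ig: "integrable MQ g" by (rule continuous_integrable_MQ[OF g])
  have "isCont g p" using g continuous_on_eq_continuous_at[OF open_UNIV, of g] by blast
  then obtain d where d: "d > 0" "\<And>w. dist w p < d \<Longrightarrow> dist (g w) (g p) < e / 2"
    using e unfolding continuous_at_eps_delta by (metis half_gt_zero)
  \<comment> \<open>Contraction and mollifier radius together move a point horizontally by less than
    eps + 4 pi eps and vertically by less than 3 eps; the sum of the two is below this multiple of
    eps.\<close>
  have "(\<lambda>n. moll_eps n * (2 + 4 * (pi + 1))) \<longlonglongrightarrow> 0"
    using tendsto_mult_left_zero[OF moll_eps(3)] .
  then have "\<forall>\<^sub>F n in sequentially. moll_eps n * (2 + 4 * (pi + 1)) < d"
    using d(1) by (intro order_tendstoD(2)) auto
  then show "\<forall>\<^sub>F n in sequentially. dist (moll n g p) (g p) < e"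
  proof eventually_elim
    case (elim n)
    let ?k = "\<lambda>w. moll_bump n (shrink n p - w)" and ?e = "moll_eps n"
    have ik: "integrable MQ ?k"
      using moll_integrable[OF continuous_integrable_MQ[of "\<lambda>w. 1 :: real"], of n "shrink n p"] by simp
    have k1: "(\<integral>w. ?k w \<partial>MQ) = 1"
      using nn_integral_eq_integral[OF ik] moll_bump_nonneg nn_integral_moll_bump_right[OF p, of n] by simp
    have close: "dist w p < d" if "?k w \<noteq> 0" for w
    proof -
      note s = moll_bump_support[OF that]
      have p': "\<bar>fst p\<bar> \<le> pi" "\<bar>snd p - 1 / 2\<bar> \<le> 1 / 2" using p unfolding mem_Q_plus by linarith+
      have e: "?e > 0" by (rule moll_eps)
      have "\<bar>?e * fst p\<bar> \<le> ?e * pi" "\<bar>?e * (snd p - 1 / 2)\<bar> \<le> ?e * (1 / 2)"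
        unfolding abs_mult using p' e by (auto intro!: mult_mono)
      moreover have "\<bar>fst p - 4 * (?e * fst p) - fst w\<bar> < ?e" "\<bar>snd p - 4 * (?e * (snd p - 1 / 2)) - snd w\<bar> < ?e"
        using s by (simp_all add: algebra_simps)
      ultimately have "\<bar>fst w - fst p\<bar> < ?e + 4 * (?e * pi)" "\<bar>snd w - snd p\<bar> < ?e + 2 * ?e"
        by linarith+
      moreover have "dist w p \<le> \<bar>fst w - fst p\<bar> + \<bar>snd w - snd p\<bar>"
        unfolding dist_norm using norm_Pair_le[of "fst w - fst p" "snd w - snd p"] by (simp add: minus_prod_def)
      moreover have "?e * (2 + 4 * (pi + 1)) = 6 * ?e + 4 * (?e * pi)" by (simp add: algebra_simps)
      ultimately show ?thesis using elim e by linarith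
    qed
    have "moll n g p - g p = (\<integral>w. ?k w *\<^sub>R g w \<partial>MQ) - (\<integral>w. ?k w \<partial>MQ) *\<^sub>R g p"
      by (simp only: moll_def k1 scaleR_one)
    also have "(\<integral>w. ?k w \<partial>MQ) *\<^sub>R g p = (\<integral>w. ?k w *\<^sub>R g p \<partial>MQ)"
      using ik by simp
    finally have "moll n g p - g p = (\<integral>w. ?k w *\<^sub>R g w \<partial>MQ) - (\<integral>w. ?k w *\<^sub>R g p \<partial>MQ)" .
    then have eq: "moll n g p - g p = (\<integral>w. ?k w *\<^sub>R (g w - g p) \<partial>MQ)"
      using moll_integrable[OF ig] ik by (simp add: scaleR_diff_right)
    have "norm (\<integral>w. ?k w *\<^sub>R (g w - g p) \<partial>MQ) \<le> (\<integral>w. norm (?k w *\<^sub>R (g w - g p)) \<partial>MQ)"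
      by (rule integral_norm_bound)
    also have "\<dots> \<le> (\<integral>w. ?k w * (e / 2) \<partial>MQ)"
    proof (rule integral_mono)
      show "integrable MQ (\<lambda>w. norm (?k w *\<^sub>R (g w - g p)))"
        using moll_integrable[OF ig] ik by (auto simp: scaleR_diff_right)
      fix w
      show "norm (?k w *\<^sub>R (g w - g p)) \<le> ?k w * (e / 2)"
      proof (cases "?k w = 0")
        case False
        from d(2)[OF close[OF this]] show ?thesis
          unfolding norm_scaleR real_norm_def abs_of_nonneg[OF moll_bump_nonneg] dist_norm
          by (intro mult_left_mono less_imp_le moll_bump_nonneg)
      qed simp
    qed (use ik in auto)
    also have "\<dots> = e / 2" using k1 by simp
    finally show ?case using e by (simp add: dist_norm eq)
  qed
qed

text \<open>The operators are uniformly bounded and converge on the dense set of continuous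
  functions, by dominated convergence there.\<close>

lemma moll_L2_tendsto:
  fixes u :: "real \<times> real \<Rightarrow> 'b::euclidean_space"
  assumes u: "u \<in> L2_space MQ"
  shows "L2_tendsto MQ (\<lambda>n. moll n u) u"
  unfolding L2_tendsto_def
proof (intro conjI allI u)
  have L2m: "moll n w \<in> L2_space MQ" if "w \<in> L2_space MQ" for n and w :: "real \<times> real \<Rightarrow> 'b"
    by (intro continuous_L2_MQ moll_continuous L2_space_integrable[OF finite_measure_MQ] that)
  show "moll n u \<in> L2_space MQ" for n by (rule L2m[OF u])
  show "(\<lambda>n. \<integral>p. (norm (moll n u p - u p))\<^sup>2 \<partial>MQ) \<longlonglongrightarrow> 0"
  proof (rule tendstoI)
    fix e :: real assume e: "e > 0"
    \<comment> \<open>The final estimate is 4a + 4b + 2c with a at most 4e/40 and b, c below e/40,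
      which stays below 22e/40.\<close>
    obtain g where g: "continuous_on UNIV g" "g \<in> L2_space MQ" "(\<integral>p. (norm (g p - u p))\<^sup>2 \<partial>MQ) < e / 40"
      using L2_dense_continuous[OF u Q_plus_lebesgue finite_measure_MQ, of "e / 40"] e by auto
    let ?d = "\<lambda>p. u p - g p"
    have d: "?d \<in> L2_space MQ" by (intro L2_space_diff u g)
    note iu = L2_space_integrable[OF finite_measure_MQ u] and ig = L2_space_integrable[OF finite_measure_MQ g(2)]
    have dsm: "(\<integral>p. (norm (?d p))\<^sup>2 \<partial>MQ) < e / 40" using g(3) by (simp add: norm_minus_commute)
    obtain B where B: "B \<ge> 0" "\<And>p. p \<in> Q_plus \<Longrightarrow> norm (g p) \<le> B"
      using continuous_bounded_on_bounded[OF g(1) bounded_Q_plus] by blast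
    have "(\<lambda>n. \<integral>p. (norm (moll n g p - g p))\<^sup>2 \<partial>MQ) \<longlonglongrightarrow> (\<integral>p. 0 \<partial>MQ)"
    proof (rule integral_dominated_convergence)
      show "integrable MQ (\<lambda>p. 2 * B\<^sup>2 + 2 * B\<^sup>2)"
        using finite_measure_MQ by (intro finite_measure.integrable_const)
      show "(\<lambda>p. (norm (moll n g p - g p))\<^sup>2) \<in> borel_measurable MQ" for n
        using L2_spaceD(1)[OF L2m[OF g(2)]] L2_spaceD(1)[OF g(2)] by measurable
      have "norm (moll n g p) \<le> B" if p: "p \<in> Q_plus" for n p
      proof -
        let ?k = "\<lambda>w. moll_bump n (shrink n p - w)"
        have ik: "integrable MQ ?k"
          using moll_integrable[OF continuous_integrable_MQ[of "\<lambda>w. 1 :: real"], of n "shrink n p"] by simp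
        have k1: "(\<integral>w. ?k w \<partial>MQ) = 1"
          using nn_integral_eq_integral[OF ik] moll_bump_nonneg nn_integral_moll_bump_right[OF p, of n] by simp
        have "norm (moll n g p) \<le> (\<integral>w. norm (?k w *\<^sub>R g w) \<partial>MQ)"
          unfolding moll_def by (rule integral_norm_bound)
        also have "\<dots> \<le> (\<integral>w. ?k w * B \<partial>MQ)"
        proof (rule integral_mono)
          show "integrable MQ (\<lambda>w. norm (?k w *\<^sub>R g w))" by (intro integrable_norm moll_integrable ig)
          show "norm (?k w *\<^sub>R g w) \<le> ?k w * B" if "w \<in> space MQ" for w
            unfolding norm_scaleR real_norm_def abs_of_nonneg[OF moll_bump_nonneg]
            using that B(2) moll_bump_nonneg by (intro mult_left_mono) auto
        qed (use ik in auto)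
        also have "\<dots> = B" using k1 by simp
        finally show ?thesis .
      qed
      then have b: "(norm (moll n g p - g p))\<^sup>2 \<le> 2 * B\<^sup>2 + 2 * B\<^sup>2" if "p \<in> Q_plus" for n p
      proof -
        have "(norm (moll n g p))\<^sup>2 \<le> B\<^sup>2" "(norm (g p))\<^sup>2 \<le> B\<^sup>2"
          using B that \<open>\<And>p n. p \<in> Q_plus \<Longrightarrow> norm (moll n g p) \<le> B\<close> by (auto intro!: power_mono)
        then show ?thesis
          using norm_add_power2_le[of "moll n g p" "- g p"]
          unfolding norm_minus_cancel diff_conv_add_uminus[symmetric] by linarith
      qed
      then show "AE p in MQ. norm ((norm (moll n g p - g p))\<^sup>2) \<le> 2 * B\<^sup>2 + 2 * B\<^sup>2" for n
        by (intro AE_I2) auto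
      show "AE p in MQ. (\<lambda>n. (norm (moll n g p - g p))\<^sup>2) \<longlonglongrightarrow> 0"
      proof (rule AE_I2)
        fix p assume "p \<in> space MQ"
        then have "(\<lambda>n. moll n g p) \<longlonglongrightarrow> g p" by (intro moll_tendsto_continuous g) simp
        then have "(\<lambda>n. (norm (moll n g p - g p))\<^sup>2) \<longlonglongrightarrow> (norm (g p - g p))\<^sup>2"
          by (intro tendsto_intros)
        then show "(\<lambda>n. (norm (moll n g p - g p))\<^sup>2) \<longlonglongrightarrow> 0" by simp
      qed
    qed simp
    then have "\<forall>\<^sub>F n in sequentially. (\<integral>p. (norm (moll n g p - g p))\<^sup>2 \<partial>MQ) < e / 40"
      using e by (intro order_tendstoD(2)) auto
    then show "\<forall>\<^sub>F n in sequentially. dist (\<integral>p. (norm (moll n u p - u p))\<^sup>2 \<partial>MQ) 0 < e"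
    proof eventually_elim
      case (elim n)
      let ?a = "\<lambda>p. (norm (moll n ?d p))\<^sup>2" and ?b = "\<lambda>p. (norm (moll n g p - g p))\<^sup>2" and ?c = "\<lambda>p. (norm (?d p))\<^sup>2"
      have i: "integrable MQ ?a" "integrable MQ ?b" "integrable MQ ?c"
        by (intro L2_spaceD(2) L2_space_diff L2m d g u)+
      have "(\<integral>p. (norm (moll n u p - u p))\<^sup>2 \<partial>MQ) \<le> (\<integral>p. 4 * ?a p + 4 * ?b p + 2 * ?c p \<partial>MQ)"
      proof (rule integral_mono_AE')
        have "(norm (moll n u p - u p))\<^sup>2 \<le> 4 * ?a p + 4 * ?b p + 2 * ?c p" for p
        proof -
          have "moll n u p - u p = (moll n ?d p + (moll n g p - g p)) + (- ?d p)"
            by (simp add: moll_diff[OF iu ig])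
          then have "(norm (moll n u p - u p))\<^sup>2 \<le> 2 * (norm (moll n ?d p + (moll n g p - g p)))\<^sup>2 + 2 * (norm (?d p))\<^sup>2"
            using norm_add_power2_le[of "moll n ?d p + (moll n g p - g p)" "- ?d p"] by (simp only: norm_minus_cancel)
          moreover have "(norm (moll n ?d p + (moll n g p - g p)))\<^sup>2 \<le> 2 * ?a p + 2 * ?b p"
            by (rule norm_add_power2_le)
          ultimately show ?thesis by linarith
        qed
        then show "AE p in MQ. (norm (moll n u p - u p))\<^sup>2 \<le> 4 * ?a p + 4 * ?b p + 2 * ?c p" by simp
      qed (use i in auto)
      also have "\<dots> = 4 * (\<integral>p. ?a p \<partial>MQ) + 4 * (\<integral>p. ?b p \<partial>MQ) + 2 * (\<integral>p. ?c p \<partial>MQ)"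
        using i by simp
      also have "\<dots> < e" using moll_L2_bound[OF d, of n] dsm elim e by linarith
      finally show ?case by simp
    qed
  qed
qed

text \<open>A derivative of the kernel in p is minus its derivative in w, times the contraction
  factor. For p in \<open>Q_plus\<close> the kernel is a test function in w, so the definition of
  the weak derivative applies to it literally.\<close>

lemma frechet_derivative_moll:
  assumes w: "has_weak_deriv Q_plus v u g" and u: "integrable MQ u" and p: "p \<in> Q_plus"
  shows "frechet_derivative (moll n u) (at p) v = (1 - 4 * moll_eps n) *\<^sub>R moll n g p"
proof -
  let ?e = "moll_eps n" and ?D = "\<lambda>q. frechet_derivative (moll_bump n) (at q)"
  let ?k = "\<lambda>w. moll_bump n (shrink n p - w)"
  have "C_k (Suc 0) (moll_bump n)" using smooth_moll_bump by (simp add: smooth_def)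
  from C_k_SucD(1)[OF this] have D: "(moll_bump n has_derivative ?D q) (at q)" for q .
  have "frechet_derivative (moll n u) (at p) v = (\<integral>w. ?D (shrink n p - w) ((1 - 4 * ?e) *\<^sub>R v) *\<^sub>R u w \<partial>MQ)"
    using smooth_convolution_has_derivative[OF smooth_moll_bump u]
    unfolding moll_def[abs_def] by (subst frechet_derivative_at[symmetric]) blast+
  also have "\<dots> = (1 - 4 * ?e) *\<^sub>R (\<integral>w. ?D (shrink n p - w) v *\<^sub>R u w \<partial>MQ)"
    by (simp add: linear_scale[OF has_derivative_linear[OF D]] flip: scaleR_scaleR integral_scaleR_right)
  also have "(\<integral>w. ?D (shrink n p - w) v *\<^sub>R u w \<partial>MQ) = moll n g p"
  proof -
    have "(?k has_derivative (\<lambda>h. ?D (shrink n p - w) (- h))) (at w)" for w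
      by (rule has_derivative_compose[of "\<lambda>w. shrink n p - w" _ _ _ "moll_bump n"])
         (auto intro!: derivative_eq_intros D)
    then have "frechet_derivative ?k (at w) v = - ?D (shrink n p - w) v" for w
      by (subst frechet_derivative_at[symmetric])
         (auto simp: linear_neg[OF has_derivative_linear[OF D]])
    moreover have "(\<integral>w. frechet_derivative ?k (at w) v *\<^sub>R u w \<partial>MQ) = - (\<integral>w. ?k w *\<^sub>R g w \<partial>MQ)"
      using w[unfolded has_weak_deriv_def, THEN conjunct2, THEN conjunct2, rule_format, OF test_function_moll[OF p, of n]] .
    ultimately have "- (\<integral>w. ?D (shrink n p - w) v *\<^sub>R u w \<partial>MQ) = - (\<integral>w. ?k w *\<^sub>R g w \<partial>MQ)"
      by (simp only: scaleR_minus_left Bochner_Integration.integral_minus)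
    then show ?thesis by (simp only: moll_def neg_equal_iff_equal)
  qed
  finally show ?thesis .
qed

lemma L2_tendsto_scaleR_seq:
  assumes X: "L2_tendsto M X Y" and c: "c \<longlonglongrightarrow> l"
  shows "L2_tendsto M (\<lambda>n p. c n *\<^sub>R X n p) (\<lambda>p. l *\<^sub>R Y p)"
  unfolding L2_tendsto_def
proof (intro conjI allI L2_space_scaleR L2_tendstoD[OF X])
  let ?d = "\<lambda>n p. (norm (X n p - Y p))\<^sup>2"
  have i: "integrable M (?d n)" "integrable M (\<lambda>p. (norm (Y p))\<^sup>2)" for n
    by (intro L2_spaceD(2) L2_space_diff L2_tendstoD[OF X])+
  have le: "(\<integral>p. (norm (c n *\<^sub>R X n p - l *\<^sub>R Y p))\<^sup>2 \<partial>M) \<le>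
      2 * ((c n)\<^sup>2 * (\<integral>p. ?d n p \<partial>M)) + 2 * ((c n - l)\<^sup>2 * (\<integral>p. (norm (Y p))\<^sup>2 \<partial>M))" for n
  proof -
    have "(\<integral>p. (norm (c n *\<^sub>R X n p - l *\<^sub>R Y p))\<^sup>2 \<partial>M) \<le>
        (\<integral>p. 2 * ((c n)\<^sup>2 * ?d n p) + 2 * ((c n - l)\<^sup>2 * (norm (Y p))\<^sup>2) \<partial>M)"
    proof (rule integral_mono_AE')
      have "(norm (c n *\<^sub>R X n p - l *\<^sub>R Y p))\<^sup>2 \<le> 2 * ((c n)\<^sup>2 * ?d n p) + 2 * ((c n - l)\<^sup>2 * (norm (Y p))\<^sup>2)" for p
      proof -
        have eq: "c n *\<^sub>R X n p - l *\<^sub>R Y p = c n *\<^sub>R (X n p - Y p) + (c n - l) *\<^sub>R Y p"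
          by (simp add: algebra_simps)
        show ?thesis
          using norm_add_power2_le[of "c n *\<^sub>R (X n p - Y p)" "(c n - l) *\<^sub>R Y p"]
          unfolding eq norm_scaleR power_mult_distrib power2_abs .
      qed
      then show "AE p in M. (norm (c n *\<^sub>R X n p - l *\<^sub>R Y p))\<^sup>2 \<le>
          2 * ((c n)\<^sup>2 * ?d n p) + 2 * ((c n - l)\<^sup>2 * (norm (Y p))\<^sup>2)" by simp
    qed (use i in auto)
    then show ?thesis using i by simp
  qed
  have "(\<lambda>n. 2 * ((c n)\<^sup>2 * (\<integral>p. ?d n p \<partial>M)) + 2 * ((c n - l)\<^sup>2 * (\<integral>p. (norm (Y p))\<^sup>2 \<partial>M)))
      \<longlonglongrightarrow> 2 * (l\<^sup>2 * 0) + 2 * ((l - l)\<^sup>2 * (\<integral>p. (norm (Y p))\<^sup>2 \<partial>M))"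
    by (intro tendsto_intros c L2_tendstoD(3)[OF X])
  then have t: "(\<lambda>n. 2 * ((c n)\<^sup>2 * (\<integral>p. ?d n p \<partial>M)) + 2 * ((c n - l)\<^sup>2 * (\<integral>p. (norm (Y p))\<^sup>2 \<partial>M))) \<longlonglongrightarrow> 0"
    by simp
  show "(\<lambda>n. \<integral>p. (norm (c n *\<^sub>R X n p - l *\<^sub>R Y p))\<^sup>2 \<partial>M) \<longlonglongrightarrow> 0"
    by (rule tendsto_sandwich[OF _ _ tendsto_const t]) (use le in auto)
qed

lemma frechet_derivative_moll_L2_tendsto:
  assumes w: "has_weak_deriv Q_plus v u g" and u: "u \<in> L2_space MQ" and g: "g \<in> L2_space MQ"
  shows "L2_tendsto MQ (\<lambda>n p. frechet_derivative (moll n u) (at p) v) g"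
proof -
  note iu = L2_space_integrable[OF finite_measure_MQ u]
  have "(\<lambda>n. 1 - 4 * moll_eps n) \<longlonglongrightarrow> 1 - 4 * 0"
    by (intro tendsto_intros moll_eps)
  from L2_tendsto_scaleR_seq[OF moll_L2_tendsto[OF g] this]
  have "L2_tendsto MQ (\<lambda>n p. (1 - 4 * moll_eps n) *\<^sub>R moll n g p) g" by simp
  then show ?thesis
    by (rule L2_tendsto_cong_AE)
       (auto intro!: AE_I2 continuous_measurable_MQ C1_alongD(2)[OF C1_along_smooth[OF smooth_moll[OF iu]]]
          L2_spaceD(1)[OF g] simp: frechet_derivative_moll[OF w iu])
qed

section \<open>The space $W^{1,2}$ and its traces\<close>

text \<open>The derivatives are arguments, not the choice made by \<open>weak_deriv\<close>; so they
  can be computed by formulas and adjusted on null sets where convenient.\<close>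

definition W12 :: "(real \<times> real \<Rightarrow> 'b::euclidean_space) \<Rightarrow> (real \<times> real \<Rightarrow> 'b) \<Rightarrow> (real \<times> real \<Rightarrow> 'b) \<Rightarrow> bool" where
  "W12 u ux uy \<longleftrightarrow> u \<in> L2_space MQ \<and> ux \<in> L2_space MQ \<and> uy \<in> L2_space MQ \<and>
     has_weak_deriv Q_plus (1, 0) u ux \<and> has_weak_deriv Q_plus (0, 1) u uy"

lemma W12D:
  assumes "W12 u ux uy"
  shows "u \<in> L2_space MQ" "ux \<in> L2_space MQ" "uy \<in> L2_space MQ"
    "has_weak_deriv Q_plus (1, 0) u ux" "has_weak_deriv Q_plus (0, 1) u uy"
  using assms by (auto simp: W12_def)

lemma sobolev_1_iff: "u \<in> sobolev Q_plus (L2_space MQ) 1 \<longleftrightarrow> (\<exists>ux uy. W12 u ux uy)"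
  by (auto simp: W12_def Basis_real_prod)

text \<open>The approximants are smooth on the whole plane, hence up to I. The same sequence
  therefore serves both for calculus rules inside and for traces.\<close>

lemma W12_approx:
  assumes u: "W12 u ux uy"
  obtains U where "\<And>n. smooth (U n)" "L2_tendsto MQ U u"
    "L2_tendsto MQ (\<lambda>n p. frechet_derivative (U n) (at p) (1, 0)) ux"
    "L2_tendsto MQ (\<lambda>n p. frechet_derivative (U n) (at p) (0, 1)) uy"
  by (rule that[OF smooth_moll moll_L2_tendsto frechet_derivative_moll_L2_tendsto frechet_derivative_moll_L2_tendsto])
     (use W12D[OF u] L2_space_integrable[OF finite_measure_MQ] in auto)

text \<open>Without bounds on the factors the products and their derivatives converge in L1 only,
  which suffices for the weak derivative.\<close>

lemma has_weak_deriv_prod: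
  assumes bl: "bounded_bilinear bl" and u: "W12 u ux uy" and w: "W12 w wx wy"
  shows "has_weak_deriv Q_plus (1, 0) (\<lambda>p. bl (u p) (w p)) (\<lambda>p. bl (u p) (wx p) + bl (ux p) (w p))"
    "has_weak_deriv Q_plus (0, 1) (\<lambda>p. bl (u p) (w p)) (\<lambda>p. bl (u p) (wy p) + bl (uy p) (w p))"
proof -
  obtain U where U: "\<And>n. smooth (U n)" "L2_tendsto MQ U u"
    "L2_tendsto MQ (\<lambda>n p. frechet_derivative (U n) (at p) (1, 0)) ux"
    "L2_tendsto MQ (\<lambda>n p. frechet_derivative (U n) (at p) (0, 1)) uy"
    using W12_approx[OF u] by blast
  obtain W where W: "\<And>n. smooth (W n)" "L2_tendsto MQ W w"
    "L2_tendsto MQ (\<lambda>n p. frechet_derivative (W n) (at p) (1, 0)) wx"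
    "L2_tendsto MQ (\<lambda>n p. frechet_derivative (W n) (at p) (0, 1)) wy"
    using W12_approx[OF w] by blast
  have "has_weak_deriv Q_plus v (\<lambda>p. bl (U n p) (W n p))
      (\<lambda>p. bl (U n p) (frechet_derivative (W n) (at p) v) + bl (frechet_derivative (U n) (at p) v) (W n p))"
    if "v \<in> Basis" for n v
    by (intro C1_along_has_weak_deriv that C1_along_prod[OF bl] C1_along_smooth U W)
  note * = has_weak_deriv_L1_limit[OF this L1_tendsto_bilinear[OF bl U(2) W(2)]
      L1_tendsto_add[OF L1_tendsto_bilinear[OF bl U(2)] L1_tendsto_bilinear[OF bl _ W(2)]]]
  show "has_weak_deriv Q_plus (1, 0) (\<lambda>p. bl (u p) (w p)) (\<lambda>p. bl (u p) (wx p) + bl (ux p) (w p))"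
    by (rule *[OF _ W(3) U(3)]) (simp add: Basis_real_prod)
  show "has_weak_deriv Q_plus (0, 1) (\<lambda>p. bl (u p) (w p)) (\<lambda>p. bl (u p) (wy p) + bl (uy p) (w p))"
    by (rule *[OF _ W(4) U(4)]) (simp add: Basis_real_prod)
qed

lemma bilinear_measurable:
  fixes bl :: "'b::euclidean_space \<Rightarrow> 'c::euclidean_space \<Rightarrow> 'd::euclidean_space"
  assumes bl: "bounded_bilinear bl" and "u \<in> borel_measurable M" "w \<in> borel_measurable M"
  shows "(\<lambda>p. bl (u p) (w p)) \<in> borel_measurable M"
  using assms(2,3)
  by (rule borel_measurable_continuous_Pair) (auto intro!: bounded_bilinear.continuous_on[OF bl] continuous_intros)

lemma L2_space_bilinear_bounded:
  fixes bl :: "'b::euclidean_space \<Rightarrow> 'c::euclidean_space \<Rightarrow> 'd::euclidean_space"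
  assumes bl: "bounded_bilinear bl" and u: "u \<in> borel_measurable M" "AE p in M. norm (u p) \<le> B" and w: "w \<in> L2_space M"
  shows "(\<lambda>p. bl (u p) (w p)) \<in> L2_space M"
proof -
  obtain K where K: "K \<ge> 0" "\<And>a b. norm (bl a b) \<le> norm a * norm b * K"
    using bounded_bilinear.nonneg_bounded[OF bl] by auto
  show ?thesis
  proof (rule L2_spaceI_dominated)
    show "integrable M (\<lambda>p. (B * K)\<^sup>2 * (norm (w p))\<^sup>2)" using L2_spaceD(2)[OF w] by simp
    show "(\<lambda>p. bl (u p) (w p)) \<in> borel_measurable M" by (rule bilinear_measurable[OF bl u(1) L2_spaceD(1)[OF w]])
    show "AE p in M. (norm (bl (u p) (w p)))\<^sup>2 \<le> (B * K)\<^sup>2 * (norm (w p))\<^sup>2"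
      using u(2)
    proof eventually_elim
      case (elim p)
      have "norm (bl (u p) (w p)) \<le> norm (u p) * norm (w p) * K" by (rule K)
      also have "\<dots> \<le> B * norm (w p) * K" using elim K(1) by (intro mult_right_mono) auto
      finally have "(norm (bl (u p) (w p)))\<^sup>2 \<le> (B * norm (w p) * K)\<^sup>2" by (intro power_mono) auto
      then show ?case by (simp add: power_mult_distrib mult_ac)
    qed
  qed
qed

text \<open>The pointwise bounds put the product and both terms of the Leibniz rule back into
  L2.\<close>

lemma W12_prod:
  fixes bl :: "'b::euclidean_space \<Rightarrow> 'c::euclidean_space \<Rightarrow> 'd::euclidean_space"
  assumes bl: "bounded_bilinear bl" and u: "W12 u ux uy" "AE p in MQ. norm (u p) \<le> B"
    and w: "W12 w wx wy" "AE p in MQ. norm (w p) \<le> C"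
  shows "W12 (\<lambda>p. bl (u p) (w p)) (\<lambda>p. bl (u p) (wx p) + bl (ux p) (w p)) (\<lambda>p. bl (u p) (wy p) + bl (uy p) (w p))"
  unfolding W12_def
  using W12D[OF u(1)] W12D[OF w(1)]
  by (intro conjI has_weak_deriv_prod[OF bl u(1) w(1)] L2_space_add L2_space_bilinear_bounded[OF bl _ u(2)]
      L2_space_bilinear_bounded[OF bounded_bilinear.flip[OF bl] _ w(2)] L2_spaceD)

text \<open>For smooth U tending to u, the Lipschitz bound gives convergence of g'(U) in L2, and its
  product with the derivative of U converges in L1. The bounds are asked for on the whole line
  because U may take values outside the range of u.\<close>

lemma W12_chain:
  fixes u ux uy :: "real \<times> real \<Rightarrow> real" and g g' :: "real \<Rightarrow> real"
  assumes u: "W12 u ux uy" and g: "\<And>z. (g has_field_derivative g' z) (at z)"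
    and b: "\<And>z. \<bar>g' z\<bar> \<le> C" and lip: "\<And>a b. \<bar>g' a - g' b\<bar> \<le> L * \<bar>a - b\<bar>"
  shows "W12 (\<lambda>p. g (u p)) (\<lambda>p. g' (u p) * ux p) (\<lambda>p. g' (u p) * uy p)"
proof -
  have cg: "continuous_on UNIV g" using g by (meson DERIV_continuous_on has_field_derivative_at_within)
  have lipg: "\<bar>g a - g b\<bar> \<le> C * \<bar>a - b\<bar>" for a b
    using field_differentiable_bound[of UNIV g g' C a b] g b
    by (simp add: has_field_derivative_at_within)
  have cg': "continuous_on UNIV g'"
  proof (rule lipschitz_on_continuous_on)
    show "(\<bar>L\<bar>)-lipschitz_on UNIV g'"
    proof (rule lipschitz_onI)
      fix x y show "dist (g' x) (g' y) \<le> \<bar>L\<bar> * dist x y"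
        using lip[of x y] mult_right_mono[OF abs_ge_self[of L], of "\<bar>x - y\<bar>"] by (simp add: dist_real_def)
    qed simp
  qed
  have [measurable]: "g \<in> borel_measurable borel" "g' \<in> borel_measurable borel"
    using cg cg' by (auto intro: borel_measurable_continuous_onI)
  obtain U where U: "\<And>n. smooth (U n)" "L2_tendsto MQ U u"
    "L2_tendsto MQ (\<lambda>n p. frechet_derivative (U n) (at p) (1, 0)) ux"
    "L2_tendsto MQ (\<lambda>n p. frechet_derivative (U n) (at p) (0, 1)) uy"
    using W12_approx[OF u] by blast
  have t: "L2_tendsto MQ (\<lambda>n p. g (U n p)) (\<lambda>p. g (u p))" "L2_tendsto MQ (\<lambda>n p. g' (U n p)) (\<lambda>p. g' (u p))"
    by (rule L2_tendsto_lipschitz[OF U(2) finite_measure_MQ]; use lipg lip in auto)+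
  have "has_weak_deriv Q_plus v (\<lambda>p. g (U n p)) (\<lambda>p. g' (U n p) * frechet_derivative (U n) (at p) v)"
    if "v \<in> Basis" for n v
    by (intro C1_along_has_weak_deriv that C1_along_chain[OF C1_along_smooth[OF U(1)] g cg'])
  note * = has_weak_deriv_L1_limit[OF this L2_tendsto_imp_L1[OF t(1) finite_measure_MQ]
      L1_tendsto_bilinear[OF bounded_bilinear_mult t(2)]]
  have "(\<lambda>p. g' (u p) *\<^sub>R w p) \<in> L2_space MQ" if "w \<in> L2_space MQ" for w :: "real \<times> real \<Rightarrow> real"
    using L2_spaceD(1)[OF W12D(1)[OF u]] by (intro L2_space_bounded_mult[OF that, where C=C]) (auto simp: b)
  then show ?thesis
    unfolding W12_def using *[OF _ U(3)] *[OF _ U(4)] W12D[OF u] L2_tendstoD(2)[OF t(1)]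
    by (auto simp: Basis_real_prod)
qed

text \<open>Lebesgue measurability is lost under composition with general maps and does not match
  product sigma-algebras; slices and averages are therefore formed from Borel
  representatives.\<close>

lemma borel_representative:
  fixes u :: "'a::euclidean_space \<Rightarrow> 'b::euclidean_space"
  assumes u: "u \<in> borel_measurable (lebesgue_on S)" and S: "S \<in> sets lebesgue"
  obtains u' where "u' \<in> borel_measurable borel" "AE p in lebesgue_on S. u p = u' p"
proof -
  have "\<exists>w. w \<in> borel_measurable borel \<and> (AE p in lebesgue_on S. u p \<bullet> b = w p)" for b
  proof -
    have "(\<lambda>p. u p \<bullet> b) \<in> borel_measurable (lebesgue_on S)" using u by measurable
    then have "(\<lambda>p. if p \<in> S then u p \<bullet> b else 0) \<in> borel_measurable (completion lborel)"
      using S by (simp add: borel_measurable_if)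
    from completion_ex_borel_measurable_real[OF this]
    obtain w where w: "w \<in> borel_measurable borel" "AE p in lborel. (if p \<in> S then u p \<bullet> b else 0) = w p"
      by auto
    have "AE p in lebesgue. (if p \<in> S then u p \<bullet> b else 0) = w p" by (rule AE_completion[OF w(2)])
    then have "AE p in lebesgue_on S. u p \<bullet> b = w p"
      using S by (auto simp: AE_restrict_space_iff elim: eventually_mono)
    then show ?thesis using w(1) by blast
  qed
  then obtain w where w: "\<And>b. w b \<in> borel_measurable borel" "\<And>b. AE p in lebesgue_on S. u p \<bullet> b = w b p"
    by metis
  show ?thesis
  proof (rule that)
    show "(\<lambda>p. \<Sum>b\<in>Basis. w b p *\<^sub>R b) \<in> borel_measurable borel"
      using w(1) by (intro borel_measurable_sum borel_measurable_scaleR) auto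
    have "AE p in lebesgue_on S. \<forall>b\<in>Basis. u p \<bullet> b = w b p"
      by (intro AE_finite_allI w(2)) auto
    then show "AE p in lebesgue_on S. u p = (\<Sum>b\<in>Basis. w b p *\<^sub>R b)"
    proof eventually_elim
      case (elim p)
      then show ?case using euclidean_representation[of "u p"] by simp
    qed
  qed
qed

section \<open>Integrals over vertical slices and the boundary value\<close>

lemma finite_measure_I: "finite_measure I_measure"
  unfolding I_measure_def
  by (rule finite_measureI) (simp add: emeasure_restrict_space)

lemma nn_integral_I:
  assumes "f \<in> borel_measurable borel"
  shows "(\<integral>\<^sup>+x. f x \<partial>I_measure) = (\<integral>\<^sup>+x. f x * indicator {- pi<..<pi} x \<partial>lborel)"
  unfolding I_measure_def by (subst nn_integral_restrict_space) (auto simp: nn_integral_completion)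

abbreviation MY :: "real measure" where
  "MY \<equiv> restrict_space lborel {0<..<1}"

lemma finite_measure_MY: "finite_measure MY"
  by (rule finite_measureI) (simp add: emeasure_restrict_space)

lemma nn_integral_MQ_iterated:
  assumes [measurable]: "f \<in> borel_measurable borel"
  shows "(\<integral>\<^sup>+p. f p \<partial>MQ) = (\<integral>\<^sup>+x. (\<integral>\<^sup>+y. f (x, y) \<partial>MY) \<partial>I_measure)"
proof -
  have [measurable]: "f \<in> borel_measurable (borel \<Otimes>\<^sub>M borel)" by (simp add: borel_prod)
  have "(\<integral>\<^sup>+p. f p \<partial>MQ) = (\<integral>\<^sup>+p. f p * indicator Q_plus p \<partial>(lborel \<Otimes>\<^sub>M lborel))"
    by (simp add: nn_integral_MQ lborel_prod)
  also have "\<dots> = (\<integral>\<^sup>+x. (\<integral>\<^sup>+y. f (x, y) * indicator Q_plus (x, y) \<partial>lborel) \<partial>lborel)"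
  proof (rule lborel.nn_integral_fst[symmetric])
    show "(\<lambda>p. f p * indicator Q_plus p) \<in> borel_measurable (lborel \<Otimes>\<^sub>M lborel)"
      unfolding lborel_prod by measurable
  qed
  also have "\<dots> = (\<integral>\<^sup>+x. (\<integral>\<^sup>+y. f (x, y) * indicator {0<..<1} y \<partial>lborel) * indicator {- pi<..<pi} x \<partial>lborel)"
    by (intro nn_integral_cong) (auto simp: indicator_def mem_Q_plus intro!: nn_integral_cong)
  also have "\<dots> = (\<integral>\<^sup>+x. (\<integral>\<^sup>+y. f (x, y) * indicator {0<..<1} y \<partial>lborel) \<partial>I_measure)"
    by (rule nn_integral_I[symmetric]) measurable
  finally show ?thesis by (simp add: nn_integral_restrict_space)
qed

lemma param_integral_measurable:
  fixes D :: "'a::euclidean_space \<times> 'c::euclidean_space \<Rightarrow> 'b::euclidean_space"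
  assumes "D \<in> borel_measurable borel" and S: "finite_measure (restrict_space lborel S)"
  shows "(\<lambda>x. \<integral>y. D (x, y) \<partial>restrict_space lborel S) \<in> borel_measurable borel"
proof -
  interpret finite_measure "restrict_space lborel S" by (rule S)
  have D: "D \<in> borel_measurable (borel \<Otimes>\<^sub>M borel)" using assms by (simp add: borel_prod)
  have "snd \<in> (borel :: 'a measure) \<Otimes>\<^sub>M restrict_space lborel S \<rightarrow>\<^sub>M (borel :: 'c measure)"
    by (rule measurable_compose[OF measurable_snd]) (auto intro: measurable_restrict_space1)
  then have "(\<lambda>z. (fst z, snd z)) \<in> (borel :: 'a measure) \<Otimes>\<^sub>M restrict_space lborel S \<rightarrow>\<^sub>M borel \<Otimes>\<^sub>M (borel :: 'c measure)"
    by measurable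
  from measurable_compose[OF this D] have "(\<lambda>(x, y). D (x, y)) \<in> borel_measurable (borel \<Otimes>\<^sub>M restrict_space lborel S)"
    by (simp add: split_beta')
  then show ?thesis by (rule borel_measurable_lebesgue_integral)
qed

lemma slice_measurable:
  fixes D :: "real \<times> real \<Rightarrow> 'b::euclidean_space"
  assumes "D \<in> borel_measurable borel"
  shows "(\<lambda>y. D (x, y)) \<in> borel_measurable MY"
proof -
  have "(\<lambda>y. (x, y)) \<in> borel \<rightarrow>\<^sub>M borel"
    by (intro borel_measurable_continuous_onI continuous_intros)
  from measurable_compose[OF this assms] show ?thesis
    by (intro measurable_restrict_space1) simp
qed

lemma slice_L1_bound:
  fixes D :: "real \<times> real \<Rightarrow> 'b::euclidean_space"
  assumes D: "D \<in> borel_measurable borel"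
  shows "(\<integral>\<^sup>+x. norm (\<integral>y. D (x, y) \<partial>MY) \<partial>I_measure) \<le> (\<integral>\<^sup>+p. norm (D p) \<partial>MQ)"
proof -
  have "(\<integral>\<^sup>+x. norm (\<integral>y. D (x, y) \<partial>MY) \<partial>I_measure) \<le> (\<integral>\<^sup>+x. (\<integral>\<^sup>+y. norm (D (x, y)) \<partial>MY) \<partial>I_measure)"
  proof (rule nn_integral_mono)
    fix x
    \<comment> \<open>On a non-integrable slice the Bochner integral is 0 by convention and the
      bound is trivial.\<close>
    show "ennreal (norm (\<integral>y. D (x, y) \<partial>MY)) \<le> (\<integral>\<^sup>+y. norm (D (x, y)) \<partial>MY)"
      by (cases "integrable MY (\<lambda>y. D (x, y))")
         (auto simp: not_integrable_integral_eq intro: integral_norm_bound_ennreal)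
  qed
  also have "\<dots> = (\<integral>\<^sup>+p. norm (D p) \<partial>MQ)"
    by (rule nn_integral_MQ_iterated[symmetric]) (use D in measurable)
  finally show ?thesis .
qed

text \<open>Jensen on each slice, with constant 1 because the slices have length 1.\<close>

lemma slice_L2_bound:
  fixes D :: "real \<times> real \<Rightarrow> 'b::euclidean_space"
  assumes D: "D \<in> borel_measurable borel"
  shows "(\<integral>\<^sup>+x. ennreal ((norm (\<integral>y. D (x, y) \<partial>MY))\<^sup>2) \<partial>I_measure) \<le> (\<integral>\<^sup>+p. ennreal ((norm (D p))\<^sup>2) \<partial>MQ)"
proof -
  have "(\<integral>\<^sup>+x. ennreal ((norm (\<integral>y. D (x, y) \<partial>MY))\<^sup>2) \<partial>I_measure) \<le>
      (\<integral>\<^sup>+x. (\<integral>\<^sup>+y. ennreal ((norm (D (x, y)))\<^sup>2) \<partial>MY) \<partial>I_measure)"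
  proof (rule nn_integral_mono)
    fix x
    show "ennreal ((norm (\<integral>y. D (x, y) \<partial>MY))\<^sup>2) \<le> (\<integral>\<^sup>+y. ennreal ((norm (D (x, y)))\<^sup>2) \<partial>MY)"
      using norm_integral_power2_le[of "\<lambda>y. 1" MY "\<lambda>y. D (x, y)"] slice_measurable[OF D]
      by (simp add: emeasure_restrict_space)
  qed
  also have "\<dots> = (\<integral>\<^sup>+p. ennreal ((norm (D p))\<^sup>2) \<partial>MQ)"
    by (rule nn_integral_MQ_iterated[symmetric]) (use D in measurable)
  finally show ?thesis .
qed

text \<open>Here \<open>uy\<close> is the weak normal derivative of \<open>u\<close>. Approximation in \<open>L\<^sup>1\<close> is included because
  products of \<open>W\<^sup>1\<^sup>,\<^sup>2\<close> functions are only approximated in \<open>W\<^sup>1\<^sup>,\<^sup>1\<close>. Such a \<open>g\<close> exists because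
  \<open>u(x, 0)\<close> is the integral of \<open>u - (1 - y) u\<^sub>y\<close> over \<open>0 < y < 1\<close>, which is continuous in both norms.\<close>

definition trace_of :: "(real \<times> real \<Rightarrow> 'b::euclidean_space) \<Rightarrow> (real \<times> real \<Rightarrow> 'b) \<Rightarrow> (real \<Rightarrow> 'b) \<Rightarrow> bool" where
  "trace_of u uy g \<longleftrightarrow>
    (\<forall>X X'. (\<forall>n. C1_along (0, 1) (X n) (X' n)) \<longrightarrow>
       (L2_tendsto MQ X u \<and> L2_tendsto MQ X' uy \<longrightarrow> L2_tendsto I_measure (\<lambda>n x. X n (x, 0)) g) \<and>
       (L1_tendsto MQ X u \<and> L1_tendsto MQ X' uy \<longrightarrow> L1_tendsto I_measure (\<lambda>n x. X n (x, 0)) g))"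

text \<open>The integrand is the y-derivative of (y - 1) X, and this primitive vanishes at the upper
  end y = 1, so only the value at y = 0 remains.\<close>

lemma C1_along_boundary_value:
  fixes X :: "real \<times> real \<Rightarrow> 'b::euclidean_space"
  assumes X: "C1_along (0, 1) X X'"
  shows "integrable MY (\<lambda>y. X (x, y) - (1 - y) *\<^sub>R X' (x, y))"
    "(\<integral>y. X (x, y) - (1 - y) *\<^sub>R X' (x, y) \<partial>MY) = X (x, 0)"
proof -
  note c = C1_alongD[OF X]
  let ?f = "\<lambda>y. X (x, y) - (1 - y) *\<^sub>R X' (x, y)"
  have cf: "continuous_on UNIV ?f"
    by (intro continuous_intros continuous_on_compose2[OF c(1)] continuous_on_compose2[OF c(2)]) auto
  have d: "((\<lambda>y. (y - 1) *\<^sub>R X (x, y)) has_vector_derivative ?f y) (at y)" for y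
    using c(3)[of "(x, 0)" y]
    by (auto intro!: derivative_eq_intros simp: algebra_simps)
  have "has_bochner_integral lborel (\<lambda>y. indicator {0..1} y *\<^sub>R ?f y) ((1 - 1) *\<^sub>R X (x, 1) - (0 - 1) *\<^sub>R X (x, 0))"
    by (rule has_bochner_integral_FTC_Icc[where F="\<lambda>y. (y - 1) *\<^sub>R X (x, y)"])
       (auto intro!: has_vector_derivative_at_within[OF d] continuous_on_subset[OF cf])
  moreover have "AE y in lborel. indicator {0..1} y *\<^sub>R ?f y = indicator {0<..<1} y *\<^sub>R ?f y"
  proof -
    have "AE y in lborel. y \<noteq> (0::real) \<and> y \<noteq> 1" using AE_lborel_singleton by (intro AE_conjI)
    then show ?thesis by eventually_elim (auto simp: indicator_def)
  qed
  moreover have "?f \<in> borel_measurable borel" using cf by (rule borel_measurable_continuous_onI)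
  ultimately have "has_bochner_integral lborel (\<lambda>y. indicator {0<..<1} y *\<^sub>R ?f y) (X (x, 0))"
    by (subst has_bochner_integral_cong_AE[symmetric]) auto
  then show "integrable MY ?f" "(\<integral>y. ?f y \<partial>MY) = X (x, 0)"
    by (simp_all add: integrable_restrict_space integral_restrict_space has_bochner_integral_iff)
qed

lemma trace_of_exists:
  fixes u uy :: "real \<times> real \<Rightarrow> 'b::euclidean_space"
  assumes u: "u \<in> L2_space MQ" and uy: "uy \<in> L2_space MQ"
  obtains g where "g \<in> L2_space I_measure" "trace_of u uy g"
proof -
  obtain u' where u': "u' \<in> borel_measurable borel" "AE p in MQ. u p = u' p"
    using borel_representative[OF L2_spaceD(1)[OF u] Q_plus_lebesgue] .
  obtain w where w: "w \<in> borel_measurable borel" "AE p in MQ. uy p = w p"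
    using borel_representative[OF L2_spaceD(1)[OF uy] Q_plus_lebesgue] .
  note [measurable] = u'(1) w(1)
  have [measurable]: "(snd :: real \<times> real \<Rightarrow> real) \<in> borel_measurable borel"
    by (intro borel_measurable_continuous_onI continuous_intros)
  define F where "F p = u' p - (1 - snd p) *\<^sub>R w p" for p
  have F [measurable]: "F \<in> borel_measurable borel" unfolding F_def by measurable
  define g where "g x = (\<integral>y. F (x, y) \<partial>MY)" for x
  have gm [measurable]: "g \<in> borel_measurable borel"
    unfolding g_def by (rule param_integral_measurable[OF F finite_measure_MY])
  have gI: "g \<in> borel_measurable I_measure"
    unfolding I_measure_def by (intro borel_measurable_lebesgue_on gm)
  have "u' \<in> L2_space MQ" "w \<in> L2_space MQ"
    using u' w L2_space_cong_AE[OF u] L2_space_cong_AE[OF uy] borel_measurable_lebesgue_on by blast+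
  note L2' = this
  have sndc: "(\<lambda>p. - (1 - snd p)) \<in> borel_measurable MQ" "AE p in MQ. \<bar>- (1 - snd p)\<bar> \<le> 1"
    by (rule borel_measurable_lebesgue_on, measurable) (auto intro!: AE_I2 simp: mem_Q_plus)
  have FL2: "F \<in> L2_space MQ"
    using L2_space_add[OF L2'(1) L2_space_bounded_mult[OF L2'(2) sndc]]
    by (simp add: F_def[abs_def] algebra_simps)
  have "(\<integral>\<^sup>+x. ennreal ((norm (g x))\<^sup>2) \<partial>I_measure) \<le> (\<integral>\<^sup>+p. ennreal ((norm (F p))\<^sup>2) \<partial>MQ)"
    unfolding g_def by (rule slice_L2_bound[OF F])
  also have "\<dots> < \<infinity>"
    using L2_spaceD(2)[OF FL2] by (simp add: nn_integral_eq_integral)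
  finally have gL2: "g \<in> L2_space I_measure"
    using gI by (auto simp: L2_space_def intro!: integrableI_nonneg)
  \<comment> \<open>Both slices must be integrable before the difference of their integrals can be
    written as the integral of the difference.\<close>
  have iF: "AE x in I_measure. integrable MY (\<lambda>y. F (x, y))"
  proof -
    have "(\<integral>\<^sup>+x. (\<integral>\<^sup>+y. norm (F (x, y)) \<partial>MY) \<partial>I_measure) = (\<integral>\<^sup>+p. norm (F p) \<partial>MQ)"
      by (rule nn_integral_MQ_iterated[symmetric]) measurable
    also have "\<dots> < \<infinity>"
      using L2_space_integrable[OF finite_measure_MQ FL2] by (simp add: nn_integral_eq_integral)
    finally have "AE x in I_measure. (\<integral>\<^sup>+y. norm (F (x, y)) \<partial>MY) \<noteq> \<infinity>"
    proof (intro nn_integral_PInf_AE)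
      have "(\<lambda>p. ennreal (norm (F p)) * indicator {0<..<1} (snd p)) \<in> borel_measurable (lborel \<Otimes>\<^sub>M (lborel :: real measure))"
        unfolding lborel_prod by measurable
      then have "(\<lambda>x. \<integral>\<^sup>+y. ennreal (norm (F (x, y))) * indicator {0<..<1} y \<partial>lborel) \<in> borel_measurable lborel"
        by (intro lborel.borel_measurable_nn_integral) (simp add: split_beta')
      then have "(\<lambda>x. \<integral>\<^sup>+y. ennreal (norm (F (x, y))) * indicator {0<..<1} y \<partial>lborel) \<in> borel_measurable borel"
        by simp
      then show "(\<lambda>x. \<integral>\<^sup>+y. norm (F (x, y)) \<partial>MY) \<in> borel_measurable I_measure"
        unfolding I_measure_def by (intro borel_measurable_lebesgue_on) (simp add: nn_integral_restrict_space)
    qed auto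
    then show ?thesis
    proof eventually_elim
      case (elim x)
      then show ?case
        using slice_measurable[OF F, of x] by (intro integrableI_bounded) (auto simp: top.not_eq_extremum)
    qed
  qed
  have D: "AE x in I_measure. X (x, 0) - g x = (\<integral>y. (X (x, y) - (1 - y) *\<^sub>R X' (x, y)) - F (x, y) \<partial>MY)"
    if X: "C1_along (0, 1) X X'" for X X'
    using iF
  proof eventually_elim
    case (elim x)
    then show ?case using C1_along_boundary_value[OF X, of x] by (simp add: g_def)
  qed
  have Dm: "(\<lambda>p. (X p - (1 - snd p) *\<^sub>R X' p) - F p) \<in> borel_measurable borel" if X: "C1_along (0, 1) X X'" for X X'
  proof -
    have [measurable]: "X \<in> borel_measurable borel" "X' \<in> borel_measurable borel"
      using C1_alongD[OF X] by (auto intro: borel_measurable_continuous_onI)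
    show ?thesis by measurable
  qed
  \<comment> \<open>The deviation is a combination of X - u and X' - uy with coefficients bounded by
    1, so convergence of these in either mode carries over to the boundary values.\<close>
  have DAE: "AE p in MQ. (X p - (1 - snd p) *\<^sub>R X' p) - F p = (X p - u p) + (- (1 - snd p)) *\<^sub>R (X' p - uy p)" for X X'
    using u'(2) w(2) by eventually_elim (simp add: F_def algebra_simps)
  have XI: "(\<lambda>x. X (x, 0)) \<in> L2_space I_measure" if X: "C1_along (0, 1) X X'" for X X' :: "real \<times> real \<Rightarrow> 'b"
  proof -
    have c: "continuous_on UNIV (\<lambda>x. X (x, 0))"
      by (rule continuous_on_compose2[OF C1_alongD(1)[OF X]]) (auto intro!: continuous_intros)
    then obtain B where "\<And>x. x \<in> {- pi<..<pi} \<Longrightarrow> norm (X (x, 0)) \<le> B"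
      using continuous_bounded_on_bounded[OF c, of "{- pi<..<pi}"] by auto
    then have "AE x in I_measure. norm (X (x, 0)) \<le> B"
      unfolding I_measure_def by (intro AE_I2) auto
    moreover have "(\<lambda>x. X (x, 0)) \<in> borel_measurable I_measure"
      unfolding I_measure_def by (intro borel_measurable_lebesgue_on borel_measurable_continuous_onI c)
    ultimately show ?thesis by (intro L2_space_bounded[OF finite_measure_I])
  qed
  have "trace_of u uy g"
    unfolding trace_of_def
  proof (intro allI impI conjI; (elim conjE)?)
    fix X X' :: "nat \<Rightarrow> real \<times> real \<Rightarrow> 'b"
    assume X: "\<forall>n. C1_along (0, 1) (X n) (X' n)"
    let ?D = "\<lambda>n p. (X n p - (1 - snd p) *\<^sub>R X' n p) - F p"
    {
      assume t: "L2_tendsto MQ X u" "L2_tendsto MQ X' uy"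
      define E where "E n p = (X n p - u p) + (- (1 - snd p)) *\<^sub>R (X' n p - uy p)" for n p
      have E: "L2_tendsto MQ E (\<lambda>p. (u p - u p) + (- (1 - snd p)) *\<^sub>R (uy p - uy p))"
        unfolding E_def
        by (intro L2_tendsto_add L2_tendsto_bounded_mult[OF _ sndc] L2_tendsto_diff t L2_tendsto_const u uy)
      show "L2_tendsto I_measure (\<lambda>n x. X n (x, 0)) g"
      proof (rule L2_tendsto_dominated[OF E])
        show "(\<lambda>x. X n (x, 0)) \<in> L2_space I_measure" for n using XI X by blast
        show "g \<in> L2_space I_measure" by (rule gL2)
        fix n
        have "ennreal (\<integral>x. (norm (X n (x, 0) - g x))\<^sup>2 \<partial>I_measure) = (\<integral>\<^sup>+x. ennreal ((norm (X n (x, 0) - g x))\<^sup>2) \<partial>I_measure)"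
          by (intro nn_integral_eq_integral[symmetric] L2_spaceD(2) L2_space_diff gL2 XI[OF X[rule_format]]) auto
        also have "\<dots> = (\<integral>\<^sup>+x. ennreal ((norm (\<integral>y. ?D n (x, y) \<partial>MY))\<^sup>2) \<partial>I_measure)"
          by (rule nn_integral_cong_AE) (use D[OF X[rule_format, of n]] in \<open>auto elim!: eventually_mono\<close>)
        also have "\<dots> \<le> (\<integral>\<^sup>+p. ennreal ((norm (?D n p))\<^sup>2) \<partial>MQ)"
          by (rule slice_L2_bound[OF Dm[OF X[rule_format]]])
        also have "\<dots> = (\<integral>\<^sup>+p. ennreal ((norm (E n p))\<^sup>2) \<partial>MQ)"
        proof (rule nn_integral_cong_AE)
          show "AE p in MQ. ennreal ((norm (?D n p))\<^sup>2) = ennreal ((norm (E n p))\<^sup>2)"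
            using DAE[of "X n" "X' n"] by eventually_elim (simp only: E_def)
        qed
        also have "\<dots> = ennreal (\<integral>p. (norm (E n p))\<^sup>2 \<partial>MQ)"
          by (intro nn_integral_eq_integral L2_spaceD(2) L2_tendstoD(1)[OF E]) auto
        finally show "(\<integral>x. (norm (X n (x, 0) - g x))\<^sup>2 \<partial>I_measure) \<le>
            1 * (\<integral>p. (norm (E n p - ((u p - u p) + (- (1 - snd p)) *\<^sub>R (uy p - uy p))))\<^sup>2 \<partial>MQ)"
          by simp
      qed
    }
    {
      assume t: "L1_tendsto MQ X u" "L1_tendsto MQ X' uy"
      note i = L1_tendstoD(1,2)[OF t(1)] L1_tendstoD(1,2)[OF t(2)]
      show "L1_tendsto I_measure (\<lambda>n x. X n (x, 0)) g"
      proof (rule L1_tendsto_dominated)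
        show iX: "integrable I_measure (\<lambda>x. X n (x, 0))" for n
          using L2_space_integrable[OF finite_measure_I XI] X by blast
        show ig: "integrable I_measure g" by (rule L2_space_integrable[OF finite_measure_I gL2])
        show "(\<lambda>n. (\<integral>p. norm (X n p - u p) \<partial>MQ) + (\<integral>p. norm (X' n p - uy p) \<partial>MQ)) \<longlonglongrightarrow> 0"
          using tendsto_add[OF L1_tendstoD(3)[OF t(1)] L1_tendstoD(3)[OF t(2)]] by simp
        fix n
        have "ennreal (\<integral>x. norm (X n (x, 0) - g x) \<partial>I_measure) = (\<integral>\<^sup>+x. norm (X n (x, 0) - g x) \<partial>I_measure)"
          using iX ig by (intro nn_integral_eq_integral[symmetric]) auto
        also have "\<dots> = (\<integral>\<^sup>+x. norm (\<integral>y. ?D n (x, y) \<partial>MY) \<partial>I_measure)"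
          by (rule nn_integral_cong_AE) (use D[OF X[rule_format, of n]] in \<open>auto elim!: eventually_mono\<close>)
        also have "\<dots> \<le> (\<integral>\<^sup>+p. norm (?D n p) \<partial>MQ)"
          by (rule slice_L1_bound[OF Dm[OF X[rule_format]]])
        also have "\<dots> \<le> (\<integral>\<^sup>+p. ennreal (norm (X n p - u p) + norm (X' n p - uy p)) \<partial>MQ)"
        proof (rule nn_integral_mono_AE)
          show "AE p in MQ. ennreal (norm (?D n p)) \<le> ennreal (norm (X n p - u p) + norm (X' n p - uy p))"
            using DAE[of "X n" "X' n"] sndc(2)
          proof eventually_elim
            case (elim p)
            have "norm ((X n p - u p) + (- (1 - snd p)) *\<^sub>R (X' n p - uy p)) \<le>
                norm (X n p - u p) + norm ((- (1 - snd p)) *\<^sub>R (X' n p - uy p))"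
              by (rule norm_triangle_ineq)
            also have "norm ((- (1 - snd p)) *\<^sub>R (X' n p - uy p)) \<le> norm (X' n p - uy p)"
              using elim(2) by (auto intro: mult_left_le_one_le)
            finally show ?case unfolding elim(1) by (intro ennreal_leI) auto
          qed
        qed
        also have "\<dots> = ennreal (\<integral>p. norm (X n p - u p) + norm (X' n p - uy p) \<partial>MQ)"
          using i by (intro nn_integral_eq_integral) auto
        also have "(\<integral>p. norm (X n p - u p) + norm (X' n p - uy p) \<partial>MQ) =
            (\<integral>p. norm (X n p - u p) \<partial>MQ) + (\<integral>p. norm (X' n p - uy p) \<partial>MQ)"
          using i by simp
        finally show "(\<integral>x. norm (X n (x, 0) - g x) \<partial>I_measure) \<le>
            (\<integral>p. norm (X n p - u p) \<partial>MQ) + (\<integral>p. norm (X' n p - uy p) \<partial>MQ)"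
          by (subst (asm) ennreal_le_iff) (auto intro!: add_nonneg_nonneg)
      qed
    }
  qed
  then show ?thesis using that gL2 by blast
qed

lemma trace_ofD:
  assumes "trace_of u uy g" "\<And>n. C1_along (0, 1) (X n) (X' n)"
  shows "L2_tendsto MQ X u \<Longrightarrow> L2_tendsto MQ X' uy \<Longrightarrow> L2_tendsto I_measure (\<lambda>n x. X n (x, 0)) g"
    "L1_tendsto MQ X u \<Longrightarrow> L1_tendsto MQ X' uy \<Longrightarrow> L1_tendsto I_measure (\<lambda>n x. X n (x, 0)) g"
  using assms unfolding trace_of_def by blast+

section \<open>Linearity of weak derivatives and their behaviour under changes on null sets\<close>

lemma test_function_frechet_derivative:
  assumes \<zeta>: "test_function \<Omega> \<zeta>"
  shows "test_function \<Omega> (\<lambda>p. frechet_derivative \<zeta> (at p) v)"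
proof (rule test_function_if_compact_superset)
  let ?K = "closure {p. \<zeta> p \<noteq> 0}"
  show "smooth (\<lambda>p. frechet_derivative \<zeta> (at p) v)"
    using \<zeta> smooth_frechet_derivative by (auto simp: test_function_def)
  show "compact ?K" "?K \<subseteq> \<Omega>" using \<zeta> by (auto simp: test_function_def)
  show "p \<in> ?K" if "frechet_derivative \<zeta> (at p) v \<noteq> 0" for p
  proof (rule ccontr)
    assume p: "p \<notin> ?K"
    have "((\<lambda>p. 0) has_derivative (\<lambda>v. 0)) (at p)" by simp
    then have "(\<zeta> has_derivative (\<lambda>v. 0)) (at p)"
      by (rule has_derivative_transform_within_open[where s="- ?K"])
         (use p closure_subset[of "{p. \<zeta> p \<noteq> 0}"] in auto)
    then show False using that frechet_derivative_at by metis
  qed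
qed

lemma has_weak_deriv_add_scaleR:
  assumes u: "has_weak_deriv Q_plus v u g" and w: "has_weak_deriv Q_plus v w h"
  shows "has_weak_deriv Q_plus v (\<lambda>p. a *\<^sub>R u p + b *\<^sub>R w p) (\<lambda>p. a *\<^sub>R g p + b *\<^sub>R h p)"
  unfolding has_weak_deriv_def
proof (intro conjI allI impI)
  note l = u[unfolded has_weak_deriv_def] w[unfolded has_weak_deriv_def]
  show "locally_integrable Q_plus (\<lambda>p. a *\<^sub>R u p + b *\<^sub>R w p)" "locally_integrable Q_plus (\<lambda>p. a *\<^sub>R g p + b *\<^sub>R h p)"
    using l by (auto simp: locally_integrable_def)
  fix \<zeta> assume \<zeta>: "test_function Q_plus \<zeta>"
  let ?d = "\<lambda>p. frechet_derivative \<zeta> (at p) v"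
  note d = test_function_frechet_derivative[OF \<zeta>, of v]
  have i: "integrable MQ (\<lambda>p. ?d p *\<^sub>R u p)" "integrable MQ (\<lambda>p. ?d p *\<^sub>R w p)"
    "integrable MQ (\<lambda>p. \<zeta> p *\<^sub>R g p)" "integrable MQ (\<lambda>p. \<zeta> p *\<^sub>R h p)"
    using integrable_MQ_test_function_mult[OF _ d] integrable_MQ_test_function_mult[OF _ \<zeta>] l by auto
  have "(\<integral>p. ?d p *\<^sub>R (a *\<^sub>R u p + b *\<^sub>R w p) \<partial>MQ) = (\<integral>p. a *\<^sub>R (?d p *\<^sub>R u p) + b *\<^sub>R (?d p *\<^sub>R w p) \<partial>MQ)"
    by (simp add: scaleR_add_right mult.commute)
  also have "\<dots> = a *\<^sub>R (\<integral>p. ?d p *\<^sub>R u p \<partial>MQ) + b *\<^sub>R (\<integral>p. ?d p *\<^sub>R w p \<partial>MQ)"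
    using i by (simp del: scaleR_scaleR)
  also have "\<dots> = - (a *\<^sub>R (\<integral>p. \<zeta> p *\<^sub>R g p \<partial>MQ) + b *\<^sub>R (\<integral>p. \<zeta> p *\<^sub>R h p \<partial>MQ))"
    using l \<zeta> by simp
  also have "a *\<^sub>R (\<integral>p. \<zeta> p *\<^sub>R g p \<partial>MQ) + b *\<^sub>R (\<integral>p. \<zeta> p *\<^sub>R h p \<partial>MQ) =
      (\<integral>p. a *\<^sub>R (\<zeta> p *\<^sub>R g p) + b *\<^sub>R (\<zeta> p *\<^sub>R h p) \<partial>MQ)"
    using i by (simp del: scaleR_scaleR)
  also have "\<dots> = (\<integral>p. \<zeta> p *\<^sub>R (a *\<^sub>R g p + b *\<^sub>R h p) \<partial>MQ)"
    by (simp add: scaleR_add_right mult.commute)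
  finally show "(\<integral>p. ?d p *\<^sub>R (a *\<^sub>R u p + b *\<^sub>R w p) \<partial>MQ) = - (\<integral>p. \<zeta> p *\<^sub>R (a *\<^sub>R g p + b *\<^sub>R h p) \<partial>MQ)" .
qed

lemma has_weak_deriv_weak_deriv:
  "has_weak_deriv \<Omega> v u g \<Longrightarrow> has_weak_deriv \<Omega> v u (weak_deriv \<Omega> v u)"
  unfolding weak_deriv_def by (rule someI[of "has_weak_deriv \<Omega> v u"])

lemma weak_deriv_AE:
  "has_weak_deriv Q_plus v u g \<Longrightarrow> AE p in MQ. weak_deriv Q_plus v u p = g p"
  using has_weak_deriv_unique has_weak_deriv_weak_deriv by blast

text \<open>The product of u with each cutoff is integrable, hence measurable; dividing by the
  cutoff again gives functions that at each point are eventually equal to u.\<close>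

lemma locally_integrable_measurable:
  fixes u :: "real \<times> real \<Rightarrow> 'b::euclidean_space"
  assumes "locally_integrable Q_plus u"
  shows "u \<in> borel_measurable MQ"
proof (rule borel_measurable_LIMSEQ_metric)
  show "(\<lambda>p. (1 / cutoff n p) *\<^sub>R (cutoff n p *\<^sub>R u p)) \<in> borel_measurable MQ" for n
  proof -
    have t: "test_function Q_plus (\<lambda>p. 1 * cutoff n p)"
      by (intro test_function_cutoff_mult) (simp add: smooth_def)
    then have "(\<lambda>p. cutoff n p *\<^sub>R u p) \<in> borel_measurable MQ"
      using integrable_MQ_test_function_mult[OF assms t] by auto
    moreover have "cutoff n \<in> borel_measurable MQ"
      by (rule continuous_measurable_MQ[OF C1_alongD(1)[OF C1_along_smooth[OF smooth_cutoff]]])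
    ultimately show ?thesis
      by (intro borel_measurable_scaleR[OF borel_measurable_divide[OF borel_measurable_const]])
  qed
  show "(\<lambda>n. (1 / cutoff n p) *\<^sub>R (cutoff n p *\<^sub>R u p)) \<longlonglongrightarrow> u p" if "p \<in> space MQ" for p
  proof (rule tendsto_eventually)
    have "p \<in> Q_plus" using that by simp
    from cutoff_eventually_nonzero[OF this]
    show "\<forall>\<^sub>F n in sequentially. (1 / cutoff n p) *\<^sub>R (cutoff n p *\<^sub>R u p) = u p"
      by eventually_elim simp
  qed
qed

lemma has_weak_deriv_measurable:
  assumes "has_weak_deriv Q_plus v u g"
  shows "u \<in> borel_measurable MQ" "g \<in> borel_measurable MQ"
  using assms by (auto simp: has_weak_deriv_def intro: locally_integrable_measurable)

lemma locally_integrable_cong_AE: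
  fixes u :: "real \<times> real \<Rightarrow> 'b::euclidean_space"
  assumes u: "locally_integrable Q_plus u" and w: "w \<in> borel_measurable MQ" and eq: "AE p in MQ. u p = w p"
  shows "locally_integrable Q_plus w"
  unfolding locally_integrable_def
proof safe
  fix K assume K: "compact K" "K \<subseteq> Q_plus"
  then have Kl: "K \<in> sets lebesgue" by (simp add: lmeasurable_compact fmeasurableD)
  have "u \<in> borel_measurable (lebesgue_on K)"
    using u K by (auto simp: locally_integrable_def)
  moreover have "w \<in> borel_measurable (lebesgue_on K)"
    using measurable_restrict_mono[OF w K(2)] .
  moreover have "AE p in lebesgue_on K. u p = w p"
    using eq K(2) Kl by (auto simp: AE_restrict_space_iff elim: eventually_mono)
  ultimately show "integrable (lebesgue_on K) w"
    using u K by (subst integrable_cong_AE[of w _ u]) (auto simp: locally_integrable_def elim: eventually_mono)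
qed

lemma has_weak_deriv_cong_AE:
  fixes u w :: "real \<times> real \<Rightarrow> 'b::euclidean_space"
  assumes g: "has_weak_deriv Q_plus v u g" and w: "w \<in> borel_measurable MQ" "AE p in MQ. u p = w p"
    and h: "h \<in> borel_measurable MQ" "AE p in MQ. g p = h p"
  shows "has_weak_deriv Q_plus v w h"
  unfolding has_weak_deriv_def
proof (intro conjI allI impI)
  note l = g[unfolded has_weak_deriv_def]
  show "locally_integrable Q_plus w" "locally_integrable Q_plus h"
    using l w h locally_integrable_cong_AE by blast+
  fix \<zeta> assume \<zeta>: "test_function Q_plus \<zeta>"
  let ?d = "\<lambda>p. frechet_derivative \<zeta> (at p) v"
  note cz = C1_alongD[OF C1_along_smooth[OF test_functionD(1)[OF \<zeta>], of v]]
  note m = continuous_measurable_MQ[OF cz(1)] continuous_measurable_MQ[OF cz(2)] has_weak_deriv_measurable[OF g]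
  have "(\<integral>p. ?d p *\<^sub>R w p \<partial>MQ) = (\<integral>p. ?d p *\<^sub>R u p \<partial>MQ)"
    using m w by (intro integral_cong_AE borel_measurable_scaleR) (auto elim: eventually_mono)
  also have "\<dots> = - (\<integral>p. \<zeta> p *\<^sub>R g p \<partial>MQ)" using l \<zeta> by blast
  also have "(\<integral>p. \<zeta> p *\<^sub>R g p \<partial>MQ) = (\<integral>p. \<zeta> p *\<^sub>R h p \<partial>MQ)"
    using m h by (intro integral_cong_AE borel_measurable_scaleR) (auto elim: eventually_mono)
  finally show "(\<integral>p. ?d p *\<^sub>R w p \<partial>MQ) = - (\<integral>p. \<zeta> p *\<^sub>R h p \<partial>MQ)" .
qed

text \<open>An equality of functions, stronger than equality almost everywhere: both sides choose
  from the same set of candidates.\<close>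

lemma weak_deriv_cong_AE:
  assumes "u \<in> borel_measurable MQ" "w \<in> borel_measurable MQ" "AE p in MQ. u p = w p"
  shows "weak_deriv Q_plus v u = weak_deriv Q_plus v w"
proof -
  have "has_weak_deriv Q_plus v u g \<longleftrightarrow> has_weak_deriv Q_plus v w g" for g
    using has_weak_deriv_cong_AE[of v u g w g] has_weak_deriv_cong_AE[of v w g u g] assms
      has_weak_deriv_measurable(2)[of v u g] has_weak_deriv_measurable(2)[of v w g]
    by (auto simp: eq_commute)
  then have "has_weak_deriv Q_plus v u = has_weak_deriv Q_plus v w" by blast
  then show ?thesis by (simp add: weak_deriv_def)
qed

lemma W12_cong_AE:
  assumes u: "W12 u ux uy"
    and "w \<in> borel_measurable MQ" "AE p in MQ. u p = w p"
    and "wx \<in> borel_measurable MQ" "AE p in MQ. ux p = wx p"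
    and "wy \<in> borel_measurable MQ" "AE p in MQ. uy p = wy p"
  shows "W12 w wx wy"
  unfolding W12_def
  by (intro conjI L2_space_cong_AE[OF W12D(1)[OF u]] L2_space_cong_AE[OF W12D(2)[OF u]]
      L2_space_cong_AE[OF W12D(3)[OF u]] has_weak_deriv_cong_AE[OF W12D(4)[OF u]]
      has_weak_deriv_cong_AE[OF W12D(5)[OF u]] assms)

lemma W12_add_scaleR:
  assumes "W12 u ux uy" "W12 w wx wy"
  shows "W12 (\<lambda>p. a *\<^sub>R u p + b *\<^sub>R w p) (\<lambda>p. a *\<^sub>R ux p + b *\<^sub>R wx p) (\<lambda>p. a *\<^sub>R uy p + b *\<^sub>R wy p)"
  unfolding W12_def
  by (intro conjI L2_space_add L2_space_scaleR has_weak_deriv_add_scaleR W12D[OF assms(1)] W12D[OF assms(2)])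

lemma W12_diff:
  assumes "W12 u ux uy" "W12 w wx wy"
  shows "W12 (\<lambda>p. u p - w p) (\<lambda>p. ux p - wx p) (\<lambda>p. uy p - wy p)"
  using W12_add_scaleR[OF assms, of 1 "-1"] by simp

lemma W12_C1:
  assumes "C1_along (1, 0) u ux" "C1_along (0, 1) u uy"
  shows "W12 u ux uy"
  unfolding W12_def
  by (intro conjI continuous_L2_MQ C1_alongD(1)[OF assms(1)] C1_alongD(2)[OF assms(1)] C1_alongD(2)[OF assms(2)]
      C1_along_has_weak_deriv assms) (simp_all add: Basis_real_prod)

lemma W12_smooth:
  "smooth U \<Longrightarrow> W12 U (\<lambda>p. frechet_derivative U (at p) (1, 0)) (\<lambda>p. frechet_derivative U (at p) (0, 1))"
  by (intro W12_C1 C1_along_smooth)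

lemma W12_const: "W12 (\<lambda>p. c) (\<lambda>p. 0) (\<lambda>p. 0)"
  by (intro W12_C1) (simp_all add: C1_along_def)

section \<open>Existence, uniqueness and calculus of traces\<close>

lemma L2_norm_cong_AE:
  assumes "u \<in> borel_measurable M" "w \<in> borel_measurable M" "AE p in M. u p = w p"
  shows "L2_norm M u = L2_norm M w"
  unfolding L2_norm_def using assms
  by (intro arg_cong[where f=sqrt] integral_cong_AE) (auto elim: eventually_mono)

lemma sobolev_norm_1_eq:
  assumes u: "W12 u ux uy"
  shows "sobolev_norm Q_plus (L2_norm MQ) 1 u = L2_norm MQ u + L2_norm MQ ux + L2_norm MQ uy"
proof -
  have "L2_norm MQ (weak_deriv Q_plus v u) = L2_norm MQ g" if "has_weak_deriv Q_plus v u g" for v g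
    using has_weak_deriv_measurable[OF that] has_weak_deriv_measurable[OF has_weak_deriv_weak_deriv[OF that]]
      weak_deriv_AE[OF that] by (intro L2_norm_cong_AE) auto
  then show ?thesis using W12D[OF u] by (simp add: Basis_real_prod)
qed

lemma L2_tendsto_iff_norm:
  assumes "\<And>n. X n \<in> L2_space M" "Y \<in> L2_space M"
  shows "L2_tendsto M X Y \<longleftrightarrow> (\<lambda>n. L2_norm M (\<lambda>p. X n p - Y p)) \<longlonglongrightarrow> 0"
proof
  assume "L2_tendsto M X Y"
  then show "(\<lambda>n. L2_norm M (\<lambda>p. X n p - Y p)) \<longlonglongrightarrow> 0"
    using tendsto_real_sqrt[OF L2_tendstoD(3)] by (fastforce simp: L2_norm_def)
next
  assume "(\<lambda>n. L2_norm M (\<lambda>p. X n p - Y p)) \<longlonglongrightarrow> 0"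
  then have "(\<lambda>n. (L2_norm M (\<lambda>p. X n p - Y p))\<^sup>2) \<longlonglongrightarrow> 0\<^sup>2" by (rule tendsto_power)
  then show "L2_tendsto M X Y" using assms by (simp add: L2_norm_def L2_tendsto_def)
qed

lemma L2_tendsto_norm: "L2_tendsto M X Y \<Longrightarrow> (\<lambda>n. L2_norm M (\<lambda>p. X n p - Y p)) \<longlonglongrightarrow> 0"
  using L2_tendsto_iff_norm[of X M Y] by (auto simp: L2_tendsto_def)

lemma L2_norm_nonneg: "L2_norm M u \<ge> 0"
  by (simp add: L2_norm_def)

lemma sobolev_norm_1_tendsto_iff:
  assumes U: "\<And>n. smooth (U n)" and u: "W12 u ux uy"
  shows "(\<lambda>n. sobolev_norm Q_plus (L2_norm MQ) 1 (\<lambda>p. U n p - u p)) \<longlonglongrightarrow> 0 \<longleftrightarrow>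
    L2_tendsto MQ U u \<and> L2_tendsto MQ (\<lambda>n p. frechet_derivative (U n) (at p) (1, 0)) ux \<and>
    L2_tendsto MQ (\<lambda>n p. frechet_derivative (U n) (at p) (0, 1)) uy"
proof -
  let ?a = "\<lambda>n. L2_norm MQ (\<lambda>p. U n p - u p)"
    and ?b = "\<lambda>n. L2_norm MQ (\<lambda>p. frechet_derivative (U n) (at p) (1, 0) - ux p)"
    and ?c = "\<lambda>n. L2_norm MQ (\<lambda>p. frechet_derivative (U n) (at p) (0, 1) - uy p)"
  note Un = W12D(1-3)[OF W12_smooth[OF U]] and un = W12D(1-3)[OF u]
  have "(\<lambda>n. ?a n + ?b n + ?c n) \<longlonglongrightarrow> 0 \<longleftrightarrow> ?a \<longlonglongrightarrow> 0 \<and> ?b \<longlonglongrightarrow> 0 \<and> ?c \<longlonglongrightarrow> 0"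
  proof
    assume s: "(\<lambda>n. ?a n + ?b n + ?c n) \<longlonglongrightarrow> 0"
    show "?a \<longlonglongrightarrow> 0 \<and> ?b \<longlonglongrightarrow> 0 \<and> ?c \<longlonglongrightarrow> 0"
      by (intro conjI; rule tendsto_sandwich[OF _ _ tendsto_const s])
         (auto intro!: always_eventually add_nonneg_nonneg simp: L2_norm_nonneg add_increasing add_increasing2)
  next
    assume "?a \<longlonglongrightarrow> 0 \<and> ?b \<longlonglongrightarrow> 0 \<and> ?c \<longlonglongrightarrow> 0"
    then have "(\<lambda>n. ?a n + ?b n + ?c n) \<longlonglongrightarrow> 0 + 0 + 0" by (intro tendsto_add) auto
    then show "(\<lambda>n. ?a n + ?b n + ?c n) \<longlonglongrightarrow> 0" by simp
  qed
  then show ?thesis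
    unfolding sobolev_norm_1_eq[OF W12_diff[OF W12_smooth[OF U] u]]
    using L2_tendsto_iff_norm[OF Un(1) un(1)] L2_tendsto_iff_norm[OF Un(2) un(2)] L2_tendsto_iff_norm[OF Un(3) un(3)]
    by simp
qed

lemma has_traceD:
  assumes "has_trace u g" "W12 u ux uy"
  obtains U where "\<And>n. smooth (U n)" "L2_tendsto MQ U u"
    "L2_tendsto MQ (\<lambda>n p. frechet_derivative (U n) (at p) (1, 0)) ux"
    "L2_tendsto MQ (\<lambda>n p. frechet_derivative (U n) (at p) (0, 1)) uy"
    "L2_tendsto I_measure (\<lambda>n x. U n (x, 0)) g"
proof -
  obtain U where U: "\<And>n. smooth (U n)"
      "(\<lambda>n. sobolev_norm Q_plus (L2_norm MQ) 1 (\<lambda>p. U n p - u p)) \<longlonglongrightarrow> 0"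
      "(\<lambda>n. L2_norm I_measure (\<lambda>x. U n (x, 0) - g x)) \<longlonglongrightarrow> 0" and g: "g \<in> L2_space I_measure"
    using assms(1) unfolding has_trace_def by blast
  have "(\<lambda>x. U n (x, 0)) \<in> L2_space I_measure" for n
  proof -
    have c: "continuous_on UNIV (\<lambda>x. U n (x, 0))"
      by (rule continuous_on_compose2[OF C1_alongD(1)[OF C1_along_smooth[OF U(1)]]]) (auto intro!: continuous_intros)
    then obtain B where "\<And>x. x \<in> {- pi<..<pi} \<Longrightarrow> norm (U n (x, 0)) \<le> B"
      using continuous_bounded_on_bounded[OF c, of "{- pi<..<pi}"] by auto
    then have "AE x in I_measure. norm (U n (x, 0)) \<le> B"
      unfolding I_measure_def by (intro AE_I2) auto
    moreover have "(\<lambda>x. U n (x, 0)) \<in> borel_measurable I_measure"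
      unfolding I_measure_def by (intro borel_measurable_lebesgue_on borel_measurable_continuous_onI c)
    ultimately show ?thesis by (intro L2_space_bounded[OF finite_measure_I])
  qed
  then have "L2_tendsto I_measure (\<lambda>n x. U n (x, 0)) g"
    using L2_tendsto_iff_norm[of "\<lambda>n x. U n (x, 0)" I_measure g] U(3) g by simp
  moreover note sobolev_norm_1_tendsto_iff[where U=U, OF U(1) assms(2), THEN iffD1, OF U(2)]
  ultimately show ?thesis by (elim conjE) (rule that[OF U(1)])
qed

lemma has_traceI:
  assumes u: "W12 u ux uy" and g: "g \<in> L2_space I_measure" "trace_of u uy g"
  shows "has_trace u g"
proof -
  obtain U where U: "\<And>n. smooth (U n)" "L2_tendsto MQ U u"
    "L2_tendsto MQ (\<lambda>n p. frechet_derivative (U n) (at p) (1, 0)) ux"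
    "L2_tendsto MQ (\<lambda>n p. frechet_derivative (U n) (at p) (0, 1)) uy"
    by (rule W12_approx[OF u]) (rule that; assumption)
  have t: "L2_tendsto I_measure (\<lambda>n x. U n (x, 0)) g"
    by (rule trace_ofD(1)[OF g(2) C1_along_smooth[OF U(1)] U(2) U(4)])
  show ?thesis
    unfolding has_trace_def
  proof (intro conjI exI[of _ U] allI U(1) g(1))
    show "u \<in> sobolev Q_plus (L2_space MQ) 1" using u sobolev_1_iff by blast
    show "(\<lambda>n. sobolev_norm Q_plus (L2_norm MQ) 1 (\<lambda>p. U n p - u p)) \<longlonglongrightarrow> 0"
      using sobolev_norm_1_tendsto_iff[where U=U, OF U(1) u] U by blast
    show "(\<lambda>n. L2_norm I_measure (\<lambda>x. U n (x, 0) - g x)) \<longlonglongrightarrow> 0"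
      by (rule L2_tendsto_norm[OF t])
  qed
qed

text \<open>The sequence that witnesses \<open>has_trace\<close> is among those over which
  \<open>trace_of\<close> quantifies, so its boundary values tend to both functions.\<close>

lemma trace_of_AE_unique:
  assumes "has_trace u g" "W12 u ux uy" "trace_of u uy h"
  shows "AE x in I_measure. g x = h x"
proof -
  obtain U where U: "\<And>n. smooth (U n)" "L2_tendsto MQ U u"
    "L2_tendsto MQ (\<lambda>n p. frechet_derivative (U n) (at p) (1, 0)) ux"
    "L2_tendsto MQ (\<lambda>n p. frechet_derivative (U n) (at p) (0, 1)) uy"
    "L2_tendsto I_measure (\<lambda>n x. U n (x, 0)) g"
    by (rule has_traceD[OF assms(1,2)]) (rule that; assumption)
  have "L2_tendsto I_measure (\<lambda>n x. U n (x, 0)) h"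
    by (rule trace_ofD(1)[OF assms(3) C1_along_smooth[OF U(1)] U(2) U(4)])
  from L2_tendsto_imp_L1[OF this finite_measure_I] show ?thesis
    by (rule L1_tendsto_unique[OF L2_tendsto_imp_L1[OF U(5) finite_measure_I]])
qed

lemma has_trace_W12:
  assumes "has_trace u g" shows "\<exists>ux uy. W12 u ux uy" "g \<in> L2_space I_measure"
  using assms sobolev_1_iff unfolding has_trace_def by blast+

lemma has_trace_exists:
  assumes "W12 u ux uy" obtains g where "has_trace u g"
  using trace_of_exists[OF W12D(1)[OF assms] W12D(3)[OF assms]] has_traceI[OF assms] by metis

lemma has_trace_unique:
  assumes "has_trace u g" "has_trace u h"
  shows "AE x in I_measure. g x = h x"
proof -
  obtain ux uy where u: "W12 u ux uy" using has_trace_W12[OF assms(1)] by blast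
  obtain k where k: "trace_of u uy k" using trace_of_exists[OF W12D(1)[OF u] W12D(3)[OF u]] by blast
  show ?thesis
    using trace_of_AE_unique[OF assms(1) u k] trace_of_AE_unique[OF assms(2) u k] by eventually_elim simp
qed

lemma has_trace_trace_I: "has_trace u g \<Longrightarrow> has_trace u (trace_I u)"
  unfolding trace_I_def by (rule someI[of "has_trace u"])

lemma trace_I_AE: "has_trace u g \<Longrightarrow> AE x in I_measure. trace_I u x = g x"
  using has_trace_unique has_trace_trace_I by blast

text \<open>\<open>has_trace\<close> speaks of some approximating sequence; the detour through
  \<open>trace_of\<close> shows that every sequence of class C1 in the normal direction will
  do.\<close>

lemma has_trace_limit:
  assumes g: "has_trace u g" and u: "W12 u ux uy" and X: "\<And>n. C1_along (0, 1) (X n) (X' n)"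
    and t: "L2_tendsto MQ X u" "L2_tendsto MQ X' uy"
  shows "L2_tendsto I_measure (\<lambda>n x. X n (x, 0)) g"
proof -
  obtain h where h: "h \<in> L2_space I_measure" "trace_of u uy h"
    using trace_of_exists[OF W12D(1)[OF u] W12D(3)[OF u]] by blast
  have th: "L2_tendsto I_measure (\<lambda>n x. X n (x, 0)) h" by (rule trace_ofD(1)[OF h(2) X t])
  have "AE x in I_measure. h x = g x"
    using trace_of_AE_unique[OF g u h(2)] by eventually_elim simp
  with AE_I2 show ?thesis
    using L2_spaceD(1)[OF L2_tendstoD(1)[OF th]] L2_spaceD(1)[OF has_trace_W12(2)[OF g]]
    by (intro L2_tendsto_cong_AE[OF th]) auto
qed

text \<open>Products of approximants converge in W^{1,1} only, so the L1 half of
  \<open>trace_of\<close> is the one that applies; on I the products of the boundary values converge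
  in L1 as well.\<close>

lemma has_trace_prod:
  fixes bl :: "'b::euclidean_space \<Rightarrow> 'c::euclidean_space \<Rightarrow> 'd::euclidean_space"
  assumes bl: "bounded_bilinear bl" and u: "W12 u ux uy" "AE p in MQ. norm (u p) \<le> B"
    and w: "W12 w wx wy" "AE p in MQ. norm (w p) \<le> C"
    and g: "has_trace u g" and h: "has_trace w h" and k: "has_trace (\<lambda>p. bl (u p) (w p)) k"
  shows "AE x in I_measure. k x = bl (g x) (h x)"
proof -
  obtain U where U: "\<And>n. smooth (U n)" "L2_tendsto MQ U u"
    "L2_tendsto MQ (\<lambda>n p. frechet_derivative (U n) (at p) (1, 0)) ux"
    "L2_tendsto MQ (\<lambda>n p. frechet_derivative (U n) (at p) (0, 1)) uy"
    "L2_tendsto I_measure (\<lambda>n x. U n (x, 0)) g"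
    by (rule has_traceD[OF g u(1)]) (rule that; assumption)
  obtain W where W: "\<And>n. smooth (W n)" "L2_tendsto MQ W w"
    "L2_tendsto MQ (\<lambda>n p. frechet_derivative (W n) (at p) (1, 0)) wx"
    "L2_tendsto MQ (\<lambda>n p. frechet_derivative (W n) (at p) (0, 1)) wy"
    "L2_tendsto I_measure (\<lambda>n x. W n (x, 0)) h"
    by (rule has_traceD[OF h w(1)]) (rule that; assumption)
  note uw = W12_prod[OF bl u w]
  obtain k' where k': "trace_of (\<lambda>p. bl (u p) (w p)) (\<lambda>p. bl (u p) (wy p) + bl (uy p) (w p)) k'"
    using trace_of_exists[OF W12D(1)[OF uw] W12D(3)[OF uw]] by blast
  have "C1_along (0, 1) (\<lambda>p. bl (U n p) (W n p))
      (\<lambda>p. bl (U n p) (frechet_derivative (W n) (at p) (0, 1)) + bl (frechet_derivative (U n) (at p) (0, 1)) (W n p))" for n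
    by (intro C1_along_prod[OF bl] C1_along_smooth U W)
  from trace_ofD(2)[OF k' this L1_tendsto_bilinear[OF bl U(2) W(2)]
    L1_tendsto_add[OF L1_tendsto_bilinear[OF bl U(2) W(4)] L1_tendsto_bilinear[OF bl U(4) W(2)]]]
  have "L1_tendsto I_measure (\<lambda>n x. bl (U n (x, 0)) (W n (x, 0))) k'" .
  from L1_tendsto_unique[OF this L1_tendsto_bilinear[OF bl U(5) W(5)]] trace_of_AE_unique[OF k uw k']
  show ?thesis by eventually_elim simp
qed

lemma has_trace_add_scaleR:
  assumes g: "has_trace u g" and h: "has_trace w h"
  shows "has_trace (\<lambda>p. a *\<^sub>R u p + b *\<^sub>R w p) (\<lambda>x. a *\<^sub>R g x + b *\<^sub>R h x)"
proof -
  obtain ux uy where u: "W12 u ux uy" using has_trace_W12[OF g] by blast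
  obtain wx wy where w: "W12 w wx wy" using has_trace_W12[OF h] by blast
  obtain U where U: "\<And>n. smooth (U n)" "L2_tendsto MQ U u"
    "L2_tendsto MQ (\<lambda>n p. frechet_derivative (U n) (at p) (1, 0)) ux"
    "L2_tendsto MQ (\<lambda>n p. frechet_derivative (U n) (at p) (0, 1)) uy"
    "L2_tendsto I_measure (\<lambda>n x. U n (x, 0)) g"
    by (rule has_traceD[OF g u]) (rule that; assumption)
  obtain W where W: "\<And>n. smooth (W n)" "L2_tendsto MQ W w"
    "L2_tendsto MQ (\<lambda>n p. frechet_derivative (W n) (at p) (1, 0)) wx"
    "L2_tendsto MQ (\<lambda>n p. frechet_derivative (W n) (at p) (0, 1)) wy"
    "L2_tendsto I_measure (\<lambda>n x. W n (x, 0)) h"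
    by (rule has_traceD[OF h w]) (rule that; assumption)
  let ?V = "\<lambda>n p. a *\<^sub>R U n p + b *\<^sub>R W n p"
  note uw = W12_add_scaleR[OF u w, of a b]
  have V: "smooth (?V n)" for n
    using U(1)[of n] W(1)[of n] unfolding smooth_def by (intro allI C_k_add C_k_scaleR) auto
  have d: "frechet_derivative (?V n) (at p) v = a *\<^sub>R frechet_derivative (U n) (at p) v + b *\<^sub>R frechet_derivative (W n) (at p) v" for n p v
  proof -
    have "C_k (Suc 0) (U n)" "C_k (Suc 0) (W n)" using U W by (auto simp: smooth_def)
    note D = C_k_SucD(1)[OF this(1)] C_k_SucD(1)[OF this(2)]
    show ?thesis
      by (subst frechet_derivative_at[symmetric])
         (rule has_derivative_add[OF has_derivative_scaleR_right[OF D(1)] has_derivative_scaleR_right[OF D(2)]], rule refl)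
  qed
  have t: "L2_tendsto MQ ?V (\<lambda>p. a *\<^sub>R u p + b *\<^sub>R w p)"
      "L2_tendsto MQ (\<lambda>n p. frechet_derivative (?V n) (at p) (1, 0)) (\<lambda>p. a *\<^sub>R ux p + b *\<^sub>R wx p)"
      "L2_tendsto MQ (\<lambda>n p. frechet_derivative (?V n) (at p) (0, 1)) (\<lambda>p. a *\<^sub>R uy p + b *\<^sub>R wy p)"
      "L2_tendsto I_measure (\<lambda>n x. ?V n (x, 0)) (\<lambda>x. a *\<^sub>R g x + b *\<^sub>R h x)"
    unfolding d by (intro L2_tendsto_add L2_tendsto_scaleR U W)+
  show ?thesis
    unfolding has_trace_def
  proof (intro conjI exI[of _ ?V] allI V)
    show "(\<lambda>p. a *\<^sub>R u p + b *\<^sub>R w p) \<in> sobolev Q_plus (L2_space MQ) 1" using uw sobolev_1_iff by blast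
    show "(\<lambda>x. a *\<^sub>R g x + b *\<^sub>R h x) \<in> L2_space I_measure" using L2_tendstoD(2)[OF t(4)] .
    show "(\<lambda>n. sobolev_norm Q_plus (L2_norm MQ) 1 (\<lambda>p. ?V n p - (a *\<^sub>R u p + b *\<^sub>R w p))) \<longlonglongrightarrow> 0"
      using sobolev_norm_1_tendsto_iff[where U="?V", OF V uw] t by blast
    show "(\<lambda>n. L2_norm I_measure (\<lambda>x. ?V n (x, 0) - (a *\<^sub>R g x + b *\<^sub>R h x))) \<longlonglongrightarrow> 0"
      by (rule L2_tendsto_norm[OF t(4)])
  qed
qed

lemma has_trace_cong_AE:
  assumes g: "has_trace u g" and w: "w \<in> borel_measurable MQ" "AE p in MQ. u p = w p"
  shows "has_trace w g"
proof -
  obtain ux uy where u: "W12 u ux uy" using has_trace_W12[OF g] by blast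
  have w': "W12 w ux uy"
    by (rule W12_cong_AE[OF u w]) (auto intro: L2_spaceD W12D[OF u])
  obtain U where U: "\<And>n. smooth (U n)" "L2_tendsto MQ U u"
    "L2_tendsto MQ (\<lambda>n p. frechet_derivative (U n) (at p) (1, 0)) ux"
    "L2_tendsto MQ (\<lambda>n p. frechet_derivative (U n) (at p) (0, 1)) uy"
    "L2_tendsto I_measure (\<lambda>n x. U n (x, 0)) g"
    by (rule has_traceD[OF g u]) (rule that; assumption)
  have "L2_tendsto MQ U w"
    by (rule L2_tendsto_cong_AE[OF U(2)]) (use w L2_spaceD(1)[OF L2_tendstoD(1)[OF U(2)]] in auto)
  with U have "(\<lambda>n. sobolev_norm Q_plus (L2_norm MQ) 1 (\<lambda>p. U n p - w p)) \<longlonglongrightarrow> 0"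
    using sobolev_norm_1_tendsto_iff[where U=U, OF U(1) w'] by blast
  moreover have "(\<lambda>n. L2_norm I_measure (\<lambda>x. U n (x, 0) - g x)) \<longlonglongrightarrow> 0"
    by (rule L2_tendsto_norm[OF U(5)])
  moreover have "w \<in> sobolev Q_plus (L2_space MQ) 1" using w' sobolev_1_iff by blast
  ultimately show ?thesis
    unfolding has_trace_def using U(1) has_trace_W12(2)[OF g] by (intro conjI exI[of _ U]) auto
qed

lemma has_trace_const: "has_trace (\<lambda>p. c) (\<lambda>x. c)"
proof -
  have s: "smooth (\<lambda>p :: real \<times> real. c)" by (simp add: smooth_def)
  have "sobolev_norm Q_plus (L2_norm MQ) 1 (\<lambda>p :: real \<times> real. c - c) = 0"
    using sobolev_norm_1_eq[OF W12_const[of "0 :: 'a"]] by (simp add: L2_norm_def)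
  moreover have "(\<lambda>x. c) \<in> L2_space I_measure"
    by (intro L2_space_bounded[OF finite_measure_I, where C="norm c"]) auto
  moreover have "(\<lambda>p :: real \<times> real. c) \<in> sobolev Q_plus (L2_space MQ) 1"
    using W12_const[of c] sobolev_1_iff by blast
  moreover have "L2_norm I_measure (\<lambda>x. c - c) = 0" by (simp add: L2_norm_def)
  ultimately show ?thesis
    unfolding has_trace_def using s by (intro conjI exI[of _ "\<lambda>n p. c"]) (simp_all del: sobolev.simps sobolev_norm.simps)
qed

lemma has_trace_AE_cong_trace:
  assumes g: "has_trace u g" and eq: "AE x in I_measure. g x = h x" and h: "h \<in> L2_space I_measure"
  shows "has_trace u h"
proof -
  obtain ux uy where u: "W12 u ux uy" using has_trace_W12[OF g] by blast
  obtain U where U: "\<And>n. smooth (U n)" "L2_tendsto MQ U u"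
    "L2_tendsto MQ (\<lambda>n p. frechet_derivative (U n) (at p) (1, 0)) ux"
    "L2_tendsto MQ (\<lambda>n p. frechet_derivative (U n) (at p) (0, 1)) uy"
    "L2_tendsto I_measure (\<lambda>n x. U n (x, 0)) g"
    by (rule has_traceD[OF g u]) (rule that; assumption)
  have "L2_tendsto I_measure (\<lambda>n x. U n (x, 0)) h"
    by (rule L2_tendsto_cong_AE[OF U(5)]) (use eq L2_spaceD(1)[OF L2_tendstoD(1)[OF U(5)]] L2_spaceD(1)[OF h] in auto)
  from L2_tendsto_norm[OF this] show ?thesis
    unfolding has_trace_def
    using sobolev_norm_1_tendsto_iff[where U=U, OF U(1) u, THEN iffD2, OF conjI[OF U(2) conjI[OF U(3,4)]]] u sobolev_1_iff U(1) h
    by (intro conjI exI[of _ U]) blast+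
qed

section \<open>Extension of boundary data as a normal derivative\<close>

text \<open>For \<open>\<sigma> = (s, r)\<close> the point \<open>avg_map \<sigma> (x, y)\<close> lies at distance of order \<open>y\<close> from \<open>(x, 0)\<close>; the factor
  \<open>1 - y / 2\<close> keeps it inside the half rectangle also near the corners. Averaging over \<open>\<sigma>\<close> mollifies at
  scale \<open>y\<close>, so a derivative in \<open>(x, y)\<close> costs a factor \<open>1 / y\<close> that \<open>ext_kernel\<close> compensates.\<close>

definition avg_map :: "real \<times> real \<Rightarrow> real \<times> real \<Rightarrow> real \<times> real" where
  "avg_map \<sigma> p = (fst p * (1 - snd p / 2) + snd p * fst \<sigma>, snd p * snd \<sigma>)"

text \<open>With r between 1/2 and 1 the sampled point lies at height between y/2 and y, which keeps
  the change of variables in p uniformly invertible. The box has area 1, so averaging over it obeys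
  Jensen with constant 1.\<close>

abbreviation avg_box :: "(real \<times> real) set" where
  "avg_box \<equiv> cbox (- 1, 1 / 2) (1, 1)"

abbreviation MB :: "(real \<times> real) measure" where
  "MB \<equiv> restrict_space lborel avg_box"

definition avg :: "(real \<times> real \<Rightarrow> real \<times> real \<Rightarrow> real) \<Rightarrow> (real \<times> real \<Rightarrow> 'b::euclidean_space) \<Rightarrow> real \<times> real \<Rightarrow> 'b" where
  "avg k h p = (\<integral>\<sigma>. k \<sigma> p *\<^sub>R h (avg_map \<sigma> p) \<partial>MB)"

lemma continuous_avg_map: "continuous_on UNIV (\<lambda>z. avg_map (fst z) (snd z))"
  unfolding avg_map_def by (intro continuous_intros) auto

lemma mem_avg_box: "\<sigma> \<in> avg_box \<longleftrightarrow> - 1 \<le> fst \<sigma> \<and> fst \<sigma> \<le> 1 \<and> 1 / 2 \<le> snd \<sigma> \<and> snd \<sigma> \<le> 1"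
  by (cases \<sigma>) (auto simp: cbox_Pair_eq)

text \<open>The factor 1 - y/2 frees a margin pi y / 2 at the lateral sides, and the horizontal
  excursion is at most y; it fits because pi > 2.\<close>

lemma avg_map_in_Q_plus:
  assumes p: "p \<in> Q_plus" and s: "\<sigma> \<in> avg_box"
  shows "avg_map \<sigma> p \<in> Q_plus"
proof -
  note p' = p[unfolded mem_Q_plus] and s' = s[unfolded mem_avg_box]
  have "\<bar>fst p * (1 - snd p / 2)\<bar> < pi * (1 - snd p / 2)"
    using p' unfolding abs_mult by (auto intro!: mult_strict_right_mono)
  moreover have "\<bar>snd p * fst \<sigma>\<bar> \<le> snd p * 1"
    using p' s' unfolding abs_mult by (intro mult_mono) auto
  moreover have "snd p * 2 \<le> snd p * pi" using p' pi_gt3 by (intro mult_left_mono) auto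
  moreover have "pi * (1 - snd p / 2) = pi - (snd p * pi) / 2" by (simp add: algebra_simps)
  ultimately have "\<bar>fst p * (1 - snd p / 2) + snd p * fst \<sigma>\<bar> < pi" by linarith
  moreover have "0 < snd p * snd \<sigma>" using p' s' by simp
  moreover have "snd p * snd \<sigma> \<le> snd p * 1" using p' s' by (intro mult_left_mono) auto
  ultimately show ?thesis
    using p' unfolding mem_Q_plus avg_map_def fst_conv snd_conv abs_less_iff by linarith
qed

section \<open>Mean square estimates for averages\<close>

lemma emeasure_MB: "(\<integral>\<^sup>+\<sigma>. 1 \<partial>MB) = 1"
proof -
  have "emeasure lborel avg_box = ennreal ((\<Prod>b\<in>Basis. ((1 :: real, 1 :: real) - (- 1, 1 / 2)) \<bullet> b))"
    by (rule emeasure_lborel_cbox) (auto simp: Basis_real_prod)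
  also have "\<dots> = 1" by (simp add: Basis_real_prod)
  finally show ?thesis by (simp add: emeasure_restrict_space)
qed

lemma finite_measure_MB: "finite_measure MB"
  using emeasure_MB by (intro finite_measureI) simp

text \<open>For fixed \<sigma> the map is triangular: at fixed height it scales x by 1 - y/2, and it
  scales y by r. Both factors are at least 1/2, so each of the two substitutions costs at most
  2.\<close>

lemma nn_integral_avg_map_le:
  assumes [measurable]: "H \<in> borel_measurable borel" and s: "\<sigma> \<in> avg_box"
  shows "(\<integral>\<^sup>+p. H (avg_map \<sigma> p) \<partial>MQ) \<le> 4 * (\<integral>\<^sup>+p. H p \<partial>lborel)"
proof -
  have [measurable]: "fst \<in> borel_measurable borel" "snd \<in> borel_measurable (borel :: (real \<times> real) measure)"
    by (intro borel_measurable_continuous_onI continuous_intros)+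
  have pr [measurable]: "H \<in> borel_measurable (lborel \<Otimes>\<^sub>M lborel)" unfolding lborel_prod by simp
  have am: "avg_map \<sigma> \<in> borel \<rightarrow>\<^sub>M borel"
    unfolding avg_map_def by (intro borel_measurable_continuous_onI continuous_intros) auto
  note [measurable] = measurable_compose[OF am assms(1)]
  define G where "G y = (\<integral>\<^sup>+x. H (x, y) \<partial>lborel)" for y
  have G [measurable]: "G \<in> borel_measurable borel"
  proof -
    have "(\<lambda>z. H (snd z, fst z)) \<in> borel_measurable (lborel \<Otimes>\<^sub>M lborel)" by measurable
    then have "G \<in> borel_measurable lborel"
      unfolding G_def by (intro lborel.borel_measurable_nn_integral) (simp add: split_beta')
    then show ?thesis by simp
  qed
  have scale: "(\<integral>\<^sup>+x. f (t + c * x) \<partial>lborel) \<le> 2 * (\<integral>\<^sup>+x. f x \<partial>lborel)"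
    if [measurable]: "f \<in> borel_measurable borel" and c: "1 / 2 \<le> c" for f :: "real \<Rightarrow> ennreal" and t c
  proof -
    have "(\<integral>\<^sup>+x. f x \<partial>lborel) = ennreal \<bar>c\<bar> * (\<integral>\<^sup>+x. f (t + c * x) \<partial>lborel)"
      using c by (intro nn_integral_real_affine) auto
    then have "2 * (\<integral>\<^sup>+x. f x \<partial>lborel) = ennreal (2 * c) * (\<integral>\<^sup>+x. f (t + c * x) \<partial>lborel)"
      using c by (simp add: ennreal_mult mult.assoc)
    moreover have "1 * (\<integral>\<^sup>+x. f (t + c * x) \<partial>lborel) \<le> ennreal (2 * c) * (\<integral>\<^sup>+x. f (t + c * x) \<partial>lborel)"
      using c by (intro mult_right_mono) (auto simp flip: ennreal_1 intro!: ennreal_leI)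
    ultimately show ?thesis by simp
  qed
  have "(\<integral>\<^sup>+p. H (avg_map \<sigma> p) \<partial>MQ) = (\<integral>\<^sup>+p. H (avg_map \<sigma> p) * indicator Q_plus p \<partial>(lborel \<Otimes>\<^sub>M lborel))"
    unfolding lborel_prod by (rule nn_integral_MQ) measurable
  also have "\<dots> = (\<integral>\<^sup>+y. (\<integral>\<^sup>+x. H (avg_map \<sigma> (x, y)) * indicator Q_plus (x, y) \<partial>lborel) \<partial>lborel)"
  proof (rule lborel_pair.nn_integral_snd[symmetric])
    show "(\<lambda>p. H (avg_map \<sigma> p) * indicator Q_plus p) \<in> borel_measurable (lborel \<Otimes>\<^sub>M lborel)"
      unfolding lborel_prod by measurable
  qed
  also have "\<dots> \<le> (\<integral>\<^sup>+y. 2 * G (0 + snd \<sigma> * y) \<partial>lborel)"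
  proof (rule nn_integral_mono)
    fix y
    show "(\<integral>\<^sup>+x. H (avg_map \<sigma> (x, y)) * indicator Q_plus (x, y) \<partial>lborel) \<le> 2 * G (0 + snd \<sigma> * y)"
    proof (cases "0 < y \<and> y < 1")
      case True
      have "(\<lambda>x. (x, snd \<sigma> * y)) \<in> borel \<rightarrow>\<^sub>M borel"
        by (intro borel_measurable_continuous_onI continuous_intros)
      note m = measurable_compose[OF this assms(1)]
      have "(\<integral>\<^sup>+x. H (avg_map \<sigma> (x, y)) * indicator Q_plus (x, y) \<partial>lborel) \<le>
          (\<integral>\<^sup>+x. H (y * fst \<sigma> + (1 - y / 2) * x, snd \<sigma> * y) \<partial>lborel)"
        by (intro nn_integral_mono) (auto simp: indicator_def avg_map_def algebra_simps)
      also have "\<dots> \<le> 2 * (\<integral>\<^sup>+x. H (x, snd \<sigma> * y) \<partial>lborel)"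
        by (rule scale[OF m]) (use True in auto)
      finally show ?thesis by (simp add: G_def)
    next
      case False
      then have "(\<lambda>x. H (avg_map \<sigma> (x, y)) * indicator Q_plus (x, y)) = (\<lambda>x. 0)"
        by (auto simp: indicator_def mem_Q_plus fun_eq_iff)
      then show ?thesis by simp
    qed
  qed
  also have "\<dots> = 2 * (\<integral>\<^sup>+y. G (0 + snd \<sigma> * y) \<partial>lborel)"
    by (rule nn_integral_cmult) measurable
  also have "\<dots> \<le> 2 * (2 * (\<integral>\<^sup>+y. G y \<partial>lborel))"
    by (intro mult_left_mono scale G) (use s[unfolded mem_avg_box] in auto)
  also have "(\<integral>\<^sup>+y. G y \<partial>lborel) = (\<integral>\<^sup>+p. H p \<partial>(lborel \<Otimes>\<^sub>M lborel))"
    unfolding G_def by (rule lborel_pair.nn_integral_snd[OF pr])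
  also have "2 * (2 * (\<integral>\<^sup>+p. H p \<partial>(lborel \<Otimes>\<^sub>M lborel))) = 4 * (\<integral>\<^sup>+p. H p \<partial>lborel)"
    by (simp add: lborel_prod flip: mult.assoc)
  finally show ?thesis .
qed

lemma kernel_bounded:
  fixes k :: "real \<times> real \<Rightarrow> real \<times> real \<Rightarrow> real"
  assumes "continuous_on UNIV (\<lambda>z. k (fst z) (snd z))"
  obtains K where "K \<ge> 0" "\<And>\<sigma> p. \<sigma> \<in> avg_box \<Longrightarrow> p \<in> Q_plus \<Longrightarrow> \<bar>k \<sigma> p\<bar> \<le> K"
proof -
  have "bounded (avg_box \<times> Q_plus)" by (intro bounded_Times) auto
  then obtain K where "K \<ge> 0" "\<And>z. z \<in> avg_box \<times> Q_plus \<Longrightarrow> norm (k (fst z) (snd z)) \<le> K"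
    using continuous_bounded_on_bounded[OF assms] by blast
  then show ?thesis using that[of K] by force
qed

lemma avg_integrand_measurable:
  fixes h :: "real \<times> real \<Rightarrow> 'b::euclidean_space"
  assumes k: "continuous_on UNIV (\<lambda>z. k (fst z) (snd z))" and h: "h \<in> borel_measurable borel"
  shows "(\<lambda>z. k (snd z) (fst z) *\<^sub>R h (avg_map (snd z) (fst z))) \<in> borel_measurable borel"
proof (rule borel_measurable_scaleR)
  have c: "continuous_on UNIV (\<lambda>z :: (real \<times> real) \<times> (real \<times> real). (snd z, fst z))"
    by (intro continuous_intros)
  show "(\<lambda>z. k (snd z) (fst z)) \<in> borel_measurable borel"
    using continuous_on_compose2[OF k c] by (intro borel_measurable_continuous_onI) auto
  have "(\<lambda>z. avg_map (snd z) (fst z)) \<in> borel \<rightarrow>\<^sub>M borel"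
    using continuous_on_compose2[OF continuous_avg_map c] by (intro borel_measurable_continuous_onI) auto
  from measurable_compose[OF this h] show "(\<lambda>z. h (avg_map (snd z) (fst z))) \<in> borel_measurable borel" .
qed

lemma avg_measurable:
  assumes "continuous_on UNIV (\<lambda>z. k (fst z) (snd z))" "h \<in> borel_measurable borel"
  shows "avg k h \<in> borel_measurable borel"
  unfolding avg_def[abs_def]
  using param_integral_measurable[OF avg_integrand_measurable[OF assms] finite_measure_MB] by simp

lemma section_measurable_MB:
  assumes "D \<in> borel_measurable (borel :: ((real \<times> real) \<times> (real \<times> real)) measure)"
  shows "(\<lambda>\<sigma>. D (p, \<sigma>)) \<in> borel_measurable MB"
proof -
  have "(\<lambda>\<sigma>. (p, \<sigma>)) \<in> borel \<rightarrow>\<^sub>M borel"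
    by (intro borel_measurable_continuous_onI continuous_intros)
  from measurable_compose[OF this assms] show ?thesis
    by (intro measurable_restrict_space1) simp
qed

lemma pair_MQ_MB_measurable:
  assumes "f \<in> borel_measurable (borel :: ((real \<times> real) \<times> (real \<times> real)) measure)"
  shows "f \<in> borel_measurable (MQ \<Otimes>\<^sub>M MB)"
proof -
  have "(\<lambda>z. (fst z, snd z)) \<in> MQ \<Otimes>\<^sub>M MB \<rightarrow>\<^sub>M borel \<Otimes>\<^sub>M borel"
  proof (rule measurable_Pair)
    show "fst \<in> MQ \<Otimes>\<^sub>M MB \<rightarrow>\<^sub>M borel"
      by (rule measurable_compose[OF measurable_fst borel_measurable_lebesgue_on]) simp
    show "snd \<in> MQ \<Otimes>\<^sub>M MB \<rightarrow>\<^sub>M borel"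
      by (rule measurable_compose[OF measurable_snd]) (auto intro: measurable_restrict_space1)
  qed
  from measurable_compose[OF this, of f borel] show ?thesis using assms by (simp add: borel_prod)
qed

text \<open>Tonelli puts the p-integral inside, where \<sigma> is fixed and the change of variables
  applies; the outer integral over \<sigma> has total mass 1.\<close>

lemma avg_integrand_nn_bound:
  fixes h :: "real \<times> real \<Rightarrow> 'b::euclidean_space"
  assumes k: "continuous_on UNIV (\<lambda>z. k (fst z) (snd z))" and h [measurable]: "h \<in> borel_measurable borel"
    and K: "\<And>\<sigma> p. \<sigma> \<in> avg_box \<Longrightarrow> p \<in> Q_plus \<Longrightarrow> \<bar>k \<sigma> p\<bar> \<le> K"
  shows "(\<integral>\<^sup>+p. (\<integral>\<^sup>+\<sigma>. ennreal ((norm (k \<sigma> p *\<^sub>R h (avg_map \<sigma> p)))\<^sup>2) \<partial>MB) \<partial>MQ) \<le>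
    ennreal (K\<^sup>2) * (4 * (\<integral>\<^sup>+p. ennreal ((norm (h p))\<^sup>2) \<partial>MQ))"
proof -
  interpret pair_sigma_finite MQ MB
    by (intro pair_sigma_finite.intro finite_measure.axioms(1) finite_measure_MQ finite_measure_MB)
  define H where "H p = ennreal ((norm (h p))\<^sup>2) * indicator Q_plus p" for p
  have H [measurable]: "H \<in> borel_measurable borel" unfolding H_def by measurable
  have c: "continuous_on UNIV (\<lambda>z :: (real \<times> real) \<times> (real \<times> real). (snd z, fst z))"
    by (intro continuous_intros)
  have am: "(\<lambda>z. avg_map (snd z) (fst z)) \<in> borel \<rightarrow>\<^sub>M borel"
    using continuous_on_compose2[OF continuous_avg_map c] by (intro borel_measurable_continuous_onI) auto
  have "(\<integral>\<^sup>+p. (\<integral>\<^sup>+\<sigma>. ennreal ((norm (k \<sigma> p *\<^sub>R h (avg_map \<sigma> p)))\<^sup>2) \<partial>MB) \<partial>MQ) \<le>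
      (\<integral>\<^sup>+p. (\<integral>\<^sup>+\<sigma>. ennreal (K\<^sup>2) * H (avg_map \<sigma> p) \<partial>MB) \<partial>MQ)"
  proof (intro nn_integral_mono)
    fix p \<sigma> assume "p \<in> space MQ" "\<sigma> \<in> space MB"
    then have p: "p \<in> Q_plus" and s: "\<sigma> \<in> avg_box" by simp_all
    have "\<bar>k \<sigma> p\<bar>\<^sup>2 \<le> K\<^sup>2" using K[OF s p] by (intro power_mono) auto
    then have "(norm (k \<sigma> p *\<^sub>R h (avg_map \<sigma> p)))\<^sup>2 \<le> K\<^sup>2 * (norm (h (avg_map \<sigma> p)))\<^sup>2"
      by (simp add: power_mult_distrib mult_right_mono)
    then show "ennreal ((norm (k \<sigma> p *\<^sub>R h (avg_map \<sigma> p)))\<^sup>2) \<le> ennreal (K\<^sup>2) * H (avg_map \<sigma> p)"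
      using avg_map_in_Q_plus[OF p s] by (simp add: H_def ennreal_leI flip: ennreal_mult)
  qed
  also have "\<dots> = (\<integral>\<^sup>+\<sigma>. (\<integral>\<^sup>+p. ennreal (K\<^sup>2) * H (avg_map \<sigma> p) \<partial>MQ) \<partial>MB)"
  proof (rule Fubini'[symmetric])
    show "(\<lambda>(p, \<sigma>). ennreal (K\<^sup>2) * H (avg_map \<sigma> p)) \<in> borel_measurable (MQ \<Otimes>\<^sub>M MB)"
      unfolding split_beta'
      by (intro pair_MQ_MB_measurable borel_measurable_times_ennreal measurable_compose[OF am H]) simp
  qed
  also have "\<dots> \<le> (\<integral>\<^sup>+\<sigma>. ennreal (K\<^sup>2) * (4 * (\<integral>\<^sup>+p. H p \<partial>lborel)) \<partial>MB)"
  proof (rule nn_integral_mono)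
    fix \<sigma> assume "\<sigma> \<in> space MB"
    then have s: "\<sigma> \<in> avg_box" by simp
    have "avg_map \<sigma> \<in> borel \<rightarrow>\<^sub>M borel"
      unfolding avg_map_def by (intro borel_measurable_continuous_onI continuous_intros) auto
    from borel_measurable_lebesgue_on[OF measurable_compose[OF this H]]
    have "(\<integral>\<^sup>+p. ennreal (K\<^sup>2) * H (avg_map \<sigma> p) \<partial>MQ) = ennreal (K\<^sup>2) * (\<integral>\<^sup>+p. H (avg_map \<sigma> p) \<partial>MQ)"
      by (rule nn_integral_cmult)
    also have "\<dots> \<le> ennreal (K\<^sup>2) * (4 * (\<integral>\<^sup>+p. H p \<partial>lborel))"
      by (intro mult_left_mono nn_integral_avg_map_le H s) auto
    finally show "(\<integral>\<^sup>+p. ennreal (K\<^sup>2) * H (avg_map \<sigma> p) \<partial>MQ) \<le> ennreal (K\<^sup>2) * (4 * (\<integral>\<^sup>+p. H p \<partial>lborel))" .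
  qed
  also have "\<dots> = ennreal (K\<^sup>2) * (4 * (\<integral>\<^sup>+p. H p \<partial>lborel))"
    using emeasure_MB by simp
  also have "(\<integral>\<^sup>+p. H p \<partial>lborel) = (\<integral>\<^sup>+p. ennreal ((norm (h p))\<^sup>2) \<partial>MQ)"
    unfolding H_def by (rule nn_integral_MQ[symmetric]) measurable
  finally show ?thesis .
qed

lemma avg_L2_nn_bound:
  fixes h :: "real \<times> real \<Rightarrow> 'b::euclidean_space"
  assumes k: "continuous_on UNIV (\<lambda>z. k (fst z) (snd z))" and h [measurable]: "h \<in> borel_measurable borel"
    and K: "\<And>\<sigma> p. \<sigma> \<in> avg_box \<Longrightarrow> p \<in> Q_plus \<Longrightarrow> \<bar>k \<sigma> p\<bar> \<le> K"
  shows "(\<integral>\<^sup>+p. ennreal ((norm (avg k h p))\<^sup>2) \<partial>MQ) \<le> ennreal (K\<^sup>2) * (4 * (\<integral>\<^sup>+p. ennreal ((norm (h p))\<^sup>2) \<partial>MQ))"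
proof (rule order_trans[OF nn_integral_mono avg_integrand_nn_bound[OF k h K]])
  fix p
  have "(\<lambda>\<sigma>. k \<sigma> p *\<^sub>R h (avg_map \<sigma> p)) \<in> borel_measurable MB"
    using section_measurable_MB[OF avg_integrand_measurable[OF k h], of p] by simp
  then show "ennreal ((norm (avg k h p))\<^sup>2) \<le> (\<integral>\<^sup>+\<sigma>. ennreal ((norm (k \<sigma> p *\<^sub>R h (avg_map \<sigma> p)))\<^sup>2) \<partial>MB)"
    using norm_integral_power2_le[of "\<lambda>_. 1" MB "\<lambda>\<sigma>. k \<sigma> p *\<^sub>R h (avg_map \<sigma> p)"] emeasure_MB
    by (simp add: avg_def)
qed

text \<open>For a merely square integrable h the average may be undefined at some points.
  Integrability for almost every p makes \<open>avg k\<close> additive almost everywhere, as the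
  convergence lemma requires.\<close>

lemma avg_integrand_integrable:
  fixes h :: "real \<times> real \<Rightarrow> 'b::euclidean_space"
  assumes k: "continuous_on UNIV (\<lambda>z. k (fst z) (snd z))" and h: "h \<in> borel_measurable borel" "h \<in> L2_space MQ"
  shows "AE p in MQ. integrable MB (\<lambda>\<sigma>. k \<sigma> p *\<^sub>R h (avg_map \<sigma> p))"
proof -
  obtain K where K: "\<And>\<sigma> p. \<sigma> \<in> avg_box \<Longrightarrow> p \<in> Q_plus \<Longrightarrow> \<bar>k \<sigma> p\<bar> \<le> K"
    by (rule kernel_bounded[OF k]) (rule that; assumption)
  let ?f = "\<lambda>p \<sigma>. k \<sigma> p *\<^sub>R h (avg_map \<sigma> p)"
  note m = avg_integrand_measurable[OF k h(1)]
  have ms: "?f p \<in> borel_measurable MB" for p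
    using section_measurable_MB[OF m, of p] by simp
  interpret finite_measure MB by (rule finite_measure_MB)
  have "(\<integral>\<^sup>+p. (\<integral>\<^sup>+\<sigma>. ennreal ((norm (?f p \<sigma>))\<^sup>2) \<partial>MB) \<partial>MQ) \<le>
      ennreal (K\<^sup>2) * (4 * (\<integral>\<^sup>+p. ennreal ((norm (h p))\<^sup>2) \<partial>MQ))"
    by (rule avg_integrand_nn_bound[OF k h(1) K])
  also have "\<dots> < \<infinity>"
    using L2_spaceD(2)[OF h(2)] by (simp add: nn_integral_eq_integral ennreal_mult_less_top)
  finally have "AE p in MQ. (\<integral>\<^sup>+\<sigma>. ennreal ((norm (?f p \<sigma>))\<^sup>2) \<partial>MB) \<noteq> \<infinity>"
  proof (intro nn_integral_PInf_AE)
    have "(\<lambda>(p, \<sigma>). ennreal ((norm (?f p \<sigma>))\<^sup>2)) \<in> borel_measurable (MQ \<Otimes>\<^sub>M MB)"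
      unfolding split_beta'
      by (rule pair_MQ_MB_measurable, rule measurable_compose[OF m, of "\<lambda>v. ennreal ((norm v)\<^sup>2)"]) measurable
    then show "(\<lambda>p. \<integral>\<^sup>+\<sigma>. ennreal ((norm (?f p \<sigma>))\<^sup>2) \<partial>MB) \<in> borel_measurable MQ"
      by (rule borel_measurable_nn_integral)
  qed auto
  then show ?thesis
  proof eventually_elim
    case (elim p)
    have "(\<lambda>\<sigma>. (norm (?f p \<sigma>))\<^sup>2) \<in> borel_measurable MB"
      by (rule measurable_compose[OF ms[of p], of "\<lambda>v. (norm v)\<^sup>2"]) measurable
    then have "integrable MB (\<lambda>\<sigma>. (norm (?f p \<sigma>))\<^sup>2)"
      using elim by (intro integrableI_nonneg) (simp_all del: norm_scaleR add: top.not_eq_extremum)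
    then have "?f p \<in> L2_space MB"
      using ms[of p] unfolding L2_space_def by blast
    then show ?case by (rule L2_space_integrable[OF finite_measure_MB])
  qed
qed

lemma avg_L2:
  fixes h :: "real \<times> real \<Rightarrow> 'b::euclidean_space"
  assumes k: "continuous_on UNIV (\<lambda>z. k (fst z) (snd z))" and h: "h \<in> borel_measurable borel" "h \<in> L2_space MQ"
    and K: "\<And>\<sigma> p. \<sigma> \<in> avg_box \<Longrightarrow> p \<in> Q_plus \<Longrightarrow> \<bar>k \<sigma> p\<bar> \<le> K"
  shows "avg k h \<in> L2_space MQ"
    "(\<integral>p. (norm (avg k h p))\<^sup>2 \<partial>MQ) \<le> 4 * K\<^sup>2 * (\<integral>p. (norm (h p))\<^sup>2 \<partial>MQ)"
proof -
  have m: "avg k h \<in> borel_measurable MQ"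
    by (intro borel_measurable_lebesgue_on avg_measurable k h)
  have "(\<integral>\<^sup>+p. ennreal ((norm (avg k h p))\<^sup>2) \<partial>MQ) \<le> ennreal (K\<^sup>2) * (4 * (\<integral>\<^sup>+p. ennreal ((norm (h p))\<^sup>2) \<partial>MQ))"
    by (rule avg_L2_nn_bound[OF k h(1) K])
  also have "\<dots> = ennreal (K\<^sup>2) * (4 * ennreal (\<integral>p. (norm (h p))\<^sup>2 \<partial>MQ))"
    using L2_spaceD(2)[OF h(2)] by (simp add: nn_integral_eq_integral)
  also have "\<dots> = ennreal (4 * K\<^sup>2 * (\<integral>p. (norm (h p))\<^sup>2 \<partial>MQ))"
    by (simp add: ennreal_mult mult_ac)
  finally have le: "(\<integral>\<^sup>+p. ennreal ((norm (avg k h p))\<^sup>2) \<partial>MQ) \<le> ennreal (4 * K\<^sup>2 * (\<integral>p. (norm (h p))\<^sup>2 \<partial>MQ))" .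
  also have "\<dots> < \<infinity>" by simp
  finally have i: "integrable MQ (\<lambda>p. (norm (avg k h p))\<^sup>2)"
    using m by (intro integrableI_nonneg) auto
  then show "avg k h \<in> L2_space MQ" using m by (simp add: L2_space_def)
  show "(\<integral>p. (norm (avg k h p))\<^sup>2 \<partial>MQ) \<le> 4 * K\<^sup>2 * (\<integral>p. (norm (h p))\<^sup>2 \<partial>MQ)"
    using le i by (simp add: nn_integral_eq_integral ennreal_le_iff)
qed

lemma avg_L2_tendsto:
  fixes h :: "real \<times> real \<Rightarrow> 'b::euclidean_space"
  assumes k: "continuous_on UNIV (\<lambda>z. k (fst z) (snd z))" and h: "h \<in> borel_measurable borel"
    and X: "\<And>n. X n \<in> borel_measurable borel" "L2_tendsto MQ X h"
  shows "L2_tendsto MQ (\<lambda>n. avg k (X n)) (avg k h)"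
proof -
  obtain K where K: "\<And>\<sigma> p. \<sigma> \<in> avg_box \<Longrightarrow> p \<in> Q_plus \<Longrightarrow> \<bar>k \<sigma> p\<bar> \<le> K"
    by (rule kernel_bounded[OF k]) (rule that; assumption)
  note L2 = L2_tendstoD(1,2)[OF X(2)]
  show ?thesis
  proof (rule L2_tendsto_dominated[OF X(2)])
    show "avg k (X n) \<in> L2_space MQ" "avg k h \<in> L2_space MQ" for n
      by (intro avg_L2(1)[OF k _ _ K] h X L2; assumption)+
    fix n
    have m: "(\<lambda>p. X n p - h p) \<in> borel_measurable borel" using X(1)[of n] h by measurable
    have "AE p in MQ. avg k (X n) p - avg k h p = avg k (\<lambda>p. X n p - h p) p"
      using avg_integrand_integrable[OF k X(1) L2(1), of n] avg_integrand_integrable[OF k h L2(2)]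
      by eventually_elim (simp add: avg_def scaleR_diff_right)
    then have "(\<integral>p. (norm (avg k (X n) p - avg k h p))\<^sup>2 \<partial>MQ) = (\<integral>p. (norm (avg k (\<lambda>p. X n p - h p) p))\<^sup>2 \<partial>MQ)"
      using avg_measurable[OF k X(1), of n] avg_measurable[OF k h] avg_measurable[OF k m]
      by (intro integral_cong_AE borel_measurable_lebesgue_on) (measurable, auto elim: eventually_mono)
    also have "\<dots> \<le> 4 * K\<^sup>2 * (\<integral>p. (norm (X n p - h p))\<^sup>2 \<partial>MQ)"
      by (rule avg_L2(2)[OF k m L2_space_diff[OF L2] K])
    finally show "(\<integral>p. (norm (avg k (X n) p - avg k h p))\<^sup>2 \<partial>MQ) \<le> 4 * K\<^sup>2 * (\<integral>p. (norm (X n p - h p))\<^sup>2 \<partial>MQ)" .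
  qed
qed

section \<open>Derivatives and traces of averages\<close>

lemma C1_along_param_integral:
  fixes G G' :: "'a::euclidean_space \<Rightarrow> 'c::euclidean_space \<Rightarrow> 'b::euclidean_space"
  assumes G: "continuous_on UNIV (\<lambda>z. G (fst z) (snd z))" and G': "continuous_on UNIV (\<lambda>z. G' (fst z) (snd z))"
    and d: "\<And>\<sigma>. C1_along v (\<lambda>p. G p \<sigma>) (\<lambda>p. G' p \<sigma>)"
  shows "C1_along v (\<lambda>p. integral (cbox a b) (G p)) (\<lambda>p. integral (cbox a b) (G' p))"
  unfolding C1_along_def
proof (intro conjI allI)
  show "continuous_on UNIV (\<lambda>p. integral (cbox a b) (G p))"
    by (rule integral_continuous_on_param) (use G in \<open>auto simp: split_beta' intro: continuous_on_subset\<close>)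
  show "continuous_on UNIV (\<lambda>p. integral (cbox a b) (G' p))"
    by (rule integral_continuous_on_param) (use G' in \<open>auto simp: split_beta' intro: continuous_on_subset\<close>)
  fix p and t :: real
  have "((\<lambda>s. integral (cbox a b) (G (p + s *\<^sub>R v))) has_vector_derivative integral (cbox a b) (G' (p + t *\<^sub>R v))) (at t within UNIV)"
  proof (rule leibniz_rule_vector_derivative)
    show "((\<lambda>s. G (p + s *\<^sub>R v) \<sigma>) has_vector_derivative G' (p + s *\<^sub>R v) \<sigma>) (at s within UNIV)" for s \<sigma>
      using C1_alongD(3)[OF d] by simp
    show "G (p + s *\<^sub>R v) integrable_on cbox a b" for s
      by (intro integrable_continuous continuous_on_compose2[OF G, of _ "\<lambda>\<sigma>. (p + s *\<^sub>R v, \<sigma>)", simplified])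
         (auto intro!: continuous_intros)
    show "continuous_on (UNIV \<times> cbox a b) (\<lambda>(s, \<sigma>). G' (p + s *\<^sub>R v) \<sigma>)"
      unfolding split_beta'
      by (rule continuous_on_compose2[OF G', of _ "\<lambda>z. (p + fst z *\<^sub>R v, snd z)", simplified])
         (auto intro!: continuous_intros)
  qed auto
  then show "((\<lambda>s. integral (cbox a b) (G (p + s *\<^sub>R v))) has_vector_derivative integral (cbox a b) (G' (p + t *\<^sub>R v))) (at t)"
    by simp
qed

lemma continuous_on_Pair_left: "continuous_on UNIV F \<Longrightarrow> continuous_on S (\<lambda>y. F (x, y))"
  by (rule continuous_on_compose2[of UNIV F]) (auto intro!: continuous_intros)

lemma continuous_on_Pair_right: "continuous_on UNIV F \<Longrightarrow> continuous_on S (\<lambda>x. F (x, y))"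
  by (rule continuous_on_compose2[of UNIV F]) (auto intro!: continuous_intros)

lemma continuous_kernel_section:
  assumes "continuous_on UNIV (\<lambda>z. k (fst z) (snd z))"
  shows "continuous_on UNIV (\<lambda>\<sigma>. k \<sigma> p)" "continuous_on UNIV (k \<sigma>)"
  using continuous_on_Pair_left[OF assms, of UNIV] continuous_on_Pair_right[OF assms, of UNIV] by simp_all

lemma continuous_avg_integrand:
  fixes U :: "real \<times> real \<Rightarrow> 'b::euclidean_space"
  assumes k: "continuous_on UNIV (\<lambda>z. k (fst z) (snd z))" and U: "continuous_on UNIV U"
  shows "continuous_on UNIV (\<lambda>z. k (snd z) (fst z) *\<^sub>R U (avg_map (snd z) (fst z)))"
proof -
  have c: "continuous_on UNIV (\<lambda>z :: (real \<times> real) \<times> (real \<times> real). (snd z, fst z))"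
    by (intro continuous_intros)
  have "continuous_on UNIV (\<lambda>z. k (snd z) (fst z))" "continuous_on UNIV (\<lambda>z. avg_map (snd z) (fst z))"
    using continuous_on_compose2[OF k c] continuous_on_compose2[OF continuous_avg_map c] by simp_all
  then show ?thesis
    by (intro continuous_on_scaleR continuous_on_compose2[OF U _ subset_UNIV])
qed

lemma avg_eq_integral:
  fixes U :: "real \<times> real \<Rightarrow> 'b::euclidean_space"
  assumes k: "continuous_on UNIV (\<lambda>z. k (fst z) (snd z))" and U: "continuous_on UNIV U"
  shows "avg k U p = integral avg_box (\<lambda>\<sigma>. k \<sigma> p *\<^sub>R U (avg_map \<sigma> p))"
proof -
  have c: "continuous_on UNIV (\<lambda>\<sigma>. k \<sigma> p *\<^sub>R U (avg_map \<sigma> p))"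
    using continuous_on_Pair_left[OF continuous_avg_integrand[OF k U]] by simp
  have "set_integrable lborel avg_box (\<lambda>\<sigma>. k \<sigma> p *\<^sub>R U (avg_map \<sigma> p))"
    unfolding set_integrable_def by (intro borel_integrable_compact continuous_on_subset[OF c]) auto
  from set_borel_integral_eq_integral(2)[OF this] show ?thesis
    by (simp add: avg_def integral_restrict_space set_lebesgue_integral_def)
qed

lemma smooth_has_derivative:
  assumes "smooth U" shows "(U has_derivative frechet_derivative U (at q)) (at q)"
proof -
  have "C_k (Suc 0) U" using assms by (simp add: smooth_def)
  from C_k_SucD(1)[OF this] show ?thesis .
qed

lemma frechet_derivative_pair:
  fixes U :: "real \<times> real \<Rightarrow> 'b::euclidean_space"
  assumes "smooth U"
  shows "frechet_derivative U (at q) (a, b) = a *\<^sub>R frechet_derivative U (at q) (1, 0) + b *\<^sub>R frechet_derivative U (at q) (0, 1)"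
proof -
  note l = has_derivative_linear[OF smooth_has_derivative[OF assms, of q]]
  have "(a, b) = a *\<^sub>R (1, 0) + b *\<^sub>R (0, 1 :: real)" by simp
  then show ?thesis using linear_add[OF l] linear_scale[OF l] by metis
qed

lemma continuous_frechet_derivative:
  assumes "smooth U" shows "continuous_on UNIV (\<lambda>q. frechet_derivative U (at q) v)"
  using C1_alongD(2)[OF C1_along_smooth[OF assms]] .

text \<open>The point is the contrast between the two pairs: derivatives in \<sigma> carry the
  factor \<open>snd p\<close>, derivatives in p do not. Thus y times a derivative of U at the
  sampled point is a derivative in \<sigma>.\<close>

lemma C1_along_compose_avg_map:
  fixes U :: "real \<times> real \<Rightarrow> 'b::euclidean_space"
  assumes U: "smooth U"
  defines "Ux \<equiv> \<lambda>q. frechet_derivative U (at q) (1, 0)" and "Uy \<equiv> \<lambda>q. frechet_derivative U (at q) (0, 1)"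
  shows "C1_along (1, 0) (\<lambda>p. U (avg_map \<sigma> p)) (\<lambda>p. (1 - snd p / 2) *\<^sub>R Ux (avg_map \<sigma> p))"
    "C1_along (0, 1) (\<lambda>p. U (avg_map \<sigma> p))
      (\<lambda>p. (fst \<sigma> - fst p / 2) *\<^sub>R Ux (avg_map \<sigma> p) + snd \<sigma> *\<^sub>R Uy (avg_map \<sigma> p))"
    "C1_along (1, 0) (\<lambda>\<sigma>. U (avg_map \<sigma> p)) (\<lambda>\<sigma>. snd p *\<^sub>R Ux (avg_map \<sigma> p))"
    "C1_along (0, 1) (\<lambda>\<sigma>. U (avg_map \<sigma> p)) (\<lambda>\<sigma>. snd p *\<^sub>R Uy (avg_map \<sigma> p))"
proof -
  note D = smooth_has_derivative[OF U]
  have c: "continuous_on UNIV Ux" "continuous_on UNIV Uy"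
    unfolding Ux_def Uy_def by (intro continuous_frechet_derivative U)+
  have ap: "continuous_on UNIV (avg_map \<sigma>)" "continuous_on UNIV (\<lambda>\<sigma>. avg_map \<sigma> p)"
    unfolding avg_map_def by (intro continuous_intros; simp)+
  note cc = continuous_on_compose2[OF c(1) ap(1) subset_UNIV] continuous_on_compose2[OF c(2) ap(1) subset_UNIV]
    continuous_on_compose2[OF c(1) ap(2) subset_UNIV] continuous_on_compose2[OF c(2) ap(2) subset_UNIV]
  have dp: "((\<lambda>p. U (avg_map \<sigma> p)) has_derivative (\<lambda>h. frechet_derivative U (at (avg_map \<sigma> p))
      (fst h * (1 - snd p / 2) - fst p * snd h / 2 + snd h * fst \<sigma>, snd h * snd \<sigma>))) (at p)" for p
    by (rule has_derivative_compose[OF _ D])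
       (auto simp: avg_map_def fun_eq_iff algebra_simps intro!: derivative_eq_intros)
  have ds: "((\<lambda>\<sigma>. U (avg_map \<sigma> p)) has_derivative (\<lambda>h. frechet_derivative U (at (avg_map \<sigma> p))
      (snd p * fst h, snd p * snd h))) (at \<sigma>)" for \<sigma>
    by (rule has_derivative_compose[OF _ D])
       (auto simp: avg_map_def fun_eq_iff algebra_simps intro!: derivative_eq_intros)
  have e: "frechet_derivative U (at q) (a, b) = a *\<^sub>R Ux q + b *\<^sub>R Uy q" for q a b
    unfolding Ux_def Uy_def by (rule frechet_derivative_pair[OF U])
  have C1I: "C1_along v F G" if "\<And>p. (F has_derivative F' p) (at p)" "\<And>p. F' p v = G p" "continuous_on UNIV G"
    for v :: "real \<times> real" and F F' and G :: "real \<times> real \<Rightarrow> 'b"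
    using C1_along_has_derivative[of F F' v] that by simp
  show "C1_along (1, 0) (\<lambda>p. U (avg_map \<sigma> p)) (\<lambda>p. (1 - snd p / 2) *\<^sub>R Ux (avg_map \<sigma> p))"
    by (rule C1I[OF dp]) (auto simp: e intro!: continuous_intros cc)
  show "C1_along (0, 1) (\<lambda>p. U (avg_map \<sigma> p))
      (\<lambda>p. (fst \<sigma> - fst p / 2) *\<^sub>R Ux (avg_map \<sigma> p) + snd \<sigma> *\<^sub>R Uy (avg_map \<sigma> p))"
    by (rule C1I[OF dp]) (auto simp: e intro!: continuous_intros cc)
  show "C1_along (1, 0) (\<lambda>\<sigma>. U (avg_map \<sigma> p)) (\<lambda>\<sigma>. snd p *\<^sub>R Ux (avg_map \<sigma> p))"
    by (rule C1I[OF ds]) (auto simp: e intro!: continuous_intros cc)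
  show "C1_along (0, 1) (\<lambda>\<sigma>. U (avg_map \<sigma> p)) (\<lambda>\<sigma>. snd p *\<^sub>R Uy (avg_map \<sigma> p))"
    by (rule C1I[OF ds]) (auto simp: e intro!: continuous_intros cc)
qed

lemma avg_add_integral:
  fixes U V :: "real \<times> real \<Rightarrow> 'b::euclidean_space"
  assumes k: "continuous_on UNIV (\<lambda>z. k (fst z) (snd z))" and U: "continuous_on UNIV U"
    and l: "continuous_on UNIV (\<lambda>z. l (fst z) (snd z))" and V: "continuous_on UNIV V"
  shows "avg k U p + avg l V p = integral avg_box (\<lambda>\<sigma>. k \<sigma> p *\<^sub>R U (avg_map \<sigma> p) + l \<sigma> p *\<^sub>R V (avg_map \<sigma> p))"
proof -
  have "(\<lambda>\<sigma>. k \<sigma> p *\<^sub>R U (avg_map \<sigma> p)) integrable_on avg_box" "(\<lambda>\<sigma>. l \<sigma> p *\<^sub>R V (avg_map \<sigma> p)) integrable_on avg_box"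
    using integrable_continuous[OF continuous_on_Pair_left[OF continuous_avg_integrand[OF k U]]]
      integrable_continuous[OF continuous_on_Pair_left[OF continuous_avg_integrand[OF l V]]] by simp_all
  then show ?thesis by (simp add: avg_eq_integral[OF k U] avg_eq_integral[OF l V] integral_add)
qed

text \<open>Kernels depend on p as well, because differentiating \<open>avg_map\<close> produces
  coefficients such as \<open>1 - snd p / 2\<close>. Explicit derivatives allow differentiating an
  average of an average kernel again.\<close>

definition C1_kernel :: "(real \<times> real \<Rightarrow> real \<times> real \<Rightarrow> real) \<Rightarrow> (real \<times> real \<Rightarrow> real \<times> real \<Rightarrow> real) \<Rightarrow>
    (real \<times> real \<Rightarrow> real \<times> real \<Rightarrow> real) \<Rightarrow> bool" where
  "C1_kernel k kx ky \<longleftrightarrow> continuous_on UNIV (\<lambda>z. k (fst z) (snd z)) \<and>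
     continuous_on UNIV (\<lambda>z. kx (fst z) (snd z)) \<and> continuous_on UNIV (\<lambda>z. ky (fst z) (snd z)) \<and>
     (\<forall>\<sigma>. C1_along (1, 0) (k \<sigma>) (kx \<sigma>) \<and> C1_along (0, 1) (k \<sigma>) (ky \<sigma>))"

lemma C1_kernelD:
  assumes "C1_kernel k kx ky"
  shows "continuous_on UNIV (\<lambda>z. k (fst z) (snd z))" "continuous_on UNIV (\<lambda>z. kx (fst z) (snd z))"
    "continuous_on UNIV (\<lambda>z. ky (fst z) (snd z))" "C1_along (1, 0) (k \<sigma>) (kx \<sigma>)" "C1_along (0, 1) (k \<sigma>) (ky \<sigma>)"
  using assms unfolding C1_kernel_def by blast+

lemma C1_kernel_mult_continuous:
  assumes "C1_kernel k kx ky"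
  shows "continuous_on UNIV (\<lambda>z. k (fst z) (snd z) * (1 - snd (snd z) / 2))"
    "continuous_on UNIV (\<lambda>z. k (fst z) (snd z) * (fst (fst z) - fst (snd z) / 2))"
    "continuous_on UNIV (\<lambda>z. k (fst z) (snd z) * snd (fst z))"
  by (intro continuous_intros C1_kernelD(1)[OF assms]; simp)+

text \<open>Here the derivatives fall on U and on the kernel. This form yields the second
  derivatives of the extension; for the first ones it is transformed further in
  \<open>C1_along_ext\<close>.\<close>

lemma C1_along_avg:
  fixes U :: "real \<times> real \<Rightarrow> 'b::euclidean_space"
  assumes k: "C1_kernel k kx ky" and U: "smooth U"
  defines "Ux \<equiv> \<lambda>q. frechet_derivative U (at q) (1, 0)" and "Uy \<equiv> \<lambda>q. frechet_derivative U (at q) (0, 1)"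
  shows "C1_along (1, 0) (avg k U) (\<lambda>p. avg (\<lambda>\<sigma> p. k \<sigma> p * (1 - snd p / 2)) Ux p + avg kx U p)"
    "C1_along (0, 1) (avg k U)
      (\<lambda>p. (avg (\<lambda>\<sigma> p. k \<sigma> p * (fst \<sigma> - fst p / 2)) Ux p + avg (\<lambda>\<sigma> p. k \<sigma> p * snd \<sigma>) Uy p) + avg ky U p)"
proof -
  note kc = C1_kernelD[OF k] and km = C1_kernel_mult_continuous[OF k]
  have Uc: "continuous_on UNIV U" by (rule C1_alongD(1)[OF C1_along_smooth[OF U]])
  have cD: "continuous_on UNIV Ux" "continuous_on UNIV Uy"
    unfolding Ux_def Uy_def by (intro continuous_frechet_derivative U)+
  note ci = continuous_avg_integrand[OF kc(1) Uc] continuous_avg_integrand[OF kc(2) Uc] continuous_avg_integrand[OF kc(3) Uc]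
    continuous_avg_integrand[OF km(1) cD(1)] continuous_avg_integrand[OF km(2) cD(1)] continuous_avg_integrand[OF km(3) cD(2)]
  let ?G = "\<lambda>p \<sigma>. k \<sigma> p *\<^sub>R U (avg_map \<sigma> p)"
  have e0: "avg k U = (\<lambda>p. integral avg_box (?G p))"
    using avg_eq_integral[OF kc(1) Uc] by (simp add: fun_eq_iff)
  let ?Gx = "\<lambda>p \<sigma>. k \<sigma> p *\<^sub>R ((1 - snd p / 2) *\<^sub>R Ux (avg_map \<sigma> p)) + kx \<sigma> p *\<^sub>R U (avg_map \<sigma> p)"
  have "C1_along (1, 0) (avg k U) (\<lambda>p. integral avg_box (?Gx p))"
    unfolding e0
  proof (rule C1_along_param_integral)
    show "continuous_on UNIV (\<lambda>z. ?G (fst z) (snd z))" by (rule ci(1))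
    show "continuous_on UNIV (\<lambda>z. ?Gx (fst z) (snd z))"
      using continuous_on_add[OF ci(4) ci(2)] by simp
    show "C1_along (1, 0) (\<lambda>p. ?G p \<sigma>) (\<lambda>p. ?Gx p \<sigma>)" for \<sigma>
      using C1_along_prod[OF bounded_bilinear_scaleR kc(4) C1_along_compose_avg_map(1)[OF U]] by (simp add: Ux_def)
  qed
  then show "C1_along (1, 0) (avg k U) (\<lambda>p. avg (\<lambda>\<sigma> p. k \<sigma> p * (1 - snd p / 2)) Ux p + avg kx U p)"
    unfolding avg_add_integral[OF km(1) cD(1) kc(2) Uc] by simp
  let ?Gy = "\<lambda>p \<sigma>. k \<sigma> p *\<^sub>R ((fst \<sigma> - fst p / 2) *\<^sub>R Ux (avg_map \<sigma> p) + snd \<sigma> *\<^sub>R Uy (avg_map \<sigma> p)) + ky \<sigma> p *\<^sub>R U (avg_map \<sigma> p)"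
  have "C1_along (0, 1) (avg k U) (\<lambda>p. integral avg_box (?Gy p))"
    unfolding e0
  proof (rule C1_along_param_integral)
    show "continuous_on UNIV (\<lambda>z. ?G (fst z) (snd z))" by (rule ci(1))
    show "continuous_on UNIV (\<lambda>z. ?Gy (fst z) (snd z))"
      using continuous_on_add[OF continuous_on_add[OF ci(5) ci(6)] ci(3)] by (simp add: scaleR_add_right)
    show "C1_along (0, 1) (\<lambda>p. ?G p \<sigma>) (\<lambda>p. ?Gy p \<sigma>)" for \<sigma>
      using C1_along_prod[OF bounded_bilinear_scaleR kc(5) C1_along_compose_avg_map(2)[OF U]] by (simp add: Ux_def Uy_def)
  qed
  moreover have "integral avg_box (?Gy p) =
      (avg (\<lambda>\<sigma> p. k \<sigma> p * (fst \<sigma> - fst p / 2)) Ux p + avg (\<lambda>\<sigma> p. k \<sigma> p * snd \<sigma>) Uy p) + avg ky U p" for p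
  proof -
    have io: "(\<lambda>\<sigma>. F (p, \<sigma>)) integrable_on avg_box" if "continuous_on UNIV F" for F :: "(real \<times> real) \<times> (real \<times> real) \<Rightarrow> 'b"
      by (intro integrable_continuous continuous_on_Pair_left that)
    show ?thesis
      unfolding avg_eq_integral[OF kc(3) Uc] avg_add_integral[OF km(2) cD(1) km(3) cD(2)]
      using integral_add[OF io[OF continuous_on_add[OF ci(5) ci(6)]] io[OF ci(3)]] by (simp add: scaleR_add_right)
  qed
  ultimately show "C1_along (0, 1) (avg k U)
      (\<lambda>p. (avg (\<lambda>\<sigma> p. k \<sigma> p * (fst \<sigma> - fst p / 2)) Ux p + avg (\<lambda>\<sigma> p. k \<sigma> p * snd \<sigma>) Uy p) + avg ky U p)"
    by simp
qed

text \<open>\<open>avg_bounded\<close> estimates the average at each p separately and therefore asks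
  for the bound at every point.\<close>

lemma L2_bounded_representative:
  fixes h :: "real \<times> real \<Rightarrow> 'b::euclidean_space"
  assumes h: "h \<in> borel_measurable MQ" "AE p in MQ. norm (h p) \<le> C" and C: "C \<ge> 0"
  obtains h' where "h' \<in> borel_measurable borel" "AE p in MQ. h p = h' p" "\<And>p. norm (h' p) \<le> C"
proof -
  obtain w where w: "w \<in> borel_measurable borel" "AE p in MQ. h p = w p"
    using borel_representative[OF h(1) Q_plus_lebesgue] by blast
  note [measurable] = w(1)
  let ?h = "\<lambda>p. if norm (w p) \<le> C then w p else 0"
  have "?h \<in> borel_measurable borel" by measurable
  moreover have "AE p in MQ. h p = ?h p" using w(2) h(2) by eventually_elim auto
  moreover have "norm (?h p) \<le> C" for p using C by auto
  ultimately show ?thesis using that by blast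
qed

text \<open>All claims hold for smooth U and survive the L2 limit, by the mean square bounds. For
  the trace, both sequences of boundary values have the same terms, so their limits agree.\<close>

lemma W12_avg:
  fixes h :: "real \<times> real \<Rightarrow> 'b::euclidean_space"
  assumes k: "C1_kernel k kx ky" and h: "W12 h hx hy"
    and b: "h \<in> borel_measurable borel" "hx \<in> borel_measurable borel" "hy \<in> borel_measurable borel"
  shows "W12 (avg k h) (\<lambda>p. avg (\<lambda>\<sigma> p. k \<sigma> p * (1 - snd p / 2)) hx p + avg kx h p)
    (\<lambda>p. (avg (\<lambda>\<sigma> p. k \<sigma> p * (fst \<sigma> - fst p / 2)) hx p + avg (\<lambda>\<sigma> p. k \<sigma> p * snd \<sigma>) hy p) + avg ky h p)"
    "has_trace h g \<Longrightarrow> has_trace (avg k h) (\<lambda>x. integral avg_box (\<lambda>\<sigma>. k \<sigma> (x, 0)) *\<^sub>R g x)"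
proof -
  note kc = C1_kernelD[OF k] and km = C1_kernel_mult_continuous[OF k]
  obtain U where U: "\<And>n. smooth (U n)" "L2_tendsto MQ U h"
    "L2_tendsto MQ (\<lambda>n p. frechet_derivative (U n) (at p) (1, 0)) hx"
    "L2_tendsto MQ (\<lambda>n p. frechet_derivative (U n) (at p) (0, 1)) hy"
    by (rule W12_approx[OF h]) (rule that; assumption)
  have Um: "U n \<in> borel_measurable borel" "(\<lambda>p. frechet_derivative (U n) (at p) v) \<in> borel_measurable borel" for n v
    by (rule borel_measurable_continuous_onI, rule C1_alongD(1)[OF C1_along_smooth[OF U(1)]])
      (rule borel_measurable_continuous_onI, rule continuous_frechet_derivative[OF U(1)])
  let ?ax = "\<lambda>hx h p. avg (\<lambda>\<sigma> p. k \<sigma> p * (1 - snd p / 2)) hx p + avg kx h p"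
  let ?ay = "\<lambda>hx hy h p. (avg (\<lambda>\<sigma> p. k \<sigma> p * (fst \<sigma> - fst p / 2)) hx p + avg (\<lambda>\<sigma> p. k \<sigma> p * snd \<sigma>) hy p) + avg ky h p"
  let ?Ux = "\<lambda>n p. frechet_derivative (U n) (at p) (1, 0)" and ?Uy = "\<lambda>n p. frechet_derivative (U n) (at p) (0, 1)"
  have t0: "L2_tendsto MQ (\<lambda>n. avg k (U n)) (avg k h)"
    by (rule avg_L2_tendsto[OF kc(1) b(1) Um(1) U(2)])
  have tx: "L2_tendsto MQ (\<lambda>n. ?ax (?Ux n) (U n)) (?ax hx h)"
    by (rule L2_tendsto_add[OF avg_L2_tendsto[OF km(1) b(2) Um(2) U(3)] avg_L2_tendsto[OF kc(2) b(1) Um(1) U(2)]])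
  have ty: "L2_tendsto MQ (\<lambda>n. ?ay (?Ux n) (?Uy n) (U n)) (?ay hx hy h)"
    by (rule L2_tendsto_add[OF L2_tendsto_add[OF avg_L2_tendsto[OF km(2) b(2) Um(2) U(3)]
          avg_L2_tendsto[OF km(3) b(3) Um(2) U(4)]] avg_L2_tendsto[OF kc(3) b(1) Um(1) U(2)]])
  note C1 = C1_along_avg[OF k U(1)]
  show W: "W12 (avg k h) (?ax hx h) (?ay hx hy h)"
    unfolding W12_def
  proof (intro conjI L2_tendstoD(2)[OF t0] L2_tendstoD(2)[OF tx] L2_tendstoD(2)[OF ty])
    show "has_weak_deriv Q_plus (1, 0) (avg k h) (?ax hx h)"
      by (rule has_weak_deriv_L1_limit[OF C1_along_has_weak_deriv[OF C1(1)]
          L2_tendsto_imp_L1[OF t0 finite_measure_MQ] L2_tendsto_imp_L1[OF tx finite_measure_MQ]])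
         (simp add: Basis_real_prod)
    show "has_weak_deriv Q_plus (0, 1) (avg k h) (?ay hx hy h)"
      by (rule has_weak_deriv_L1_limit[OF C1_along_has_weak_deriv[OF C1(2)]
          L2_tendsto_imp_L1[OF t0 finite_measure_MQ] L2_tendsto_imp_L1[OF ty finite_measure_MQ]])
         (simp add: Basis_real_prod)
  qed
  assume g: "has_trace h g"
  let ?\<kappa> = "\<lambda>x. integral avg_box (\<lambda>\<sigma>. k \<sigma> (x, 0))"
  have \<kappa>c: "continuous_on UNIV ?\<kappa>"
  proof (rule integral_continuous_on_param)
    show "continuous_on (UNIV \<times> avg_box) (\<lambda>(x, \<sigma>). k \<sigma> (x, 0))"
      unfolding split_beta'
      by (rule continuous_on_compose2[OF kc(1), of _ "\<lambda>z. (snd z, (fst z, 0))", simplified]) (auto intro!: continuous_intros)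
  qed
  obtain B where B: "\<And>x. x \<in> {- pi<..<pi} \<Longrightarrow> norm (?\<kappa> x) \<le> B"
    using continuous_bounded_on_bounded[OF \<kappa>c, of "{- pi<..<pi}"] by auto
  have \<kappa>b: "AE x in I_measure. \<bar>?\<kappa> x\<bar> \<le> B"
    unfolding I_measure_def using B by (intro AE_I2) auto
  have \<kappa>m: "?\<kappa> \<in> borel_measurable I_measure"
    unfolding I_measure_def by (intro borel_measurable_lebesgue_on borel_measurable_continuous_onI \<kappa>c)
  have tg: "L2_tendsto I_measure (\<lambda>n x. U n (x, 0)) g"
    by (rule has_trace_limit[OF g h C1_along_smooth[OF U(1)] U(2) U(4)])
  obtain G where G: "has_trace (avg k h) G" using has_trace_exists[OF W] .
  have tG: "L2_tendsto I_measure (\<lambda>n x. avg k (U n) (x, 0)) G"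
    by (rule has_trace_limit[OF G W C1(2) t0 ty])
  \<comment> \<open>At height 0 every sample point \<open>avg_map \<sigma> (x, 0)\<close> equals (x,
    0), so only the integral of the kernel remains.\<close>
  have "avg k (U n) (x, 0) = ?\<kappa> x *\<^sub>R U n (x, 0)" for n x
  proof -
    have Uc: "continuous_on UNIV (U n)" by (rule C1_alongD(1)[OF C1_along_smooth[OF U(1)]])
    have "(\<lambda>\<sigma>. k \<sigma> (x, 0)) integrable_on avg_box"
      by (intro integrable_continuous continuous_on_subset[OF continuous_kernel_section(1)[OF kc(1)]]) auto
    then show ?thesis
      unfolding avg_eq_integral[OF kc(1) Uc] by (simp add: avg_map_def integral_linear[where h="\<lambda>r. r *\<^sub>R U n (x, 0)", unfolded o_def] bounded_linear_scaleR_left)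
  qed
  then have tG': "L2_tendsto I_measure (\<lambda>n x. avg k (U n) (x, 0)) (\<lambda>x. ?\<kappa> x *\<^sub>R g x)"
    using L2_tendsto_bounded_mult[OF tg \<kappa>m \<kappa>b] by simp
  have "AE x in I_measure. G x = ?\<kappa> x *\<^sub>R g x"
    by (rule L1_tendsto_unique[OF L2_tendsto_imp_L1[OF tG finite_measure_I] L2_tendsto_imp_L1[OF tG' finite_measure_I]])
  then show "has_trace (avg k h) (\<lambda>x. ?\<kappa> x *\<^sub>R g x)"
    using has_trace_AE_cong_trace[OF G _ L2_tendstoD(2)[OF tG']] by blast
qed

lemma avg_bounded:
  fixes h :: "real \<times> real \<Rightarrow> 'b::euclidean_space"
  assumes k: "continuous_on UNIV (\<lambda>z. k (fst z) (snd z))" and h: "h \<in> borel_measurable borel" "\<And>p. norm (h p) \<le> C"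
  obtains K where "AE p in MQ. norm (avg k h p) \<le> K"
proof -
  obtain K where K: "K \<ge> 0" "\<And>\<sigma> p. \<sigma> \<in> avg_box \<Longrightarrow> p \<in> Q_plus \<Longrightarrow> \<bar>k \<sigma> p\<bar> \<le> K"
    by (rule kernel_bounded[OF k]) (rule that; assumption)
  have "norm (avg k h p) \<le> K * C" if p: "p \<in> Q_plus" for p
  proof -
    have b: "norm (k \<sigma> p *\<^sub>R h (avg_map \<sigma> p)) \<le> K * C" if "\<sigma> \<in> avg_box" for \<sigma>
      unfolding norm_scaleR real_norm_def using K(2)[OF that p] h(2) K(1) by (intro mult_mono) auto
    have m: "(\<lambda>\<sigma>. k \<sigma> p *\<^sub>R h (avg_map \<sigma> p)) \<in> borel_measurable MB"
      using section_measurable_MB[OF avg_integrand_measurable[OF k h(1)], of p] by simp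
    have i: "integrable MB (\<lambda>\<sigma>. k \<sigma> p *\<^sub>R h (avg_map \<sigma> p))"
      by (rule integrable_bounded[OF finite_measure_MB m, of "K * C"]) (use b in \<open>auto intro!: AE_I2\<close>)
    have "norm (avg k h p) \<le> (\<integral>\<sigma>. norm (k \<sigma> p *\<^sub>R h (avg_map \<sigma> p)) \<partial>MB)"
      unfolding avg_def by (rule integral_norm_bound)
    also have "\<dots> \<le> (\<integral>\<sigma>. K * C \<partial>MB)"
      by (rule integral_mono[OF integrable_norm[OF i] finite_measure.integrable_const[OF finite_measure_MB]])
         (use b in auto)
    also have "\<dots> = K * C" using emeasure_MB by (simp add: measure_def)
    finally show ?thesis .
  qed
  then have "AE p in MQ. norm (avg k h p) \<le> K * C" by (intro AE_I2) auto
  then show ?thesis using that by blast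
qed

section \<open>The extension kernel and integration by parts in the averaging variables\<close>

lemma C1_alongI:
  assumes "\<And>p. (F has_derivative F' p) (at p)" "\<And>p. F' p v = G p" "continuous_on UNIV G"
  shows "C1_along v F G"
  using C1_along_has_derivative[of F F' v] assms by simp

text \<open>The factor 36 normalises the integral over \<open>avg_box\<close> to 1; the zeros on the boundary allow integration by
  parts in \<open>\<sigma>\<close>.\<close>

definition bubble :: "real \<times> real \<Rightarrow> real" where
  "bubble \<sigma> = 36 * (1 - (fst \<sigma>)\<^sup>2) * ((snd \<sigma> - 1 / 2) * (1 - snd \<sigma>))"

definition bubble_s :: "real \<times> real \<Rightarrow> real" where
  "bubble_s \<sigma> = - 72 * fst \<sigma> * ((snd \<sigma> - 1 / 2) * (1 - snd \<sigma>))"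

definition bubble_r :: "real \<times> real \<Rightarrow> real" where
  "bubble_r \<sigma> = 36 * (1 - (fst \<sigma>)\<^sup>2) * (3 / 2 - 2 * snd \<sigma>)"

lemma continuous_bubble:
  "continuous_on S bubble" "continuous_on S bubble_s" "continuous_on S bubble_r"
  unfolding bubble_def bubble_s_def bubble_r_def by (intro continuous_intros)+

lemma C1_along_bubble: "C1_along (1, 0) bubble bubble_s" "C1_along (0, 1) bubble bubble_r"
proof -
  have "(bubble has_derivative (\<lambda>h. bubble_s p * fst h + bubble_r p * snd h)) (at p)" for p
    unfolding bubble_def[abs_def] bubble_s_def bubble_r_def
    by (auto intro!: derivative_eq_intros simp: fun_eq_iff field_simps power2_eq_square)
  from C1_alongI[OF this] show "C1_along (1, 0) bubble bubble_s" "C1_along (0, 1) bubble bubble_r"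
    by (simp_all add: continuous_bubble)
qed

text \<open>The factor in s integrates to 4/3 and the factor in r to 1/48, with product
  1/36.\<close>

lemma integral_bubble: "integral avg_box bubble = 1"
proof -
  have "integral avg_box bubble = integral (cbox (- 1) 1) (\<lambda>s. integral (cbox (1 / 2) 1) (\<lambda>r. bubble (s, r)))"
    by (rule integral_prod_continuous) (rule continuous_bubble)
  also have "(\<lambda>s. integral (cbox (1 / 2) 1) (\<lambda>r. bubble (s, r))) = (\<lambda>s. 3 / 4 * (1 - s\<^sup>2))"
  proof
    fix s :: real
    let ?P = "\<lambda>r::real. 36 * (1 - s\<^sup>2) * (3 * r\<^sup>2 / 4 - r ^ 3 / 3 - r / 2)"
    have "((\<lambda>r. bubble (s, r)) has_integral ?P 1 - ?P (1 / 2)) {1 / 2..1}"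
      by (rule fundamental_theorem_of_calculus)
         (auto simp: bubble_def has_real_derivative_iff_has_vector_derivative[symmetric] field_simps power2_eq_square
          intro!: derivative_eq_intros)
    moreover have "?P 1 - ?P (1 / 2) = 3 / 4 * (1 - s\<^sup>2)"
      by (simp add: field_simps power2_eq_square power3_eq_cube)
    ultimately show "integral (cbox (1 / 2) 1) (\<lambda>r. bubble (s, r)) = 3 / 4 * (1 - s\<^sup>2)"
      unfolding box_real by (metis integral_unique)
  qed
  also have "integral (cbox (- 1) 1) (\<lambda>s. 3 / 4 * (1 - s\<^sup>2)) = (1::real)"
  proof -
    let ?P = "\<lambda>s::real. 3 / 4 * (s - s ^ 3 / 3)"
    have "((\<lambda>s. 3 / 4 * (1 - s\<^sup>2)) has_integral ?P 1 - ?P (- 1)) {- 1..1}"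
      by (rule fundamental_theorem_of_calculus)
         (auto simp: has_real_derivative_iff_has_vector_derivative[symmetric] field_simps power2_eq_square
          intro!: derivative_eq_intros)
    from integral_unique[OF this]
    have "integral {- 1..1} (\<lambda>s. 3 / 4 * (1 - s\<^sup>2)) = ?P 1 - ?P (- 1)" .
    also have "?P 1 - ?P (- 1) = 1" by simp
    finally show ?thesis unfolding box_real .
  qed
  finally show ?thesis .
qed

lemma integral_parts_s:
  fixes U :: "real \<times> real \<Rightarrow> 'b::euclidean_space"
  assumes w: "C1_along (1, 0) w ws" and 0: "\<And>r. w (- 1, r) = 0" "\<And>r. w (1, r) = 0" and U: "smooth U"
  shows "integral avg_box (\<lambda>\<sigma>. w \<sigma> *\<^sub>R (snd p *\<^sub>R frechet_derivative U (at (avg_map \<sigma> p)) (1, 0)) + ws \<sigma> *\<^sub>R U (avg_map \<sigma> p)) = 0"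
  by (rule integral_partial_x_eq_0[OF C1_along_prod[OF bounded_bilinear_scaleR w C1_along_compose_avg_map(3)[OF U]]])
     (simp_all add: 0)

lemma integral_parts_r:
  fixes U :: "real \<times> real \<Rightarrow> 'b::euclidean_space"
  assumes w: "C1_along (0, 1) w wr" and 0: "\<And>s. w (s, 1 / 2) = 0" "\<And>s. w (s, 1) = 0" and U: "smooth U"
  shows "integral avg_box (\<lambda>\<sigma>. w \<sigma> *\<^sub>R (snd p *\<^sub>R frechet_derivative U (at (avg_map \<sigma> p)) (0, 1)) + wr \<sigma> *\<^sub>R U (avg_map \<sigma> p)) = 0"
  by (rule integral_partial_y_eq_0[OF C1_along_prod[OF bounded_bilinear_scaleR w C1_along_compose_avg_map(4)[OF U]]])
     (simp_all add: 0)

text \<open>The resulting average is y times a weighted mean of h near (x, 0): it vanishes on I and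
  has normal derivative h there.\<close>

definition ext_kernel :: "real \<times> real \<Rightarrow> real \<times> real \<Rightarrow> real" where
  "ext_kernel \<sigma> p = snd p * bubble \<sigma>"

text \<open>After integration by parts in \<open>\<sigma>\<close>, the first derivatives of the average with \<open>ext_kernel\<close> are again
  averages of the same function, with the following kernels.\<close>

definition ext_kernel_x :: "real \<times> real \<Rightarrow> real \<times> real \<Rightarrow> real" where
  "ext_kernel_x \<sigma> p = - (1 - snd p / 2) * bubble_s \<sigma>"

definition ext_kernel_y :: "real \<times> real \<Rightarrow> real \<times> real \<Rightarrow> real" where
  "ext_kernel_y \<sigma> p = - bubble \<sigma> - (fst \<sigma> - fst p / 2) * bubble_s \<sigma> - snd \<sigma> * bubble_r \<sigma>"

lemma continuous_bubble_fst:
  "continuous_on UNIV (\<lambda>z. bubble (fst z))" "continuous_on UNIV (\<lambda>z. bubble_s (fst z))" "continuous_on UNIV (\<lambda>z. bubble_r (fst z))"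
  by (rule continuous_on_compose2[OF continuous_bubble(1)] continuous_on_compose2[OF continuous_bubble(2)]
      continuous_on_compose2[OF continuous_bubble(3)]; auto intro!: continuous_intros)+

lemma C1_kernel_ext:
  "C1_kernel ext_kernel (\<lambda>\<sigma> p. 0) (\<lambda>\<sigma> p. bubble \<sigma>)"
  "C1_kernel ext_kernel_x (\<lambda>\<sigma> p. 0) (\<lambda>\<sigma> p. bubble_s \<sigma> / 2)"
  "C1_kernel ext_kernel_y (\<lambda>\<sigma> p. bubble_s \<sigma> / 2) (\<lambda>\<sigma> p. 0)"
proof -
  have "(ext_kernel \<sigma> has_derivative (\<lambda>h. snd h * bubble \<sigma>)) (at p)" for \<sigma> p
    unfolding ext_kernel_def[abs_def] by (auto intro!: derivative_eq_intros)
  note 1 = C1_alongI[OF this]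
  have "(ext_kernel_x \<sigma> has_derivative (\<lambda>h. snd h * (bubble_s \<sigma> / 2))) (at p)" for \<sigma> p
    unfolding ext_kernel_x_def[abs_def] by (auto intro!: derivative_eq_intros)
  note 2 = C1_alongI[OF this]
  have "(ext_kernel_y \<sigma> has_derivative (\<lambda>h. fst h * (bubble_s \<sigma> / 2))) (at p)" for \<sigma> p
    unfolding ext_kernel_y_def[abs_def] by (auto intro!: derivative_eq_intros simp: fun_eq_iff algebra_simps)
  note 3 = C1_alongI[OF this]
  have c: "continuous_on UNIV (\<lambda>z. ext_kernel (fst z) (snd z))" "continuous_on UNIV (\<lambda>z. ext_kernel_x (fst z) (snd z))"
    "continuous_on UNIV (\<lambda>z. ext_kernel_y (fst z) (snd z))"
    unfolding ext_kernel_def ext_kernel_x_def ext_kernel_y_def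
    by (intro continuous_intros continuous_bubble_fst; simp)+
  have c': "continuous_on UNIV (\<lambda>z. bubble_s (fst z) / 2)"
    by (intro continuous_intros continuous_bubble_fst) simp
  show "C1_kernel ext_kernel (\<lambda>\<sigma> p. 0) (\<lambda>\<sigma> p. bubble \<sigma>)"
    unfolding C1_kernel_def by (intro conjI allI c 1 continuous_on_const continuous_bubble_fst) simp_all
  show "C1_kernel ext_kernel_x (\<lambda>\<sigma> p. 0) (\<lambda>\<sigma> p. bubble_s \<sigma> / 2)"
    unfolding C1_kernel_def by (intro conjI allI c c' 2 continuous_on_const) simp_all
  show "C1_kernel ext_kernel_y (\<lambda>\<sigma> p. bubble_s \<sigma> / 2) (\<lambda>\<sigma> p. 0)"
    unfolding C1_kernel_def by (intro conjI allI c c' 3 continuous_on_const) simp_all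
qed

lemma integral_eqI:
  fixes A B :: "real \<times> real \<Rightarrow> 'b::euclidean_space"
  assumes "continuous_on UNIV A" "continuous_on UNIV B" "integral (cbox a b) (\<lambda>\<sigma>. A \<sigma> - B \<sigma>) = 0"
  shows "integral (cbox a b) A = integral (cbox a b) B"
  using integral_diff[OF integrable_continuous[OF continuous_on_subset[OF assms(1) subset_UNIV]]
      integrable_continuous[OF continuous_on_subset[OF assms(2) subset_UNIV]], of a b] assms(3) by simp

lemma continuous_avg_section:
  fixes U :: "real \<times> real \<Rightarrow> 'b::euclidean_space"
  assumes "continuous_on UNIV (\<lambda>z. k (fst z) (snd z))" "continuous_on UNIV U"
  shows "continuous_on UNIV (\<lambda>\<sigma>. k \<sigma> p *\<^sub>R U (avg_map \<sigma> p))"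
  using continuous_on_Pair_left[OF continuous_avg_integrand[OF assms], of UNIV p] by simp

text \<open>The kernel contains the factor y, so the terms with derivatives of U are derivatives in
  \<sigma>. Since \<open>bubble\<close> vanishes on the boundary of the box they move onto the
  kernel, and no derivative of U is left: the first derivatives are bounded for bounded data and can
  be differentiated once more.\<close>

lemma C1_along_ext:
  fixes U :: "real \<times> real \<Rightarrow> 'b::euclidean_space"
  assumes U: "smooth U"
  shows "C1_along (1, 0) (avg ext_kernel U) (avg ext_kernel_x U)"
    "C1_along (0, 1) (avg ext_kernel U) (avg ext_kernel_y U)"
proof -
  define Ux Uy where "Ux q = frechet_derivative U (at q) (1, 0)" and "Uy q = frechet_derivative U (at q) (0, 1)" for q
  note kc = C1_kernelD[OF C1_kernel_ext(1)] and km = C1_kernel_mult_continuous[OF C1_kernel_ext(1)]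
  note kx = C1_kernelD(1)[OF C1_kernel_ext(2)] and ky = C1_kernelD(1)[OF C1_kernel_ext(3)]
  have Uc: "continuous_on UNIV U" by (rule C1_alongD(1)[OF C1_along_smooth[OF U]])
  have cD: "continuous_on UNIV Ux" "continuous_on UNIV Uy"
    unfolding Ux_def[abs_def] Uy_def[abs_def] by (intro continuous_frechet_derivative U)+
  note C1 = C1_along_avg[OF C1_kernel_ext(1) U, folded Ux_def Uy_def]
  note cs = continuous_avg_section[OF km(1) cD(1)] continuous_avg_section[OF kc(2) Uc] continuous_avg_section[OF kx Uc]
    continuous_avg_section[OF km(2) cD(1)] continuous_avg_section[OF km(3) cD(2)] continuous_avg_section[OF kc(3) Uc]
    continuous_avg_section[OF ky Uc]
  have "avg (\<lambda>\<sigma> p. ext_kernel \<sigma> p * (1 - snd p / 2)) Ux p + avg (\<lambda>\<sigma> p. 0) U p = avg ext_kernel_x U p" for p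
    unfolding avg_add_integral[OF km(1) cD(1) kc(2) Uc] avg_eq_integral[OF kx Uc]
  proof (rule integral_eqI[OF continuous_on_add[OF cs(1,2)] cs(3)])
    have "integral avg_box (\<lambda>\<sigma>. (1 - snd p / 2) *\<^sub>R (bubble \<sigma> *\<^sub>R (snd p *\<^sub>R Ux (avg_map \<sigma> p)) + bubble_s \<sigma> *\<^sub>R U (avg_map \<sigma> p))) = 0"
      unfolding integral_cmul Ux_def
      by (subst integral_parts_s[OF C1_along_bubble(1) _ _ U]) (simp_all add: bubble_def)
    then show "integral avg_box (\<lambda>\<sigma>. (ext_kernel \<sigma> p * (1 - snd p / 2)) *\<^sub>R Ux (avg_map \<sigma> p) + 0 *\<^sub>R U (avg_map \<sigma> p)
        - ext_kernel_x \<sigma> p *\<^sub>R U (avg_map \<sigma> p)) = 0"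
      by (simp add: ext_kernel_def ext_kernel_x_def algebra_simps)
  qed
  then show "C1_along (1, 0) (avg ext_kernel U) (avg ext_kernel_x U)" using C1(1) by simp
  have "avg (\<lambda>\<sigma> p. ext_kernel \<sigma> p * (fst \<sigma> - fst p / 2)) Ux p + avg (\<lambda>\<sigma> p. ext_kernel \<sigma> p * snd \<sigma>) Uy p
      + avg (\<lambda>\<sigma> p. bubble \<sigma>) U p = avg ext_kernel_y U p" for p
  proof -
    let ?A = "\<lambda>\<sigma>. ((ext_kernel \<sigma> p * (fst \<sigma> - fst p / 2)) *\<^sub>R Ux (avg_map \<sigma> p) + (ext_kernel \<sigma> p * snd \<sigma>) *\<^sub>R Uy (avg_map \<sigma> p))
        + bubble \<sigma> *\<^sub>R U (avg_map \<sigma> p)"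
    note io = integrable_continuous[OF continuous_on_subset[OF _ subset_UNIV]]
    \<comment> \<open>These are the weights of Ux and Uy without the factor y. Each integration by
      parts produces a term -\<open>bubble\<close>; one of the two cancels the \<open>bubble\<close>
      that stems from differentiating the factor y, which leaves the single one in
      \<open>ext_kernel_y\<close>.\<close>
    let ?w1 = "\<lambda>\<sigma>. (fst \<sigma> - fst p / 2) * bubble \<sigma>" and ?w1s = "\<lambda>\<sigma>. (fst \<sigma> - fst p / 2) * bubble_s \<sigma> + 1 * bubble \<sigma>"
    let ?w2 = "\<lambda>\<sigma>. snd \<sigma> * bubble \<sigma>" and ?w2r = "\<lambda>\<sigma>. snd \<sigma> * bubble_r \<sigma> + 1 * bubble \<sigma>"
    let ?I1 = "\<lambda>\<sigma>. ?w1 \<sigma> *\<^sub>R (snd p *\<^sub>R Ux (avg_map \<sigma> p)) + ?w1s \<sigma> *\<^sub>R U (avg_map \<sigma> p)"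
    let ?I2 = "\<lambda>\<sigma>. ?w2 \<sigma> *\<^sub>R (snd p *\<^sub>R Uy (avg_map \<sigma> p)) + ?w2r \<sigma> *\<^sub>R U (avg_map \<sigma> p)"
    have w1: "C1_along (1, 0) ?w1 ?w1s"
      by (rule C1_along_prod[OF bounded_bilinear_mult _ C1_along_bubble(1)])
         (rule C1_alongI[where F'="\<lambda>p h. fst h"], auto intro!: derivative_eq_intros)
    have w2: "C1_along (0, 1) ?w2 ?w2r"
      by (rule C1_along_prod[OF bounded_bilinear_mult _ C1_along_bubble(2)])
         (rule C1_alongI[where F'="\<lambda>p h. snd h"], auto intro!: derivative_eq_intros)
    have I1: "integral avg_box ?I1 = 0"
      unfolding Ux_def by (rule integral_parts_s[OF w1 _ _ U]) (simp_all add: bubble_def)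
    have I2: "integral avg_box ?I2 = 0"
      unfolding Uy_def by (rule integral_parts_r[OF w2 _ _ U]) (simp_all add: bubble_def)
    have c1: "continuous_on UNIV ?I1"
      unfolding Ux_def
      by (rule C1_alongD(2)[OF C1_along_prod[OF bounded_bilinear_scaleR w1 C1_along_compose_avg_map(3)[OF U]]])
    have c2: "continuous_on UNIV ?I2"
      unfolding Uy_def
      by (rule C1_alongD(2)[OF C1_along_prod[OF bounded_bilinear_scaleR w2 C1_along_compose_avg_map(4)[OF U]]])
    have "avg (\<lambda>\<sigma> p. ext_kernel \<sigma> p * (fst \<sigma> - fst p / 2)) Ux p + avg (\<lambda>\<sigma> p. ext_kernel \<sigma> p * snd \<sigma>) Uy p
      + avg (\<lambda>\<sigma> p. bubble \<sigma>) U p = integral avg_box ?A"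
      unfolding avg_add_integral[OF km(2) cD(1) km(3) cD(2)] avg_eq_integral[OF kc(3) Uc]
      by (rule integral_add[symmetric]) (intro io continuous_on_add cs)+
    also have "\<dots> = avg ext_kernel_y U p"
      unfolding avg_eq_integral[OF ky Uc]
    proof (rule integral_eqI[OF continuous_on_add[OF continuous_on_add[OF cs(4,5)] cs(6)] cs(7)])
      have "integral avg_box (\<lambda>\<sigma>. ?I1 \<sigma> + ?I2 \<sigma>) = 0"
        using integral_add[OF io[OF c1] io[OF c2], of "(- 1, 1 / 2)" "(1, 1)"] I1 I2 by simp
      also have "(\<lambda>\<sigma>. ?I1 \<sigma> + ?I2 \<sigma>) = (\<lambda>\<sigma>. ?A \<sigma> - ext_kernel_y \<sigma> p *\<^sub>R U (avg_map \<sigma> p))"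
        by (simp add: fun_eq_iff ext_kernel_def ext_kernel_y_def algebra_simps)
      finally show "integral avg_box (\<lambda>\<sigma>. ?A \<sigma> - ext_kernel_y \<sigma> p *\<^sub>R U (avg_map \<sigma> p)) = 0" .
    qed
    finally show ?thesis .
  qed
  then show "C1_along (0, 1) (avg ext_kernel U) (avg ext_kernel_y U)" using C1(2) by simp
qed

text \<open>By \<open>W12_avg\<close> these integrals are the factors by which the boundary datum is
  multiplied in the traces of the extension, of its tangential and of its normal derivative.\<close>

lemma integral_ext_kernel:
  "integral avg_box (\<lambda>\<sigma>. ext_kernel \<sigma> (x, 0)) = 0"
  "integral avg_box (\<lambda>\<sigma>. ext_kernel_x \<sigma> (x, 0)) = 0"
  "integral avg_box (\<lambda>\<sigma>. ext_kernel_y \<sigma> (x, 0)) = 1"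
proof -
  have s1: "smooth (\<lambda>p :: real \<times> real. 1 :: real)" by (simp add: smooth_def)
  have one: "avg k (\<lambda>p. 1) (x, 0) = integral avg_box (\<lambda>\<sigma>. k \<sigma> (x, 0))"
    if "continuous_on UNIV (\<lambda>z. k (fst z) (snd z))" for k :: "real \<times> real \<Rightarrow> real \<times> real \<Rightarrow> real"
    using avg_eq_integral[OF that, of "\<lambda>p. 1 :: real"] by simp
  note k = C1_kernelD[OF C1_kernel_ext(1)]
  show "integral avg_box (\<lambda>\<sigma>. ext_kernel \<sigma> (x, 0)) = 0" by (simp add: ext_kernel_def)
  have "integral avg_box bubble_s = 0"
    by (rule integral_partial_x_eq_0[OF C1_along_bubble(1)]) (simp_all add: bubble_def)
  then show "integral avg_box (\<lambda>\<sigma>. ext_kernel_x \<sigma> (x, 0)) = 0"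
    by (simp add: ext_kernel_x_def)
  \<comment> \<open>Evaluate the two expressions for the normal derivative of the extension of the constant 1.\<close>
  let ?D = "\<lambda>v q. frechet_derivative (\<lambda>p :: real \<times> real. 1 :: real) (at q) v"
  have D: "?D v = (\<lambda>q. 0)" for v by (simp add: fun_eq_iff)
  have "((\<lambda>s. avg ext_kernel (\<lambda>p. 1 :: real) ((x, 0) + s *\<^sub>R (0, 1))) has_vector_derivative
      avg ext_kernel_y (\<lambda>p. 1) ((x, 0) + 0 *\<^sub>R (0, 1))) (at 0)"
    by (rule C1_alongD(3)[OF C1_along_ext(2)[OF s1]])
  moreover have "((\<lambda>s. avg ext_kernel (\<lambda>p. 1 :: real) ((x, 0) + s *\<^sub>R (0, 1))) has_vector_derivative
      avg (\<lambda>\<sigma> p. ext_kernel \<sigma> p * (fst \<sigma> - fst p / 2)) (?D (1, 0)) ((x, 0) + 0 *\<^sub>R (0, 1)) +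
      avg (\<lambda>\<sigma> p. ext_kernel \<sigma> p * snd \<sigma>) (?D (0, 1)) ((x, 0) + 0 *\<^sub>R (0, 1)) +
      avg (\<lambda>\<sigma> p. bubble \<sigma>) (\<lambda>p. 1) ((x, 0) + 0 *\<^sub>R (0, 1))) (at 0)"
    by (rule C1_alongD(3)[OF C1_along_avg(2)[OF C1_kernel_ext(1) s1]])
  ultimately have "avg ext_kernel_y (\<lambda>p. 1 :: real) (x, 0) = avg (\<lambda>\<sigma> p. bubble \<sigma>) (\<lambda>p. 1) (x, 0)"
    unfolding D by (drule_tac vector_derivative_unique_at) (simp_all add: avg_def)
  then show "integral avg_box (\<lambda>\<sigma>. ext_kernel_y \<sigma> (x, 0)) = 1"
    using one[OF C1_kernelD(1)[OF C1_kernel_ext(3)]] one[OF k(3)] integral_bubble by simp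
qed

text \<open>The first derivatives are averages of h with kernels of class C1. Hence they are
  bounded, and by \<open>W12_avg\<close> their own derivatives are averages of h, hx and hy, which
  are square integrable.\<close>

lemma boundary_extension:
  fixes h :: "real \<times> real \<Rightarrow> 'b::euclidean_space"
  assumes h: "W12 h hx hy" "AE p in MQ. norm (h p) \<le> C" and g: "has_trace h g"
  obtains \<Psi> \<Psi>x \<Psi>y \<Psi>xx \<Psi>xy \<Psi>yx \<Psi>yy K where "W12 \<Psi> \<Psi>x \<Psi>y" "W12 \<Psi>x \<Psi>xx \<Psi>xy" "W12 \<Psi>y \<Psi>yx \<Psi>yy"
    "AE p in MQ. norm (\<Psi> p) \<le> K" "AE p in MQ. norm (\<Psi>x p) \<le> K" "AE p in MQ. norm (\<Psi>y p) \<le> K"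
    "has_trace \<Psi> (\<lambda>x. 0)" "has_trace \<Psi>x (\<lambda>x. 0)" "has_trace \<Psi>y g"
proof -
  have "AE p in MQ. norm (h p) \<le> max C 0" using h(2) by eventually_elim simp
  then obtain w where w: "w \<in> borel_measurable borel" "AE p in MQ. h p = w p" "\<And>p. norm (w p) \<le> max C 0"
    by (rule L2_bounded_representative[OF L2_spaceD(1)[OF W12D(1)[OF h(1)]]]) (simp, rule that)
  obtain wx where wx: "wx \<in> borel_measurable borel" "AE p in MQ. hx p = wx p"
    by (rule borel_representative[OF L2_spaceD(1)[OF W12D(2)[OF h(1)]] Q_plus_lebesgue])
  obtain wy where wy: "wy \<in> borel_measurable borel" "AE p in MQ. hy p = wy p"
    by (rule borel_representative[OF L2_spaceD(1)[OF W12D(3)[OF h(1)]] Q_plus_lebesgue])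
  have W: "W12 w wx wy"
    by (rule W12_cong_AE[OF h(1)]; intro borel_measurable_lebesgue_on w wx wy)
  have gw: "has_trace w g"
    by (rule has_trace_cong_AE[OF g borel_measurable_lebesgue_on[OF w(1)] w(2)])
  obtain U where U: "\<And>n. smooth (U n)" "L2_tendsto MQ U w"
    by (rule W12_approx[OF W]) (rule that; assumption)
  have Um: "U n \<in> borel_measurable borel" for n
    by (rule borel_measurable_continuous_onI, rule C1_alongD(1)[OF C1_along_smooth[OF U(1)]])
  have t: "L1_tendsto MQ (\<lambda>n. avg k (U n)) (avg k w)" if "C1_kernel k kx ky" for k kx ky
    by (rule L2_tendsto_imp_L1[OF avg_L2_tendsto[OF C1_kernelD(1)[OF that] w(1) Um U(2)] finite_measure_MQ])
  note A = W12_avg[OF C1_kernel_ext(1) W w(1) wx(1) wy(1)] and Ax = W12_avg[OF C1_kernel_ext(2) W w(1) wx(1) wy(1)]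
    and Ay = W12_avg[OF C1_kernel_ext(3) W w(1) wx(1) wy(1)]
  have "W12 (avg ext_kernel w) (avg ext_kernel_x w) (avg ext_kernel_y w)"
    unfolding W12_def
  proof (intro conjI W12D(1)[OF A(1)] W12D(1)[OF Ax(1)] W12D(1)[OF Ay(1)])
    show "has_weak_deriv Q_plus (1, 0) (avg ext_kernel w) (avg ext_kernel_x w)"
      by (rule has_weak_deriv_L1_limit[OF C1_along_has_weak_deriv[OF C1_along_ext(1)[OF U(1)]]
          t[OF C1_kernel_ext(1)] t[OF C1_kernel_ext(2)]]) (simp add: Basis_real_prod)
    show "has_weak_deriv Q_plus (0, 1) (avg ext_kernel w) (avg ext_kernel_y w)"
      by (rule has_weak_deriv_L1_limit[OF C1_along_has_weak_deriv[OF C1_along_ext(2)[OF U(1)]]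
          t[OF C1_kernel_ext(1)] t[OF C1_kernel_ext(3)]]) (simp add: Basis_real_prod)
  qed
  moreover obtain K0 where K0: "AE p in MQ. norm (avg ext_kernel w p) \<le> K0"
    by (rule avg_bounded[OF C1_kernelD(1)[OF C1_kernel_ext(1)] w(1,3)])
  moreover obtain K1 where K1: "AE p in MQ. norm (avg ext_kernel_x w p) \<le> K1"
    by (rule avg_bounded[OF C1_kernelD(1)[OF C1_kernel_ext(2)] w(1,3)])
  moreover obtain K2 where K2: "AE p in MQ. norm (avg ext_kernel_y w p) \<le> K2"
    by (rule avg_bounded[OF C1_kernelD(1)[OF C1_kernel_ext(3)] w(1,3)])
  let ?K = "max K0 (max K1 K2)"
  have "AE p in MQ. norm (avg ext_kernel w p) \<le> ?K" "AE p in MQ. norm (avg ext_kernel_x w p) \<le> ?K"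
    "AE p in MQ. norm (avg ext_kernel_y w p) \<le> ?K"
    using K0 K1 K2 by (eventually_elim, simp add: le_max_iff_disj)+
  moreover have "has_trace (avg ext_kernel w) (\<lambda>x. 0)" "has_trace (avg ext_kernel_x w) (\<lambda>x. 0)" "has_trace (avg ext_kernel_y w) g"
    using A(2)[OF gw] Ax(2)[OF gw] Ay(2)[OF gw] by (simp_all add: integral_ext_kernel)
  ultimately show ?thesis using that A(1) Ax(1) Ay(1) by blast
qed

section \<open>Bounded Sobolev functions and the Banach space\<close>

lemma Linf_space_iff:
  fixes u :: "'a \<Rightarrow> 'b::euclidean_space"
  shows "u \<in> Linf_space M \<longleftrightarrow> u \<in> borel_measurable M \<and> (\<exists>C. AE p in M. norm (u p) \<le> C)"
proof safe
  assume u: "u \<in> Linf_space M"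
  then show m: "u \<in> borel_measurable M" by (simp add: Linf_space_def)
  let ?e = "esssup M (\<lambda>p. ereal (norm (u p)))"
  have ae: "AE p in M. ereal (norm (u p)) \<le> ?e" by (rule esssup_AE)
  have "?e < \<infinity>" using u by (simp add: Linf_space_def)
  \<comment> \<open>The maximum with 0 covers the zero measure, whose essential supremum is minus
    infinity.\<close>
  then have "?e \<le> ereal (real_of_ereal (max 0 ?e))"
    by (cases ?e) (auto simp: max_def)
  with ae have "AE p in M. norm (u p) \<le> real_of_ereal (max 0 ?e)"
    by (auto elim!: eventually_mono dest: order_trans)
  then show "\<exists>C. AE p in M. norm (u p) \<le> C" by blast
next
  fix C assume m: "u \<in> borel_measurable M" and C: "AE p in M. norm (u p) \<le> C"
  have "esssup M (\<lambda>p. ereal (norm (u p))) \<le> ereal C"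
    using m C by (intro esssup_I) auto
  then show "u \<in> Linf_space M" using m by (auto simp: Linf_space_def less_ereal.simps intro: le_less_trans)
qed

section \<open>Homogeneity of the Sobolev norms\<close>

lemma Linf_norm_cong_AE:
  assumes "u \<in> borel_measurable M" "w \<in> borel_measurable M" "AE p in M. u p = w p"
  shows "Linf_norm M u = Linf_norm M w"
  unfolding Linf_norm_def using assms
  by (intro arg_cong[where f=real_of_ereal] esssup_AE_cong) (auto elim: eventually_mono)

lemma Linf_norm_scaleR:
  assumes "c \<noteq> 0"
  shows "Linf_norm M (\<lambda>p. c *\<^sub>R u p) = \<bar>c\<bar> * Linf_norm M u"
  using esssup_cmult[of "\<bar>c\<bar>" M "\<lambda>p. ereal (norm (u p))"] assms by (simp add: Linf_norm_def)

lemma L2_norm_scaleR: "L2_norm M (\<lambda>p. c *\<^sub>R u p) = \<bar>c\<bar> * L2_norm M u"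
  by (simp add: L2_norm_def power_mult_distrib real_sqrt_mult)

text \<open>The chosen weak derivative of c u and c times that of u agree only almost everywhere, so
  the norm and the space must respect such changes. Homogeneity is the property of the norm on which
  the curve relies: all remainders there are multiples of one function.\<close>

lemma sobolev_norm_scaleR:
  fixes u :: "real \<times> real \<Rightarrow> 'b::euclidean_space" and N :: "(real \<times> real \<Rightarrow> 'b) \<Rightarrow> real"
  assumes cong: "\<And>u w. u \<in> borel_measurable MQ \<Longrightarrow> w \<in> borel_measurable MQ \<Longrightarrow> AE p in MQ. u p = w p \<Longrightarrow> N u = N w"
    and scale: "\<And>u. N (\<lambda>p. c *\<^sub>R u p) = \<bar>c\<bar> * N u"
    and X: "\<And>u. u \<in> X \<Longrightarrow> u \<in> borel_measurable MQ"
      "\<And>u w. u \<in> X \<Longrightarrow> w \<in> borel_measurable MQ \<Longrightarrow> AE p in MQ. u p = w p \<Longrightarrow> w \<in> X"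
  shows "u \<in> sobolev Q_plus X k \<Longrightarrow>
    sobolev_norm Q_plus N k (\<lambda>p. c *\<^sub>R u p) = \<bar>c\<bar> * sobolev_norm Q_plus N k u"
proof (induction k arbitrary: u)
  case 0
  show ?case by (simp add: scale)
next
  case (Suc k)
  have norm_cong: "sobolev_norm Q_plus N k u = sobolev_norm Q_plus N k w"
    if "u \<in> borel_measurable MQ" "w \<in> borel_measurable MQ" "AE p in MQ. u p = w p" for u w
    using that weak_deriv_cong_AE[OF that] cong[OF that] by (cases k) simp_all
  have space_cong: "w \<in> sobolev Q_plus X k"
    if u: "u \<in> sobolev Q_plus X k" and w: "w \<in> borel_measurable MQ" "AE p in MQ. u p = w p" for u w
  proof (cases k)
    case 0
    then show ?thesis using that X(2) by simp
  next
    case (Suc j)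
    then have "u \<in> X" using u by simp
    moreover have "\<exists>g\<in>sobolev Q_plus X j. has_weak_deriv Q_plus v w g" if v: "v \<in> Basis" for v
    proof -
      obtain g where "g \<in> sobolev Q_plus X j" "has_weak_deriv Q_plus v u g"
        using u Suc v by auto
      then show ?thesis
        using has_weak_deriv_cong_AE[of v u g w g] w has_weak_deriv_measurable(2) by blast
    qed
    ultimately show ?thesis using Suc X(2) w by simp
  qed
  have "sobolev_norm Q_plus N k (weak_deriv Q_plus v (\<lambda>p. c *\<^sub>R u p)) =
      \<bar>c\<bar> * sobolev_norm Q_plus N k (weak_deriv Q_plus v u)" if v: "v \<in> Basis" for v
  proof -
    obtain g where g: "g \<in> sobolev Q_plus X k" "has_weak_deriv Q_plus v u g"
      using Suc.prems v by auto
    note d = has_weak_deriv_weak_deriv[OF g(2)]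
    have "has_weak_deriv Q_plus v (\<lambda>p. c *\<^sub>R u p) (\<lambda>p. c *\<^sub>R weak_deriv Q_plus v u p)"
      using has_weak_deriv_add_scaleR[OF d d, of c 0] by simp
    from weak_deriv_AE[OF this] has_weak_deriv_measurable(2)[OF this]
      has_weak_deriv_measurable(2)[OF has_weak_deriv_weak_deriv[OF this]]
    have "sobolev_norm Q_plus N k (weak_deriv Q_plus v (\<lambda>p. c *\<^sub>R u p)) =
        sobolev_norm Q_plus N k (\<lambda>p. c *\<^sub>R weak_deriv Q_plus v u p)"
      by (intro norm_cong)
    also have "\<dots> = \<bar>c\<bar> * sobolev_norm Q_plus N k (weak_deriv Q_plus v u)"
    proof (rule Suc.IH)
      have "AE p in MQ. g p = weak_deriv Q_plus v u p"
        using weak_deriv_AE[OF g(2)] by eventually_elim simp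
      then show "weak_deriv Q_plus v u \<in> sobolev Q_plus X k"
        by (rule space_cong[OF g(1) has_weak_deriv_measurable(2)[OF d]])
    qed
    finally show ?thesis .
  qed
  then show ?case by (simp add: scale distrib_left sum_distrib_left)
qed

lemma W_norm_scaleR:
  assumes u: "u \<in> W22_W1inf" and c: "c \<noteq> 0"
  shows "W_norm (\<lambda>p. c *\<^sub>R u p) = \<bar>c\<bar> * W_norm u"
proof -
  have "sobolev_norm Q_plus (L2_norm MQ) 2 (\<lambda>p. c *\<^sub>R u p) = \<bar>c\<bar> * sobolev_norm Q_plus (L2_norm MQ) 2 u"
    by (rule sobolev_norm_scaleR[where X="L2_space MQ"])
       (use u in \<open>auto simp: W22_W1inf_def L2_norm_scaleR intro: L2_norm_cong_AE L2_spaceD(1) L2_space_cong_AE\<close>)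
  moreover have "sobolev_norm Q_plus (Linf_norm MQ) 1 (\<lambda>p. c *\<^sub>R u p) = \<bar>c\<bar> * sobolev_norm Q_plus (Linf_norm MQ) 1 u"
  proof (rule sobolev_norm_scaleR[where X="Linf_space MQ"])
    show "w \<in> Linf_space MQ" if uw: "u \<in> Linf_space MQ" "w \<in> borel_measurable MQ" "AE p in MQ. u p = w p"
      for u w :: "real \<times> real \<Rightarrow> real^3"
    proof -
      obtain C where "AE p in MQ. norm (u p) \<le> C" using uw(1) by (auto simp: Linf_space_iff)
      with uw(3) have "AE p in MQ. norm (w p) \<le> C" by eventually_elim simp
      then show ?thesis using uw(2) by (auto simp: Linf_space_iff)
    qed
    show "u \<in> sobolev Q_plus (Linf_space MQ) 1" using u by (simp add: W22_W1inf_def)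
    show "u \<in> borel_measurable MQ" if "u \<in> Linf_space MQ" for u :: "real \<times> real \<Rightarrow> real^3"
      using that by (simp add: Linf_space_iff)
    show "Linf_norm MQ u = Linf_norm MQ w"
      if "u \<in> borel_measurable MQ" "w \<in> borel_measurable MQ" "AE p in MQ. u p = w p" for u w :: "real \<times> real \<Rightarrow> real^3"
      by (rule Linf_norm_cong_AE[OF that])
    show "Linf_norm MQ (\<lambda>p. c *\<^sub>R u p) = \<bar>c\<bar> * Linf_norm MQ u" for u :: "real \<times> real \<Rightarrow> real^3"
      by (rule Linf_norm_scaleR[OF c])
  qed
  ultimately show ?thesis by (simp add: W_norm_def distrib_left)
qed

text \<open>The algebra of bounded W^{1,2} functions, in which the first derivatives of members of
  \<open>W22_W1inf\<close> live. It is closed under bilinear products, and traces are multiplicative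
  on it.\<close>

definition W12_Linf :: "(real \<times> real \<Rightarrow> 'b::euclidean_space) \<Rightarrow> bool" where
  "W12_Linf u \<longleftrightarrow> (\<exists>ux uy C. W12 u ux uy \<and> (AE p in MQ. norm (u p) \<le> C))"

lemma W12_LinfI: "W12 u ux uy \<Longrightarrow> AE p in MQ. norm (u p) \<le> C \<Longrightarrow> W12_Linf u"
  unfolding W12_Linf_def by blast

lemma W12_Linf_measurable: "W12_Linf u \<Longrightarrow> u \<in> borel_measurable MQ"
  unfolding W12_Linf_def using W12D(1) L2_spaceD(1) by blast

lemma W12_Linf_bounded:
  assumes "W12_Linf u" obtains C where "C \<ge> 0" "AE p in MQ. norm (u p) \<le> C"
proof -
  obtain C where "AE p in MQ. norm (u p) \<le> C" using assms unfolding W12_Linf_def by blast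
  then have "AE p in MQ. norm (u p) \<le> max C 0" by eventually_elim simp
  then show ?thesis using that[of "max C 0"] by simp
qed

lemma W12_Linf_cong_AE:
  assumes "W12_Linf u" "w \<in> borel_measurable MQ" "AE p in MQ. u p = w p"
  shows "W12_Linf w"
proof -
  obtain ux uy C where u: "W12 u ux uy" "AE p in MQ. norm (u p) \<le> C"
    using assms(1) unfolding W12_Linf_def by blast
  have "W12 w ux uy"
    by (rule W12_cong_AE[OF u(1) assms(2,3)]) (auto intro: L2_spaceD W12D[OF u(1)])
  moreover have "AE p in MQ. norm (w p) \<le> C" using u(2) assms(3) by eventually_elim simp
  ultimately show ?thesis by (rule W12_LinfI)
qed

lemma W12_Linf_const: "W12_Linf (\<lambda>p. c)"
  by (rule W12_LinfI[OF W12_const, where C="norm c"]) simp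

lemma W12_Linf_add_scaleR:
  assumes "W12_Linf u" "W12_Linf w"
  shows "W12_Linf (\<lambda>p. a *\<^sub>R u p + b *\<^sub>R w p)"
proof -
  obtain ux uy C where u: "W12 u ux uy" "AE p in MQ. norm (u p) \<le> C"
    using assms(1) unfolding W12_Linf_def by blast
  obtain wx wy D where w: "W12 w wx wy" "AE p in MQ. norm (w p) \<le> D"
    using assms(2) unfolding W12_Linf_def by blast
  have "AE p in MQ. norm (a *\<^sub>R u p + b *\<^sub>R w p) \<le> \<bar>a\<bar> * C + \<bar>b\<bar> * D"
    using u(2) w(2)
  proof eventually_elim
    case (elim p)
    have "norm (a *\<^sub>R u p + b *\<^sub>R w p) \<le> \<bar>a\<bar> * norm (u p) + \<bar>b\<bar> * norm (w p)"
      using norm_triangle_ineq[of "a *\<^sub>R u p" "b *\<^sub>R w p"] by simp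
    also have "\<dots> \<le> \<bar>a\<bar> * C + \<bar>b\<bar> * D" using elim by (intro add_mono mult_left_mono) auto
    finally show ?case .
  qed
  then show ?thesis by (rule W12_LinfI[OF W12_add_scaleR[OF u(1) w(1)]])
qed

lemma W12_Linf_prod:
  fixes bl :: "'b::euclidean_space \<Rightarrow> 'c::euclidean_space \<Rightarrow> 'd::euclidean_space"
  assumes bl: "bounded_bilinear bl" and u: "W12_Linf u" and w: "W12_Linf w"
  shows "W12_Linf (\<lambda>p. bl (u p) (w p))"
proof -
  obtain K where K: "K \<ge> 0" "\<And>a b. norm (bl a b) \<le> norm a * norm b * K"
    using bounded_bilinear.nonneg_bounded[OF bl] by auto
  obtain ux uy C where u: "W12 u ux uy" "AE p in MQ. norm (u p) \<le> C"
    using u unfolding W12_Linf_def by blast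
  obtain wx wy D where w: "W12 w wx wy" "AE p in MQ. norm (w p) \<le> D"
    using w unfolding W12_Linf_def by blast
  have "AE p in MQ. norm (bl (u p) (w p)) \<le> C * D * K"
    using u(2) w(2)
  proof eventually_elim
    case (elim p)
    have "norm (u p) * norm (w p) \<le> C * D"
      using elim order_trans[OF norm_ge_zero elim(1)] by (intro mult_mono) auto
    then show ?case using K(2)[of "u p" "w p"] mult_right_mono[OF _ K(1)] order_trans by blast
  qed
  then show ?thesis by (rule W12_LinfI[OF W12_prod[OF bl u w]])
qed

lemma has_trace_bilinear:
  fixes bl :: "'b::euclidean_space \<Rightarrow> 'c::euclidean_space \<Rightarrow> 'd::euclidean_space"
  assumes bl: "bounded_bilinear bl" and u: "W12_Linf u" and w: "W12_Linf w" and g: "has_trace u g" and h: "has_trace w h"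
  shows "has_trace (\<lambda>p. bl (u p) (w p)) (\<lambda>x. bl (g x) (h x))"
proof -
  obtain k where k: "has_trace (\<lambda>p. bl (u p) (w p)) k"
    using W12_Linf_prod[OF bl u w] has_trace_exists unfolding W12_Linf_def by metis
  obtain ux uy C where u: "W12 u ux uy" "AE p in MQ. norm (u p) \<le> C"
    using u unfolding W12_Linf_def by blast
  obtain wx wy D where w: "W12 w wx wy" "AE p in MQ. norm (w p) \<le> D"
    using w unfolding W12_Linf_def by blast
  have eq: "AE x in I_measure. k x = bl (g x) (h x)"
    by (rule has_trace_prod[OF bl u w g h k])
  have "(\<lambda>x. bl (g x) (h x)) \<in> L2_space I_measure"
    by (rule L2_space_cong_AE[OF has_trace_W12(2)[OF k] _ eq])
       (intro bilinear_measurable[OF bl] L2_spaceD(1) has_trace_W12(2)[OF g] has_trace_W12(2)[OF h])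
  then show ?thesis by (rule has_trace_AE_cong_trace[OF k eq])
qed

lemma W22I:
  assumes u: "W12 u ux uy" "AE p in MQ. norm (u p) \<le> C" and ux: "W12_Linf ux" and uy: "W12_Linf uy"
  shows "u \<in> W22_W1inf"
proof -
  have Linf: "w \<in> Linf_space MQ" if "W12_Linf w" for w :: "real \<times> real \<Rightarrow> real^3"
    using W12_Linf_measurable[OF that] W12_Linf_bounded[OF that] unfolding Linf_space_iff by blast
  have S: "w \<in> sobolev Q_plus (L2_space MQ) 1" if "W12_Linf w" for w :: "real \<times> real \<Rightarrow> real^3"
    using that sobolev_1_iff unfolding W12_Linf_def by blast
  note d = W12D[OF u(1)]
  have "u \<in> sobolev Q_plus (L2_space MQ) (Suc 1)"
    unfolding sobolev.simps(2) using d S[OF ux] S[OF uy] by (auto simp: Basis_real_prod simp del: sobolev.simps One_nat_def)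
  moreover have "u \<in> sobolev Q_plus (Linf_space MQ) (Suc 0)"
    unfolding sobolev.simps using d Linf[OF ux] Linf[OF uy] Linf[OF W12_LinfI[OF u]]
    by (auto simp: Basis_real_prod)
  ultimately show ?thesis by (simp add: W22_W1inf_def numeral_2_eq_2 del: sobolev.simps)
qed

text \<open>The two Sobolev conditions supply separate weak derivatives, one in W^{1,2} and one
  bounded. Uniqueness identifies them with each other and with the chosen
  \<open>weak_deriv\<close>.\<close>

lemma W22D:
  assumes u: "u \<in> W22_W1inf"
  shows "W12 u (d_x u) (d_y u)" "W12_Linf u" "W12_Linf (d_x u)" "W12_Linf (d_y u)"
proof -
  have s: "u \<in> sobolev Q_plus (L2_space MQ) (Suc 1)" "u \<in> sobolev Q_plus (Linf_space MQ) (Suc 0)"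
    using u by (simp_all add: W22_W1inf_def numeral_2_eq_2 del: sobolev.simps)
  have uL2: "u \<in> L2_space MQ" using s(1) by simp
  have *: "W12_Linf (weak_deriv Q_plus v u) \<and> has_weak_deriv Q_plus v u (weak_deriv Q_plus v u)" if v: "v \<in> Basis" for v
  proof -
    obtain g where g: "g \<in> sobolev Q_plus (L2_space MQ) 1" "has_weak_deriv Q_plus v u g"
      using s(1) v unfolding sobolev.simps(2) by blast
    obtain h where h: "h \<in> Linf_space MQ" "has_weak_deriv Q_plus v u h"
      using s(2) v by auto
    obtain C where C: "AE p in MQ. norm (h p) \<le> C" using h(1) by (auto simp: Linf_space_iff)
    note d = has_weak_deriv_weak_deriv[OF g(2)]
    have "AE p in MQ. norm (g p) \<le> C"
      using C has_weak_deriv_unique[OF h(2) g(2)] by eventually_elim simp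
    moreover obtain gx gy where "W12 g gx gy" using g(1) sobolev_1_iff by blast
    ultimately have "W12_Linf g" using W12_LinfI by blast
    then have "W12_Linf (weak_deriv Q_plus v u)"
      by (rule W12_Linf_cong_AE[OF _ has_weak_deriv_measurable(2)[OF d] has_weak_deriv_unique[OF g(2) d]])
    then show ?thesis using d by blast
  qed
  have L2: "w \<in> L2_space MQ" if "W12_Linf w" for w :: "real \<times> real \<Rightarrow> real^3"
    using that W12D(1) unfolding W12_Linf_def by blast
  show dx: "W12_Linf (d_x u)" and dy: "W12_Linf (d_y u)"
    using * by (auto simp: Basis_real_prod)
  show W: "W12 u (d_x u) (d_y u)"
    unfolding W12_def using uL2 L2[OF dx] L2[OF dy] * by (auto simp: Basis_real_prod)
  obtain C where "AE p in MQ. norm (u p) \<le> C" using s(2) by (auto simp: Linf_space_iff)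
  then show "W12_Linf u" by (rule W12_LinfI[OF W])
qed

lemma W22_add_scaleR:
  assumes u: "u \<in> W22_W1inf" and w: "w \<in> W22_W1inf"
  shows "(\<lambda>p. a *\<^sub>R u p + b *\<^sub>R w p) \<in> W22_W1inf"
    "AE p in MQ. d_x (\<lambda>p. a *\<^sub>R u p + b *\<^sub>R w p) p = a *\<^sub>R d_x u p + b *\<^sub>R d_x w p"
    "AE p in MQ. d_y (\<lambda>p. a *\<^sub>R u p + b *\<^sub>R w p) p = a *\<^sub>R d_y u p + b *\<^sub>R d_y w p"
proof -
  note U = W22D[OF u] and W = W22D[OF w]
  obtain C where "AE p in MQ. norm (a *\<^sub>R u p + b *\<^sub>R w p) \<le> C"
    using W12_Linf_bounded[OF W12_Linf_add_scaleR[OF U(2) W(2)]] by blast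
  then show "(\<lambda>p. a *\<^sub>R u p + b *\<^sub>R w p) \<in> W22_W1inf"
    by (rule W22I[OF W12_add_scaleR[OF U(1) W(1)]]) (intro W12_Linf_add_scaleR U W)+
  show "AE p in MQ. d_x (\<lambda>p. a *\<^sub>R u p + b *\<^sub>R w p) p = a *\<^sub>R d_x u p + b *\<^sub>R d_x w p"
    "AE p in MQ. d_y (\<lambda>p. a *\<^sub>R u p + b *\<^sub>R w p) p = a *\<^sub>R d_y u p + b *\<^sub>R d_y w p"
    by (rule weak_deriv_AE, rule W12D[OF W12_add_scaleR[OF U(1) W(1)]])+
qed

text \<open>The function \<open>1 / sqrt z\<close>, continued linearly below a positive threshold, so that its
  derivative is bounded and Lipschitz on the whole line.\<close>

definition rsqrt :: "real \<Rightarrow> real \<Rightarrow> real" where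
  "rsqrt m z = (if z \<ge> m then 1 / sqrt z else 1 / sqrt m - (z - m) / (2 * sqrt m ^ 3))"

definition rsqrt_deriv :: "real \<Rightarrow> real \<Rightarrow> real" where
  "rsqrt_deriv m z = - 1 / (2 * sqrt (max z m) ^ 3)"

lemma inverse_sqrt_has_derivative:
  assumes "z > 0"
  shows "((\<lambda>z. 1 / sqrt z) has_field_derivative - 1 / (2 * sqrt z ^ 3)) (at z)"
proof -
  have "((\<lambda>z. 1 / sqrt z) has_field_derivative (0 * sqrt z - 1 * (inverse (sqrt z) / 2)) / (sqrt z * sqrt z)) (at z)"
    using assms by (intro DERIV_divide DERIV_const DERIV_real_sqrt) auto
  moreover have "(0 * sqrt z - 1 * (inverse (sqrt z) / 2)) / (sqrt z * sqrt z) = - 1 / (2 * sqrt z ^ 3)"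
    using assms by (simp add: divide_simps power3_eq_cube)
  ultimately show ?thesis by simp
qed

lemma rsqrt_has_derivative:
  assumes m: "m > 0"
  shows "(rsqrt m has_field_derivative rsqrt_deriv m z) (at z)"
proof -
  let ?l = "\<lambda>z. 1 / sqrt m - (z - m) / (2 * sqrt m ^ 3)"
  have l: "(?l has_field_derivative - 1 / (2 * sqrt m ^ 3)) (at z)" for z
    using m by (auto intro!: derivative_eq_intros simp: field_simps)
  consider "z > m" | "z < m" | "z = m" by linarith
  then show ?thesis
  proof cases
    case 1
    have "((\<lambda>z. 1 / sqrt z) has_field_derivative - 1 / (2 * sqrt z ^ 3)) (at z)"
      using 1 m by (intro inverse_sqrt_has_derivative) simp
    then have "(rsqrt m has_field_derivative - 1 / (2 * sqrt z ^ 3)) (at z)"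
      by (rule has_field_derivative_transform_within_open[where S="{m<..}"]) (use 1 in \<open>auto simp: rsqrt_def\<close>)
    then show ?thesis using 1 by (simp add: rsqrt_deriv_def)
  next
    case 2
    have "(rsqrt m has_field_derivative - 1 / (2 * sqrt m ^ 3)) (at z)"
      by (rule has_field_derivative_transform_within_open[OF l, where S="{..<m}"]) (use 2 in \<open>auto simp: rsqrt_def\<close>)
    then show ?thesis using 2 by (simp add: rsqrt_deriv_def max_def)
  next
    case 3
    let ?d = "- 1 / (2 * sqrt m ^ 3)"
    have "((\<lambda>h. (1 / sqrt (m + h) - 1 / sqrt m) / h) \<longlongrightarrow> ?d) (at_right 0)"
      using inverse_sqrt_has_derivative[OF m] unfolding DERIV_def by (rule filterlim_at_split[THEN iffD1, THEN conjunct2])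
    then have "((\<lambda>h. (rsqrt m (m + h) - rsqrt m m) / h) \<longlongrightarrow> ?d) (at_right 0)"
      by (rule Lim_transform_eventually) (auto simp: eventually_at_filter rsqrt_def)
    moreover have "((\<lambda>h. (?l (m + h) - ?l m) / h) \<longlongrightarrow> ?d) (at_left 0)"
      using l[of m] unfolding DERIV_def by (rule filterlim_at_split[THEN iffD1, THEN conjunct1])
    then have "((\<lambda>h. (rsqrt m (m + h) - rsqrt m m) / h) \<longlongrightarrow> ?d) (at_left 0)"
      by (rule Lim_transform_eventually) (auto simp: eventually_at_filter rsqrt_def)
    ultimately show ?thesis
      using 3 by (simp add: DERIV_def filterlim_at_split rsqrt_deriv_def)
  qed
qed

lemma rsqrt_deriv_bound:
  assumes m: "m > 0" shows "\<bar>rsqrt_deriv m z\<bar> \<le> 1 / (2 * sqrt m ^ 3)"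
proof -
  have "sqrt m ^ 3 \<le> sqrt (max z m) ^ 3" using m by (intro power_mono real_sqrt_le_mono) auto
  moreover have "0 < sqrt m ^ 3" using m by simp
  ultimately show ?thesis by (simp add: rsqrt_deriv_def frac_le)
qed

text \<open>The function is one with bounded derivative on z \<ge> m, composed with the clamp
  \<open>max z m\<close>, which does not increase distances.\<close>

lemma rsqrt_deriv_lipschitz:
  assumes m: "m > 0"
  obtains L where "\<And>a b. \<bar>rsqrt_deriv m a - rsqrt_deriv m b\<bar> \<le> L * \<bar>a - b\<bar>"
proof -
  define h h' :: "real \<Rightarrow> real" where "h z = - 1 / (2 * sqrt z ^ 3)" and "h' z = 3 / (4 * sqrt z ^ 5)" for z
  have d: "(h has_field_derivative h' z) (at z within {m..})" if "z \<in> {m..}" for z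
  proof -
    have z: "z > 0" using that m by simp
    have "(h has_field_derivative (0 * (2 * sqrt z ^ 3) - (- 1) * (2 * (of_nat 3 * (inverse (sqrt z) / 2 * sqrt z ^ (3 - Suc 0)))))
        / ((2 * sqrt z ^ 3) * (2 * sqrt z ^ 3))) (at z)"
      unfolding h_def using z by (intro DERIV_divide DERIV_const DERIV_cmult DERIV_power DERIV_real_sqrt) auto
    moreover have "(0 * (2 * sqrt z ^ 3) - (- 1) * (2 * (of_nat 3 * (inverse (sqrt z) / 2 * sqrt z ^ (3 - Suc 0)))))
        / ((2 * sqrt z ^ 3) * (2 * sqrt z ^ 3)) = h' z"
      unfolding h'_def using z by (simp add: divide_simps eval_nat_numeral)
    ultimately have "(h has_field_derivative h' z) (at z)" by simp
    then show ?thesis by (rule has_field_derivative_at_within)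
  qed
  have b: "norm (h' z) \<le> 3 / (4 * sqrt m ^ 5)" if "z \<in> {m..}" for z
  proof -
    have "sqrt m ^ 5 \<le> sqrt z ^ 5" using m that by (intro power_mono real_sqrt_le_mono) auto
    moreover have "0 < sqrt m ^ 5" using m by simp
    ultimately show ?thesis using m that by (simp add: h'_def frac_le)
  qed
  show ?thesis
  proof (rule that)
    fix a b :: real
    have "norm (h (max a m) - h (max b m)) \<le> 3 / (4 * sqrt m ^ 5) * norm (max a m - max b m)"
      by (rule field_differentiable_bound[OF _ d b]) auto
    also have "\<dots> \<le> 3 / (4 * sqrt m ^ 5) * \<bar>a - b\<bar>"
      using m by (intro mult_left_mono) (auto simp: max_def)
    finally show "\<bar>rsqrt_deriv m a - rsqrt_deriv m b\<bar> \<le> 3 / (4 * sqrt m ^ 5) * \<bar>a - b\<bar>"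
      by (simp add: rsqrt_deriv_def h_def)
  qed
qed

lemma W12_Linf_inverse_sqrt:
  fixes u :: "real \<times> real \<Rightarrow> real"
  assumes u: "W12_Linf u" and m: "m > 0" and ge: "AE p in MQ. u p \<ge> m"
  shows "W12_Linf (\<lambda>p. 1 / sqrt (u p))"
proof -
  obtain ux uy where W: "W12 u ux uy" using u unfolding W12_Linf_def by blast
  obtain L where L: "\<And>a b. \<bar>rsqrt_deriv m a - rsqrt_deriv m b\<bar> \<le> L * \<bar>a - b\<bar>"
    by (rule rsqrt_deriv_lipschitz[OF m]) (rule that)
  note C = W12_chain[OF W rsqrt_has_derivative[OF m] rsqrt_deriv_bound[OF m] L]
  have eq: "AE p in MQ. rsqrt m (u p) = 1 / sqrt (u p)"
    using ge by eventually_elim (simp add: rsqrt_def)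
  have "AE p in MQ. norm (rsqrt m (u p)) \<le> 1 / sqrt m"
    using ge
  proof eventually_elim
    case (elim p)
    then have "sqrt m \<le> sqrt (u p)" by simp
    then have "1 / sqrt (u p) \<le> 1 / sqrt m" using m by (intro frac_le) auto
    then show ?case using elim m by (simp add: rsqrt_def)
  qed
  from W12_LinfI[OF C this]
  show ?thesis
    by (rule W12_Linf_cong_AE[OF _ _ eq]) (use W12_Linf_measurable[OF u] in measurable)
qed

section \<open>The boundary condition along $I$\<close>

text \<open>I lies in the closure of \<open>Q_plus\<close>. This carries the formula for the
  derivative of a mollified function, known inside only, to the boundary.\<close>

lemma continuous_eq_on_I:
  fixes F G :: "real \<times> real \<Rightarrow> 'b::euclidean_space"
  assumes "continuous_on UNIV F" "continuous_on UNIV G" "\<And>p. p \<in> Q_plus \<Longrightarrow> F p = G p" and x: "- pi < x" "x < pi"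
  shows "F (x, 0) = G (x, 0)"
proof -
  have "(0, 1 / 2) \<in> Q_plus" by (simp add: mem_Q_plus)
  then have "closure Q_plus = cbox (- pi, 0) (pi, 1)"
    unfolding Q_plus_eq_box by (intro closure_box) auto
  then have cl: "(x, 0) \<in> closure Q_plus" using x by (simp add: cbox_Pair_eq)
  have "continuous_on (closure Q_plus) (\<lambda>p. F p - G p)"
    using assms(1,2) by (intro continuous_intros) (auto intro: continuous_on_subset)
  from continuous_constant_on_closure[OF this _ cl, of 0] show ?thesis using assms(3) by simp
qed

text \<open>For mollified functions, integrate by parts on I against a \<theta> vanishing at both
  ends and pass to the limit: the trace of ux is the weak derivative of the trace of u, which is
  0.\<close>

lemma has_trace_tangential_eq_0:
  fixes u :: "real \<times> real \<Rightarrow> real"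
  assumes u: "W12 u ux uy" and ux: "W12 ux uxx uxy" and 0: "has_trace u (\<lambda>x. 0)" and g: "has_trace ux g"
  shows "AE x in I_measure. g x = 0"
proof -
  let ?J = "{- pi<..<pi}"
  note iu = L2_space_integrable[OF finite_measure_MQ W12D(1)[OF u]] and iux = L2_space_integrable[OF finite_measure_MQ W12D(1)[OF ux]]
  let ?l = "\<lambda>n. 1 - 4 * moll_eps n"
  let ?D = "\<lambda>n p. frechet_derivative (moll n u) (at p) (1, 0)"
  have tu: "L2_tendsto I_measure (\<lambda>n x. moll n u (x, 0)) (\<lambda>x. 0)"
    by (rule has_trace_limit[OF 0 u C1_along_smooth[OF smooth_moll[OF iu]] moll_L2_tendsto[OF W12D(1)[OF u]]
        frechet_derivative_moll_L2_tendsto[OF W12D(5)[OF u] W12D(1)[OF u] W12D(3)[OF u]]])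
  have tux: "L2_tendsto I_measure (\<lambda>n x. moll n ux (x, 0)) g"
    by (rule has_trace_limit[OF g ux C1_along_smooth[OF smooth_moll[OF iux]] moll_L2_tendsto[OF W12D(1)[OF ux]]
        frechet_derivative_moll_L2_tendsto[OF W12D(5)[OF ux] W12D(1)[OF ux] W12D(3)[OF ux]]])
  have "?l \<longlonglongrightarrow> 1 - 4 * 0" by (intro tendsto_intros moll_eps)
  from L2_tendsto_scaleR_seq[OF tux this]
  have tD: "L2_tendsto I_measure (\<lambda>n x. ?l n *\<^sub>R moll n ux (x, 0)) g" by simp
  have bnd: "(\<theta> :: real \<Rightarrow> real) \<in> borel_measurable I_measure" "\<exists>B. AE x in I_measure. \<bar>\<theta> x\<bar> \<le> B"
    if \<theta>: "continuous_on UNIV \<theta>" for \<theta> :: "real \<Rightarrow> real"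
  proof -
    show "\<theta> \<in> borel_measurable I_measure"
      unfolding I_measure_def by (intro borel_measurable_lebesgue_on borel_measurable_continuous_onI \<theta>)
    obtain B where "\<And>x. x \<in> ?J \<Longrightarrow> norm (\<theta> x) \<le> B"
      using continuous_bounded_on_bounded[OF \<theta>, of ?J] by auto
    then have "AE x in I_measure. \<bar>\<theta> x\<bar> \<le> B" unfolding I_measure_def by (intro AE_I2) auto
    then show "\<exists>B. AE x in I_measure. \<bar>\<theta> x\<bar> \<le> B" by blast
  qed
  have orth: "(\<integral>x. \<theta> x * g x \<partial>I_measure) = 0"
    if \<theta>: "\<And>x. (\<theta> has_real_derivative \<theta>' x) (at x)" "continuous_on UNIV \<theta>'" "\<theta> (- pi) = 0" "\<theta> pi = 0" for \<theta> \<theta>' :: "real \<Rightarrow> real"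
  proof -
    have c\<theta>: "continuous_on UNIV \<theta>" using \<theta>(1) by (meson DERIV_continuous_on has_field_derivative_at_within)
    obtain B where B: "AE x in I_measure. \<bar>\<theta> x\<bar> \<le> B" using bnd(2)[OF c\<theta>] by blast
    obtain B' where B': "AE x in I_measure. \<bar>\<theta>' x\<bar> \<le> B'" using bnd(2)[OF \<theta>(2)] by blast
    have lim1: "(\<lambda>n. \<integral>x. \<theta> x * (?l n * moll n ux (x, 0)) \<partial>I_measure) \<longlonglongrightarrow> (\<integral>x. \<theta> x * g x \<partial>I_measure)"
      using L1_tendsto_integral[OF L2_tendsto_imp_L1[OF L2_tendsto_bounded_mult[OF tD bnd(1)[OF c\<theta>] B] finite_measure_I]] by simp
    have lim2: "(\<lambda>n. \<integral>x. \<theta>' x * moll n u (x, 0) \<partial>I_measure) \<longlonglongrightarrow> 0"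
      using L1_tendsto_integral[OF L2_tendsto_imp_L1[OF L2_tendsto_bounded_mult[OF tu bnd(1)[OF \<theta>(2)] B'] finite_measure_I]] by simp
    have "(\<integral>x. \<theta> x * (?l n * moll n ux (x, 0)) \<partial>I_measure) = - (\<integral>x. \<theta>' x * moll n u (x, 0) \<partial>I_measure)" for n
    proof -
      note C1 = C1_along_smooth[OF smooth_moll[OF iu], of "(1, 0)" n]
      note c = C1_alongD[OF C1] and cx = moll_continuous[OF iux, of n]
      have c0: "continuous_on UNIV (\<lambda>x. F (x, 0))" if "continuous_on UNIV F" for F :: "real \<times> real \<Rightarrow> real"
        by (rule continuous_on_Pair_right[OF that])
      have int: "integrable I_measure F" if F: "continuous_on UNIV F" for F :: "real \<Rightarrow> real"
        using integrable_bounded[OF finite_measure_I bnd(1)[OF F]] bnd(2)[OF F] by auto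
      have cl: "continuous_on UNIV (\<lambda>p. ?l n *\<^sub>R moll n ux p)" by (intro continuous_intros cx)
      have eqD: "?D n (x, 0) = ?l n * moll n ux (x, 0)" if "x \<in> ?J" for x
        using continuous_eq_on_I[OF c(2) cl frechet_derivative_moll[OF W12D(4)[OF u] iu], of x] that by simp
      let ?F = "\<lambda>x. \<theta> x * moll n u (x, 0)" and ?F' = "\<lambda>x. \<theta> x * ?D n (x, 0) + \<theta>' x * moll n u (x, 0)"
      have cF': "continuous_on UNIV ?F'" by (intro continuous_intros c\<theta> \<theta>(2) c0 c)
      have "(?F' has_integral ?F pi - ?F (- pi)) {- pi..pi}"
      proof (rule fundamental_theorem_of_calculus)
        fix x
        have "((\<lambda>x. moll n u (x, 0)) has_vector_derivative ?D n (x, 0)) (at x)"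
          using c(3)[of "(0, 0)" x] by simp
        then have V: "((\<lambda>x. moll n u (x, 0)) has_real_derivative ?D n (x, 0)) (at x)"
          by (simp add: has_real_derivative_iff_has_vector_derivative)
        have "(?F has_real_derivative ?F' x) (at x)"
          by (rule DERIV_cong[OF DERIV_mult[OF \<theta>(1) V]]) simp
        then show "(?F has_vector_derivative ?F' x) (at x within {- pi..pi})"
          by (simp add: has_real_derivative_iff_has_vector_derivative has_vector_derivative_at_within)
      qed simp
      then have "integral {- pi..pi} ?F' = 0" using \<theta>(3,4) by (simp add: integral_unique)
      moreover have "(\<integral>x. ?F' x \<partial>I_measure) = integral {- pi..pi} ?F'"
        using lebesgue_integral_eq_integral[OF int[OF cF', unfolded I_measure_def]] unfolding I_measure_def
        by (simp add: integral_open_interval_real)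
      ultimately have "(\<integral>x. ?F' x \<partial>I_measure) = 0" by simp
      moreover have "(\<integral>x. ?F' x \<partial>I_measure) = (\<integral>x. \<theta> x * ?D n (x, 0) \<partial>I_measure) + (\<integral>x. \<theta>' x * moll n u (x, 0) \<partial>I_measure)"
        by (intro Bochner_Integration.integral_add int continuous_intros c\<theta> \<theta>(2) c0 c)
      moreover have "(\<integral>x. \<theta> x * ?D n (x, 0) \<partial>I_measure) = (\<integral>x. \<theta> x * (?l n * moll n ux (x, 0)) \<partial>I_measure)"
        by (intro Bochner_Integration.integral_cong refl) (simp add: I_measure_def eqD)
      ultimately show ?thesis by simp
    qed
    with lim1 have "(\<lambda>n. - (\<integral>x. \<theta>' x * moll n u (x, 0) \<partial>I_measure)) \<longlonglongrightarrow> (\<integral>x. \<theta> x * g x \<partial>I_measure)" by simp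
    moreover have "(\<lambda>n. - (\<integral>x. \<theta>' x * moll n u (x, 0) \<partial>I_measure)) \<longlonglongrightarrow> 0" using tendsto_minus[OF lim2] by simp
    ultimately show ?thesis by (rule LIMSEQ_unique)
  qed
  \<comment> \<open>The weight vanishes at the end points, so that polynomials times it are
    admissible as \<theta>, and is positive inside, so that it can be divided out.\<close>
  have "AE x in lebesgue_on ?J. (pi\<^sup>2 - x\<^sup>2) * g x = 0"
  proof (rule AE_eq_0_if_orthogonal_polynomials)
    have c: "continuous_on UNIV (\<lambda>x::real. pi\<^sup>2 - x\<^sup>2)" by (intro continuous_intros)
    obtain B where B: "AE x in I_measure. \<bar>pi\<^sup>2 - x\<^sup>2\<bar> \<le> B" using bnd(2)[OF c] by blast
    have "integrable I_measure (\<lambda>x. (pi\<^sup>2 - x\<^sup>2) *\<^sub>R g x)"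
      by (rule L2_space_integrable[OF finite_measure_I L2_space_bounded_mult[OF has_trace_W12(2)[OF g] bnd(1)[OF c] B]])
    then show "integrable (lebesgue_on ?J) (\<lambda>x. (pi\<^sup>2 - x\<^sup>2) * g x)" by (simp add: I_measure_def)
    fix P :: "real \<Rightarrow> real" assume P: "real_polynomial_function P"
    have "real_polynomial_function (\<lambda>x::real. pi\<^sup>2 - x\<^sup>2)"
      by (intro real_polynomial_function_diff real_polynomial_function_power
          real_polynomial_function.intros(1,2) bounded_linear_ident)
    from real_polynomial_function.intros(4)[OF P this] obtain \<theta>' where \<theta>': "real_polynomial_function \<theta>'"
      "\<And>x. ((\<lambda>x. P x * (pi\<^sup>2 - x\<^sup>2)) has_real_derivative \<theta>' x) (at x)"
      using has_real_derivative_polynomial_function by blast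
    have "(\<integral>x. (P x * (pi\<^sup>2 - x\<^sup>2)) * g x \<partial>I_measure) = 0"
      using \<theta>' by (intro orth[of "\<lambda>x. P x * (pi\<^sup>2 - x\<^sup>2)" \<theta>'])
         (auto simp: real_polynomial_function_eq intro: continuous_on_polymonial_function)
    then show "(\<integral>x. P x * ((pi\<^sup>2 - x\<^sup>2) * g x) \<partial>lebesgue_on ?J) = 0"
      by (simp add: I_measure_def mult.assoc)
  qed auto
  then show ?thesis
    unfolding I_measure_def using AE_space
  proof eventually_elim
    case (elim x)
    then have "\<bar>x\<bar> < pi" by (auto simp: abs_less_iff)
    then have "x\<^sup>2 < pi\<^sup>2" using power_strict_mono[of "\<bar>x\<bar>" pi 2] by simp
    then show ?case using elim(1) by simp
  qed
qed

section \<open>The unit normal and its trace\<close>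

lemma bounded_bilinear_cross3: "bounded_bilinear cross3"
  using bilinear_cross bilinear_conv_bounded_bilinear by blast

lemma inner_e3: "v \<bullet> e3 = v $ 3"
  by (simp add: e3_def inner_vec_def sum_3)

text \<open>Lagrange's identity for the cross product.\<close>

lemma det_g_eq: "det_g u p = (norm (cross3 (d_x u p) (d_y u p)))\<^sup>2"
  unfolding det_g_def g11_def g12_def g22_def norm_cross
  by (simp add: power2_norm_eq_inner)

lemma W12_Linf_det_g:
  assumes u: "u \<in> W22_W1inf"
  shows "W12_Linf (\<lambda>p. cross3 (d_x u p) (d_y u p))" "W12_Linf (det_g u)"
proof -
  show N: "W12_Linf (\<lambda>p. cross3 (d_x u p) (d_y u p))"
    by (intro W12_Linf_prod[OF bounded_bilinear_cross3] W22D[OF u])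
  have "det_g u = (\<lambda>p. cross3 (d_x u p) (d_y u p) \<bullet> cross3 (d_x u p) (d_y u p))"
    by (simp add: fun_eq_iff det_g_eq power2_norm_eq_inner)
  then show "W12_Linf (det_g u)" using W12_Linf_prod[OF bounded_bilinear_inner N N] by simp
qed

lemma essinf_pos_iff:
  assumes h: "h \<in> borel_measurable M"
  shows "essinf M h > 0 \<longleftrightarrow> (\<exists>c>0. AE p in M. c \<le> h p)"
proof -
  have neg: "0 < - x \<longleftrightarrow> x < 0" for x :: ereal by (cases x) auto
  show ?thesis
  proof
    assume "essinf M h > 0"
    then have "esssup M (\<lambda>p. ereal (- h p)) < 0" by (simp add: essinf_def neg)
    then obtain c where c: "esssup M (\<lambda>p. ereal (- h p)) < ereal c" "ereal c < 0" using ereal_dense2 by blast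
    have "AE p in M. ereal (- h p) \<le> esssup M (\<lambda>p. ereal (- h p))" by (rule esssup_AE)
    then have "AE p in M. - c \<le> h p"
    proof eventually_elim
      case (elim p)
      then have "ereal (- h p) < ereal c" using c(1) by (rule le_less_trans)
      then show ?case by simp
    qed
    then show "\<exists>c>0. AE p in M. c \<le> h p" using c(2) by (intro exI[of _ "- c"]) simp
  next
    assume "\<exists>c>0. AE p in M. c \<le> h p"
    then obtain c where c: "c > 0" "AE p in M. c \<le> h p" by blast
    have "esssup M (\<lambda>p. ereal (- h p)) \<le> ereal (- c)"
      using h c(2) by (intro esssup_I) auto
    also have "\<dots> < 0" using c(1) by simp
    finally show "essinf M h > 0" by (simp add: essinf_def neg)
  qed
qed

lemma W22_imm_iff: "u \<in> W22_imm \<longleftrightarrow> u \<in> W22_W1inf \<and> (\<exists>c>0. AE p in MQ. c \<le> det_g u p)"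
  using essinf_pos_iff[OF W12_Linf_measurable[OF W12_Linf_det_g(2)]] by (auto simp: W22_imm_def)

text \<open>The normal is the cross product of the tangents times (det g)^(-1/2), a product inside
  the algebra \<open>W12_Linf\<close>, so its trace is the product of traces. As \<omega> is
  nonzero, conditions on the normal become conditions on the cross product.\<close>

lemma unit_normal_trace:
  assumes u: "u \<in> W22_imm" and a: "has_trace (d_x u) a" and b: "has_trace (d_y u) b"
  obtains \<omega> where "W12_Linf (\<lambda>p. 1 / sqrt (det_g u p))" "has_trace (\<lambda>p. 1 / sqrt (det_g u p)) \<omega>"
    "AE x in I_measure. \<omega> x \<noteq> 0" "has_trace (unit_normal u) (\<lambda>x. \<omega> x *\<^sub>R cross3 (a x) (b x))"
proof -
  let ?w = "\<lambda>p. 1 / sqrt (det_g u p)" and ?N = "\<lambda>p. cross3 (d_x u p) (d_y u p)"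
  obtain c where W: "u \<in> W22_W1inf" and c: "c > 0" "AE p in MQ. c \<le> det_g u p"
    using u W22_imm_iff by blast
  note N = W12_Linf_det_g(1)[OF W] and D = W12_Linf_det_g(2)[OF W]
  have w: "W12_Linf ?w" by (rule W12_Linf_inverse_sqrt[OF D c])
  obtain \<omega> where \<omega>: "has_trace ?w \<omega>" using w has_trace_exists unfolding W12_Linf_def by metis
  obtain d where d: "has_trace (det_g u) d" using D has_trace_exists unfolding W12_Linf_def by metis
  have NT: "has_trace ?N (\<lambda>x. cross3 (a x) (b x))"
    by (intro has_trace_bilinear[OF bounded_bilinear_cross3] W22D[OF W] a b)
  \<comment> \<open>The identity \<open>w * w * det_g = 1\<close> passes to the traces and forces
    \<omega> to be nonzero.\<close>
  have H1: "has_trace (\<lambda>p. (?w p * ?w p) * det_g u p) (\<lambda>x. (\<omega> x * \<omega> x) * d x)"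
    by (intro has_trace_bilinear[OF bounded_bilinear_mult] W12_Linf_prod[OF bounded_bilinear_mult] w D \<omega> d)
  have H2: "AE p in MQ. (?w p * ?w p) * det_g u p = 1" using c(2)
  proof eventually_elim
    case (elim p)
    then have "det_g u p > 0" using c(1) by simp
    then show ?case by simp
  qed
  have "has_trace (\<lambda>p. 1) (\<lambda>x. (\<omega> x * \<omega> x) * d x)"
    by (rule has_trace_cong_AE[OF H1 _ H2]) simp
  from has_trace_unique[OF this has_trace_const] have \<omega>0: "AE x in I_measure. \<omega> x \<noteq> 0"
    by eventually_elim auto
  have "unit_normal u = (\<lambda>p. ?w p *\<^sub>R ?N p)"
    by (simp add: fun_eq_iff unit_normal_def det_g_eq divide_inverse)
  then have "has_trace (unit_normal u) (\<lambda>x. \<omega> x *\<^sub>R cross3 (a x) (b x))"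
    using has_trace_bilinear[OF bounded_bilinear_scaleR w N \<omega> NT] by simp
  then show ?thesis using that[OF w \<omega> \<omega>0] by blast
qed

text \<open>The pointwise algebra at a boundary point: a and b are the tangents of f, a' and b'
  those of the variation, and \<omega> is 1/|a|^2. The third component of the cross product is the
  determinant of the horizontal parts, so they have to be proportional.\<close>

lemma tangent_vectors_parallel:
  fixes a b a' b' :: "real^3"
  assumes a3: "a $ 3 = 0" and \<omega>: "\<omega> * (a \<bullet> a) = 1" and ab: "a \<bullet> b = 0" and bb: "b \<bullet> b = a \<bullet> a"
    and N: "cross3 a b $ 3 = 0" and b': "b' \<bullet> cross3 a b = 0"
  shows "cross3 (a + t *\<^sub>R a') (b + t *\<^sub>R b' + t\<^sup>2 *\<^sub>R (((b' \<bullet> a) * \<omega>) *\<^sub>R a')) $ 3 = 0"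
proof -
  define \<alpha> where "\<alpha> = a$1 * a$1 + a$2 * a$2"
  have \<alpha>: "a \<bullet> a = \<alpha>" "\<omega> * \<alpha> = 1" using a3 \<omega> by (simp_all add: \<alpha>_def inner_vec_def sum_3)
  then have \<alpha>0: "\<alpha> \<noteq> 0" by auto
  have o: "a$1 * b$1 + a$2 * b$2 = 0" using ab a3 by (simp add: inner_vec_def sum_3)
  have x: "a$1 * b$2 = a$2 * b$1" using N by (simp add: cross3_simps)
  \<comment> \<open>The horizontal part of b is both orthogonal and parallel to a. These two
    conditions form a linear system with determinant \<alpha>, inverted here and below; so b is
    vertical.\<close>
  have "\<alpha> * b$1 = a$1 * (a$1 * b$1 + a$2 * b$2) - a$2 * (a$1 * b$2 - a$2 * b$1)"
    by (simp add: \<alpha>_def algebra_simps)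
  then have b1: "b$1 = 0" using o x \<alpha>0 by simp
  have "\<alpha> * b$2 = a$2 * (a$1 * b$1 + a$2 * b$2) + a$1 * (a$1 * b$2 - a$2 * b$1)"
    by (simp add: \<alpha>_def algebra_simps)
  then have b2: "b$2 = 0" using o x \<alpha>0 by simp
  have "b$3 * b$3 = \<alpha>" using bb b1 b2 \<alpha> by (simp add: inner_vec_def sum_3)
  then have b3: "b$3 \<noteq> 0" using \<alpha>0 by auto
  \<comment> \<open>For vertical b the vector \<open>cross3 a b\<close> is a turned by a right angle
    in the horizontal plane and scaled, so the horizontal part of b' is parallel to a.\<close>
  have "b$3 * (b'$1 * a$2 - b'$2 * a$1) = 0"
    using b' a3 b1 b2 by (simp add: cross3_simps)
  then have p: "b'$1 * a$2 = b'$2 * a$1" using b3 by simp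
  define \<gamma> where "\<gamma> = (b' \<bullet> a) * \<omega>"
  have g: "b' \<bullet> a = b'$1 * a$1 + b'$2 * a$2" using a3 by (simp add: inner_vec_def sum_3)
  have "\<gamma> * a$1 = \<omega> * ((b'$1 * a$1 + b'$2 * a$2) * a$1)" by (simp add: \<gamma>_def g)
  also have "(b'$1 * a$1 + b'$2 * a$2) * a$1 = b'$1 * \<alpha> + a$2 * (b'$2 * a$1 - b'$1 * a$2)"
    by (simp add: \<alpha>_def algebra_simps)
  also have "\<omega> * \<dots> = b'$1" using p \<alpha>(2) by (simp add: algebra_simps)
  finally have g1: "b'$1 = \<gamma> * a$1" by simp
  have "\<gamma> * a$2 = \<omega> * ((b'$1 * a$1 + b'$2 * a$2) * a$2)" by (simp add: \<gamma>_def g)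
  also have "(b'$1 * a$1 + b'$2 * a$2) * a$2 = b'$2 * \<alpha> + a$1 * (b'$1 * a$2 - b'$2 * a$1)"
    by (simp add: \<alpha>_def algebra_simps)
  also have "\<omega> * \<dots> = b'$2" using p \<alpha>(2) by (simp add: algebra_simps)
  finally have g2: "b'$2 = \<gamma> * a$2" by simp
  show ?thesis
    unfolding \<gamma>_def[symmetric] by (simp add: cross3_simps b1 b2 g1 g2 power2_eq_square)
qed

lemma det_g_uniformly_continuous:
  fixes R c :: real
  assumes c: "c > 0"
  obtains d where "d > 0" "\<And>a b a' b' :: real^3. norm a \<le> R \<Longrightarrow> norm b \<le> R \<Longrightarrow> norm (a' - a) < d \<Longrightarrow> norm (b' - b) < d \<Longrightarrow>
    (norm (cross3 a b))\<^sup>2 - c < (norm (cross3 a' b'))\<^sup>2"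
proof -
  let ?f = "\<lambda>z :: (real^3) \<times> (real^3). (norm (cross3 (fst z) (snd z)))\<^sup>2"
  let ?C = "cball (0::real^3) (R + 1) \<times> cball (0::real^3) (R + 1)"
  have "continuous_on ?C ?f"
    by (intro continuous_intros bounded_bilinear.continuous_on[OF bounded_bilinear_cross3])
  then have "uniformly_continuous_on ?C ?f"
    by (intro compact_uniformly_continuous compact_Times compact_cball)
  then obtain d where d: "d > 0" "\<And>z z'. z \<in> ?C \<Longrightarrow> z' \<in> ?C \<Longrightarrow> dist z' z < d \<Longrightarrow> dist (?f z') (?f z) < c"
    unfolding uniformly_continuous_on_def using c by metis
  show ?thesis
  \<comment> \<open>The bound 1 keeps the perturbed vectors in the balls of radius R + 1; d / 2 for
    each vector keeps the distance of the pairs below d.\<close>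
  proof (rule that[of "min 1 (d / 2)"])
    show "0 < min 1 (d / 2)" using d(1) by simp
    fix a b a' b' :: "real^3"
    assume a: "norm a \<le> R" "norm b \<le> R" and l: "norm (a' - a) < min 1 (d / 2)" "norm (b' - b) < min 1 (d / 2)"
    have "norm a' \<le> norm a + norm (a' - a)" "norm b' \<le> norm b + norm (b' - b)"
      by (rule norm_triangle_sub)+
    then have "(a, b) \<in> ?C" "(a', b') \<in> ?C" using a l by auto
    moreover have "dist (a', b') (a, b) < d"
    proof -
      have "dist (a', b') (a, b) \<le> norm (a' - a) + norm (b' - b)"
        unfolding dist_norm using norm_Pair_le[of "a' - a" "b' - b"] by (simp add: minus_prod_def)
      then show ?thesis using l by linarith
    qed
    ultimately have "dist (?f (a', b')) (?f (a, b)) < c" by (rule d(2))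
    then show "(norm (cross3 a b))\<^sup>2 - c < (norm (cross3 a' b'))\<^sup>2" by (simp add: dist_real_def abs_less_iff)
  qed
qed

text \<open>Openness of the set of immersions, made explicit along this curve: the first derivatives
  move uniformly little, so \<open>det_g\<close> keeps at least half of its lower bound.\<close>

lemma W22_imm_perturbation:
  assumes f: "f \<in> W22_imm" and \<phi>: "\<phi> \<in> W22_W1inf" and \<psi>: "\<psi> \<in> W22_W1inf"
  obtains \<delta> where "\<delta> > 0" "\<And>t. \<bar>t\<bar> < \<delta> \<Longrightarrow> (\<lambda>p. f p + t *\<^sub>R \<phi> p + t\<^sup>2 *\<^sub>R \<psi> p) \<in> W22_imm"
proof -
  obtain c where fW: "f \<in> W22_W1inf" and c: "c > 0" "AE p in MQ. c \<le> det_g f p"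
    using f W22_imm_iff by blast
  obtain R1 where R1: "R1 \<ge> 0" "AE p in MQ. norm (d_x f p) \<le> R1" using W12_Linf_bounded[OF W22D(3)[OF fW]] .
  obtain R2 where R2: "R2 \<ge> 0" "AE p in MQ. norm (d_y f p) \<le> R2" using W12_Linf_bounded[OF W22D(4)[OF fW]] .
  obtain P1 where P1: "P1 \<ge> 0" "AE p in MQ. norm (d_x \<phi> p) \<le> P1" using W12_Linf_bounded[OF W22D(3)[OF \<phi>]] .
  obtain P2 where P2: "P2 \<ge> 0" "AE p in MQ. norm (d_y \<phi> p) \<le> P2" using W12_Linf_bounded[OF W22D(4)[OF \<phi>]] .
  obtain S1 where S1: "S1 \<ge> 0" "AE p in MQ. norm (d_x \<psi> p) \<le> S1" using W12_Linf_bounded[OF W22D(3)[OF \<psi>]] .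
  obtain S2 where S2: "S2 \<ge> 0" "AE p in MQ. norm (d_y \<psi> p) \<le> S2" using W12_Linf_bounded[OF W22D(4)[OF \<psi>]] .
  define R where "R = max R1 R2"
  \<comment> \<open>For |t| < 1 one has t^2 \<le> |t|, so each first derivative moves by at most |t|
    K; the added 1 makes K positive.\<close>
  define K where "K = P1 + P2 + S1 + S2 + 1"
  have K: "K > 0" using P1 P2 S1 S2 by (simp add: K_def)
  obtain d where d: "d > 0" "\<And>a b a' b' :: real^3. norm a \<le> R \<Longrightarrow> norm b \<le> R \<Longrightarrow> norm (a' - a) < d \<Longrightarrow> norm (b' - b) < d \<Longrightarrow>
    (norm (cross3 a b))\<^sup>2 - c / 2 < (norm (cross3 a' b'))\<^sup>2"
    by (rule det_g_uniformly_continuous[of "c / 2" R]) (use c in simp, rule that)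
  show ?thesis
  proof (rule that[of "min 1 (d / K)"])
    show "0 < min 1 (d / K)" using d K by simp
    fix t :: real assume t: "\<bar>t\<bar> < min 1 (d / K)"
    let ?F = "\<lambda>p. f p + t *\<^sub>R \<phi> p + t\<^sup>2 *\<^sub>R \<psi> p"
    note G = W22_add_scaleR[OF fW \<phi>, of 1 t]
    note F = W22_add_scaleR[OF G(1) \<psi>, of 1 "t\<^sup>2"]
    have small: "norm (t *\<^sub>R x + t\<^sup>2 *\<^sub>R y) < d" if "norm x + norm y \<le> K" for x y :: "real^3"
    proof -
      have "\<bar>t\<bar> * \<bar>t\<bar> \<le> \<bar>t\<bar> * 1" using t by (intro mult_left_mono) auto
      then have "t\<^sup>2 \<le> \<bar>t\<bar>" by (simp add: power2_eq_square)
      then have "norm (t *\<^sub>R x + t\<^sup>2 *\<^sub>R y) \<le> \<bar>t\<bar> * norm x + \<bar>t\<bar> * norm y"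
        using norm_triangle_ineq[of "t *\<^sub>R x" "t\<^sup>2 *\<^sub>R y"] mult_right_mono[of "t\<^sup>2" "\<bar>t\<bar>" "norm y"] by simp
      also have "\<dots> = \<bar>t\<bar> * (norm x + norm y)" by (simp add: algebra_simps)
      also have "\<dots> \<le> \<bar>t\<bar> * K" using that by (intro mult_left_mono) auto
      also have "\<dots> < d" using t K by (simp add: field_simps)
      finally show ?thesis .
    qed
    have "AE p in MQ. c / 2 \<le> det_g ?F p"
      using c(2) R1(2) R2(2) P1(2) P2(2) S1(2) S2(2) F(2,3) G(2,3)
    proof eventually_elim
      case (elim p)
      have x: "d_x ?F p - d_x f p = t *\<^sub>R d_x \<phi> p + t\<^sup>2 *\<^sub>R d_x \<psi> p"
        and y: "d_y ?F p - d_y f p = t *\<^sub>R d_y \<phi> p + t\<^sup>2 *\<^sub>R d_y \<psi> p"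
        using elim by simp_all
      have "(norm (cross3 (d_x f p) (d_y f p)))\<^sup>2 - c / 2 < (norm (cross3 (d_x ?F p) (d_y ?F p)))\<^sup>2"
      proof (rule d(2))
        show "norm (d_x f p) \<le> R" "norm (d_y f p) \<le> R" using elim by (auto simp: R_def)
        show "norm (d_x ?F p - d_x f p) < d" unfolding x using elim P2 S2 by (intro small) (simp add: K_def)
        show "norm (d_y ?F p - d_y f p) < d" unfolding y using elim P1 S1 by (intro small) (simp add: K_def)
      qed
      then show ?case using elim(1) by (simp add: det_g_eq)
    qed
    moreover have "?F \<in> W22_W1inf" using F(1) by simp
    moreover have "c / 2 > 0" using c(1) by simp
    ultimately show "?F \<in> W22_imm" unfolding W22_imm_iff by blast
  qed
qed

section \<open>The quadratic curve and its boundary values\<close>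

lemma W12_Linf_has_trace: assumes "W12_Linf u" obtains g where "has_trace u g"
  using assms has_trace_exists unfolding W12_Linf_def by metis

lemma has_trace_AE_imp:
  assumes u: "has_trace u g" and w: "has_trace w h" and eq: "AE p in MQ. u p = w p"
  shows "AE x in I_measure. g x = h x"
proof -
  obtain wx wy where "W12 w wx wy" using has_trace_W12[OF w] by blast
  then have "w \<in> borel_measurable MQ" using W12D(1) L2_spaceD(1) by blast
  from has_trace_unique[OF has_trace_cong_AE[OF u this eq] w] show ?thesis .
qed

text \<open>The difference quotient differs from the proposed derivative by exactly h \<psi>, so
  homogeneity of \<open>W_norm\<close> gives the limit.\<close>

lemma has_curve_deriv_quadratic:
  assumes \<phi>: "\<phi> \<in> W22_W1inf" and \<psi>: "\<psi> \<in> W22_W1inf"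
  shows "has_curve_deriv (\<lambda>t p. f p + t *\<^sub>R \<phi> p + t\<^sup>2 *\<^sub>R \<psi> p) (\<lambda>p. \<phi> p + (2 * t) *\<^sub>R \<psi> p) t"
  unfolding has_curve_deriv_def
proof (intro conjI)
  show "(\<lambda>p. \<phi> p + (2 * t) *\<^sub>R \<psi> p) \<in> W22_W1inf"
    using W22_add_scaleR(1)[OF \<phi> \<psi>, of 1 "2 * t"] by simp
  have "(f p + (t + h) *\<^sub>R \<phi> p + (t + h)\<^sup>2 *\<^sub>R \<psi> p - (f p + t *\<^sub>R \<phi> p + t\<^sup>2 *\<^sub>R \<psi> p)) /\<^sub>R h
      - (\<phi> p + (2 * t) *\<^sub>R \<psi> p) = h *\<^sub>R \<psi> p" if h: "h \<noteq> 0" for h p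
  proof -
    have "f p + (t + h) *\<^sub>R \<phi> p + (t + h)\<^sup>2 *\<^sub>R \<psi> p - (f p + t *\<^sub>R \<phi> p + t\<^sup>2 *\<^sub>R \<psi> p) =
        h *\<^sub>R (\<phi> p + (2 * t) *\<^sub>R \<psi> p + h *\<^sub>R \<psi> p)"
      by (simp add: power2_eq_square algebra_simps scaleR_2[symmetric] del: scaleR_2)
    then show ?thesis using h by simp
  qed
  then have eq: "W_norm (\<lambda>p. (f p + (t + h) *\<^sub>R \<phi> p + (t + h)\<^sup>2 *\<^sub>R \<psi> p - (f p + t *\<^sub>R \<phi> p + t\<^sup>2 *\<^sub>R \<psi> p)) /\<^sub>R h
      - (\<phi> p + (2 * t) *\<^sub>R \<psi> p)) = \<bar>h\<bar> * W_norm \<psi>" if "h \<noteq> 0" for h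
    using that by (simp add: W_norm_scaleR[OF \<psi>])
  have "((\<lambda>h. \<bar>h\<bar> * W_norm \<psi>) \<longlongrightarrow> \<bar>0\<bar> * W_norm \<psi>) (at 0)" by (intro tendsto_intros)
  then have "((\<lambda>h. \<bar>h\<bar> * W_norm \<psi>) \<longlongrightarrow> 0) (at 0)" by simp
  then show "((\<lambda>h. W_norm (\<lambda>p. (f p + (t + h) *\<^sub>R \<phi> p + (t + h)\<^sup>2 *\<^sub>R \<psi> p - (f p + t *\<^sub>R \<phi> p + t\<^sup>2 *\<^sub>R \<psi> p)) /\<^sub>R h
      - (\<phi> p + (2 * t) *\<^sub>R \<psi> p))) \<longlongrightarrow> 0) (at 0)"
    by (rule Lim_transform_eventually)
      (unfold eventually_at_filter, intro always_eventually allI impI, rule eq[symmetric])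
qed

lemma C1_curve_on_quadratic:
  assumes f: "f \<in> W22_W1inf" and \<phi>: "\<phi> \<in> W22_W1inf" and \<psi>: "\<psi> \<in> W22_W1inf"
  shows "C1_curve_on T (\<lambda>t p. f p + t *\<^sub>R \<phi> p + t\<^sup>2 *\<^sub>R \<psi> p)"
  unfolding C1_curve_on_def
proof (intro conjI ballI exI[of _ "\<lambda>t p. \<phi> p + (2 * t) *\<^sub>R \<psi> p"])
  show "(\<lambda>p. f p + t *\<^sub>R \<phi> p + t\<^sup>2 *\<^sub>R \<psi> p) \<in> W22_W1inf" for t
    using W22_add_scaleR(1)[OF W22_add_scaleR(1)[OF f \<phi>, of 1 t] \<psi>, of 1 "t\<^sup>2"] by simp
  show "has_curve_deriv (\<lambda>t p. f p + t *\<^sub>R \<phi> p + t\<^sup>2 *\<^sub>R \<psi> p) (\<lambda>p. \<phi> p + (2 * t) *\<^sub>R \<psi> p) t" for t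
    by (rule has_curve_deriv_quadratic[OF \<phi> \<psi>])
  fix t
  have "(\<lambda>p. \<phi> p + (2 * s) *\<^sub>R \<psi> p - (\<phi> p + (2 * t) *\<^sub>R \<psi> p)) = (\<lambda>p. (2 * (s - t)) *\<^sub>R \<psi> p)" for s
    by (simp add: fun_eq_iff right_diff_distrib scaleR_diff_left)
  then have eq: "W_norm (\<lambda>p. \<phi> p + (2 * s) *\<^sub>R \<psi> p - (\<phi> p + (2 * t) *\<^sub>R \<psi> p)) = \<bar>2 * (s - t)\<bar> * W_norm \<psi>" if "s \<noteq> t" for s
    using W_norm_scaleR[OF \<psi>, of "2 * (s - t)"] that by simp
  have "((\<lambda>s. \<bar>2 * (s - t)\<bar> * W_norm \<psi>) \<longlongrightarrow> \<bar>2 * (t - t)\<bar> * W_norm \<psi>) (at t within T)" by (intro tendsto_intros)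
  then have "((\<lambda>s. \<bar>2 * (s - t)\<bar> * W_norm \<psi>) \<longlongrightarrow> 0) (at t within T)" by simp
  then show "((\<lambda>s. W_norm (\<lambda>p. \<phi> p + (2 * s) *\<^sub>R \<psi> p - (\<phi> p + (2 * t) *\<^sub>R \<psi> p))) \<longlongrightarrow> 0) (at t within T)"
    by (rule Lim_transform_eventually)
      (unfold eventually_at_filter, intro always_eventually allI impI, rule eq[symmetric])
qed

theorem mainTheorem3:
  fixes f \<phi> :: "real \<times> real \<Rightarrow> real^3"
  assumes "f \<in> W22_conf"
    and "AE x in I_measure. trace_I f x \<bullet> e3 = 0"
    and "AE x in I_measure. trace_I (unit_normal f) x \<bullet> e3 = 0"
    and "\<phi> \<in> W22_W1inf"
    and "admissible f \<phi>"
  shows "\<exists>\<delta>>0. \<exists>F :: real \<Rightarrow> real \<times> real \<Rightarrow> real^3.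
           (\<forall>t\<in>{- \<delta><..<\<delta>}. F t \<in> W22_imm) \<and>
           C1_curve_on {- \<delta><..<\<delta>} F \<and>
           (AE p in lebesgue_on Q_plus. F 0 p = f p) \<and>
           has_curve_deriv F \<phi> 0 \<and>
           (\<forall>t\<in>{- \<delta><..<\<delta>}.
              (AE x in I_measure. trace_I (F t) x \<bullet> e3 = 0) \<and>
              (AE x in I_measure. trace_I (unit_normal (F t)) x \<bullet> e3 = 0))"
proof -
  have fi: "f \<in> W22_imm" and conf: "AE p in MQ. g11 f p = g22 f p \<and> g12 f p = 0"
    using assms(1) by (auto simp: W22_conf_def)
  obtain c where f: "f \<in> W22_W1inf" and c: "c > 0" "AE p in MQ. c \<le> det_g f p"
    using fi W22_imm_iff by blast
  note fW = W22D[OF f] and \<phi>W = W22D[OF assms(4)]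
  obtain tf where tf: "has_trace f tf" using W12_Linf_has_trace[OF fW(2)] .
  obtain a where a: "has_trace (d_x f) a" using W12_Linf_has_trace[OF fW(3)] .
  obtain b where b: "has_trace (d_y f) b" using W12_Linf_has_trace[OF fW(4)] .
  obtain t\<phi> where t\<phi>: "has_trace \<phi> t\<phi>" using W12_Linf_has_trace[OF \<phi>W(2)] .
  obtain a' where a': "has_trace (d_x \<phi>) a'" using W12_Linf_has_trace[OF \<phi>W(3)] .
  obtain b' where b': "has_trace (d_y \<phi>) b'" using W12_Linf_has_trace[OF \<phi>W(4)] .
  let ?w = "\<lambda>p. 1 / sqrt (det_g f p)"
  obtain \<omega> where w: "W12_Linf ?w" "has_trace ?w \<omega>" and \<omega>0: "AE x in I_measure. \<omega> x \<noteq> 0"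
    and \<nu>: "has_trace (unit_normal f) (\<lambda>x. \<omega> x *\<^sub>R cross3 (a x) (b x))"
    using unit_normal_trace[OF fi a b] .

  \<comment> \<open>This extends c \<phi>_x from I to the half rectangle. The factor 1/g11 is
    written as 1/sqrt(det g), which agrees with it by conformality and is already known to be a
    bounded W^{1,2} function with a trace.\<close>
  define h where "h p = ((d_y \<phi> p \<bullet> d_x f p) * ?w p) *\<^sub>R d_x \<phi> p" for p
  define \<eta> where "\<eta> x = ((b' x \<bullet> a x) * \<omega> x) *\<^sub>R a' x" for x
  have h: "W12_Linf h" "has_trace h \<eta>"
    unfolding h_def[abs_def] \<eta>_def[abs_def]
    by (intro W12_Linf_prod[OF bounded_bilinear_scaleR] W12_Linf_prod[OF bounded_bilinear_mult]
        W12_Linf_prod[OF bounded_bilinear_inner] has_trace_bilinear[OF bounded_bilinear_scaleR]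
        has_trace_bilinear[OF bounded_bilinear_mult] has_trace_bilinear[OF bounded_bilinear_inner]
        fW \<phi>W w a b a' b')+
  obtain hx hy C where "W12 h hx hy" "AE p in MQ. norm (h p) \<le> C"
    using h(1) unfolding W12_Linf_def by blast
  then obtain \<psi> \<psi>x \<psi>y \<psi>xx \<psi>xy \<psi>yx \<psi>yy K where \<psi>W: "W12 \<psi> \<psi>x \<psi>y" "W12 \<psi>x \<psi>xx \<psi>xy" "W12 \<psi>y \<psi>yx \<psi>yy"
    and \<psi>b: "AE p in MQ. norm (\<psi> p) \<le> K" "AE p in MQ. norm (\<psi>x p) \<le> K" "AE p in MQ. norm (\<psi>y p) \<le> K"
    and \<psi>t: "has_trace \<psi> (\<lambda>x. 0)" "has_trace \<psi>x (\<lambda>x. 0)" "has_trace \<psi>y \<eta>"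
    by (rule boundary_extension[OF _ _ h(2)]) (rule that; assumption)
  have \<psi>: "\<psi> \<in> W22_W1inf"
    by (rule W22I[OF \<psi>W(1) \<psi>b(1) W12_LinfI[OF \<psi>W(2) \<psi>b(2)] W12_LinfI[OF \<psi>W(3) \<psi>b(3)]])
  note \<psi>D = W22D[OF \<psi>]
  \<comment> \<open>The traces were found for the constructed derivatives; the chosen ones agree
    with them almost everywhere.\<close>
  have \<psi>dx: "has_trace (d_x \<psi>) (\<lambda>x. 0)"
    by (rule has_trace_cong_AE[OF \<psi>t(2) W12_Linf_measurable[OF \<psi>D(3)] has_weak_deriv_unique[OF W12D(4)[OF \<psi>W(1)] W12D(4)[OF \<psi>D(1)]]])
  have \<psi>dy: "has_trace (d_y \<psi>) \<eta>"
    by (rule has_trace_cong_AE[OF \<psi>t(3) W12_Linf_measurable[OF \<psi>D(4)] has_weak_deriv_unique[OF W12D(5)[OF \<psi>W(1)] W12D(5)[OF \<psi>D(1)]]])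

  \<comment> \<open>The third component of f has trace 0, hence so has its tangential
    derivative.\<close>
  have "AE x in I_measure. a x $ 3 = 0"
  proof -
    obtain B where B: "AE p in MQ. norm (f p) \<le> B" using W12_Linf_bounded[OF fW(2)] by blast
    have W: "W12 (\<lambda>p. f p \<bullet> e3) (\<lambda>p. d_x f p \<bullet> e3) (\<lambda>p. d_y f p \<bullet> e3)"
      using W12_prod[OF bounded_bilinear_inner fW(1) B W12_const[of e3], of "norm e3"] by simp
    obtain ux uy where Wx: "W12 (\<lambda>p. d_x f p \<bullet> e3) ux uy"
      using W12_Linf_prod[OF bounded_bilinear_inner fW(3) W12_Linf_const[of e3]] unfolding W12_Linf_def by blast
    have "has_trace (\<lambda>p. f p \<bullet> e3) (\<lambda>x. tf x \<bullet> e3)"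
      by (intro has_trace_bilinear[OF bounded_bilinear_inner] fW W12_Linf_const tf has_trace_const)
    moreover have "AE x in I_measure. tf x \<bullet> e3 = 0"
      using trace_I_AE[OF tf] assms(2) by eventually_elim simp
    moreover have "(\<lambda>x. 0 :: real) \<in> L2_space I_measure" by (simp add: L2_space_def)
    ultimately have "has_trace (\<lambda>p. f p \<bullet> e3) (\<lambda>x. 0)" by (rule has_trace_AE_cong_trace)
    moreover have "has_trace (\<lambda>p. d_x f p \<bullet> e3) (\<lambda>x. a x \<bullet> e3)"
      by (intro has_trace_bilinear[OF bounded_bilinear_inner] fW W12_Linf_const a has_trace_const)
    ultimately show ?thesis
      using has_trace_tangential_eq_0[OF W Wx] by (simp add: inner_e3)
  qed
  \<comment> \<open>Conformality gives det g = g11^2, so the product of 1/sqrt(det g) with g11 is 1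
    already inside, and the identity passes to the traces.\<close>
  moreover have "AE x in I_measure. \<omega> x * (a x \<bullet> a x) = 1"
  proof (rule has_trace_AE_imp[OF _ has_trace_const])
    show "has_trace (\<lambda>p. ?w p * (d_x f p \<bullet> d_x f p)) (\<lambda>x. \<omega> x * (a x \<bullet> a x))"
      by (intro has_trace_bilinear[OF bounded_bilinear_mult] has_trace_bilinear[OF bounded_bilinear_inner]
          W12_Linf_prod[OF bounded_bilinear_inner] fW w a)
    show "AE p in MQ. ?w p * (d_x f p \<bullet> d_x f p) = 1"
      using conf c(2)
    proof eventually_elim
      case (elim p)
      have d: "det_g f p = (d_x f p \<bullet> d_x f p)\<^sup>2"
        using elim(1) by (simp add: det_g_def g11_def power2_eq_square)
      then have "d_x f p \<bullet> d_x f p \<noteq> 0" using elim(2) c(1) by auto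
      then show ?case by (simp add: d)
    qed
  qed
  moreover have "AE x in I_measure. a x \<bullet> b x = 0"
    by (rule has_trace_AE_imp[OF has_trace_bilinear[OF bounded_bilinear_inner fW(3,4) a b] has_trace_const])
       (use conf in eventually_elim, simp add: g12_def)
  moreover have "AE x in I_measure. b x \<bullet> b x = a x \<bullet> a x"
    by (rule has_trace_AE_imp[OF has_trace_bilinear[OF bounded_bilinear_inner fW(4,4) b b]
          has_trace_bilinear[OF bounded_bilinear_inner fW(3,3) a a]])
       (use conf in eventually_elim, simp add: g11_def g22_def)
  \<comment> \<open>The hypothesis concerns the trace of the unit normal, which is \<omega> times
    this cross product; \<omega> is nonzero and cancels. Admissibility is treated in the same way
    below.\<close>
  moreover have "AE x in I_measure. cross3 (a x) (b x) $ 3 = 0"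
    using trace_I_AE[OF \<nu>] assms(3) \<omega>0 by eventually_elim (simp add: inner_e3)
  moreover have "AE x in I_measure. trace_I (d_y \<phi>) x \<bullet> trace_I (unit_normal f) x = 0"
    using assms(5) by (simp add: admissible_def)
  then have "AE x in I_measure. b' x \<bullet> cross3 (a x) (b x) = 0"
    using trace_I_AE[OF \<nu>] trace_I_AE[OF b'] \<omega>0 by eventually_elim simp
  ultimately have boundary: "AE x in I_measure. \<forall>t. cross3 (a x + t *\<^sub>R a' x) (b x + t *\<^sub>R b' x + t\<^sup>2 *\<^sub>R \<eta> x) $ 3 = 0"
  proof eventually_elim
    case (elim x)
    then show ?case unfolding \<eta>_def by (intro allI tangent_vectors_parallel)
  qed

  let ?F = "\<lambda>t p. f p + t *\<^sub>R \<phi> p + t\<^sup>2 *\<^sub>R \<psi> p"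
  obtain \<delta> where \<delta>: "\<delta> > 0" "\<And>t. \<bar>t\<bar> < \<delta> \<Longrightarrow> ?F t \<in> W22_imm"
    using W22_imm_perturbation[OF fi assms(4) \<psi>] by blast
  have "AE x in I_measure. trace_I (?F t) x \<bullet> e3 = 0" for t
  proof -
    \<comment> \<open>The quadratic term contributes nothing, since \<psi> has trace 0; what remains
      is horizontal by the hypotheses on f and \<phi>.\<close>
    have Ft: "has_trace (?F t) (\<lambda>x. tf x + t *\<^sub>R t\<phi> x)"
      using has_trace_add_scaleR[OF has_trace_add_scaleR[OF tf t\<phi>, of 1 t] \<psi>t(1), of 1 "t\<^sup>2"] by simp
    have "AE x in I_measure. trace_I \<phi> x \<bullet> e3 = 0" using assms(5) by (simp add: admissible_def)
    then show ?thesis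
      using trace_I_AE[OF Ft] trace_I_AE[OF tf] trace_I_AE[OF t\<phi>] assms(2)
      by eventually_elim (simp add: inner_add_left)
  qed
  moreover have "AE x in I_measure. trace_I (unit_normal (?F t)) x \<bullet> e3 = 0" if t: "\<bar>t\<bar> < \<delta>" for t
  proof -
    note G = W22_add_scaleR[OF f assms(4), of 1 t]
    note F = W22_add_scaleR[OF G(1) \<psi>, of 1 "t\<^sup>2"]
    have FW: "?F t \<in> W22_W1inf" using F(1) by simp
    have "has_trace (\<lambda>p. d_x f p + t *\<^sub>R d_x \<phi> p + t\<^sup>2 *\<^sub>R d_x \<psi> p) (\<lambda>x. a x + t *\<^sub>R a' x)"
      using has_trace_add_scaleR[OF has_trace_add_scaleR[OF a a', of 1 t] \<psi>dx, of 1 "t\<^sup>2"] by simp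
    moreover have "AE p in MQ. d_x f p + t *\<^sub>R d_x \<phi> p + t\<^sup>2 *\<^sub>R d_x \<psi> p = d_x (?F t) p"
      using G(2) F(2) by eventually_elim simp
    ultimately have A: "has_trace (d_x (?F t)) (\<lambda>x. a x + t *\<^sub>R a' x)"
      by (rule has_trace_cong_AE[OF _ W12_Linf_measurable[OF W22D(3)[OF FW]]])
    have "has_trace (\<lambda>p. d_y f p + t *\<^sub>R d_y \<phi> p + t\<^sup>2 *\<^sub>R d_y \<psi> p) (\<lambda>x. b x + t *\<^sub>R b' x + t\<^sup>2 *\<^sub>R \<eta> x)"
      using has_trace_add_scaleR[OF has_trace_add_scaleR[OF b b', of 1 t] \<psi>dy, of 1 "t\<^sup>2"] by simp
    moreover have "AE p in MQ. d_y f p + t *\<^sub>R d_y \<phi> p + t\<^sup>2 *\<^sub>R d_y \<psi> p = d_y (?F t) p"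
      using G(3) F(3) by eventually_elim simp
    ultimately have B: "has_trace (d_y (?F t)) (\<lambda>x. b x + t *\<^sub>R b' x + t\<^sup>2 *\<^sub>R \<eta> x)"
      by (rule has_trace_cong_AE[OF _ W12_Linf_measurable[OF W22D(4)[OF FW]]])
    obtain \<omega>t where "has_trace (unit_normal (?F t))
        (\<lambda>x. \<omega>t x *\<^sub>R cross3 (a x + t *\<^sub>R a' x) (b x + t *\<^sub>R b' x + t\<^sup>2 *\<^sub>R \<eta> x))"
      using unit_normal_trace[OF \<delta>(2)[OF t] A B] by blast
    from trace_I_AE[OF this] boundary show ?thesis
      by eventually_elim (simp add: inner_e3)
  qed
  moreover have "has_curve_deriv ?F \<phi> 0"
    using has_curve_deriv_quadratic[OF assms(4) \<psi>, of f 0] by simp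
  moreover have "C1_curve_on {- \<delta><..<\<delta>} ?F"
    by (rule C1_curve_on_quadratic[OF f assms(4) \<psi>])
  ultimately show ?thesis
    using \<delta> by (intro exI[of _ \<delta>] conjI exI[of _ ?F]) auto
qed

end
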